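(* Assume the Unique Games Conjecture. Let $H$ be any fixed directed graph on $k$ vertices and let $\varepsilon>0$ be any fixed constant. Then there is no polynomial-time $\left(\frac{\alpha_H}{2\lceil \log k\rceil} - \varepsilon\right)$-approximation algorithm for Directed Multicut$(H)$.
   Context: Here $\log$ is the base-2 logarithm. Directed Multicut: the input is a directed supply graph $G=(V,E)$ with nonnegative edge weights $w_e$ and a directed simple demand graph $H=(V_H,F)$ with $V_H \subseteq V$. A feasible solution is a set $E'\subseteq E$ such that for every $(s,t)\in F$ there is no directed path from $s$ to $t$ in $G-E'$; the goal is to minimize $\sum_{e\in E'} w_e$. Directed Multicut$(H)$ is the special case in which the demand graph is the fixed graph $H$ (its vertices mapped to vertices of an arbitrary supply graph $G$). The distance LP for an instance is: minimize $\sum_{e\in E} w_e x_e$ subject to $\sum_{e\in p} x_e \ge 1$ for every directed $s$-$t$ path $p$ in $G$ and every $(s,t)\in F$, and $x_e\ge 0$. The flow-cut gap $\alpha_H$ is the supremum, over all instances of Directed Multicut$(H)$, of the ratio between the optimum multicut weight and the optimum value of the distance LP. An $\alpha$-approximation algorithm returns a feasible solution of weight at most $\alpha$ times the optimum.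
   Formalization: The Unique Games Conjecture is taken in its NP-hardness form, so P ≠ NP is assumed explicitly (otherwise the claim can fail), and H is required to have at least one arc, since otherwise α_H (a supremum of 0/0) or the division by ⌈log k⌉ is undefined. *)

theory Defs
  imports
    Complex_Main
    "HOL-Library.Extended_Real"
    "HOL-Library.FuncSet"
    "HOL-Library.Log_Nat"
    "HOL-Combinatorics.Permutations"
    "HOL-Computational_Algebra.Polynomial"
    "Graph_Theory.Pair_Digraph"
begin

section \<open>Polynomial-time computation\<close>

text \<open>
  Deterministic multitape Turing machines with two-way infinite tapes. States and tape symbols
  are initial segments of the naturals. State 0 is initial and state 1 is the halting state;
  symbol 0 is the blank, symbols 1 and 2 are the bits False and True. An action on a tape is a
  written symbol together with a head movement in \<open>{-1, 0, 1}\<close>. Tape 0 carries both the input and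
  the output.
\<close>

record tm =
  tm_tapes :: nat
  tm_states :: nat
  tm_symbols :: nat
  tm_delta :: "nat \<Rightarrow> nat list \<Rightarrow> nat \<times> (nat \<times> int) list"

definition tm_wf :: "tm \<Rightarrow> bool" where
  "tm_wf M \<longleftrightarrow> 1 \<le> tm_tapes M \<and> 2 \<le> tm_states M \<and> 3 \<le> tm_symbols M \<and>
     (\<forall>q ss. q < tm_states M \<and> length ss = tm_tapes M \<and> set ss \<subseteq> {..<tm_symbols M} \<longrightarrow>
        (case tm_delta M q ss of (q', as) \<Rightarrow>
           q' < tm_states M \<and> length as = tm_tapes M \<and>
           set as \<subseteq> {..<tm_symbols M} \<times> {-1, 0, 1}))"

type_synonym tm_config = "nat \<times> ((int \<Rightarrow> nat) \<times> int) list"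

definition word_tape :: "bool list \<Rightarrow> int \<Rightarrow> nat" where
  "word_tape x i = (if 0 \<le> i \<and> i < int (length x) then (if x ! nat i then 2 else 1) else 0)"

definition tm_init :: "tm \<Rightarrow> bool list \<Rightarrow> tm_config" where
  "tm_init M x = (0, (word_tape x, 0) # replicate (tm_tapes M - 1) (\<lambda>_. 0, 0))"

definition tm_step :: "tm \<Rightarrow> tm_config \<Rightarrow> tm_config" where
  "tm_step M = (\<lambda>(q, ts).
     if q = 1 then (q, ts)
     else (case tm_delta M q (map (\<lambda>(t, h). t h) ts) of (q', as) \<Rightarrow>
       (q', map2 (\<lambda>(t, h) (s, d). (t(h := s), h + d)) ts as)))"

text \<open>
  The output is the bit string that starts in cell 0 of tape 0 and is followed by a blank.
  Halting configurations are fixed points of the step function, so this says that the machine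
  halts within the given number of steps.
\<close>

definition tm_outputs :: "tm \<Rightarrow> bool list \<Rightarrow> nat \<Rightarrow> bool list \<Rightarrow> bool" where
  "tm_outputs M x n y \<longleftrightarrow> (case (tm_step M ^^ n) (tm_init M x) of (q, ts) \<Rightarrow>
     q = 1 \<and> (\<forall>i \<le> length y. fst (hd ts) (int i) = word_tape y (int i)))"

text \<open>Nothing is required of the machine on inputs outside \<open>D\<close>.\<close>

definition poly_time_on :: "bool list set \<Rightarrow> (bool list \<Rightarrow> bool list) \<Rightarrow> bool" where
  "poly_time_on D f \<longleftrightarrow> (\<exists>M (p :: nat poly). tm_wf M \<and>
     (\<forall>x \<in> D. tm_outputs M x (poly p (length x)) (f x)))"

section \<open>Encodings\<close>

text \<open>
  All codes below are prefix-free, hence tuples are encoded by concatenation. Numbers are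
  written in binary, least significant bit first.
\<close>

definition enc_list :: "('a \<Rightarrow> bool list) \<Rightarrow> 'a list \<Rightarrow> bool list" where
  "enc_list f xs = concat (map (\<lambda>x. True # f x) xs) @ [False]"

definition enc_bits :: "bool list \<Rightarrow> bool list" where
  "enc_bits = enc_list (\<lambda>b. [b])"

definition enc_nat :: "nat \<Rightarrow> bool list" where
  "enc_nat n = enc_bits (map (bit n) [0..<floorlog 2 n])"

definition enc_arc :: "nat \<times> nat \<Rightarrow> bool list" where
  "enc_arc = (\<lambda>(u, v). enc_nat u @ enc_nat v)"

text \<open>For nonnegative rational numbers only.\<close>

definition enc_rat :: "rat \<Rightarrow> bool list" where
  "enc_rat r = (case quotient_of r of (a, b) \<Rightarrow> enc_nat (nat a) @ enc_nat (nat b))"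

section \<open>P, NP and NP-hardness of promise problems\<close>

definition class_P :: "bool list set set" where
  "class_P = {L. poly_time_on UNIV (\<lambda>x. [x \<in> L])}"

definition class_NP :: "bool list set set" where
  "class_NP = {L. \<exists>V \<in> class_P. \<exists>p :: nat poly.
     \<forall>x. x \<in> L \<longleftrightarrow> (\<exists>w. length w \<le> poly p (length x) \<and> enc_bits x @ w \<in> V)}"

definition NP_hard_promise :: "bool list set \<Rightarrow> bool list set \<Rightarrow> bool" where
  "NP_hard_promise YES NO \<longleftrightarrow> (\<forall>L \<in> class_NP. \<exists>f. poly_time_on UNIV f \<and>
     (\<forall>x. (x \<in> L \<longrightarrow> f x \<in> YES) \<and> (x \<notin> L \<longrightarrow> f x \<in> NO)))"

section \<open>The Unique Games Conjecture\<close>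

text \<open>
  A unique game on the bipartite multigraph with sides \<open>{..<ug_left U}\<close> and \<open>{..<ug_right U}\<close>.
  A constraint \<open>(u, v, \<pi>)\<close> is satisfied if the label of \<open>v\<close> is the image under \<open>\<pi>\<close> of the label
  of \<open>u\<close>.
\<close>

record ug =
  ug_left :: nat
  ug_right :: nat
  ug_constraints :: "(nat \<times> nat \<times> (nat \<Rightarrow> nat)) list"

definition ug_instance :: "nat \<Rightarrow> ug \<Rightarrow> bool" where
  "ug_instance R U \<longleftrightarrow> 1 \<le> R \<and> ug_constraints U \<noteq> [] \<and>
     (\<forall>(u, v, \<pi>) \<in> set (ug_constraints U).
        u < ug_left U \<and> v < ug_right U \<and> \<pi> permutes {..<R})"

definition ug_satisfied :: "ug \<Rightarrow> (nat \<Rightarrow> nat) \<Rightarrow> (nat \<Rightarrow> nat) \<Rightarrow> real" where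
  "ug_satisfied U f g =
     real (length (filter (\<lambda>(u, v, \<pi>). g v = \<pi> (f u)) (ug_constraints U)))
       / real (length (ug_constraints U))"

definition ug_value :: "nat \<Rightarrow> ug \<Rightarrow> real" where
  "ug_value R U = Max {ug_satisfied U f g | f g.
     f \<in> {..<ug_left U} \<rightarrow>\<^sub>E {..<R} \<and> g \<in> {..<ug_right U} \<rightarrow>\<^sub>E {..<R}}"

definition enc_ug :: "nat \<Rightarrow> ug \<Rightarrow> bool list" where
  "enc_ug R U = enc_nat (ug_left U) @ enc_nat (ug_right U) @
     enc_list (\<lambda>(u, v, \<pi>). enc_nat u @ enc_nat v @ enc_list enc_nat (map \<pi> [0..<R]))
       (ug_constraints U)"

definition unique_games_conjecture :: bool where
  "unique_games_conjecture \<longleftrightarrow> (\<forall>\<epsilon> > 0. \<forall>\<delta> > 0. \<exists>R.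
     NP_hard_promise
       {enc_ug R U | U. ug_instance R U \<and> ug_value R U \<ge> 1 - \<epsilon>}
       {enc_ug R U | U. ug_instance R U \<and> ug_value R U \<le> \<delta>})"

section \<open>Directed Multicut with a fixed demand graph\<close>

text \<open>
  The field \<open>terminal\<close> embeds the vertices of the demand graph into those of the supply graph.
\<close>

record dmc =
  supply_graph :: "nat pair_pre_digraph"
  weight :: "nat \<times> nat \<Rightarrow> real"
  terminal :: "nat \<Rightarrow> nat"

definition dmc_instance :: "nat pair_pre_digraph \<Rightarrow> dmc \<Rightarrow> bool" where
  "dmc_instance H I \<longleftrightarrow> pair_fin_digraph (supply_graph I) \<and>
     (\<forall>e \<in> parcs (supply_graph I). 0 \<le> weight I e) \<and>
     inj_on (terminal I) (pverts H) \<and> terminal I ` pverts H \<subseteq> pverts (supply_graph I)"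

definition multicut :: "nat pair_pre_digraph \<Rightarrow> dmc \<Rightarrow> (nat \<times> nat) set \<Rightarrow> bool" where
  "multicut H I C \<longleftrightarrow> C \<subseteq> parcs (supply_graph I) \<and>
     (\<forall>(s, t) \<in> parcs H.
        \<not> (\<exists>p. pre_digraph.apath
                 (with_proj ((supply_graph I)\<lparr>parcs := parcs (supply_graph I) - C\<rparr>))
                 (terminal I s) p (terminal I t)))"

definition multicut_opt :: "nat pair_pre_digraph \<Rightarrow> dmc \<Rightarrow> real" where
  "multicut_opt H I = (INF C \<in> {C. multicut H I C}. \<Sum>e\<in>C. weight I e)"

definition distance_lp_feasible ::
    "nat pair_pre_digraph \<Rightarrow> dmc \<Rightarrow> (nat \<times> nat \<Rightarrow> real) \<Rightarrow> bool" where
  "distance_lp_feasible H I x \<longleftrightarrow> (\<forall>e \<in> parcs (supply_graph I). 0 \<le> x e) \<and>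
     (\<forall>(s, t) \<in> parcs H. \<forall>p.
        pre_digraph.apath (with_proj (supply_graph I)) (terminal I s) p (terminal I t)
          \<longrightarrow> (\<Sum>e\<leftarrow>p. x e) \<ge> 1)"

definition distance_lp_opt :: "nat pair_pre_digraph \<Rightarrow> dmc \<Rightarrow> real" where
  "distance_lp_opt H I =
     (INF x \<in> {x. distance_lp_feasible H I x}. \<Sum>e\<in>parcs (supply_graph I). weight I e * x e)"

text \<open>
  Instances of LP value 0 also have multicut optimum 0; their undefined ratio 0/0 is left out.
\<close>

definition flow_cut_gap :: "nat pair_pre_digraph \<Rightarrow> ereal" where
  "flow_cut_gap H = (SUP I \<in> {I. dmc_instance H I \<and> distance_lp_opt H I > 0}.
     ereal (multicut_opt H I / distance_lp_opt H I))"

text \<open>Instances given to an algorithm have rational weights.\<close>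

definition dmc_inputs :: "nat pair_pre_digraph \<Rightarrow> dmc set" where
  "dmc_inputs H = {I. dmc_instance H I \<and> (\<forall>e \<in> parcs (supply_graph I). weight I e \<in> \<rat>)}"

definition enc_dmc :: "nat pair_pre_digraph \<Rightarrow> dmc \<Rightarrow> bool list" where
  "enc_dmc H I = (let vs = sorted_list_of_set (pverts (supply_graph I)) in
     enc_list enc_nat vs @
     enc_list (\<lambda>e. enc_arc e @ enc_rat (inv real_of_rat (weight I e)))
       (filter (\<lambda>e. e \<in> parcs (supply_graph I)) (List.product vs vs)) @
     enc_list enc_nat (map (terminal I) (sorted_list_of_set (pverts H))))"

definition dmc_approximation ::
    "nat pair_pre_digraph \<Rightarrow> ereal \<Rightarrow> (bool list \<Rightarrow> bool list) \<Rightarrow> bool" where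
  "dmc_approximation H \<alpha> A \<longleftrightarrow> (\<forall>I \<in> dmc_inputs H. \<exists>es.
     A (enc_dmc H I) = enc_list enc_arc es \<and> multicut H I (set es) \<and>
     ereal (\<Sum>e\<in>set es. weight I e) \<le> \<alpha> * ereal (multicut_opt H I))"

definition poly_time_dmc_approximable :: "nat pair_pre_digraph \<Rightarrow> ereal \<Rightarrow> bool" where
  "poly_time_dmc_approximable H \<alpha> \<longleftrightarrow>
     (\<exists>A. poly_time_on (enc_dmc H ` dmc_inputs H) A \<and> dmc_approximation H \<alpha> A)"

end

theory Submission
  imports Defs "HOL-Number_Theory.Cong" "HOL-Analysis.Convex"
begin

text \<open>
  Number the vertices of \<open>H\<close> in binary. Every demand \<open>(s, t)\<close> is contained in one of the
  \<open>2 \<lceil>log k\<rceil>\<close> bipartite demand graphs whose sources have a given bit with a given value and whose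
  sinks have the opposite value. A gap instance for \<open>H\<close> therefore yields one for such a bipartite
  piece, at the loss of a factor \<open>2 \<lceil>log k\<rceil>\<close>. In the bipartite case a multicut is a labelling of
  the vertices by sets of sources, the LP solution is a family of distances, and cutting every
  source at a common random threshold costs the LP value.

  This turns a gap instance into a dictatorship test. Replace every vertex by a cube whose points
  assign a threshold in binary to every label of a unique game, and shift the thresholds by the
  length along every arc. The dictator cuts cost about the LP value. Unit arcs along the edges of
  the cube bound the total influence of a cheap cut, so that by the theorem of Kahn, Kalai and
  Linial each of its Boolean functions is almost constant unless it has an influential coordinate.
  If all are almost constant then, by the invariance of the uniform measure under shifts, rounding
  them to constants gives an integral cut of the gap instance, which is expensive. The influential
  coordinates of a cheap cut yield good labels for the unique game.

  An approximation algorithm with the stated ratio then decides the unique games promise problem,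
  and P would equal NP. Polynomial time is established by compiling a small programming language
  with bit string registers to Turing machines.
\<close>

section \<open>A structured language for Turing machines\<close>

type_synonym tapes = "nat \<Rightarrow> (int \<Rightarrow> nat) \<times> int"

datatype com =
    Skip
  | Act "(nat \<Rightarrow> nat) \<Rightarrow> nat \<Rightarrow> nat \<times> int"
  | Seq com com
  | Cond "(nat \<Rightarrow> nat) \<Rightarrow> bool" com com
  | Loop "(nat \<Rightarrow> nat) \<Rightarrow> bool" com

definition keep :: "(nat \<Rightarrow> nat) \<Rightarrow> nat \<Rightarrow> nat \<times> int" where
  "keep ss i = (ss i, 0)"

primrec com_step :: "com \<Rightarrow> (nat \<Rightarrow> nat) \<Rightarrow> com \<times> (nat \<Rightarrow> nat \<times> int)" where
  "com_step Skip ss = (Skip, keep ss)"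
| "com_step (Act a) ss = (Skip, a ss)"
| "com_step (Seq c d) ss =
     (if c = Skip then (d, keep ss) else (Seq (fst (com_step c ss)) d, snd (com_step c ss)))"
| "com_step (Cond p c d) ss = (if p ss then c else d, keep ss)"
| "com_step (Loop p c) ss = (if p ss then Seq c (Loop p c) else Skip, keep ss)"

definition heads :: "tapes \<Rightarrow> nat \<Rightarrow> nat" where
  "heads \<tau> i = fst (\<tau> i) (snd (\<tau> i))"

definition perform :: "(nat \<Rightarrow> nat \<times> int) \<Rightarrow> tapes \<Rightarrow> tapes" where
  "perform a \<tau> i = ((fst (\<tau> i))(snd (\<tau> i) := fst (a i)), snd (\<tau> i) + snd (a i))"

definition config_step :: "com \<times> tapes \<Rightarrow> com \<times> tapes" where
  "config_step = (\<lambda>(c, \<tau>). (fst (com_step c (heads \<tau>)), perform (snd (com_step c (heads \<tau>))) \<tau>))"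

definition runs :: "com \<Rightarrow> tapes \<Rightarrow> nat \<Rightarrow> tapes \<Rightarrow> bool" where
  "runs c \<tau> t \<tau>' \<longleftrightarrow> (config_step ^^ t) (c, \<tau>) = (Skip, \<tau>')"

lemma perform_keep [simp]: "perform (keep (heads \<tau>)) \<tau> = \<tau>"
  by (auto simp: perform_def keep_def heads_def fun_eq_iff prod_eq_iff)

lemma runs_0_iff: "runs c \<tau> 0 \<tau>' \<longleftrightarrow> c = Skip \<and> \<tau> = \<tau>'"
  by (simp add: runs_def)

lemma runs_Suc_iff:
  "runs c \<tau> (Suc t) \<tau>' \<longleftrightarrow>
     runs (fst (com_step c (heads \<tau>))) (perform (snd (com_step c (heads \<tau>))) \<tau>) t \<tau>'"
  by (simp add: runs_def config_step_def funpow_Suc_right del: funpow.simps)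

lemma runs_Skip_iff: "runs Skip \<tau> t \<tau>' \<longleftrightarrow> \<tau> = \<tau>'"
  by (induction t) (simp_all add: runs_0_iff runs_Suc_iff)

lemma runs_mono: "runs c \<tau> t \<tau>' \<Longrightarrow> t \<le> u \<Longrightarrow> runs c \<tau> u \<tau>'"
proof (induction t arbitrary: c \<tau> u)
  case 0
  then show ?case by (simp add: runs_0_iff runs_Skip_iff)
next
  case (Suc t)
  then show ?case by (cases u) (simp_all add: runs_Suc_iff)
qed

lemma runs_Act: "runs (Act a) \<tau> 1 (perform (a (heads \<tau>)) \<tau>)"
  by (simp add: runs_Suc_iff runs_0_iff)

lemma runs_Seq: "runs c \<tau> t \<tau>' \<Longrightarrow> runs d \<tau>' u \<tau>'' \<Longrightarrow> runs (Seq c d) \<tau> (t + 1 + u) \<tau>''"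
proof (induction t arbitrary: c \<tau>)
  case 0
  then show ?case by (simp add: runs_0_iff runs_Suc_iff)
next
  case (Suc t)
  show ?case
  proof (cases "c = Skip")
    case True
    then have "runs d \<tau> (Suc t + u) \<tau>''"
      using Suc.prems by (simp add: runs_Skip_iff runs_mono[where t = u])
    then show ?thesis using True by (simp add: runs_Suc_iff)
  next
    case False
    then show ?thesis using Suc by (simp add: runs_Suc_iff)
  qed
qed

lemma runs_Cond:
  assumes "runs (if p (heads \<tau>) then c else d) \<tau> t \<tau>'"
  shows "runs (Cond p c d) \<tau> (t + 1) \<tau>'"
  using assms by (simp add: runs_Suc_iff)

lemma runs_Loop:
  assumes "runs (if p (heads \<tau>) then Seq c (Loop p c) else Skip) \<tau> t \<tau>'"
  shows "runs (Loop p c) \<tau> (t + 1) \<tau>'"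
  using assms by (simp add: runs_Suc_iff)

lemma backward_iterate:
  fixes P :: "nat \<Rightarrow> nat \<Rightarrow> bool"
  assumes "P n b" and "\<And>k t. k < n \<Longrightarrow> P (Suc k) t \<Longrightarrow> P k (a + t)"
  shows "P 0 (n * a + b)"
proof -
  have "P (n - k) (k * a + b)" if "k \<le> n" for k
    using that
  proof (induction k)
    case (Suc k)
    then show ?case using assms(2)[of "n - Suc k" "k * a + b"] by (simp add: Suc_diff_Suc add.assoc)
  qed (simp add: assms(1))
  from this[of n] show ?thesis by simp
qed

lemma runs_Loop_iterate:
  assumes "\<And>k. k < n \<Longrightarrow> p (heads (T k))" "\<And>k. k < n \<Longrightarrow> runs c (T k) t (T (Suc k))"
    and "\<not> p (heads (T n))"
  shows "runs (Loop p c) (T 0) (n * (t + 2) + 1) (T n)"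
proof (rule backward_iterate)
  show "runs (Loop p c) (T n) 1 (T n)"
    using runs_Loop[of p "T n" c 0] assms(3) by (simp add: runs_0_iff)
next
  fix k u assume "k < n" and rest: "runs (Loop p c) (T (Suc k)) u (T n)"
  then have "runs (Seq c (Loop p c)) (T k) (t + 1 + u) (T n)"
    by (intro runs_Seq[OF _ rest] assms(2))
  then show "runs (Loop p c) (T k) (t + 2 + u) (T n)"
    using runs_Loop[of p "T k" c "t + 1 + u"] assms(1)[OF \<open>k < n\<close>] by simp
qed

text \<open>
  One number bounds the tapes that are touched and the symbols that are written. An action may
  also rewrite the scanned symbol, which makes the condition monotone in the bound.
\<close>

primrec bounded_com :: "nat \<Rightarrow> com \<Rightarrow> bool" where
  "bounded_com B Skip = True"
| "bounded_com B (Act a) = (\<forall>ss i. (fst (a ss i) < B \<or> fst (a ss i) = ss i) \<and>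
     snd (a ss i) \<in> {-1, 0, 1} \<and> (B \<le> i \<longrightarrow> a ss i = (ss i, 0)))"
| "bounded_com B (Seq c d) = (bounded_com B c \<and> bounded_com B d)"
| "bounded_com B (Cond p c d) = (bounded_com B c \<and> bounded_com B d)"
| "bounded_com B (Loop p c) = bounded_com B c"

lemma bounded_com_mono: "bounded_com B c \<Longrightarrow> B \<le> B' \<Longrightarrow> bounded_com B' c"
proof (induction c)
  case (Act a)
  then show ?case unfolding bounded_com.simps by (meson le_trans less_le_trans)
qed auto

primrec residuals :: "com \<Rightarrow> com set" where
  "residuals Skip = {Skip}"
| "residuals (Act a) = {Act a, Skip}"
| "residuals (Seq c d) = (\<lambda>c'. Seq c' d) ` residuals c \<union> residuals d"
| "residuals (Cond p c d) = {Cond p c d} \<union> residuals c \<union> residuals d"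
| "residuals (Loop p c) = {Loop p c, Skip} \<union> (\<lambda>c'. Seq c' (Loop p c)) ` residuals c"

lemma finite_residuals: "finite (residuals c)"
  by (induction c) auto

lemma self_in_residuals: "c \<in> residuals c"
  by (induction c) auto

lemma Skip_in_residuals: "Skip \<in> residuals c"
  by (induction c) auto

lemma com_step_residuals: "c' \<in> residuals c \<Longrightarrow> fst (com_step c' ss) \<in> residuals c"
  by (induction c arbitrary: c') (auto simp: self_in_residuals split: if_splits)

lemma bounded_residuals: "c' \<in> residuals c \<Longrightarrow> bounded_com B c \<Longrightarrow> bounded_com B c'"
  by (induction c arbitrary: c') auto

lemma bounded_com_step:
  assumes "bounded_com B c"
  shows "fst (snd (com_step c ss) i) < B \<or> fst (snd (com_step c ss) i) = ss i"
    "snd (snd (com_step c ss) i) \<in> {-1, 0, 1}"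
    "B \<le> i \<Longrightarrow> snd (com_step c ss) i = (ss i, 0)"
  using assms by (induction c) (simp_all add: keep_def)

definition input_tapes :: "bool list \<Rightarrow> tapes" where
  "input_tapes x i = (if i = 0 then word_tape x else (\<lambda>_. 0), 0)"

definition com_states :: "com \<Rightarrow> com \<Rightarrow> nat" where
  "com_states c0 = (SOME e. inj_on e (residuals c0) \<and> e c0 = 0 \<and> e Skip = 1)"

lemma com_states:
  assumes "c0 \<noteq> Skip"
  shows "inj_on (com_states c0) (residuals c0)" "com_states c0 c0 = 0" "com_states c0 Skip = 1"
proof -
  obtain h :: "com \<Rightarrow> nat" where h: "inj_on h (residuals c0)"
    using finite_residuals finite_imp_inj_to_nat_seg by metis
  define e where "e c = (if c = c0 then 0 else if c = Skip then 1 else Suc (Suc (h c)))" for c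
  have "inj_on e (residuals c0) \<and> e c0 = 0 \<and> e Skip = 1"
    using h assms by (auto simp: e_def inj_on_def split: if_splits)
  then have "inj_on (com_states c0) (residuals c0) \<and> com_states c0 c0 = 0 \<and> com_states c0 Skip = 1"
    unfolding com_states_def
    by (rule someI[where P = "\<lambda>e. inj_on e (residuals c0) \<and> e c0 = 0 \<and> e Skip = 1"])
  then show "inj_on (com_states c0) (residuals c0)" "com_states c0 c0 = 0" "com_states c0 Skip = 1"
    by auto
qed

definition com_tm :: "nat \<Rightarrow> com \<Rightarrow> tm" where
  "com_tm B c0 = \<lparr>tm_tapes = B,
     tm_states = Suc (Suc (Max (com_states c0 ` residuals c0))), tm_symbols = B,
     tm_delta = (\<lambda>q ss. if q \<in> com_states c0 ` residuals c0
       then (let c = inv_into (residuals c0) (com_states c0) q;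
                 r = com_step c (\<lambda>i. if i < B then ss ! i else 0)
             in (com_states c0 (fst r), map (snd r) [0..<B]))
       else (1, map (\<lambda>s. (s, 0)) ss))\<rparr>"

lemma tm_wf_com_tm:
  assumes "bounded_com B c0" "3 \<le> B" "c0 \<noteq> Skip"
  shows "tm_wf (com_tm B c0)"
proof -
  have states: "com_states c0 c < Suc (Suc (Max (com_states c0 ` residuals c0)))"
    if "c \<in> residuals c0" for c
    using Max_ge[of "com_states c0 ` residuals c0" "com_states c0 c"] that finite_residuals
    by (simp add: le_imp_less_Suc less_SucI)
  show ?thesis unfolding tm_wf_def
  proof (intro conjI allI impI)
    fix q ss
    assume valid: "q < tm_states (com_tm B c0) \<and> length ss = tm_tapes (com_tm B c0) \<and>
        set ss \<subseteq> {..<tm_symbols (com_tm B c0)}"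
    show "case tm_delta (com_tm B c0) q ss of (q', as) \<Rightarrow>
           q' < tm_states (com_tm B c0) \<and> length as = tm_tapes (com_tm B c0) \<and>
           set as \<subseteq> {..<tm_symbols (com_tm B c0)} \<times> {-1, 0, 1}"
    proof (cases "q \<in> com_states c0 ` residuals c0")
      case True
      define c where "c = inv_into (residuals c0) (com_states c0) q"
      define s where "s = (\<lambda>i. if i < B then ss ! i else 0)"
      have c: "c \<in> residuals c0" unfolding c_def using True by (rule inv_into_into)
      have "s i < B" for i
        using valid assms(2) by (auto simp: com_tm_def s_def subset_iff)
      then have "fst (snd (com_step c s) i) < B \<and> snd (snd (com_step c s) i) \<in> {-1, 0, 1}" for i
        using bounded_com_step(1,2)[OF bounded_residuals[OF c assms(1)], of s i] by metis
      then have "set (map (snd (com_step c s)) [0..<B]) \<subseteq> {..<B} \<times> {-1, 0, 1}"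
        by (simp add: image_subset_iff mem_Times_iff)
      then show ?thesis
        using states[OF com_step_residuals[OF c]] True
        by (auto simp: com_tm_def Let_def c_def s_def)
    qed (use valid in \<open>auto simp: com_tm_def\<close>)
  qed (use assms in \<open>auto simp: com_tm_def\<close>)
qed

lemma tm_step_com_tm:
  assumes "c0 \<noteq> Skip" "c \<in> residuals c0" and blank: "\<And>i. B \<le> i \<Longrightarrow> \<tau> i = (\<lambda>_. 0, 0)"
    and step: "config_step (c, \<tau>) = (c', \<tau>')"
  shows "tm_step (com_tm B c0) (com_states c0 c, map \<tau> [0..<B]) =
      (com_states c0 c', map \<tau>' [0..<B])"
proof (cases "c = Skip")
  case True
  then show ?thesis
    using step com_states(3)[OF assms(1)] by (auto simp: config_step_def tm_step_def)
next
  case False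
  define r where "r = com_step c (heads \<tau>)"
  have not_halted: "com_states c0 c \<noteq> 1"
    using False com_states[OF assms(1)] assms(2) Skip_in_residuals by (metis inj_onD)
  have scanned: "(\<lambda>i. if i < B then map (\<lambda>(t, h). t h) (map \<tau> [0..<B]) ! i else 0) = heads \<tau>"
    using blank by (auto simp: fun_eq_iff heads_def case_prod_beta)
  have decode: "inv_into (residuals c0) (com_states c0) (com_states c0 c) = c"
    using com_states(1)[OF assms(1)] assms(2) by simp
  have "map2 (\<lambda>(t, h) (s, d). (t(h := s), h + d)) (map \<tau> [0..<B]) (map (snd r) [0..<B])
      = map (perform (snd r) \<tau>) [0..<B]"
    by (rule nth_equalityI) (auto simp: perform_def case_prod_beta)
  then have "tm_step (com_tm B c0) (com_states c0 c, map \<tau> [0..<B]) =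
      (com_states c0 (fst r), map (perform (snd r) \<tau>) [0..<B])"
    using not_halted scanned decode assms(2) unfolding tm_step_def com_tm_def
    by (simp add: Let_def r_def)
  then show ?thesis using step by (auto simp: config_step_def r_def)
qed

lemma com_tm_simulates:
  assumes "bounded_com B c0" "3 \<le> B" "c0 \<noteq> Skip"
  shows "\<exists>c \<tau>. (config_step ^^ t) (c0, input_tapes x) = (c, \<tau>) \<and> c \<in> residuals c0 \<and>
     (tm_step (com_tm B c0) ^^ t) (tm_init (com_tm B c0) x) = (com_states c0 c, map \<tau> [0..<B]) \<and>
     (\<forall>i\<ge>B. \<tau> i = (\<lambda>_. 0, 0))"
proof (induction t)
  case 0
  have "replicate (B - 1) (\<lambda>_. 0, 0) = map (input_tapes x) [1..<B]"
    by (rule nth_equalityI) (auto simp: input_tapes_def)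
  then have "(word_tape x, 0) # replicate (B - 1) (\<lambda>_. 0, 0) = map (input_tapes x) [0..<B]"
    using assms(2) by (simp add: upt_conv_Cons input_tapes_def)
  then show ?case
    using com_states[OF assms(3)] assms(2)
    by (auto simp: tm_init_def com_tm_def self_in_residuals) (auto simp: input_tapes_def)
next
  case (Suc t)
  then obtain c \<tau> where reached: "(config_step ^^ t) (c0, input_tapes x) = (c, \<tau>)"
      and c: "c \<in> residuals c0"
      and sim: "(tm_step (com_tm B c0) ^^ t) (tm_init (com_tm B c0) x) =
        (com_states c0 c, map \<tau> [0..<B])"
      and blank: "\<forall>i\<ge>B. \<tau> i = (\<lambda>_. 0, 0)" by blast
  obtain c' \<tau>' where step: "config_step (c, \<tau>) = (c', \<tau>')" by fastforce
  have "c' \<in> residuals c0"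
    using step com_step_residuals[OF c] by (auto simp: config_step_def)
  moreover have "\<tau>' i = (\<lambda>_. 0, 0)" if "B \<le> i" for i
    using bounded_com_step(3)[OF bounded_residuals[OF c assms(1)] that,
      of "heads \<tau>"] blank that step
    by (auto simp: config_step_def perform_def heads_def)
  ultimately show ?case
    using reached sim step tm_step_com_tm[OF assms(3) c _ step] blank by auto
qed

lemma poly_time_on_com:
  fixes p :: "nat poly"
  assumes "bounded_com B c"
    and "\<And>x. x \<in> D \<Longrightarrow> \<exists>\<tau>. runs c (input_tapes x) (poly p (length x)) \<tau> \<and>
       (\<forall>i\<le>length (f x). fst (\<tau> 0) (int i) = word_tape (f x) (int i))"
  shows "poly_time_on D f"
proof -
  define c0 where "c0 = Seq c Skip"
  define M where "M = com_tm (B + 3) c0"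
  have bounded: "bounded_com (B + 3) c0"
    using bounded_com_mono[OF assms(1)] by (simp add: c0_def)
  have c0: "c0 \<noteq> Skip" by (simp add: c0_def)
  have "tm_outputs M x (poly (p + 1) (length x)) (f x)" if "x \<in> D" for x
  proof -
    obtain \<tau> where run: "runs c (input_tapes x) (poly p (length x)) \<tau>"
        and out: "\<forall>i\<le>length (f x). fst (\<tau> 0) (int i) = word_tape (f x) (int i)"
      using assms(2) \<open>x \<in> D\<close> by blast
    have "runs c0 (input_tapes x) (poly (p + 1) (length x)) \<tau>"
      using runs_Seq[OF run, of Skip 0 \<tau>] by (simp add: c0_def runs_0_iff)
    then show ?thesis
      using com_tm_simulates[OF bounded _ c0, of "poly (p + 1) (length x)" x] out
        com_states(3)[OF c0]
      by (auto simp: runs_def tm_outputs_def M_def hd_map)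
  qed
  moreover have "tm_wf M" unfolding M_def using bounded c0 by (intro tm_wf_com_tm) auto
  ultimately show ?thesis unfolding poly_time_on_def by blast
qed

section \<open>Programs on registers\<close>

type_synonym store = "nat \<Rightarrow> bool list"

definition stack_tape :: "(int \<Rightarrow> nat) \<times> int \<Rightarrow> bool list \<Rightarrow> bool" where
  "stack_tape t x \<longleftrightarrow> (\<forall>i. fst t i = word_tape x (i - snd t))"

definition top_symbol :: "bool list \<Rightarrow> nat" where
  "top_symbol x = (case x of [] \<Rightarrow> 0 | b # _ \<Rightarrow> if b then 2 else 1)"

lemma top_symbol_simps [simp]:
  "top_symbol [] = 0" "top_symbol (b # x) = (if b then 2 else 1)" "top_symbol x = 0 \<longleftrightarrow> x = []"
  by (auto simp: top_symbol_def split: list.splits)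

lemma word_tape_Nil [simp]: "word_tape [] i = 0"
  by (simp add: word_tape_def)

lemma word_tape_Cons:
  "word_tape (b # x) i = (if i = 0 then if b then 2 else 1 else word_tape x (i - 1))"
proof -
  have "nat i = Suc (nat (i - 1))" if "i > 0" using that by linarith
  then show ?thesis by (auto simp: word_tape_def)
qed

lemma word_tape_tl: "word_tape (tl x) (i - 1) = (if i = 0 then 0 else word_tape x i)"
  by (cases x) (auto simp: word_tape_Cons, simp add: word_tape_def)

lemma word_tape_eq_0_iff: "word_tape x i = 0 \<longleftrightarrow> \<not> (0 \<le> i \<and> i < int (length x))"
  by (auto simp: word_tape_def)

lemma stack_tape_head: "stack_tape t x \<Longrightarrow> fst t (snd t) = top_symbol x"
  by (cases x) (auto simp: stack_tape_def word_tape_Cons)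

definition nonblank :: "(int \<Rightarrow> nat) \<times> int \<Rightarrow> int set" where
  "nonblank t = {i. fst t i \<noteq> 0}"

lemma card_nonblank_stack_tape:
  assumes "stack_tape t x"
  shows "finite (nonblank t)" "card (nonblank t) = length x"
proof -
  have "bij_betw (\<lambda>j. int j + snd t) {..<length x} (nonblank t)"
    by (rule bij_betwI[where g = "\<lambda>i. nat (i - snd t)"])
      (use assms in \<open>auto simp: nonblank_def stack_tape_def word_tape_eq_0_iff simp del: neq0_conv\<close>)
  then show "finite (nonblank t)" "card (nonblank t) = length x"
    using bij_betw_finite bij_betw_same_card by fastforce+
qed

text \<open>Tape 0 is reserved for input and output and tape 1 for the marker of cell 0 of tape 0.\<close>

definition represents :: "tapes \<Rightarrow> store \<Rightarrow> bool" where
  "represents \<tau> s \<longleftrightarrow> (\<forall>r. stack_tape (\<tau> (r + 2)) (s r))"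

definition tops :: "store \<Rightarrow> nat \<Rightarrow> nat" where
  "tops s r = top_symbol (s r)"

definition reg_test :: "((nat \<Rightarrow> nat) \<Rightarrow> bool) \<Rightarrow> (nat \<Rightarrow> nat) \<Rightarrow> bool" where
  "reg_test q ss = q (\<lambda>r. ss (r + 2))"

definition store_runs :: "com \<Rightarrow> store \<Rightarrow> nat \<Rightarrow> store \<Rightarrow> bool" where
  "store_runs c s t s' \<longleftrightarrow> (\<forall>\<tau>. represents \<tau> s \<longrightarrow>
     (\<exists>\<tau>'. runs c \<tau> t \<tau>' \<and> represents \<tau>' s' \<and> \<tau>' 0 = \<tau> 0 \<and> \<tau>' 1 = \<tau> 1))"

lemma store_runs_weaken: "store_runs c s t s' \<Longrightarrow> t \<le> t' \<Longrightarrow> s' = s'' \<Longrightarrow> store_runs c s t' s''"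
  unfolding store_runs_def using runs_mono by blast

lemma reg_test_heads: "represents \<tau> s \<Longrightarrow> reg_test q (heads \<tau>) = q (tops s)"
  unfolding reg_test_def by (intro arg_cong[of _ _ q] ext)
    (auto simp: represents_def heads_def tops_def intro: stack_tape_head)

lemma store_runs_Skip: "store_runs Skip s 0 s"
  by (auto simp: store_runs_def runs_0_iff)

lemma store_runs_Seq:
  "store_runs c s t s' \<Longrightarrow> store_runs d s' u s'' \<Longrightarrow> store_runs (Seq c d) s (t + 1 + u) s''"
  unfolding store_runs_def by (metis runs_Seq)

lemma store_runs_Cond:
  assumes "store_runs (if q (tops s) then c else d) s t s'"
  shows "store_runs (Cond (reg_test q) c d) s (t + 1) s'"
proof -
  have "runs (Cond (reg_test q) c d) \<tau> (t + 1) \<tau>'"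
    if "represents \<tau> s" "runs (if q (tops s) then c else d) \<tau> t \<tau>'" for \<tau> \<tau>'
    using that by (intro runs_Cond) (simp add: reg_test_heads)
  then show ?thesis using assms unfolding store_runs_def by blast
qed

lemma store_runs_Loop:
  assumes "store_runs (if q (tops s) then Seq c (Loop (reg_test q) c) else Skip) s t s'"
  shows "store_runs (Loop (reg_test q) c) s (t + 1) s'"
proof -
  have "runs (Loop (reg_test q) c) \<tau> (t + 1) \<tau>'"
    if "represents \<tau> s"
      "runs (if q (tops s) then Seq c (Loop (reg_test q) c) else Skip) \<tau> t \<tau>'" for \<tau> \<tau>'
    using that by (intro runs_Loop) (simp add: reg_test_heads)
  then show ?thesis using assms unfolding store_runs_def by blast
qed

lemma store_runs_Loop_iterate:
  assumes "\<And>k. k < n \<Longrightarrow> q (tops (S k))" "\<And>k. k < n \<Longrightarrow> store_runs c (S k) t (S (Suc k))"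
    and "\<not> q (tops (S n))"
  shows "store_runs (Loop (reg_test q) c) (S 0) (n * (t + 2) + 1) (S n)"
proof (rule backward_iterate)
  show "store_runs (Loop (reg_test q) c) (S n) 1 (S n)"
    using store_runs_Loop[of q "S n" c 0 "S n"] assms(3) by (simp add: store_runs_Skip)
next
  fix k u assume "k < n" and rest: "store_runs (Loop (reg_test q) c) (S (Suc k)) u (S n)"
  then have "store_runs (Seq c (Loop (reg_test q) c)) (S k) (t + 1 + u) (S n)"
    by (intro store_runs_Seq[OF _ rest] assms(2))
  then show "store_runs (Loop (reg_test q) c) (S k) (t + 2 + u) (S n)"
    using store_runs_Loop[of q "S k" c "t + 1 + u"] assms(1)[OF \<open>k < n\<close>] by simp
qed

definition push :: "nat \<Rightarrow> bool \<Rightarrow> com" where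
  "push r b = Seq (Act (\<lambda>ss i. (ss i, if i = r + 2 then -1 else 0)))
     (Act (\<lambda>ss i. (if i = r + 2 then if b then 2 else 1 else ss i, 0)))"

definition pop :: "nat \<Rightarrow> com" where
  "pop r = Act (\<lambda>ss i. if i = r + 2 then (0, 1) else (ss i, 0))"

lemma bounded_push: "bounded_com (r + 3) (push r b)"
  by (auto simp: push_def)

lemma bounded_pop: "bounded_com (r + 3) (pop r)"
  by (auto simp: pop_def)

lemma represents_upd:
  assumes "represents \<tau> s" "stack_tape (\<tau>' (r + 2)) x" "\<And>i. i \<noteq> r + 2 \<Longrightarrow> \<tau>' i = \<tau> i"
  shows "represents \<tau>' (s(r := x))"
  using assms by (simp add: represents_def)

lemma store_runs_push: "store_runs (push r b) s 3 (s(r := b # s r))"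
  unfolding store_runs_def
proof (intro allI impI)
  fix \<tau> assume \<tau>: "represents \<tau> s"
  define h where "h = snd (\<tau> (r + 2))"
  define \<tau>' where "\<tau>' = \<tau>(r + 2 := ((fst (\<tau> (r + 2)))(h - 1 := if b then 2 else 1), h - 1))"
  have moved: "perform (\<lambda>i. (heads \<tau> i, if i = r + 2 then -1 else 0)) \<tau> =
      \<tau>(r + 2 := (fst (\<tau> (r + 2)), h - 1))"
    by (auto simp: perform_def heads_def h_def fun_eq_iff prod_eq_iff)
  have written: "perform (\<lambda>i. (if i = r + 2 then if b then 2 else 1 else heads \<sigma> i, 0)) \<sigma> = \<tau>'"
    if "\<sigma> = \<tau>(r + 2 := (fst (\<tau> (r + 2)), h - 1))" for \<sigma>
    unfolding that by (auto simp: perform_def heads_def \<tau>'_def fun_eq_iff prod_eq_iff)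
  have "runs (push r b) \<tau> (1 + 1 + 1) \<tau>'"
    unfolding push_def written[OF moved, symmetric] by (rule runs_Seq[OF runs_Act runs_Act])
  moreover have "represents \<tau>' (s(r := b # s r))"
  proof (rule represents_upd[OF \<tau>])
    have "stack_tape (\<tau> (r + 2)) (s r)" using \<tau> by (simp add: represents_def)
    then show "stack_tape (\<tau>' (r + 2)) (b # s r)"
      by (auto simp: stack_tape_def word_tape_Cons \<tau>'_def h_def algebra_simps)
  qed (simp add: \<tau>'_def)
  ultimately show "\<exists>\<tau>'. runs (push r b) \<tau> 3 \<tau>' \<and> represents \<tau>' (s(r := b # s r)) \<and>
      \<tau>' 0 = \<tau> 0 \<and> \<tau>' 1 = \<tau> 1"
    by (intro exI[of _ \<tau>']) (simp add: \<tau>'_def numeral_eq_Suc)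
qed

lemma store_runs_pop: "store_runs (pop r) s 1 (s(r := tl (s r)))"
  unfolding store_runs_def
proof (intro allI impI)
  fix \<tau> assume \<tau>: "represents \<tau> s"
  define h where "h = snd (\<tau> (r + 2))"
  define \<tau>' where "\<tau>' = \<tau>(r + 2 := ((fst (\<tau> (r + 2)))(h := 0), h + 1))"
  have popped: "perform (\<lambda>i. if i = r + 2 then (0, 1) else (heads \<tau> i, 0)) \<tau> = \<tau>'"
    by (auto simp: perform_def heads_def \<tau>'_def h_def fun_eq_iff prod_eq_iff)
  have "runs (pop r) \<tau> 1 \<tau>'"
    unfolding pop_def popped[symmetric] by (rule runs_Act)
  moreover have "represents \<tau>' (s(r := tl (s r)))"
  proof (rule represents_upd[OF \<tau>])
    have "stack_tape (\<tau> (r + 2)) (s r)" using \<tau> by (simp add: represents_def)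
    then show "stack_tape (\<tau>' (r + 2)) (tl (s r))"
      using word_tape_tl[of "s r" "i - h" for i]
      by (auto simp: stack_tape_def \<tau>'_def h_def algebra_simps)
  qed (simp add: \<tau>'_def)
  ultimately show "\<exists>\<tau>'. runs (pop r) \<tau> 1 \<tau>' \<and> represents \<tau>' (s(r := tl (s r))) \<and>
      \<tau>' 0 = \<tau> 0 \<and> \<tau>' 1 = \<tau> 1"
    by (intro exI[of _ \<tau>']) (simp add: \<tau>'_def)
qed

lemma card_nonblank_perform:
  assumes "finite (nonblank (\<tau> i))"
  shows "finite (nonblank (perform a \<tau> i))"
    "card (nonblank (perform a \<tau> i)) \<le> Suc (card (nonblank (\<tau> i)))"
proof -
  have sub: "nonblank (perform a \<tau> i) \<subseteq> insert (snd (\<tau> i)) (nonblank (\<tau> i))"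
    by (auto simp: nonblank_def perform_def)
  then show "finite (nonblank (perform a \<tau> i))" using assms finite_subset by blast
  have "card (nonblank (perform a \<tau> i)) \<le> card (insert (snd (\<tau> i)) (nonblank (\<tau> i)))"
    using sub assms by (intro card_mono) auto
  also have "\<dots> \<le> Suc (card (nonblank (\<tau> i)))" using assms by (simp add: card_insert_if)
  finally show "card (nonblank (perform a \<tau> i)) \<le> Suc (card (nonblank (\<tau> i)))" .
qed

lemma card_nonblank_runs:
  "runs c \<tau> t \<tau>' \<Longrightarrow> finite (nonblank (\<tau> i)) \<Longrightarrow> card (nonblank (\<tau>' i)) \<le> card (nonblank (\<tau> i)) + t"
proof (induction t arbitrary: c \<tau>)
  case 0
  then show ?case by (simp add: runs_0_iff)
next
  case (Suc t)
  let ?\<tau> = "perform (snd (com_step c (heads \<tau>))) \<tau>"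
  have "card (nonblank (\<tau>' i)) \<le> card (nonblank (?\<tau> i)) + t"
    using Suc.prems card_nonblank_perform(1)[of \<tau> i] by (intro Suc.IH) (auto simp: runs_Suc_iff)
  then show ?case
    using card_nonblank_perform(2)[of \<tau> i "snd (com_step c (heads \<tau>))"] Suc.prems(2) by linarith
qed

lemma store_runs_length:
  assumes "store_runs c s t s'"
  shows "length (s' r) \<le> length (s r) + t"
proof -
  define \<tau> :: tapes where "\<tau> i = (if i < 2 then \<lambda>_. 0 else word_tape (s (i - 2)), 0)" for i
  have \<tau>: "represents \<tau> s" by (simp add: represents_def \<tau>_def stack_tape_def)
  then obtain \<tau>' where run: "runs c \<tau> t \<tau>'" and \<tau>': "represents \<tau>' s'"
    using assms unfolding store_runs_def by blast
  have tape: "stack_tape (\<tau> (r + 2)) (s r)" and tape': "stack_tape (\<tau>' (r + 2)) (s' r)"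
    using \<tau> \<tau>' unfolding represents_def by blast+
  show ?thesis
    using card_nonblank_runs[OF run, of "r + 2"] card_nonblank_stack_tape(1)[OF tape]
    by (simp only: card_nonblank_stack_tape(2)[OF tape] card_nonblank_stack_tape(2)[OF tape'])
qed

subsection \<open>Polynomial running time\<close>

definition store_size :: "store \<Rightarrow> nat \<Rightarrow> nat" where
  "store_size s N = (\<Sum>i<N. length (s i))"

lemma store_size_mono: "N \<le> N' \<Longrightarrow> store_size s N \<le> store_size s N'"
  unfolding store_size_def by (rule sum_mono2) auto

lemma poly_nat_mono:
  fixes p :: "nat poly"
  assumes "a \<le> b"
  shows "poly p a \<le> poly p b"
  using assms by (induction p) (auto intro: mult_mono add_mono)

definition poly_size :: "('i \<Rightarrow> bool) \<Rightarrow> ('i \<Rightarrow> store) \<Rightarrow> ('i \<Rightarrow> nat) \<Rightarrow> bool" where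
  "poly_size D A n \<longleftrightarrow> (\<exists>N (p :: nat poly). \<forall>i. D i \<longrightarrow> n i \<le> poly p (store_size (A i) N))"

lemma poly_sizeE:
  assumes "poly_size D A n"
  obtains N p where "\<And>i. D i \<Longrightarrow> n i \<le> poly p (store_size (A i) N)"
  using assms unfolding poly_size_def by blast

lemma poly_size_mono: "poly_size D A n \<Longrightarrow> (\<And>i. D i \<Longrightarrow> m i \<le> n i) \<Longrightarrow> poly_size D A m"
  unfolding poly_size_def by (meson le_trans)

lemma poly_size_subst:
  assumes "poly_size D A n" "\<And>j. D' j \<Longrightarrow> D (h j) \<and> A' j = A (h j)"
  shows "poly_size D' A' (\<lambda>j. n (h j))"
  using assms unfolding poly_size_def by metis

lemma poly_size_const: "poly_size D A (\<lambda>_. c)"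
  unfolding poly_size_def by (rule exI, rule exI[of _ "[:c:]"]) simp

lemma poly_size_length: "poly_size D A (\<lambda>i. length (A i r))"
proof -
  have "length (s r) \<le> store_size s (Suc r)" for s :: store
    unfolding store_size_def by (rule member_le_sum) auto
  then show ?thesis
    unfolding poly_size_def by (intro exI[of _ "Suc r"] exI[of _ "[:0, 1:]"]) simp
qed

lemma poly_size_poly: "poly_size D A n \<Longrightarrow> poly_size D A (\<lambda>i. poly p (n i))"
  unfolding poly_size_def by (metis poly_nat_mono poly_pcompose)

lemma poly_size_combine:
  assumes "poly_size D A m" "poly_size D A n"
    and f: "\<And>a b a' b' :: nat. a \<le> a' \<Longrightarrow> b \<le> b' \<Longrightarrow> f a b \<le> f a' b'"
    and g: "\<And>(p :: nat poly) q x. f (poly p x) (poly q x) = poly (g p q) x"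
  shows "poly_size D A (\<lambda>i. f (m i) (n i))"
proof -
  obtain M p where m: "\<And>i. D i \<Longrightarrow> m i \<le> poly p (store_size (A i) M)"
    by (rule poly_sizeE[OF assms(1)]) blast
  obtain N q where n: "\<And>i. D i \<Longrightarrow> n i \<le> poly q (store_size (A i) N)"
    by (rule poly_sizeE[OF assms(2)]) blast
  have "f (m i) (n i) \<le> poly (g p q) (store_size (A i) (max M N))" if "D i" for i
    unfolding g[symmetric]
    by (intro f le_trans[OF m[OF that]] le_trans[OF n[OF that]] poly_nat_mono store_size_mono) auto
  then show ?thesis unfolding poly_size_def by blast
qed

lemma poly_size_add: "poly_size D A m \<Longrightarrow> poly_size D A n \<Longrightarrow> poly_size D A (\<lambda>i. m i + n i)"
  by (rule poly_size_combine[where f = "(+)" and g = "(+)"]) auto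

lemma poly_size_mult: "poly_size D A m \<Longrightarrow> poly_size D A n \<Longrightarrow> poly_size D A (\<lambda>i. m i * n i)"
  by (rule poly_size_combine[where f = "(*)" and g = "(*)"]) (auto intro: mult_le_mono)

lemma poly_size_Suc: "poly_size D A n \<Longrightarrow> poly_size D A (\<lambda>i. Suc (n i))"
  using poly_size_add[OF _ poly_size_const[of D A 1]] by simp

lemmas poly_size_intros =
  poly_size_const poly_size_length poly_size_poly poly_size_add poly_size_mult poly_size_Suc

lemma poly_size_trans:
  assumes n: "poly_size D B n" and B: "\<And>r. poly_size D A (\<lambda>i. length (B i r))"
  shows "poly_size D A n"
proof -
  obtain N p where "\<And>i. D i \<Longrightarrow> n i \<le> poly p (store_size (B i) N)"
    by (rule poly_sizeE[OF n]) blast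
  moreover have "poly_size D A (\<lambda>i. store_size (B i) N)"
    unfolding store_size_def by (induction N) (simp_all add: poly_size_const poly_size_add B)
  ultimately show ?thesis using poly_size_mono poly_size_poly by blast
qed

lemma poly_size_sum:
  assumes "poly_size (\<lambda>(i, k). D i \<and> k < n i) (\<lambda>(i, k). A i) (\<lambda>(i, k). m i k)" "poly_size D A n"
  shows "poly_size (\<lambda>(i, k). D i \<and> k \<le> n i) (\<lambda>(i, k). A i) (\<lambda>(i, k). \<Sum>j<k. m i j)"
proof -
  obtain N p where m: "\<And>i k. D i \<Longrightarrow> k < n i \<Longrightarrow> m i k \<le> poly p (store_size (A i) N)"
    using assms(1) unfolding poly_size_def by (auto split: prod.splits)
  have "(\<Sum>j<k. m i j) \<le> n i * poly p (store_size (A i) N)" if "D i" "k \<le> n i" for i k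
  proof -
    have "(\<Sum>j<k. m i j) \<le> k * poly p (store_size (A i) N)"
      using sum_bounded_above[of "{..<k}" "m i"] m that by simp
    also have "\<dots> \<le> n i * poly p (store_size (A i) N)" using that by (intro mult_le_mono1)
    finally show ?thesis .
  qed
  moreover have "poly_size D A (\<lambda>i. n i * poly p (store_size (A i) N))"
    unfolding store_size_def
    by (intro poly_size_mult assms(2) poly_size_poly) (induction N; simp add: poly_size_intros)
  from poly_size_subst[OF this, where h = fst and D' = "\<lambda>(i, k). D i \<and> k \<le> n i"
    and A' = "\<lambda>(i, k). A i"]
  have "poly_size (\<lambda>(i, k). D i \<and> k \<le> n i) (\<lambda>(i, k). A i)
      (\<lambda>j. n (fst j) * poly p (store_size (A (fst j)) N))"
    by auto
  ultimately show ?thesis by (elim poly_size_mono) auto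
qed

text \<open>
  A program writes at most one symbol per step, so the running time also bounds the sizes of the
  stores that it produces.
\<close>

definition poly_runs :: "('i \<Rightarrow> bool) \<Rightarrow> ('i \<Rightarrow> store) \<Rightarrow> com \<Rightarrow> ('i \<Rightarrow> store) \<Rightarrow> bool" where
  "poly_runs D A c B \<longleftrightarrow> (\<exists>b. bounded_com b c) \<and>
     (\<exists>T. poly_size D A T \<and> (\<forall>i. D i \<longrightarrow> store_runs c (A i) (T i) (B i)))"

lemma poly_runsI:
  assumes "bounded_com b c" "poly_size D A T" "\<And>i. D i \<Longrightarrow> store_runs c (A i) (T i) (B i)"
  shows "poly_runs D A c B"
  using assms unfolding poly_runs_def by blast

lemma poly_runsE:
  assumes "poly_runs D A c B"
  obtains b T where "bounded_com b c" "poly_size D A T" "\<And>i. D i \<Longrightarrow> store_runs c (A i) (T i) (B i)"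
  using assms unfolding poly_runs_def by blast

lemma poly_runs_size:
  assumes "poly_runs D A c B"
  shows "poly_size D A (\<lambda>i. length (B i r))"
proof -
  obtain T where "poly_size D A T" "\<And>i. D i \<Longrightarrow> store_runs c (A i) (T i) (B i)"
    using assms by (rule poly_runsE) blast
  then have "poly_size D A (\<lambda>i. length (A i r) + T i)"
    "\<And>i. D i \<Longrightarrow> length (B i r) \<le> length (A i r) + T i"
    by (auto intro: poly_size_add poly_size_length store_runs_length)
  then show ?thesis by (rule poly_size_mono)
qed

lemma poly_runs_subst:
  assumes "poly_runs D A c B" "\<And>j. D' j \<Longrightarrow> D (h j) \<and> A' j = A (h j) \<and> B' j = B (h j)"
  shows "poly_runs D' A' c B'"
proof -
  obtain b T where "bounded_com b c" "poly_size D A T" "\<And>i. D i \<Longrightarrow> store_runs c (A i) (T i) (B i)"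
    using assms(1) by (rule poly_runsE) blast
  moreover have "poly_size D' A' (\<lambda>j. T (h j))"
    using \<open>poly_size D A T\<close> by (rule poly_size_subst) (simp add: assms(2))
  ultimately show ?thesis using assms(2) by (intro poly_runsI[where T = "\<lambda>j. T (h j)"]) auto
qed

lemmas poly_runs_cong = poly_runs_subst[where h = "\<lambda>i. i"]

lemma poly_runs_at:
  assumes "poly_runs P (\<lambda>s. s) c F" "\<And>i. D i \<Longrightarrow> P (A i) \<and> B i = F (A i)"
  shows "poly_runs D A c B"
  using assms(1) by (rule poly_runs_subst[where h = A]) (simp add: assms(2))

lemma poly_runs_Seq:
  assumes "poly_runs D A c B" "poly_runs D B d C"
  shows "poly_runs D A (Seq c d) C"
proof -
  obtain b T where c: "bounded_com b c" "poly_size D A T" "\<And>i. D i \<Longrightarrow> store_runs c (A i) (T i) (B i)"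
    using assms(1) by (rule poly_runsE) blast
  obtain b' T' where d: "bounded_com b' d" "poly_size D B T'"
    "\<And>i. D i \<Longrightarrow> store_runs d (B i) (T' i) (C i)"
    using assms(2) by (rule poly_runsE) blast
  have "bounded_com (max b b') (Seq c d)"
    using bounded_com_mono[OF c(1)] bounded_com_mono[OF d(1)] by simp
  moreover have "poly_size D A T'"
    by (rule poly_size_trans[OF d(2) poly_runs_size[OF assms(1)]])
  then have "poly_size D A (\<lambda>i. T i + 1 + T' i)"
    by (intro poly_size_add poly_size_const c(2))
  ultimately show ?thesis
    using store_runs_Seq[OF c(3) d(3)] by (intro poly_runsI)
qed

lemma poly_runs_Cond:
  assumes "poly_runs (\<lambda>i. D i \<and> q (tops (A i))) A c B"
    "poly_runs (\<lambda>i. D i \<and> \<not> q (tops (A i))) A d B"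
  shows "poly_runs D A (Cond (reg_test q) c d) B"
proof -
  obtain b N p where c: "bounded_com b c"
    "\<And>i. D i \<Longrightarrow> q (tops (A i)) \<Longrightarrow> store_runs c (A i) (poly p (store_size (A i) N)) (B i)"
    using assms(1) unfolding poly_runs_def poly_size_def by (metis store_runs_weaken)
  obtain b' N' p' where d: "bounded_com b' d"
    "\<And>i. D i \<Longrightarrow> \<not> q (tops (A i)) \<Longrightarrow> store_runs d (A i) (poly p' (store_size (A i) N')) (B i)"
    using assms(2) unfolding poly_runs_def poly_size_def by (metis store_runs_weaken)
  let ?T = "\<lambda>i. poly p (store_size (A i) N) + poly p' (store_size (A i) N') + 1"
  have "poly_size D A (\<lambda>i. poly r (store_size (A i) M))" for r M
    unfolding poly_size_def by blast
  then have "poly_size D A ?T" by (intro poly_size_add poly_size_const)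
  moreover have "bounded_com (max b b') (Cond (reg_test q) c d)"
    using bounded_com_mono[OF c(1)] bounded_com_mono[OF d(1)] by simp
  moreover have "store_runs (Cond (reg_test q) c d) (A i) (?T i) (B i)" if "D i" for i
  proof (rule store_runs_Cond, cases "q (tops (A i))")
    case True
    then show "store_runs (if q (tops (A i)) then c else d) (A i)
        (poly p (store_size (A i) N) + poly p' (store_size (A i) N')) (B i)"
      using store_runs_weaken[OF c(2)[OF that]] by simp
  next
    case False
    then show "store_runs (if q (tops (A i)) then c else d) (A i)
        (poly p (store_size (A i) N) + poly p' (store_size (A i) N')) (B i)"
      using store_runs_weaken[OF d(2)[OF that]] by simp
  qed
  ultimately show ?thesis by (intro poly_runsI)
qed

lemma poly_runs_Loop:
  assumes body: "poly_runs (\<lambda>(i, k). D i \<and> k < n i) (\<lambda>(i, k). S i k) c (\<lambda>(i, k). S i (Suc k))"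
    and enter: "\<And>i k. D i \<Longrightarrow> k < n i \<Longrightarrow> q (tops (S i k))"
    and leave: "\<And>i. D i \<Longrightarrow> \<not> q (tops (S i (n i)))"
    and n: "poly_size D (\<lambda>i. S i 0) n"
    and size: "\<And>r. poly_size (\<lambda>(i, k). D i \<and> k < n i) (\<lambda>(i, k). S i 0) (\<lambda>(i, k). length (S i k r))"
  shows "poly_runs D (\<lambda>i. S i 0) (Loop (reg_test q) c) (\<lambda>i. S i (n i))"
proof -
  let ?D = "\<lambda>(i, k). D i \<and> k < n i"
  obtain b T where c: "bounded_com b c" "poly_size ?D (\<lambda>(i, k). S i k) T"
    "\<And>j. ?D j \<Longrightarrow> store_runs c (case j of (i, k) \<Rightarrow> S i k) (T j) (case j of (i, k) \<Rightarrow> S i (Suc k))"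
    using body by (rule poly_runsE) blast
  have "poly_size ?D (\<lambda>(i, k). S i 0) T"
    using size by (intro poly_size_trans[OF c(2)]) (simp add: case_prod_unfold)
  then obtain N p where T: "\<And>i k. D i \<Longrightarrow> k < n i \<Longrightarrow> T (i, k) \<le> poly p (store_size (S i 0) N)"
    unfolding poly_size_def by auto
  let ?t = "\<lambda>i. poly p (store_size (S i 0) N)"
  have "poly_size D (\<lambda>i. S i 0) ?t" unfolding poly_size_def by blast
  then have "poly_size D (\<lambda>i. S i 0) (\<lambda>i. n i * (?t i + 2) + 1)"
    using n by (intro poly_size_add poly_size_mult poly_size_const)
  moreover have "store_runs (Loop (reg_test q) c) (S i 0) (n i * (?t i + 2) + 1) (S i (n i))"
    if "D i" for i
    using enter leave store_runs_weaken[OF c(3)[of "(i, k)" for k]] T that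
    by (intro store_runs_Loop_iterate) auto
  ultimately show ?thesis using c(1) by (intro poly_runsI[of b]) auto
qed

lemma poly_runs_push:
  assumes "\<And>i. D i \<Longrightarrow> B i = (A i)(r := b # A i r)"
  shows "poly_runs D A (push r b) B"
  by (rule poly_runsI[OF bounded_push poly_size_const[of _ _ 3]]) (simp add: assms store_runs_push)

primrec pushes :: "nat \<Rightarrow> bool list \<Rightarrow> com" where
  "pushes r [] = Skip"
| "pushes r (b # bs) = Seq (push r b) (pushes r bs)"

lemma bounded_pushes: "bounded_com (r + 3) (pushes r bs)"
  by (induction bs) (auto simp: bounded_push simp del: One_nat_def)

lemma store_runs_pushes: "store_runs (pushes r bs) s (length bs * 4) (s(r := rev bs @ s r))"
proof (induction bs arbitrary: s)
  case Nil
  then show ?case using store_runs_Skip by simp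
next
  case (Cons b bs)
  have "store_runs (Seq (push r b) (pushes r bs)) s (3 + 1 + length bs * 4)
      ((s(r := b # s r))(r := rev bs @ (s(r := b # s r)) r))"
    by (rule store_runs_Seq[OF store_runs_push Cons.IH])
  then show ?case unfolding pushes.simps by (rule store_runs_weaken) auto
qed

lemma poly_runs_pushes:
  assumes "\<And>i. D i \<Longrightarrow> B i = (A i)(r := rev bs @ A i r)"
  shows "poly_runs D A (pushes r bs) B"
  by (rule poly_runsI[OF bounded_pushes poly_size_const[of _ _ "length bs * 4"]])
    (simp add: assms store_runs_pushes)

definition pop_each :: "nat \<Rightarrow> (bool \<Rightarrow> com) \<Rightarrow> com" where
  "pop_each r f = Loop (reg_test (\<lambda>h. h r \<noteq> 0))
     (Cond (reg_test (\<lambda>h. h r = 2)) (Seq (pop r) (f True)) (Seq (pop r) (f False)))"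

lemma store_runs_pop_each:
  assumes "\<And>k. k \<le> length x \<Longrightarrow> S k r = drop k x"
    and "\<And>k. k < length x \<Longrightarrow> store_runs (f (x ! k)) ((S k)(r := drop (Suc k) x)) t (S (Suc k))"
  shows "store_runs (pop_each r f) (S 0) (length x * ((1 + 1 + t + 1) + 2) + 1) (S (length x))"
  unfolding pop_each_def
proof (rule store_runs_Loop_iterate)
  fix k assume k: "k < length x"
  then have top: "S k r = x ! k # drop (Suc k) x"
    using assms(1)[of k] by (simp add: Cons_nth_drop_Suc)
  have "store_runs (Seq (pop r) (f (x ! k))) (S k) (1 + 1 + t) (S (Suc k))"
    using assms(2)[OF k] store_runs_pop[of r "S k"] top by (intro store_runs_Seq) auto
  then have "store_runs (if tops (S k) r = 2 then Seq (pop r) (f True) else Seq (pop r) (f False))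
      (S k) (1 + 1 + t) (S (Suc k))"
    using top by (cases "x ! k") (auto simp: tops_def)
  then show "store_runs (Cond (reg_test (\<lambda>h. h r = 2)) (Seq (pop r) (f True))
      (Seq (pop r) (f False)))
      (S k) (1 + 1 + t + 1) (S (Suc k))"
    by (rule store_runs_Cond)
qed (use assms(1) in \<open>auto simp: tops_def\<close>)

lemma poly_runs_pop_each:
  assumes f: "\<And>b. bounded_com B (f b)"
    and S: "\<And>i k. D i \<Longrightarrow> k \<le> length (S i 0 r) \<Longrightarrow> S i k r = drop k (S i 0 r)"
    and step: "\<And>i k. D i \<Longrightarrow> k < length (S i 0 r) \<Longrightarrow>
       store_runs (f (S i 0 r ! k)) ((S i k)(r := drop (Suc k) (S i 0 r))) t (S i (Suc k))"
  shows "poly_runs D (\<lambda>i. S i 0) (pop_each r f) (\<lambda>i. S i (length (S i 0 r)))"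
proof (rule poly_runsI)
  have "bounded_com (max B (r + 3)) (f b)" for b
    using f by (rule bounded_com_mono) simp
  moreover have "bounded_com (max B (r + 3)) (pop r)"
    using bounded_pop by (rule bounded_com_mono) simp
  ultimately show "bounded_com (max B (r + 3)) (pop_each r f)"
    unfolding pop_each_def by simp
  show "store_runs (pop_each r f) (S i 0) (length (S i 0 r) * ((1 + 1 + t + 1) + 2) + 1)
      (S i (length (S i 0 r)))"
    if "D i" for i
    by (rule store_runs_pop_each[OF S[OF that] step[OF that]])
qed (intro poly_size_intros)

definition move :: "nat \<Rightarrow> nat \<Rightarrow> com" where
  "move r r' = pop_each r (push r')"

lemma poly_runs_move:
  assumes "r \<noteq> r'" "\<And>i. D i \<Longrightarrow> B i = (A i)(r := [], r' := rev (A i r) @ A i r')"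
  shows "poly_runs D A (move r r') B"
proof -
  define S where "S i k = (A i)(r := drop k (A i r), r' := rev (take k (A i r)) @ A i r')" for i k
  have "poly_runs D (\<lambda>i. S i 0) (pop_each r (push r')) (\<lambda>i. S i (length (S i 0 r)))"
  proof (rule poly_runs_pop_each[OF bounded_push])
    fix i k assume "k < length (S i 0 r)"
    then show "store_runs (push r' (S i 0 r ! k))
        ((S i k)(r := drop (Suc k) (S i 0 r))) 3 (S i (Suc k))"
      using assms(1) by (intro store_runs_weaken[OF store_runs_push])
        (auto simp: S_def fun_eq_iff take_Suc_conv_app_nth)
  qed (use assms(1) in \<open>auto simp: S_def\<close>)
  then show ?thesis
    unfolding move_def using assms by (elim poly_runs_cong) (auto simp: S_def)
qed

definition move2 :: "nat \<Rightarrow> nat \<Rightarrow> nat \<Rightarrow> com" where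
  "move2 r r' r'' = pop_each r (\<lambda>b. Seq (push r' b) (push r'' b))"

lemma poly_runs_move2:
  assumes "distinct [r, r', r'']"
    and "\<And>i. D i \<Longrightarrow> B i = (A i)(r := [], r' := rev (A i r) @ A i r', r'' := rev (A i r) @ A i r'')"
  shows "poly_runs D A (move2 r r' r'') B"
proof -
  define S where "S i k = (A i)(r := drop k (A i r), r' := rev (take k (A i r)) @ A i r',
    r'' := rev (take k (A i r)) @ A i r'')" for i k
  have "poly_runs D (\<lambda>i. S i 0) (pop_each r (\<lambda>b. Seq (push r' b) (push r'' b)))
      (\<lambda>i. S i (length (S i 0 r)))"
  proof (rule poly_runs_pop_each)
    show "bounded_com (max (r' + 3) (r'' + 3)) (Seq (push r' b) (push r'' b))" for b
      using bounded_com_mono[OF bounded_push] by simp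
    fix i k assume "k < length (S i 0 r)"
    then show "store_runs (Seq (push r' (S i 0 r ! k)) (push r'' (S i 0 r ! k)))
        ((S i k)(r := drop (Suc k) (S i 0 r))) (3 + 1 + 3) (S i (Suc k))"
      using assms(1)
      by (intro store_runs_weaken[OF store_runs_Seq[OF store_runs_push store_runs_push]])
        (auto simp: S_def fun_eq_iff take_Suc_conv_app_nth)
  qed (use assms(1) in \<open>auto simp: S_def\<close>)
  then show ?thesis
    unfolding move2_def using assms by (elim poly_runs_cong) (auto simp: S_def)
qed

definition clear :: "nat \<Rightarrow> com" where
  "clear r = pop_each r (\<lambda>_. Skip)"

lemma poly_runs_clear:
  assumes "\<And>i. D i \<Longrightarrow> B i = (A i)(r := [])"
  shows "poly_runs D A (clear r) B"
proof -
  define S where "S i k = (A i)(r := drop k (A i r))" for i k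
  have "poly_runs D (\<lambda>i. S i 0) (pop_each r (\<lambda>_. Skip)) (\<lambda>i. S i (length (S i 0 r)))"
  proof (rule poly_runs_pop_each[where t = 0 and B = 0])
    show "store_runs Skip ((S i k)(r := drop (Suc k) (S i 0 r))) 0 (S i (Suc k))" for i k
      by (rule store_runs_weaken[OF store_runs_Skip]) (auto simp: S_def)
  qed (auto simp: S_def)
  then show ?thesis
    unfolding clear_def using assms by (elim poly_runs_cong) (auto simp: S_def)
qed

text \<open>
  The expression \<open>E\<close> reads registers below \<open>d\<close>. Its value can be computed into any register \<open>e \<ge>
  d\<close> such that \<open>e\<close> and all registers above it are empty; this leaves room for intermediate results
  between \<open>d\<close> and \<open>e\<close>.
\<close>

definition empty_from :: "nat \<Rightarrow> store \<Rightarrow> bool" where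
  "empty_from e s \<longleftrightarrow> (\<forall>i\<ge>e. s i = [])"

definition computable :: "nat \<Rightarrow> (store \<Rightarrow> bool) \<Rightarrow> (store \<Rightarrow> bool list) \<Rightarrow> bool" where
  "computable d D E \<longleftrightarrow> (\<forall>e\<ge>d. \<forall>s x. E (s(e := x)) = E s \<and> D (s(e := x)) = D s) \<and>
     (\<forall>e\<ge>d. \<exists>c. poly_runs (\<lambda>s. D s \<and> empty_from e s) (\<lambda>s. s) c (\<lambda>s. s(e := E s)))"

lemma computableI:
  assumes "\<And>e s x. d \<le> e \<Longrightarrow> E (s(e := x)) = E s" "\<And>e s x. d \<le> e \<Longrightarrow> D (s(e := x)) = D s"
    and "\<And>e. d \<le> e \<Longrightarrow> \<exists>c. poly_runs (\<lambda>s. D s \<and> empty_from e s) (\<lambda>s. s) c (\<lambda>s. s(e := E s))"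
  shows "computable d D E"
  using assms unfolding computable_def by blast

lemma computable_upd:
  assumes "computable d D E" "d \<le> e"
  shows "E (s(e := x)) = E s" "D (s(e := x)) = D s"
  using assms unfolding computable_def by auto

lemma computableE:
  assumes "computable d D E" "d \<le> e"
  obtains c where "poly_runs (\<lambda>s. D s \<and> empty_from e s) (\<lambda>s. s) c (\<lambda>s. s(e := E s))"
  using assms unfolding computable_def by blast

lemma computable_weaken: "computable d D E \<Longrightarrow> d \<le> d' \<Longrightarrow> computable d' D E"
  unfolding computable_def by auto

lemma computable_const:
  assumes "\<And>e s x. d \<le> e \<Longrightarrow> D (s(e := x)) = D s"
  shows "computable d D (\<lambda>s. x)"
proof (rule computableI)
  fix e
  show "\<exists>c. poly_runs (\<lambda>s. D s \<and> empty_from e s) (\<lambda>s. s) c (\<lambda>s. s(e := x))"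
    by (intro exI[of _ "pushes e (rev x)"] poly_runs_pushes) (simp add: empty_from_def)
qed (use assms in auto)

lemma computable_var:
  assumes "i < d" "\<And>e s x. d \<le> e \<Longrightarrow> D (s(e := x)) = D s"
  shows "computable d D (\<lambda>s. s i)"
proof (rule computableI)
  fix e assume "d \<le> e"
  then have ie: "i < e" using assms(1) by simp
  have "poly_runs (\<lambda>s. D s \<and> empty_from e s) (\<lambda>s. s)
      (Seq (move i (e + 1)) (move2 (e + 1) i e)) (\<lambda>s. s(e := s i))"
  proof (rule poly_runs_Seq)
    show "poly_runs (\<lambda>s. D s \<and> empty_from e s) (\<lambda>s. s) (move i (e + 1))
        (\<lambda>s. s(i := [], e + 1 := rev (s i)))"
      using ie by (intro poly_runs_move) (auto simp: empty_from_def)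
    show "poly_runs (\<lambda>s. D s \<and> empty_from e s)
        (\<lambda>s. s(i := [], e + 1 := rev (s i))) (move2 (e + 1) i e)
        (\<lambda>s. s(e := s i))"
      using ie by (intro poly_runs_move2) (auto simp: empty_from_def fun_eq_iff)
  qed
  then show "\<exists>c. poly_runs (\<lambda>s. D s \<and> empty_from e s) (\<lambda>s. s) c (\<lambda>s. s(e := s i))" by blast
qed (use assms in auto)

lemma computable_append:
  assumes E1: "computable d D E1" and E2: "computable d D E2"
  shows "computable d D (\<lambda>s. E1 s @ E2 s)"
proof (rule computableI)
  fix e assume e: "d \<le> e"
  then have e': "d \<le> e + 1" by simp
  let ?D = "\<lambda>s. D s \<and> empty_from e s"
  obtain c2 where c2: "poly_runs ?D (\<lambda>s. s) c2 (\<lambda>s. s(e := E2 s))"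
    by (rule computableE[OF E2 e])
  obtain c1 where "poly_runs (\<lambda>s. D s \<and> empty_from (e + 1) s) (\<lambda>s. s) c1 (\<lambda>s. s(e + 1 := E1 s))"
    by (rule computableE[OF E1 e'])
  then have "poly_runs ?D (\<lambda>s. s(e := E2 s)) c1 (\<lambda>s. s(e := E2 s, e + 1 := E1 s))"
    by (rule poly_runs_at) (use e in \<open>auto simp: computable_upd[OF E1] empty_from_def\<close>)
  moreover have "poly_runs ?D (\<lambda>s. s(e := E2 s, e + 1 := E1 s)) (move (e + 1) (e + 2))
      (\<lambda>s. s(e := E2 s, e + 2 := rev (E1 s)))"
    by (rule poly_runs_move) (auto simp: empty_from_def fun_eq_iff)
  moreover have "poly_runs ?D (\<lambda>s. s(e := E2 s, e + 2 := rev (E1 s))) (move (e + 2) e)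
      (\<lambda>s. s(e := E1 s @ E2 s))"
    by (rule poly_runs_move) (auto simp: empty_from_def fun_eq_iff)
  ultimately have "poly_runs ?D (\<lambda>s. s)
      (Seq c2 (Seq c1 (Seq (move (e + 1) (e + 2)) (move (e + 2) e))))
      (\<lambda>s. s(e := E1 s @ E2 s))"
    by (intro poly_runs_Seq[OF c2] poly_runs_Seq)
  then show "\<exists>c. poly_runs ?D (\<lambda>s. s) c (\<lambda>s. s(e := E1 s @ E2 s))" by blast
qed (use computable_upd[OF E1] computable_upd[OF E2] in auto)

fun cancel_common :: "'a list \<Rightarrow> 'a list \<Rightarrow> 'a list \<times> 'a list" where
  "cancel_common (x # xs) (y # ys) = (if x = y then cancel_common xs ys else (x # xs, y # ys))"
| "cancel_common xs ys = (xs, ys)"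

lemma cancel_common_eq_Nil_iff: "cancel_common xs ys = ([], []) \<longleftrightarrow> xs = ys"
  by (induction xs ys rule: cancel_common.induct) auto

definition cancel :: "nat \<Rightarrow> com" where
  "cancel e = Loop (reg_test (\<lambda>h. h e \<noteq> 0 \<and> h e = h (e + 1))) (Seq (pop e) (pop (e + 1)))"

definition cancelled :: "nat \<Rightarrow> store \<Rightarrow> store" where
  "cancelled e s = (case cancel_common (s e) (s (e + 1)) of (x, y) \<Rightarrow> s(e := x, e + 1 := y))"

lemma store_runs_cancel: "store_runs (cancel e) s (length (s e) * 5 + 1) (cancelled e s)"
proof (induction "length (s e)" arbitrary: s)
  case 0
  then have "cancelled e s = s" by (simp add: cancelled_def fun_upd_idem)
  then have "store_runs (cancel e) s (0 + 1) (cancelled e s)"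
    unfolding cancel_def using 0 by (intro store_runs_Loop) (simp add: tops_def store_runs_Skip)
  then show ?case by (rule store_runs_weaken) auto
next
  case (Suc n)
  then obtain x xs where x: "s e = x # xs" by (metis length_Suc_conv)
  show ?case
  proof (cases "\<exists>ys. s (e + 1) = x # ys")
    case True
    then obtain ys where ys: "s (e + 1) = x # ys" by blast
    define s' where "s' = s(e := xs, e + 1 := ys)"
    have "store_runs (Seq (pop e) (pop (e + 1))) s (1 + 1 + 1) s'"
      using x ys by (intro store_runs_weaken[OF store_runs_Seq[OF store_runs_pop store_runs_pop]])
        (auto simp: s'_def fun_eq_iff)
    moreover have "store_runs (cancel e) s' (length xs * 5 + 1) (cancelled e s')"
      using Suc.hyps(1)[of s'] Suc.hyps(2) x by (simp add: s'_def)
    moreover have "cancelled e s' = cancelled e s"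
      using x ys by (auto simp: cancelled_def s'_def fun_eq_iff split: prod.split)
    ultimately have "store_runs (Seq (Seq (pop e) (pop (e + 1))) (cancel e)) s
        (1 + 1 + 1 + 1 + (length xs * 5 + 1)) (cancelled e s)"
      using store_runs_Seq by metis
    then have "store_runs (cancel e) s (1 + 1 + 1 + 1 + (length xs * 5 + 1) + 1) (cancelled e s)"
      unfolding cancel_def using x ys by (intro store_runs_Loop) (simp add: tops_def)
    then show ?thesis by (rule store_runs_weaken) (simp_all add: x)
  next
    case False
    then have "cancelled e s = s" "\<not> (tops s e \<noteq> 0 \<and> tops s e = tops s (e + 1))"
      using x by (cases "s (e + 1)"; auto simp: cancelled_def tops_def fun_eq_iff)+
    then have "store_runs (cancel e) s (0 + 1) (cancelled e s)"
      unfolding cancel_def by (intro store_runs_Loop) (simp only: if_False store_runs_Skip)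
    then show ?thesis by (rule store_runs_weaken) auto
  qed
qed

lemma poly_runs_cancel:
  assumes "\<And>i. D i \<Longrightarrow> B i = cancelled e (A i)"
  shows "poly_runs D A (cancel e) B"
proof (rule poly_runsI)
  show "bounded_com (e + 4) (cancel e)"
    unfolding cancel_def using bounded_com_mono[OF bounded_pop] by simp
  show "store_runs (cancel e) (A i) (length (A i e) * 5 + 1) (B i)" if "D i" for i
    using assms[OF that] store_runs_cancel by simp
qed (intro poly_size_intros)

lemma computable_if_eq:
  assumes E1: "computable d D E1" and E2: "computable d D E2"
    and E3: "computable d D E3" and E4: "computable d D E4"
  shows "computable d D (\<lambda>s. if E1 s = E2 s then E3 s else E4 s)"
proof (rule computableI)
  fix e assume e: "d \<le> e"
  then have e': "d \<le> e + 1" by simp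
  let ?D = "\<lambda>s. D s \<and> empty_from e s"
  let ?s = "\<lambda>s. s(e := E1 s, e + 1 := E2 s)"
  let ?r = "\<lambda>s. s(e := if E1 s = E2 s then E3 s else E4 s)"
  obtain c1 where c1: "poly_runs ?D (\<lambda>s. s) c1 (\<lambda>s. s(e := E1 s))"
    by (rule computableE[OF E1 e])
  obtain c2 where "poly_runs (\<lambda>s. D s \<and> empty_from (e + 1) s) (\<lambda>s. s) c2 (\<lambda>s. s(e + 1 := E2 s))"
    by (rule computableE[OF E2 e'])
  then have c2: "poly_runs ?D (\<lambda>s. s(e := E1 s)) c2 ?s"
    by (rule poly_runs_at)
      (use e in \<open>auto simp: computable_upd[OF E2] computable_upd[OF E1] empty_from_def\<close>)
  obtain c3 where c3: "poly_runs ?D (\<lambda>s. s) c3 (\<lambda>s. s(e := E3 s))"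
    by (rule computableE[OF E3 e])
  obtain c4 where c4: "poly_runs ?D (\<lambda>s. s) c4 (\<lambda>s. s(e := E4 s))"
    by (rule computableE[OF E4 e])
  have eq_iff: "tops (cancelled e (?s s)) e = 0 \<and>
      tops (cancelled e (?s s)) (e + 1) = 0 \<longleftrightarrow> E1 s = E2 s" for s
    using cancel_common_eq_Nil_iff[of "E1 s" "E2 s"]
    by (auto simp: tops_def cancelled_def split: prod.split)
  have "poly_runs ?D (\<lambda>s. cancelled e (?s s)) (Cond (reg_test (\<lambda>h. h e = 0 \<and> h (e + 1) = 0)) c3
      (Seq (clear e) (Seq (clear (e + 1)) c4))) ?r"
  proof (rule poly_runs_Cond; unfold eq_iff)
    show "poly_runs (\<lambda>s. ?D s \<and> E1 s = E2 s) (\<lambda>s. cancelled e (?s s)) c3 ?r"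
      using c3 by (rule poly_runs_cong)
        (auto simp: cancelled_def cancel_common_eq_Nil_iff[THEN iffD2] empty_from_def fun_eq_iff)
    show "poly_runs (\<lambda>s. ?D s \<and> E1 s \<noteq> E2 s) (\<lambda>s. cancelled e (?s s))
        (Seq (clear e) (Seq (clear (e + 1)) c4)) ?r"
    proof (intro poly_runs_Seq poly_runs_clear)
      show "(\<lambda>s. s) s = ((\<lambda>s. s(e + 1 := snd (cancel_common (E1 s) (E2 s)))) s)(e + 1 := [])"
        if "?D s \<and> E1 s \<noteq> E2 s" for s
        using that by (auto simp: empty_from_def fun_eq_iff)
    qed (use c4 in \<open>auto simp: cancelled_def empty_from_def fun_eq_iff split: prod.split
      elim!: poly_runs_cong\<close>)
  qed
  moreover have "poly_runs ?D ?s (cancel e) (\<lambda>s. cancelled e (?s s))"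
    by (rule poly_runs_cancel) simp
  ultimately have "poly_runs ?D (\<lambda>s. s)
      (Seq c1 (Seq c2 (Seq (cancel e) (Cond (reg_test (\<lambda>h. h e = 0 \<and> h (e + 1) = 0)) c3
      (Seq (clear e) (Seq (clear (e + 1)) c4)))))) ?r"
    by (intro poly_runs_Seq[OF c1] poly_runs_Seq[OF c2] poly_runs_Seq)
  then show "\<exists>c. poly_runs ?D (\<lambda>s. s) c ?r" by blast
qed (use computable_upd[OF E1] computable_upd[OF E2] computable_upd[OF E3]
  computable_upd[OF E4] in auto)

fun transduce :: "(nat \<Rightarrow> bool \<Rightarrow> nat \<times> bool list) \<Rightarrow> nat \<Rightarrow> bool list \<Rightarrow> bool list" where
  "transduce \<delta> q [] = []"
| "transduce \<delta> q (b # x) = snd (\<delta> q b) @ transduce \<delta> (fst (\<delta> q b)) x"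

fun transduce_state :: "(nat \<Rightarrow> bool \<Rightarrow> nat \<times> bool list) \<Rightarrow> nat \<Rightarrow> bool list \<Rightarrow> nat" where
  "transduce_state \<delta> q [] = q"
| "transduce_state \<delta> q (b # x) = transduce_state \<delta> (fst (\<delta> q b)) x"

lemma transduce_append:
  "transduce \<delta> q (x @ y) = transduce \<delta> q x @ transduce \<delta> (transduce_state \<delta> q x) y"
  by (induction x arbitrary: q) auto

lemma transduce_state_append:
  "transduce_state \<delta> q (x @ y) = transduce_state \<delta> (transduce_state \<delta> q x) y"
  by (induction x arbitrary: q) auto

lemma transduce_state_less:
  "(\<And>q b. q < n \<Longrightarrow> fst (\<delta> q b) < n) \<Longrightarrow> q < n \<Longrightarrow> transduce_state \<delta> q x < n"
  by (induction x arbitrary: q) auto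

text \<open>
  The state is kept in unary in register \<open>e + 1\<close>; the output is collected in reverse in \<open>e + 2\<close>.
\<close>

primrec dispatch :: "nat \<Rightarrow> (nat \<Rightarrow> bool \<Rightarrow> nat \<times> bool list) \<Rightarrow> bool \<Rightarrow> nat \<Rightarrow> nat \<Rightarrow> com" where
  "dispatch e \<delta> b k 0 = Skip"
| "dispatch e \<delta> b k (Suc n) = Cond (reg_test (\<lambda>h. h (e + 1) = 0))
     (Seq (pushes (e + 1) (replicate (fst (\<delta> k b)) True)) (pushes (e + 2) (snd (\<delta> k b))))
     (Seq (pop (e + 1)) (dispatch e \<delta> b (Suc k) n))"

lemma bounded_dispatch: "bounded_com (e + 5) (dispatch e \<delta> b k n)"
  by (induction n arbitrary: k)
    (auto intro: bounded_com_mono[OF bounded_pushes] bounded_com_mono[OF bounded_pop])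

definition dispatched :: "nat \<Rightarrow> nat \<times> bool list \<Rightarrow> store \<Rightarrow> store" where
  "dispatched e r s = s(e + 1 := replicate (fst r) True, e + 2 := rev (snd r) @ s (e + 2))"

lemma store_runs_dispatch:
  assumes "\<And>q. q < k + n \<Longrightarrow> fst (\<delta> q b) \<le> M \<and> length (snd (\<delta> q b)) \<le> M"
    and "s (e + 1) = replicate j True" "j < n"
  shows "store_runs (dispatch e \<delta> b k n) s (n * 3 + M * 8 + 2) (dispatched e (\<delta> (k + j) b) s)"
  using assms
proof (induction n arbitrary: k j s)
  case 0
  then show ?case by simp
next
  case (Suc n)
  show ?case
  proof (cases j)
    case 0
    have "store_runs (Seq (pushes (e + 1) (replicate (fst (\<delta> k b)) True))
        (pushes (e + 2) (snd (\<delta> k b)))) s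
       (M * 4 + 1 + M * 4) (dispatched e (\<delta> k b) s)"
      using Suc.prems(1)[of k] Suc.prems(2) 0
      by (intro store_runs_weaken[OF store_runs_Seq[OF store_runs_pushes store_runs_pushes]])
        (auto simp: dispatched_def fun_eq_iff)
    then have "store_runs (dispatch e \<delta> b k (Suc n)) s (M * 4 + 1 + M * 4 + 1)
        (dispatched e (\<delta> k b) s)"
      using Suc.prems(2) 0 unfolding dispatch.simps by (intro store_runs_Cond) (simp add: tops_def)
    then show ?thesis by (rule store_runs_weaken) (auto simp: 0)
  next
    case (Suc j')
    define s' where "s' = s(e + 1 := replicate j' True)"
    have "store_runs (pop (e + 1)) s 1 s'"
      using Suc.prems(2) Suc by (intro store_runs_weaken[OF store_runs_pop]) (auto simp: s'_def)
    moreover have "store_runs (dispatch e \<delta> b (Suc k) n) s' (n * 3 + M * 8 + 2)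
        (dispatched e (\<delta> (Suc k + j') b) s')"
      using Suc.prems Suc by (intro Suc.IH) (auto simp: s'_def)
    ultimately have "store_runs (dispatch e \<delta> b k (Suc n)) s (1 + 1 + (n * 3 + M * 8 + 2) + 1)
        (dispatched e (\<delta> (Suc k + j') b) s')"
      using Suc.prems(2) Suc unfolding dispatch.simps
      by (intro store_runs_Cond) (simp add: tops_def store_runs_Seq[where t = 1, simplified])
    then show ?thesis by (rule store_runs_weaken) (auto simp: Suc s'_def dispatched_def)
  qed
qed

lemma poly_runs_transduce:
  assumes \<delta>: "\<And>q b. q < n \<Longrightarrow> fst (\<delta> q b) < n" and q: "q < n"
    and A: "\<And>i. D i \<Longrightarrow> A i (Suc e) = replicate q True"
    and B: "\<And>i. D i \<Longrightarrow> B i = (A i)(e := [], e + 1 := replicate (transduce_state \<delta> q (A i e)) True,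
       e + 2 := rev (transduce \<delta> q (A i e)) @ A i (e + 2))"
  shows "poly_runs D A (pop_each e (\<lambda>b. dispatch e \<delta> b 0 n)) B"
proof -
  define M where "M = Max ((\<lambda>(q, b). fst (\<delta> q b) + length (snd (\<delta> q b))) ` ({..<n} \<times> UNIV))"
  have "fst (\<delta> q b) + length (snd (\<delta> q b)) \<le> M" if "q < n" for q b
    unfolding M_def by (rule Max_ge) (use that in \<open>auto intro: image_eqI[where x = "(q, b)"]\<close>)
  then have M: "fst (\<delta> q b) \<le> M \<and> length (snd (\<delta> q b)) \<le> M" if "q < n" for q b
    using that add_leE by blast
  define st where "st i k = transduce_state \<delta> q (take k (A i e))" for i k
  define S where "S i k = (A i)(e := drop k (A i e), e + 1 := replicate (st i k) True,
    e + 2 := rev (transduce \<delta> q (take k (A i e))) @ A i (e + 2))" for i k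
  have "poly_runs D (\<lambda>i. S i 0) (pop_each e (\<lambda>b. dispatch e \<delta> b 0 n)) (\<lambda>i. S i (length (S i 0 e)))"
  proof (rule poly_runs_pop_each[OF bounded_dispatch])
    fix i k assume k: "k < length (S i 0 e)"
    let ?b = "A i e ! k"
    have start: "S i 0 e = A i e" by (simp add: S_def)
    have step: "st i (Suc k) = fst (\<delta> (st i k) ?b)"
      "transduce \<delta> q (take (Suc k) (A i e)) = transduce \<delta> q (take k (A i e)) @ snd (\<delta> (st i k) ?b)"
      using k
      by (auto simp: S_def take_Suc_conv_app_nth transduce_append transduce_state_append st_def)
    have "st i k < n" unfolding st_def using \<delta> q by (rule transduce_state_less)
    then have "store_runs (dispatch e \<delta> ?b 0 n)
        ((S i k)(e := drop (Suc k) (A i e))) (n * 3 + M * 8 + 2)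
        (dispatched e (\<delta> (0 + st i k) ?b) ((S i k)(e := drop (Suc k) (A i e))))"
      using M by (intro store_runs_dispatch) (auto simp: S_def)
    then show "store_runs (dispatch e \<delta> (S i 0 e ! k) 0 n) ((S i k)(e := drop (Suc k) (S i 0 e)))
        (n * 3 + M * 8 + 2) (S i (Suc k))"
      unfolding start by (rule store_runs_weaken) (auto simp: S_def step dispatched_def fun_eq_iff)
  qed (auto simp: S_def)
  then show ?thesis by (rule poly_runs_cong) (auto simp: A B S_def st_def fun_eq_iff)
qed

lemma computable_transduce:
  assumes E: "computable d D E" and \<delta>: "\<And>q b. q < n \<Longrightarrow> fst (\<delta> q b) < n" and q: "q < n"
  shows "computable d D (\<lambda>s. transduce \<delta> q (E s))"
proof (rule computableI)
  fix e assume e: "d \<le> e"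
  let ?D = "\<lambda>s. D s \<and> empty_from e s"
  let ?st = "\<lambda>s. replicate (transduce_state \<delta> q (E s)) True"
  obtain c where c: "poly_runs ?D (\<lambda>s. s) c (\<lambda>s. s(e := E s))"
    by (rule computableE[OF E e])
  have "poly_runs ?D (\<lambda>s. s(e := E s)) (pushes (e + 1) (replicate q True))
      (\<lambda>s. s(e := E s, e + 1 := replicate q True))"
    by (rule poly_runs_pushes) (auto simp: empty_from_def)
  moreover have "poly_runs ?D (\<lambda>s. s(e := E s, e + 1 := replicate q True))
      (pop_each e (\<lambda>b. dispatch e \<delta> b 0 n))
        (\<lambda>s. s(e + 1 := ?st s, e + 2 := rev (transduce \<delta> q (E s))))"
    by (rule poly_runs_transduce[OF \<delta> q]) (auto simp: empty_from_def fun_eq_iff)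
  moreover have "poly_runs ?D
      (\<lambda>s. s(e + 1 := ?st s, e + 2 := rev (transduce \<delta> q (E s)))) (clear (e + 1))
      (\<lambda>s. s(e + 2 := rev (transduce \<delta> q (E s))))"
    by (rule poly_runs_clear) (auto simp: empty_from_def fun_eq_iff)
  moreover have "poly_runs ?D (\<lambda>s. s(e + 2 := rev (transduce \<delta> q (E s)))) (move (e + 2) e)
      (\<lambda>s. s(e := transduce \<delta> q (E s)))"
    by (rule poly_runs_move) (auto simp: empty_from_def fun_eq_iff)
  ultimately have "poly_runs ?D (\<lambda>s. s) (Seq c (Seq (pushes (e + 1) (replicate q True))
      (Seq (pop_each e (\<lambda>b. dispatch e \<delta> b 0 n)) (Seq (clear (e + 1)) (move (e + 2) e)))))
      (\<lambda>s. s(e := transduce \<delta> q (E s)))"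
    by (intro poly_runs_Seq[OF c] poly_runs_Seq)
  then show "\<exists>c. poly_runs ?D (\<lambda>s. s) c (\<lambda>s. s(e := transduce \<delta> q (E s)))" by blast
qed (use computable_upd[OF E] in auto)

definition pack :: "bool list list \<Rightarrow> bool list" where
  "pack xs = concat (map enc_bits xs)"

lemma enc_bits_simps [simp]: "enc_bits [] = [False]" "enc_bits (b # x) = True # b # enc_bits x"
  by (auto simp: enc_bits_def enc_list_def)

lemma pack_simps [simp]: "pack [] = []" "pack (x # xs) = enc_bits x @ pack xs"
  by (auto simp: pack_def)

lemma enc_bits_neq_Nil: "enc_bits x \<noteq> []"
  by (cases x) auto

lemma length_enc_bits: "length (enc_bits x) = 2 * length x + 1"
  by (induction x) auto

lemma length_le_pack: "length xs \<le> length (pack xs)"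
  by (induction xs) (auto simp: length_enc_bits)

lemma length_nth_le_pack: "k < length xs \<Longrightarrow> length (xs ! k) \<le> length (pack xs)"
proof (induction xs arbitrary: k)
  case (Cons x xs)
  then show ?case by (cases k) (auto simp: length_enc_bits intro: le_SucI trans_le_add2)
qed simp

lemma length_pack_drop: "length (pack (drop k xs)) \<le> length (pack xs)"
  by (induction xs arbitrary: k) (auto simp: drop_Cons' le_SucI trans_le_add2)

definition unpack_item :: "nat \<Rightarrow> nat \<Rightarrow> com" where
  "unpack_item e r = Seq (Loop (reg_test (\<lambda>h. h e = 2))
     (Seq (pop e) (Seq (Cond (reg_test (\<lambda>h. h e = 2)) (push r True) (push r False)) (pop e)))) (pop e)"

lemma bounded_unpack_item: "bounded_com (e + r + 3) (unpack_item e r)"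
  unfolding unpack_item_def
  using bounded_com_mono[OF bounded_push] bounded_com_mono[OF bounded_pop] by simp

lemma store_runs_unpack_item:
  assumes "e \<noteq> r" "s e = enc_bits x @ y"
  shows "store_runs (unpack_item e r) s (length x * 10 + 3) (s(e := y, r := rev x @ s r))"
proof -
  define S where "S k = s(e := enc_bits (drop k x) @ y, r := rev (take k x) @ s r)" for k
  let ?put = "Cond (reg_test (\<lambda>h. h e = 2)) (push r True) (push r False)"
  have "store_runs (Loop (reg_test (\<lambda>h. h e = 2)) (Seq (pop e) (Seq ?put (pop e)))) (S 0)
      (length x * ((1 + 1 + (3 + 1 + 1 + 1)) + 2) + 1) (S (length x))"
  proof (rule store_runs_Loop_iterate)
    fix k assume k: "k < length x"
    then have next_bit: "drop k x = x ! k # drop (Suc k) x" by (simp add: Cons_nth_drop_Suc)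
    then show "tops (S k) e = 2" using assms(1) by (simp add: S_def tops_def)
    define t where "t = (S k)(e := x ! k # enc_bits (drop (Suc k) x) @ y)"
    have "store_runs (pop e) (S k) 1 t"
      using assms(1) next_bit
      by (intro store_runs_weaken[OF store_runs_pop]) (auto simp: t_def S_def)
    moreover have "store_runs ?put t (3 + 1) (t(r := x ! k # t r))"
      using assms(1) store_runs_push[of r "x ! k" t]
      by (intro store_runs_Cond) (cases "x ! k"; simp add: t_def tops_def)
    moreover have "store_runs (pop e) (t(r := x ! k # t r)) 1 (S (Suc k))"
      using assms(1) k by (intro store_runs_weaken[OF store_runs_pop])
        (auto simp: t_def S_def take_Suc_conv_app_nth)
    ultimately show "store_runs (Seq (pop e) (Seq ?put (pop e))) (S k)
        (1 + 1 + (3 + 1 + 1 + 1)) (S (Suc k))"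
      by (intro store_runs_Seq)
  qed (use assms(1) in \<open>simp add: S_def tops_def\<close>)
  from store_runs_Seq[OF this store_runs_pop]
  have "store_runs (unpack_item e r) (S 0) (length x * ((1 + 1 + (3 + 1 + 1 + 1)) + 2) + 1 + 1 + 1)
      ((S (length x))(e := tl (S (length x) e)))"
    unfolding unpack_item_def .
  moreover have "S 0 = s" using assms(2) by (simp add: S_def fun_upd_idem)
  moreover have "(S (length x))(e := tl (S (length x) e)) = s(e := y, r := rev x @ s r)"
    using assms(1) by (simp add: S_def fun_upd_twist)
  ultimately show ?thesis using store_runs_weaken by fastforce
qed

lemma poly_runs_unpack_item:
  assumes "e \<noteq> r" "\<And>i. D i \<Longrightarrow> A i e = enc_bits (x i) @ y i \<and>
      B i = (A i)(e := y i, r := rev (x i) @ A i r)"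
  shows "poly_runs D A (unpack_item e r) B"
proof (rule poly_runsI[OF bounded_unpack_item])
  have "poly_size D A (\<lambda>i. length (A i e) * 10 + 3)"
    by (intro poly_size_intros)
  then show "poly_size D A (\<lambda>i. length (x i) * 10 + 3)"
    by (rule poly_size_mono) (simp add: assms(2) length_enc_bits)
  show "store_runs (unpack_item e r) (A i) (length (x i) * 10 + 3) (B i)" if "D i" for i
    using store_runs_unpack_item[OF assms(1), of "A i" "x i" "y i"] assms(2)[OF that] by simp
qed

text \<open>
  The accumulator is not part of the input of the loop body, so the length of the output of one
  iteration does not depend on it and the total length stays polynomial.
\<close>

locale foreach_loop =
  fixes d :: nat and D :: "store \<Rightarrow> bool" and L :: "store \<Rightarrow> bool list"
    and xs :: "store \<Rightarrow> bool list list"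
    and E :: "store \<Rightarrow> bool list \<Rightarrow> bool list \<Rightarrow> bool list" and e :: nat
  assumes e: "d \<le> e" and L: "computable d D L" and L_pack: "\<And>s. D s \<Longrightarrow> L s = pack (xs s)"
    and E: "computable (e + 4) D (\<lambda>s. E s (s (e + 2)) (s (e + 3)))"
    and E_upd: "\<And>e s i x y. d \<le> e \<Longrightarrow> E (s(e := x)) i y = E s i y"
begin

definition out :: "store \<Rightarrow> nat \<Rightarrow> bool list" where
  "out s k = E s (replicate k True) (xs s ! k)"

definition outs :: "store \<Rightarrow> nat \<Rightarrow> bool list" where
  "outs s k = concat (map (out s) [0..<k])"

definition state :: "store \<Rightarrow> nat \<Rightarrow> store" where
  "state s k = s(e := pack (drop k (xs s)), e + 1 := rev (outs s k), e + 2 := replicate k True)"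

abbreviation "admissible s \<equiv> D s \<and> empty_from e s"
abbreviation "steps \<equiv> \<lambda>(s, k). admissible s \<and> k < length (xs s)"

lemma E_upd_above [simp]: "e \<le> r \<Longrightarrow> E (s(r := x)) = E s"
  using e by (simp add: E_upd fun_eq_iff)

lemma D_upd_above [simp]: "e \<le> r \<Longrightarrow> D (s(r := x)) = D s"
  using e by (simp add: computable_upd(2)[OF L])

lemma state_0: "admissible s \<Longrightarrow> state s 0 = s(e := pack (xs s))"
  by (auto simp: state_def outs_def empty_from_def fun_eq_iff)

lemma poly_size_input:
  assumes "\<And>s k. admissible s \<Longrightarrow> k < length (xs s) \<Longrightarrow> m (s, k) \<le> length (pack (xs s))"
  shows "poly_size steps (\<lambda>(s, k). state s 0) m"
proof (rule poly_size_mono[OF poly_size_length[where r = e]])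
  show "m i \<le> length ((case i of (s, k) \<Rightarrow> state s 0) e)" if "steps i" for i
    using that assms by (auto simp: state_0)
qed

lemma poly_size_index: "poly_size steps (\<lambda>(s, k). state s 0) (\<lambda>(s, k). k)"
  using length_le_pack by (intro poly_size_input) (auto intro: less_imp_le order_trans)

lemma poly_size_out: "poly_size steps (\<lambda>(s, k). state s 0) (\<lambda>(s, k). length (out s k))"
proof -
  obtain c where c: "poly_runs (\<lambda>s. D s \<and> empty_from (e + 4) s) (\<lambda>s. s) c
      (\<lambda>s. s(e + 4 := E s (s (e + 2)) (s (e + 3))))"
    by (rule computableE[OF E order_refl])
  define A where "A =
      (\<lambda>(s, k). s(e := [], e + 1 := [], e + 2 := replicate k True, e + 3 := xs s ! k))"
  have "poly_runs steps A c (\<lambda>(s, k). (A (s, k))(e + 4 := out s k))"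
    using c by (rule poly_runs_at) (auto simp: A_def out_def empty_from_def)
  then have "poly_size steps A (\<lambda>(s, k). length (out s k))"
    using poly_runs_size[where r = "e + 4"] by (fastforce simp: case_prod_unfold)
  then show ?thesis
  proof (rule poly_size_trans)
    fix r
    consider "r = e + 2" | "r = e + 3" | "r < e" | "r = e \<or> r = e + 1 \<or> e + 3 < r" by linarith
    then show "poly_size steps (\<lambda>(s, k). state s 0) (\<lambda>i. length (A i r))"
    proof cases
      assume "r = e + 2"
      with poly_size_index show ?thesis by (simp add: A_def case_prod_unfold)
    next
      assume "r = e + 3"
      then show ?thesis by (intro poly_size_input) (auto simp: A_def length_nth_le_pack)
    next
      assume "r < e"
      then show ?thesis
        by (intro poly_size_mono[OF poly_size_length[where r = r]]) (auto simp: A_def state_def)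
    next
      assume "r = e \<or> r = e + 1 \<or> e + 3 < r"
      then show ?thesis by (intro poly_size_input) (auto simp: A_def empty_from_def)
    qed
  qed
qed

lemma poly_size_state: "poly_size steps (\<lambda>(s, k). state s 0) (\<lambda>(s, k). length (state s k r))"
proof -
  have count: "poly_size admissible (\<lambda>s. state s 0) (\<lambda>s. length (xs s))"
    using length_le_pack by (intro poly_size_mono[OF poly_size_length[where r = e]])
      (auto simp: state_0)
  consider "r = e" | "r = e + 1" | "r = e + 2" | "r < e \<or> e + 2 < r" by linarith
  then show ?thesis
  proof cases
    assume "r = e"
    then show ?thesis by (intro poly_size_input) (auto simp: state_def length_pack_drop)
  next
    assume r: "r = e + 1"
    have "length (outs s k) = (\<Sum>j<k. length (out s j))" for s k
      unfolding outs_def by (induction k) auto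
    then show ?thesis
      using poly_size_subst[OF poly_size_sum[OF poly_size_out count], where h = "\<lambda>i. i"
        and D' = steps]
      by (simp add: r state_def case_prod_unfold)
  next
    assume "r = e + 2"
    with poly_size_index show ?thesis by (simp add: state_def case_prod_unfold)
  next
    assume "r < e \<or> e + 2 < r"
    then show ?thesis
      by (intro poly_size_mono[OF poly_size_length[where r = r]]) (auto simp: state_def)
  qed
qed

definition body :: "com \<Rightarrow> com" where
  "body c = Seq (unpack_item e (e + 4)) (Seq (move (e + 4) (e + 3)) (Seq c
     (Seq (move (e + 4) (e + 1)) (Seq (clear (e + 3)) (push (e + 2) True)))))"

lemma poly_runs_body:
  assumes c: "poly_runs (\<lambda>s. D s \<and> empty_from (e + 4) s) (\<lambda>s. s) c
      (\<lambda>s. s(e + 4 := E s (s (e + 2)) (s (e + 3))))"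
  shows "poly_runs steps (\<lambda>(s, k). state s k) (body c) (\<lambda>(s, k). state s (Suc k))"
proof -
  define T where "T =
      (\<lambda>(s, k) x y z. s(e := pack (drop (Suc k) (xs s)), e + 1 := rev (x :: bool list),
    e + 2 := replicate k True, e + 3 := y, e + 4 := z))"
  have "poly_runs steps (\<lambda>(s, k). state s k) (unpack_item e (e + 4))
      (\<lambda>(s, k). T (s, k) (outs s k) [] (rev (xs s ! k)))"
    by (rule poly_runs_unpack_item[where x = "\<lambda>(s, k). xs s ! k"
      and y = "\<lambda>(s, k). pack (drop (Suc k) (xs s))"])
      (auto simp: state_def T_def empty_from_def fun_eq_iff simp flip: Cons_nth_drop_Suc)
  moreover have "poly_runs steps (\<lambda>(s, k). T (s, k) (outs s k) [] (rev (xs s ! k)))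
      (move (e + 4) (e + 3))
      (\<lambda>(s, k). T (s, k) (outs s k) (xs s ! k) [])"
    by (rule poly_runs_move) (auto simp: T_def fun_eq_iff)
  moreover have "poly_runs steps (\<lambda>(s, k). T (s, k) (outs s k) (xs s ! k) []) c
      (\<lambda>(s, k). T (s, k) (outs s k) (xs s ! k) (out s k))"
    by (rule poly_runs_at[OF c]) (auto simp: T_def out_def empty_from_def)
  moreover have "poly_runs steps (\<lambda>(s, k). T (s, k) (outs s k) (xs s ! k) (out s k))
      (move (e + 4) (e + 1))
      (\<lambda>(s, k). T (s, k) (outs s (Suc k)) (xs s ! k) [])"
    by (rule poly_runs_move) (auto simp: T_def outs_def fun_eq_iff)
  moreover have "poly_runs steps (\<lambda>(s, k). T (s, k) (outs s (Suc k)) (xs s ! k) []) (clear (e + 3))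
      (\<lambda>(s, k). T (s, k) (outs s (Suc k)) [] [])"
    by (rule poly_runs_clear) (auto simp: T_def fun_eq_iff)
  moreover have "poly_runs steps (\<lambda>(s, k). T (s, k) (outs s (Suc k)) [] []) (push (e + 2) True)
      (\<lambda>(s, k). state s (Suc k))"
    by (rule poly_runs_push) (auto simp: T_def state_def empty_from_def fun_eq_iff)
  ultimately show ?thesis
    unfolding body_def by (intro poly_runs_Seq)
qed

lemma ex_poly_runs_foreach:
  "\<exists>c. poly_runs admissible (\<lambda>s. s) c (\<lambda>s. s(e := outs s (length (xs s))))"
proof -
  obtain c where "poly_runs (\<lambda>s. D s \<and> empty_from (e + 4) s) (\<lambda>s. s) c
      (\<lambda>s. s(e + 4 := E s (s (e + 2)) (s (e + 3))))"
    by (rule computableE[OF E order_refl])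
  then have body: "poly_runs steps (\<lambda>(s, k). state s k) (body c) (\<lambda>(s, k). state s (Suc k))"
    by (rule poly_runs_body)
  obtain l where "poly_runs admissible (\<lambda>s. s) l (\<lambda>s. s(e := L s))"
    by (rule computableE[OF L e])
  then have l: "poly_runs admissible (\<lambda>s. s) l (\<lambda>s. state s 0)"
    by (rule poly_runs_cong) (simp add: state_0 L_pack)
  have loop: "poly_runs admissible (\<lambda>s. state s 0) (Loop (reg_test (\<lambda>h. h e \<noteq> 0)) (body c))
      (\<lambda>s. state s (length (xs s)))"
  proof (rule poly_runs_Loop[OF body])
    show "tops (state s k) e \<noteq> 0" if "k < length (xs s)" for s k
      using that by (auto simp: tops_def state_def enc_bits_neq_Nil simp flip: Cons_nth_drop_Suc)
    show "poly_size admissible (\<lambda>s. state s 0) (\<lambda>s. length (xs s))"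
      using length_le_pack
      by (intro poly_size_mono[OF poly_size_length[where r = e]]) (auto simp: state_0)
    show "poly_size steps (\<lambda>(s, k). state s 0) (\<lambda>(s, k). length (state s k r))" for r
      by (rule poly_size_state)
  qed (simp add: tops_def state_def)
  have "poly_runs admissible (\<lambda>s. state s (length (xs s))) (clear (e + 2))
      (\<lambda>s. s(e + 1 := rev (outs s (length (xs s)))))"
    by (rule poly_runs_clear) (auto simp: state_def empty_from_def fun_eq_iff)
  moreover have "poly_runs admissible
      (\<lambda>s. s(e + 1 := rev (outs s (length (xs s))))) (move (e + 1) e)
      (\<lambda>s. s(e := outs s (length (xs s))))"
    by (rule poly_runs_move) (auto simp: empty_from_def fun_eq_iff)
  ultimately have "poly_runs admissible (\<lambda>s. s) (Seq l (Seq (Loop (reg_test (\<lambda>h. h e \<noteq> 0)) (body c))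
      (Seq (clear (e + 2)) (move (e + 1) e)))) (\<lambda>s. s(e := outs s (length (xs s))))"
    by (intro poly_runs_Seq[OF l] poly_runs_Seq[OF loop] poly_runs_Seq)
  then show ?thesis by blast
qed

end

lemma computable_foreach:
  assumes L: "computable d D L" and L_pack: "\<And>s. D s \<Longrightarrow> L s = pack (xs s)"
    and xs_upd: "\<And>e s x. d \<le> e \<Longrightarrow> xs (s(e := x)) = xs s"
    and E: "\<And>a. d \<le> a \<Longrightarrow> computable (a + 2) D (\<lambda>s. E s (s a) (s (a + 1)))"
    and E_upd: "\<And>e s i x y. d \<le> e \<Longrightarrow> E (s(e := x)) i y = E s i y"
  shows "computable d D
      (\<lambda>s. concat (map (\<lambda>j. E s (replicate j True) (xs s ! j)) [0..<length (xs s)]))"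
proof (rule computableI)
  fix e assume e: "d \<le> e"
  have "computable (e + 4) D (\<lambda>s. E s (s (e + 2)) (s (e + 3)))"
    using E[of "e + 2"] e by (simp add: numeral_eq_Suc)
  then interpret foreach_loop d D L xs E e
    using e by unfold_locales (simp_all add: L L_pack E_upd)
  show "\<exists>c. poly_runs admissible (\<lambda>s. s) c
      (\<lambda>s. s(e := concat (map (\<lambda>j. E s (replicate j True) (xs s ! j)) [0..<length (xs s)])))"
    using ex_poly_runs_foreach unfolding outs_def out_def .
qed (use computable_upd[OF L] xs_upd E_upd in auto)

section \<open>Calling Turing machines as subroutines\<close>

text \<open>The tapes in \<open>Y\<close> are blanked on the way; \<open>swept\<close> assumes that these tapes move to the right.\<close>

definition sweep_act :: "nat set \<Rightarrow> (nat \<Rightarrow> int) \<Rightarrow> (nat \<Rightarrow> nat) \<Rightarrow> nat \<Rightarrow> nat \<times> int" where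
  "sweep_act Y v ss i = (if i \<in> Y then 0 else ss i, v i)"

definition drift :: "nat set \<Rightarrow> int \<Rightarrow> nat \<Rightarrow> int" where
  "drift X d i = (if i \<in> X then d else 0)"

definition swept :: "nat set \<Rightarrow> (nat \<Rightarrow> int) \<Rightarrow> nat \<Rightarrow> tapes \<Rightarrow> tapes" where
  "swept Y v k \<tau> i =
     (\<lambda>p. if i \<in> Y \<and> snd (\<tau> i) \<le> p \<and> p < snd (\<tau> i) + int k then 0 else fst (\<tau> i) p,
      snd (\<tau> i) + int k * v i)"

lemma swept_0 [simp]: "swept Y v 0 \<tau> = \<tau>"
  by (auto simp: swept_def fun_eq_iff prod_eq_iff)

lemma swept_swept:
  assumes "\<And>i. i \<in> Y \<Longrightarrow> v i = 1"
  shows "swept Y v k (swept Y v m \<tau>) = swept Y v (k + m) \<tau>"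
  using assms by (auto simp: swept_def fun_eq_iff prod_eq_iff algebra_simps)

lemma heads_swept:
  assumes "i \<in> Y \<Longrightarrow> v i = 1"
  shows "heads (swept Y v k \<tau>) i = fst (\<tau> i) (snd (\<tau> i) + int k * v i)"
  using assms by (auto simp: heads_def swept_def)

lemma runs_sweep:
  assumes "\<And>i. i \<in> Y \<Longrightarrow> v i = 1"
  shows "runs (Act (sweep_act Y v)) \<tau> 1 (swept Y v 1 \<tau>)"
proof -
  have "perform (sweep_act Y v (heads \<tau>)) \<tau> = swept Y v 1 \<tau>"
    using assms by (auto simp: perform_def sweep_act_def swept_def heads_def fun_eq_iff prod_eq_iff)
  then show ?thesis using runs_Act[of "sweep_act Y v" \<tau>] by simp
qed

lemma runs_weaken: "runs c \<tau> t \<tau>' \<Longrightarrow> t \<le> t' \<Longrightarrow> \<tau>' = \<tau>'' \<Longrightarrow> runs c \<tau> t' \<tau>''"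
  using runs_mono by blast

lemma runs_Loop_sweep:
  assumes v: "\<And>i. i \<in> Y \<Longrightarrow> v i = 1"
    and "\<And>k. k < N \<Longrightarrow> p (heads (swept Y v k \<tau>))" "\<not> p (heads (swept Y v N \<tau>))"
  shows "runs (Loop p (Act (sweep_act Y v))) \<tau> (N * 3 + 1) (swept Y v N \<tau>)"
proof -
  have "runs (Loop p (Act (sweep_act Y v))) (swept Y v 0 \<tau>) (N * (1 + 2) + 1) (swept Y v N \<tau>)"
    using assms runs_sweep[of Y v "swept Y v k \<tau>" for k, OF v]
    by (intro runs_Loop_iterate) (auto simp: swept_swept[OF v])
  then show ?thesis unfolding swept_0 by (rule runs_mono) simp
qed

definition scan :: "nat \<Rightarrow> nat set \<Rightarrow> (nat \<Rightarrow> int) \<Rightarrow> com" where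
  "scan n Y v = Loop (\<lambda>ss. ss n \<noteq> 0) (Act (sweep_act Y v))"

lemma runs_scan:
  assumes "\<And>i. i \<in> Y \<Longrightarrow> v i = 1"
    and "\<And>k. k < N \<Longrightarrow> fst (\<tau> n) (snd (\<tau> n) + int k * v n) \<noteq> 0"
      "fst (\<tau> n) (snd (\<tau> n) + int N * v n) = 0"
  shows "runs (scan n Y v) \<tau> (N * 3 + 1) (swept Y v N \<tau>)"
  unfolding scan_def using assms by (intro runs_Loop_sweep) (simp_all add: heads_swept)

definition rewind :: "nat \<Rightarrow> nat set \<Rightarrow> (nat \<Rightarrow> int) \<Rightarrow> com" where
  "rewind n Y v = Seq (Act (sweep_act {} (drift {n} (-1))))
     (Seq (scan n Y (v(n := -1))) (Act (sweep_act {} (drift {n} 1))))"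

lemma runs_rewind:
  assumes "n \<notin> Y" "\<And>i. i \<in> Y \<Longrightarrow> v i = 1"
    and "\<And>k. k < N \<Longrightarrow> fst (\<tau> n) (snd (\<tau> n) - 1 - int k) \<noteq> 0" "fst (\<tau> n) (snd (\<tau> n) - 1 - int N) = 0"
  shows "runs (rewind n Y v) \<tau> (N * 3 + 5) (swept Y (v(n := -1)) N \<tau>)"
proof -
  define \<sigma> where "\<sigma> = swept {} (drift {n} (-1)) 1 \<tau>"
  have start: "\<sigma> n = (fst (\<tau> n), snd (\<tau> n) - 1)" by (simp add: \<sigma>_def swept_def drift_def)
  have "runs (Act (sweep_act {} (drift {n} (-1)))) \<tau> 1 \<sigma>"
    unfolding \<sigma>_def by (rule runs_sweep) simp
  moreover have "runs (scan n Y (v(n := -1))) \<sigma> (N * 3 + 1) (swept Y (v(n := -1)) N \<sigma>)"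
    using assms by (intro runs_scan) (auto simp: start)
  moreover have "runs (Act (sweep_act {} (drift {n} 1))) (swept Y (v(n := -1)) N \<sigma>) 1
      (swept {} (drift {n} 1) 1 (swept Y (v(n := -1)) N \<sigma>))"
    by (rule runs_sweep) simp
  ultimately have "runs (rewind n Y v) \<tau> (1 + 1 + (N * 3 + 1 + 1 + 1))
      (swept {} (drift {n} 1) 1 (swept Y (v(n := -1)) N \<sigma>))"
    unfolding rewind_def by (intro runs_Seq)
  then show ?thesis
    by (rule runs_weaken)
      (use assms(1) in \<open>auto simp: \<sigma>_def swept_def drift_def fun_eq_iff prod_eq_iff\<close>)
qed

definition copy :: "nat \<Rightarrow> nat \<Rightarrow> nat set \<Rightarrow> (nat \<Rightarrow> int) \<Rightarrow> com" where
  "copy a b Y v = Loop (\<lambda>ss. ss a \<noteq> 0)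
     (Act (\<lambda>ss i. if i = b then (min (ss a) 2, 1) else sweep_act Y v ss i))"

definition written :: "bool list \<Rightarrow> (int \<Rightarrow> nat) \<times> int \<Rightarrow> (int \<Rightarrow> nat) \<times> int" where
  "written y t =
      (\<lambda>p. if snd t \<le> p \<and> p < snd t + int (length y) then word_tape y (p - snd t) else fst t p,
     snd t + int (length y))"

lemma word_tape_take: "p < int i \<Longrightarrow> word_tape (take i y) p = word_tape y p"
  by (auto simp: word_tape_def)

lemma written_take_Suc:
  assumes "k < length y"
  shows "((fst (written (take k y) t))(snd (written (take k y) t) := word_tape y (int k)),
      snd (written (take k y) t) + 1) = written (take (Suc k) y) t"
  using assms by (auto simp: written_def fun_eq_iff word_tape_take)

lemma runs_copy:
  assumes ab: "a \<noteq> b" and v: "v a = 1" "\<And>i. i \<in> Y \<Longrightarrow> v i = 1"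
    and y: "\<And>j. j \<le> length y \<Longrightarrow> fst (\<tau> a) (snd (\<tau> a) + int j) = word_tape y (int j)"
  shows "runs (copy a b Y v) \<tau> (length y * 3 + 1) ((swept Y v (length y) \<tau>)(b := written y (\<tau> b)))"
proof -
  define act where "act = (\<lambda>ss i. if i = b then (min (ss a) 2, 1) else sweep_act Y v ss i)"
  define T where "T k = (swept Y v k \<tau>)(b := written (take k y) (\<tau> b))" for k
  have read: "heads (T k) a = word_tape y (int k)" if "k \<le> length y" for k
    using heads_swept[of a Y v k \<tau>] y[OF that] ab v by (simp add: T_def heads_def)
  have "runs (Loop (\<lambda>ss. ss a \<noteq> 0) (Act act)) (T 0) (length y * (1 + 2) + 1) (T (length y))"
  proof (rule runs_Loop_iterate)
    fix k assume k: "k < length y"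
    then show "heads (T k) a \<noteq> 0" using read[of k] by (simp add: word_tape_eq_0_iff)
    have "min (heads (T k) a) 2 = word_tape y (int k)"
      using read[of k] k by (simp add: word_tape_def)
    then have "perform (act (heads (T k))) (T k) b = T (Suc k) b"
      using written_take_Suc[OF k, of "\<tau> b"] by (simp add: perform_def act_def T_def)
    moreover have "perform (act (heads (T k))) (T k) i = T (Suc k) i" if "i \<noteq> b" for i
      using that v(2)
      by (auto simp: perform_def act_def sweep_act_def T_def swept_def heads_def
        fun_eq_iff algebra_simps)
    ultimately have "perform (act (heads (T k))) (T k) = T (Suc k)" by (metis ext)
    then show "runs (Act act) (T k) 1 (T (Suc k))" using runs_Act[of act "T k"] by simp
  qed (use read[of "length y"] in \<open>simp add: word_tape_eq_0_iff\<close>)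
  moreover have "T 0 = \<tau>" by (auto simp: T_def written_def fun_eq_iff prod_eq_iff)
  ultimately have "runs (Loop (\<lambda>ss. ss a \<noteq> 0) (Act act)) \<tau> (length y * (1 + 2) + 1) (T (length y))"
    by (simp only:)
  then show ?thesis unfolding copy_def act_def by (rule runs_weaken) (simp_all add: T_def)
qed

lemma bounded_sweep:
  assumes "Y \<subseteq> {..<B}" "\<And>i. v i \<in> {-1, 0, 1}" "\<And>i. B \<le> i \<Longrightarrow> v i = 0"
  shows "bounded_com B (Act (sweep_act Y v))"
  using assms by (auto simp: sweep_act_def subset_iff)

lemma bounded_scan:
  assumes "Y \<subseteq> {..<B}" "\<And>i. v i \<in> {-1, 0, 1}" "\<And>i. B \<le> i \<Longrightarrow> v i = 0"
  shows "bounded_com B (scan n Y v)"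
  unfolding scan_def using bounded_sweep[of Y B v] assms by simp

lemma bounded_rewind:
  assumes "n < B" "Y \<subseteq> {..<B}" "\<And>i. v i \<in> {-1, 0, 1}" "\<And>i. B \<le> i \<Longrightarrow> v i = 0"
  shows "bounded_com B (rewind n Y v)"
  unfolding rewind_def bounded_com.simps(3,5) using assms
  by (intro conjI bounded_sweep bounded_scan) (auto simp: drift_def)

lemma bounded_copy:
  assumes "b < B" "3 \<le> B" "Y \<subseteq> {..<B}" "\<And>i. v i \<in> {-1, 0, 1}" "\<And>i. B \<le> i \<Longrightarrow> v i = 0"
  shows "bounded_com B (copy a b Y v)"
  using assms by (auto simp: copy_def sweep_act_def subset_iff)

lemmas bounded_sweeps = bounded_sweep bounded_scan bounded_rewind bounded_copy


definition counts :: "nat \<Rightarrow> (int \<Rightarrow> nat) \<times> int \<Rightarrow> bool" where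
  "counts N t \<longleftrightarrow> (\<forall>p. fst t p \<noteq> 0 \<longleftrightarrow> snd t \<le> p \<and> p < snd t + int N)"

lemma counts_eq_0_iff: "counts N t \<Longrightarrow> fst t p = 0 \<longleftrightarrow> \<not> (snd t \<le> p \<and> p < snd t + int N)"
  unfolding counts_def by blast


definition lap :: "nat \<Rightarrow> nat set \<Rightarrow> (nat \<Rightarrow> int) \<Rightarrow> com" where
  "lap n Y v = Seq (scan n Y (v(n := 1))) (rewind n Y v)"

lemma runs_lap:
  assumes n: "counts N (\<tau> n)" "n \<notin> Y" "v n = 0" and v: "\<And>i. i \<in> Y \<Longrightarrow> v i = 1"
  shows "runs (lap n Y v) \<tau> (N * 6 + 7) (swept Y v (2 * N) \<tau>)"
proof -
  let ?\<sigma> = "swept Y (v(n := 1)) N \<tau>"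
  have end_of_counter: "?\<sigma> n = (fst (\<tau> n), snd (\<tau> n) + int N)" using n(2) by (simp add: swept_def)
  have "runs (scan n Y (v(n := 1))) \<tau> (N * 3 + 1) ?\<sigma>"
    using n(2) v by (intro runs_scan) (auto simp: counts_eq_0_iff[OF n(1)])
  moreover have "runs (rewind n Y v) ?\<sigma> (N * 3 + 5) (swept Y (v(n := -1)) N ?\<sigma>)"
    using n(2) v by (intro runs_rewind) (auto simp: end_of_counter counts_eq_0_iff[OF n(1)])
  ultimately have "runs (lap n Y v) \<tau> (N * 3 + 1 + 1 + (N * 3 + 5)) (swept Y (v(n := -1)) N ?\<sigma>)"
    unfolding lap_def by (rule runs_Seq)
  then show ?thesis
  proof (rule runs_weaken)
    show "swept Y (v(n := -1)) N ?\<sigma> = swept Y v (2 * N) \<tau>"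
      using n(2,3) v by (auto simp: swept_def fun_eq_iff prod_eq_iff algebra_simps)
  qed simp
qed

definition erase :: "nat \<Rightarrow> nat set \<Rightarrow> com" where
  "erase n X = Seq (lap n {} (drift X (-1))) (Seq (lap n X (drift X 1))
     (Seq (lap n X (drift X 1)) (scan n {n} (drift {n} 1))))"

definition near :: "nat \<Rightarrow> (int \<Rightarrow> nat) \<times> int \<Rightarrow> bool" where
  "near N t \<longleftrightarrow> (\<exists>g. (\<forall>p. fst t p \<noteq> 0 \<longrightarrow> g - int N \<le> p \<and> p < g + int N) \<and>
     g - int N \<le> snd t \<and> snd t \<le> g + int N)"

lemma runs_erase:
  assumes n: "counts N (\<tau> n)" "n \<notin> X" and X: "\<And>i. i \<in> X \<Longrightarrow> near N (\<tau> i)"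
  obtains \<tau>' where "runs (erase n X) \<tau> (N * 21 + 25) \<tau>'"
    "\<And>i. i \<in> insert n X \<Longrightarrow> fst (\<tau>' i) = (\<lambda>_. 0)" "\<And>i. i \<notin> insert n X \<Longrightarrow> \<tau>' i = \<tau> i"
proof -
  let ?\<sigma> = "swept {} (drift X (-1)) (2 * N) \<tau>"
  let ?\<sigma>' = "swept X (drift X 1) (2 * N) ?\<sigma>"
  let ?\<sigma>'' = "swept X (drift X 1) (2 * N) ?\<sigma>'"
  let ?\<tau> = "swept {n} (drift {n} 1) N ?\<sigma>''"
  have still: "?\<sigma> n = \<tau> n" "?\<sigma>' n = \<tau> n" "?\<sigma>'' n = \<tau> n"
    using n(2) by (simp_all add: swept_def drift_def)
  have "runs (lap n {} (drift X (-1))) \<tau> (N * 6 + 7) ?\<sigma>"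
    using n by (intro runs_lap) (simp_all add: drift_def)
  moreover have "runs (lap n X (drift X 1)) ?\<sigma> (N * 6 + 7) ?\<sigma>'"
    "runs (lap n X (drift X 1)) ?\<sigma>' (N * 6 + 7) ?\<sigma>''"
    using n still by (auto intro!: runs_lap simp: drift_def)
  moreover have "runs (scan n {n} (drift {n} 1)) ?\<sigma>'' (N * 3 + 1) ?\<tau>"
    by (rule runs_scan) (auto simp: still counts_eq_0_iff[OF n(1)] drift_def)
  ultimately have "runs (erase n X) \<tau> (N * 6 + 7 + 1 +
      (N * 6 + 7 + 1 + (N * 6 + 7 + 1 + (N * 3 + 1)))) ?\<tau>"
    unfolding erase_def by (intro runs_Seq)
  then have "runs (erase n X) \<tau> (N * 21 + 25) ?\<tau>" by (rule runs_weaken) auto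
  moreover have "fst (?\<tau> i) = (\<lambda>_. 0)" if "i \<in> insert n X" for i
  proof (cases "i = n")
    case True
    then show ?thesis using n(2) counts_eq_0_iff[OF n(1)]
      by (auto simp: swept_def drift_def fun_eq_iff)
  next
    case False
    then have i: "i \<in> X" using that by simp
    have "fst (?\<tau> i) p = (if snd (\<tau> i) - 2 * int N \<le> p \<and> p < snd (\<tau> i) + 2 * int N then 0
        else fst (\<tau> i) p)" for p
      using i False by (auto simp: swept_def drift_def)
    then show ?thesis using X[OF i] unfolding near_def by (fastforce simp: fun_eq_iff)
  qed
  moreover have "?\<tau> i = \<tau> i" if "i \<notin> insert n X" for i
    using that by (simp add: swept_def drift_def)
  ultimately show ?thesis using that by blast
qed

lemma bounded_erase:
  assumes "n < B" "X \<subseteq> {..<B}"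
  shows "bounded_com B (erase n X)"
  unfolding erase_def lap_def bounded_com.simps(3,5) using assms
  by (intro conjI bounded_sweeps) (auto simp: drift_def)

definition set_act :: "nat \<Rightarrow> nat \<Rightarrow> (nat \<Rightarrow> nat) \<Rightarrow> nat \<Rightarrow> nat \<times> int" where
  "set_act m a ss i = (if i = m then a else ss i, 0)"

lemma runs_set: "runs (Act (set_act m a)) \<tau> 1 (\<tau>(m := ((fst (\<tau> m))(snd (\<tau> m) := a), snd (\<tau> m))))"
proof -
  have "perform (set_act m a (heads \<tau>)) \<tau> = \<tau>(m := ((fst (\<tau> m))(snd (\<tau> m) := a), snd (\<tau> m)))"
    by (auto simp: fun_eq_iff perform_def set_act_def heads_def prod_eq_iff)
  then show ?thesis using runs_Act[of "set_act m a" \<tau>] by simp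
qed

lemma bounded_set: "m < B \<Longrightarrow> a < B \<Longrightarrow> bounded_com B (Act (set_act m a))"
  by (auto simp: set_act_def)

definition mark_at :: "int \<Rightarrow> int \<Rightarrow> nat" where
  "mark_at h p = (if p = h then 1 else 0)"

definition seek :: "nat \<Rightarrow> (nat \<Rightarrow> int) \<Rightarrow> com" where
  "seek m v = Loop (\<lambda>ss. ss m \<noteq> 1) (Act (sweep_act {} v))"

lemma runs_seek:
  assumes "fst (\<tau> m) = mark_at h" "snd (\<tau> m) + int N * v m = h" "v m \<noteq> 0"
  shows "runs (seek m v) \<tau> (N * 3 + 1) (swept {} v N \<tau>)"
  unfolding seek_def using assms
  by (intro runs_Loop_sweep) (auto simp: heads_swept[of m "{}", simplified] mark_at_def)

lemma bounded_seek:
  assumes "\<And>i. v i \<in> {-1, 0, 1}" "\<And>i. B \<le> i \<Longrightarrow> v i = 0"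
  shows "bounded_com B (seek m v)"
  unfolding seek_def using bounded_sweep[of "{}" B v] assms by simp

subsection \<open>Step-by-step simulation\<close>

definition tm_config_valid :: "tm \<Rightarrow> tm_config \<Rightarrow> bool" where
  "tm_config_valid M c \<longleftrightarrow> fst c < tm_states M \<and> length (snd c) = tm_tapes M \<and>
     (\<forall>i<tm_tapes M. \<forall>p. fst (snd c ! i) p < tm_symbols M)"

lemma tm_wf_delta:
  assumes "tm_wf M" "q < tm_states M" "length ss = tm_tapes M" "set ss \<subseteq> {..<tm_symbols M}"
    and r: "r = tm_delta M q ss"
  shows "fst r < tm_states M" "length (snd r) = tm_tapes M"
    "\<And>i. i < tm_tapes M \<Longrightarrow> fst (snd r ! i) < tm_symbols M \<and> snd (snd r ! i) \<in> {-1, 0, 1}"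
proof -
  have delta: "case tm_delta M q ss of (q', as) \<Rightarrow> q' < tm_states M \<and> length as = tm_tapes M \<and>
      set as \<subseteq> {..<tm_symbols M} \<times> {-1, 0, 1}"
    using assms(1)[unfolded tm_wf_def, THEN conjunct2, THEN conjunct2, THEN conjunct2,
      rule_format, of q ss]
      assms(2-4) by (simp only: simp_thms)
  then show "fst r < tm_states M" and len: "length (snd r) = tm_tapes M"
    by (auto simp: r case_prod_beta)
  show "fst (snd r ! i) < tm_symbols M \<and> snd (snd r ! i) \<in> {-1, 0, 1}" if "i < tm_tapes M" for i
  proof -
    have "snd r ! i \<in> {..<tm_symbols M} \<times> {-1, 0, 1}"
      using delta nth_mem[of i "snd r"] that len by (auto simp: r case_prod_beta)
    then show ?thesis by (auto simp: mem_Times_iff)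
  qed
qed

lemma tm_step_nth:
  assumes "tm_wf M" "tm_config_valid M c" "fst c \<noteq> 1"
    and r: "r = tm_delta M (fst c) (map (\<lambda>(t, h). t h) (snd c))"
  shows "fst (tm_step M c) = fst r" "length (snd (tm_step M c)) = tm_tapes M"
    "\<And>i. i < tm_tapes M \<Longrightarrow> snd (tm_step M c) ! i =
       ((fst (snd c ! i))(snd (snd c ! i) := fst (snd r ! i)), snd (snd c ! i) + snd (snd r ! i))"
    "fst r < tm_states M"
    "\<And>i. i < tm_tapes M \<Longrightarrow> fst (snd r ! i) < tm_symbols M \<and> snd (snd r ! i) \<in> {-1, 0, 1}"
proof -
  have "set (map (\<lambda>(t, h). t h) (snd c)) \<subseteq> {..<tm_symbols M}"
    using assms(2) by (auto simp: tm_config_valid_def in_set_conv_nth) (metis fst_conv)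
  then have delta: "fst r < tm_states M" "length (snd r) = tm_tapes M"
    "\<And>i. i < tm_tapes M \<Longrightarrow> fst (snd r ! i) < tm_symbols M \<and> snd (snd r ! i) \<in> {-1, 0, 1}"
    using tm_wf_delta[OF assms(1) _ _ _ r] assms(2) by (simp_all add: tm_config_valid_def)
  have step: "tm_step M c = (fst r, map2 (\<lambda>(t, h) (s, d). (t(h := s), h + d)) (snd c) (snd r))"
    using assms(3) by (auto simp: tm_step_def case_prod_beta r)
  show "fst (tm_step M c) = fst r" "length (snd (tm_step M c)) = tm_tapes M"
    using assms(2) delta(2) by (simp_all add: step tm_config_valid_def)
  show "snd (tm_step M c) ! i =
       ((fst (snd c ! i))(snd (snd c ! i) := fst (snd r ! i)), snd (snd c ! i) + snd (snd r ! i))"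
    if "i < tm_tapes M" for i
    using that delta(2) assms(2) by (simp add: step tm_config_valid_def case_prod_beta)
  show "fst r < tm_states M"
    "\<And>i. i < tm_tapes M \<Longrightarrow> fst (snd r ! i) < tm_symbols M \<and> snd (snd r ! i) \<in> {-1, 0, 1}"
    using delta by blast+
qed

lemma tm_config_valid_step:
  assumes "tm_wf M" "tm_config_valid M c"
  shows "tm_config_valid M (tm_step M c)"
proof (cases "fst c = 1")
  case True
  then have "tm_step M c = c" by (simp add: tm_step_def case_prod_beta prod_eq_iff)
  then show ?thesis using assms(2) by simp
next
  case False
  then show ?thesis
    using assms(2) tm_step_nth[OF assms False refl] unfolding tm_config_valid_def by auto
qed

definition confined :: "nat \<Rightarrow> nat \<Rightarrow> (int \<Rightarrow> nat) \<times> int \<Rightarrow> bool" where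
  "confined k n t \<longleftrightarrow> \<bar>snd t\<bar> \<le> int k \<and> (\<forall>p. fst t p \<noteq> 0 \<longrightarrow> - int k \<le> p \<and> p < int (max n k))"

lemma confined_step:
  assumes "tm_wf M" "tm_config_valid M c" "i < tm_tapes M" "confined k n (snd c ! i)"
  shows "confined (Suc k) n (snd (tm_step M c) ! i)"
proof (cases "fst c = 1")
  case True
  then have "tm_step M c = c" by (simp add: tm_step_def case_prod_beta prod_eq_iff)
  then show ?thesis using assms(4) unfolding confined_def by fastforce
next
  case False
  let ?r = "snd (tm_delta M (fst c) (map (\<lambda>(t, h). t h) (snd c))) ! i"
  have "snd ?r \<in> {-1, 0, 1}" using tm_step_nth(5)[OF assms(1,2) False refl assms(3)] by simp
  moreover have "- int (Suc k) \<le> p \<and> p < int (max n (Suc k))"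
    if "fst (snd c ! i) p \<noteq> 0 \<or> p = snd (snd c ! i)" for p
    using assms(4) that unfolding confined_def by (auto dest!: spec[of _ p])
  ultimately show ?thesis
    using assms(4) unfolding tm_step_nth(3)[OF assms(1,2) False refl assms(3)] confined_def
    by (auto simp del: neq0_conv split: if_splits)
qed

lemma tm_config_reachable:
  assumes "tm_wf M"
  shows "tm_config_valid M ((tm_step M ^^ k) (tm_init M x))"
    and "i < tm_tapes M \<Longrightarrow> confined k (length x) (snd ((tm_step M ^^ k) (tm_init M x)) ! i)"
proof (induction k)
  case 0
  have M: "0 < tm_states M" "3 \<le> tm_symbols M" "1 \<le> tm_tapes M"
    using assms by (auto simp: tm_wf_def)
  {
    case 1
    show ?case
      using M
      by (auto simp: tm_config_valid_def tm_init_def nth_Cons word_tape_def split: nat.splits)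
  next
    case 2
    then show ?case
      using M
      by (auto simp: confined_def tm_init_def nth_Cons word_tape_def split: nat.splits if_splits)
  }
next
  case (Suc k)
  {
    case 1
    show ?case using tm_config_valid_step[OF assms Suc.IH(1)] by simp
  next
    case 2
    then show ?case using confined_step[OF assms Suc.IH(1) _ Suc.IH(2)] by simp
  }
qed

text \<open>
  The tapes of the simulated machine start at tape \<open>b\<close>. They are followed by a tape that holds the
  state, a step counter, and a marker tape whose head moves with that of the first tape.
\<close>

definition sim_act :: "tm \<Rightarrow> nat \<Rightarrow> (nat \<Rightarrow> nat) \<Rightarrow> nat \<Rightarrow> nat \<times> int" where
  "sim_act M b ss i = (let q = b + tm_tapes M;
       r = tm_delta M (ss q) (map (\<lambda>i. ss (b + i)) [0..<tm_tapes M]) in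
     if ss q < tm_states M \<and> (\<forall>i<tm_tapes M. ss (b + i) < tm_symbols M) then
       (if i = q then (fst r, 0) else if i = q + 1 then (1, 1)
         else if i = q + 2 then (ss i, snd (snd r ! 0))
        else if b \<le> i \<and> i < q then snd r ! (i - b) else (ss i, 0))
     else (ss i, 0))"

lemma bounded_sim_act:
  assumes "tm_wf M" "b + tm_tapes M + 3 + tm_states M + tm_symbols M \<le> B"
  shows "bounded_com B (Act (sim_act M b))"
proof -
  have "(fst (sim_act M b ss i) < B \<or> fst (sim_act M b ss i) = ss i) \<and>
      snd (sim_act M b ss i) \<in> {-1, 0, 1} \<and> (B \<le> i \<longrightarrow> sim_act M b ss i = (ss i, 0))" for ss i
  proof (cases "ss (b + tm_tapes M) < tm_states M \<and> (\<forall>i<tm_tapes M. ss (b + i) < tm_symbols M)")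
    case True
    define q where "q = b + tm_tapes M"
    define r where "r = tm_delta M (ss q) (map (\<lambda>i. ss (b + i)) [0..<tm_tapes M])"
    have K: "1 \<le> tm_tapes M" using assms(1) by (simp add: tm_wf_def)
    have "set (map (\<lambda>i. ss (b + i)) [0..<tm_tapes M]) \<subseteq> {..<tm_symbols M}" using True by auto
    then have r: "fst r < tm_states M"
      "\<And>j. j < tm_tapes M \<Longrightarrow> fst (snd r ! j) < tm_symbols M \<and> snd (snd r ! j) \<in> {-1, 0, 1}"
      using tm_wf_delta[OF assms(1) _ _ _ r_def] True by (simp_all add: q_def)
    have "sim_act M b ss i = (if i = q then (fst r, 0) else if i = q + 1 then (1, 1)
        else if i = q + 2 then (ss i, snd (snd r ! 0))
        else if b \<le> i \<and> i < q then snd r ! (i - b) else (ss i, 0))"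
      using True unfolding sim_act_def Let_def q_def[symmetric] r_def[symmetric] by simp
    moreover have "i - b < tm_tapes M" if "b \<le> i" "i < q" using that by (simp add: q_def)
    ultimately show ?thesis
      using r(1) r(2)[of 0] r(2)[of "i - b"] assms(2) K by (auto simp: q_def)
  qed (auto simp: sim_act_def Let_def)
  then show ?thesis unfolding bounded_com.simps by blast
qed

definition shift_tape :: "int \<Rightarrow> (int \<Rightarrow> nat) \<times> int \<Rightarrow> (int \<Rightarrow> nat) \<times> int" where
  "shift_tape h t = (\<lambda>j. fst t (j - h), snd t + h)"

definition simulated :: "tm \<Rightarrow> nat \<Rightarrow> tapes \<Rightarrow> tm_config \<Rightarrow> nat \<Rightarrow> tapes" where
  "simulated M b \<tau> c k i = (let q = b + tm_tapes M in
     if i = q then (\<lambda>p. if p = snd (\<tau> q) then fst c else 0, snd (\<tau> q))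
     else if i = q + 1 then (\<lambda>p. if snd (\<tau> i) \<le> p \<and> p < snd (\<tau> i) + int k then 1
       else fst (\<tau> i) p, snd (\<tau> i) + int k)
     else if i = q + 2 then (fst (\<tau> i), snd (\<tau> i) + snd (snd c ! 0))
     else if b \<le> i \<and> i < q then shift_tape (snd (\<tau> i)) (snd c ! (i - b))
     else \<tau> i)"

lemma heads_simulated:
  "heads (simulated M b \<tau> c k) (b + tm_tapes M) = fst c"
  "i < tm_tapes M \<Longrightarrow> heads (simulated M b \<tau> c k) (b + i) = fst (snd c ! i) (snd (snd c ! i))"
  by (simp_all add: heads_def simulated_def Let_def shift_tape_def)

lemma perform_sim_act:
  assumes wf: "tm_wf M" and c: "tm_config_valid M c" "fst c \<noteq> 1"
  shows "perform (sim_act M b (heads (simulated M b \<tau> c k))) (simulated M b \<tau> c k) =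
    simulated M b \<tau> (tm_step M c) (Suc k)"
proof
  fix i
  define q where "q = b + tm_tapes M"
  define a where "a = sim_act M b (heads (simulated M b \<tau> c k))"
  define T where "T = simulated M b \<tau> c k"
  define r where "r = tm_delta M (fst c) (map (\<lambda>(t, h). t h) (snd c))"
  note step = tm_step_nth[OF wf c r_def]
  have K: "1 \<le> tm_tapes M" using wf by (simp add: tm_wf_def)
  have "map (\<lambda>i. heads T (b + i)) [0..<tm_tapes M] = map (\<lambda>(t, h). t h) (snd c)"
    using c(1)
    by (intro nth_equalityI) (auto simp: tm_config_valid_def case_prod_beta T_def heads_simulated)
  moreover have "heads T q < tm_states M \<and> (\<forall>i<tm_tapes M. heads T (b + i) < tm_symbols M)"
    using c(1) by (auto simp: tm_config_valid_def T_def q_def heads_simulated)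
  moreover have "heads T q = fst c" by (simp add: T_def q_def heads_simulated)
  ultimately have act: "a i = (if i = q then (fst r, 0) else if i = q + 1 then (1, 1)
      else if i = q + 2 then (heads T i, snd (snd r ! 0))
      else if b \<le> i \<and> i < q then snd r ! (i - b) else (heads T i, 0))" for i
    unfolding a_def T_def[symmetric] sim_act_def Let_def q_def[symmetric] r_def by simp
  consider "i = q" | "i = q + 1" | "i = q + 2" | "b \<le> i" "i < q" | "i < b" | "i > q + 2" by linarith
  then have "perform a T i = simulated M b \<tau> (tm_step M c) (Suc k) i"
  proof cases
    case 4
    then have "i - b < tm_tapes M" by (auto simp: q_def)
    then show ?thesis
      using 4 unfolding perform_def act
      by (simp add: T_def simulated_def Let_def q_def shift_tape_def step(3) fun_eq_iff)
  qed (use K step(1) step(3)[of 0] in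
      \<open>auto simp: perform_def act T_def simulated_def Let_def q_def heads_def fun_eq_iff\<close>)
  then show "perform (sim_act M b (heads (simulated M b \<tau> c k))) (simulated M b \<tau> c k) i =
      simulated M b \<tau> (tm_step M c) (Suc k) i"
    unfolding a_def T_def .
qed

lemma simulated_init:
  assumes K: "1 \<le> tm_tapes M" and x: "stack_tape (\<tau> b) x"
    and blank: "\<And>i. b < i \<Longrightarrow> i \<le> b + tm_tapes M \<Longrightarrow> stack_tape (\<tau> i) []"
  shows "simulated M b \<tau> (tm_init M x) 0 = \<tau>"
proof
  fix i
  have "fst (\<tau> i) = (\<lambda>_. 0)" if "b < i" "i \<le> b + tm_tapes M" for i
    using blank[OF that] by (auto simp: stack_tape_def)
  moreover have "fst (\<tau> b) = (\<lambda>j. word_tape x (j - snd (\<tau> b)))"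
    using x by (auto simp: stack_tape_def)
  ultimately show "simulated M b \<tau> (tm_init M x) 0 i = \<tau> i"
    using K
    by (auto simp: simulated_def Let_def tm_init_def shift_tape_def nth_Cons
      prod_eq_iff split: nat.splits)
qed

lemma runs_simulate:
  assumes wf: "tm_wf M" and x: "stack_tape (\<tau> b) x"
    and blank: "\<And>i. b < i \<Longrightarrow> i \<le> b + tm_tapes M \<Longrightarrow> stack_tape (\<tau> i) []"
    and running: "\<And>k. k < t \<Longrightarrow> fst ((tm_step M ^^ k) (tm_init M x)) \<noteq> 1"
    and halted: "fst ((tm_step M ^^ t) (tm_init M x)) = 1"
  shows "runs (Loop (\<lambda>ss. ss (b + tm_tapes M) \<noteq> 1) (Act (sim_act M b))) \<tau> (t * 3 + 1)
    (simulated M b \<tau> ((tm_step M ^^ t) (tm_init M x)) t)"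
proof -
  define T where "T k = simulated M b \<tau> ((tm_step M ^^ k) (tm_init M x)) k" for k
  have "runs (Loop (\<lambda>ss. ss (b + tm_tapes M) \<noteq> 1) (Act (sim_act M b))) (T 0)
      (t * (1 + 2) + 1) (T t)"
  proof (rule runs_Loop_iterate)
    fix k assume "k < t"
    then have "perform (sim_act M b (heads (T k))) (T k) = T (Suc k)"
      using perform_sim_act[OF wf tm_config_reachable(1)[OF wf] running] by (simp add: T_def)
    then show "runs (Act (sim_act M b)) (T k) 1 (T (Suc k))"
      using runs_Act[of "sim_act M b" "T k"] by simp
  qed (simp_all add: T_def heads_simulated running halted del: One_nat_def)
  moreover have "T 0 = \<tau>" using simulated_init[of M \<tau> b x] wf x blank by (simp add: T_def tm_wf_def)
  ultimately have "runs (Loop (\<lambda>ss. ss (b + tm_tapes M) \<noteq> 1) (Act (sim_act M b))) \<tau>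
      (t * (1 + 2) + 1) (T t)"
    by (simp only:)
  then show ?thesis by (rule runs_weaken) (simp_all add: T_def)
qed

subsection \<open>The subroutine call\<close>

definition load :: "nat \<Rightarrow> nat \<Rightarrow> nat \<Rightarrow> com" where
  "load b n m = Seq (copy b n {} (drift {b} 1)) (Seq (rewind b {} (\<lambda>_. 0)) (Act (set_act m 1)))"

lemma runs_load:
  assumes bnm: "distinct [b, n, m]" and x: "stack_tape (\<tau> b) x"
    and blank: "stack_tape (\<tau> m) []"
  shows "runs (load b n m) \<tau> (length x * 6 + 9)
    (\<tau>(n := written x (\<tau> n), m := (mark_at (snd (\<tau> m)), snd (\<tau> m))))"
proof -
  define \<sigma> where "\<sigma> = (swept {} (drift {b} 1) (length x) \<tau>)(n := written x (\<tau> n))"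
  have b: "\<sigma> b = (fst (\<tau> b), snd (\<tau> b) + int (length x))"
    using bnm by (simp add: \<sigma>_def swept_def drift_def)
  have content: "fst (\<tau> b) p = word_tape x (p - snd (\<tau> b))" for p
    using x by (simp add: stack_tape_def)
  have "runs (copy b n {} (drift {b} 1)) \<tau> (length x * 3 + 1) \<sigma>"
    unfolding \<sigma>_def using bnm by (intro runs_copy) (auto simp: content drift_def)
  moreover have "runs (rewind b {} (\<lambda>_. 0)) \<sigma> (length x * 3 + 5)
      (swept {} ((\<lambda>_. 0)(b := -1)) (length x) \<sigma>)"
    by (rule runs_rewind) (auto simp: b content word_tape_eq_0_iff simp del: neq0_conv)
  then have "runs (rewind b {} (\<lambda>_. 0)) \<sigma> (length x * 3 + 5) (\<tau>(n := written x (\<tau> n)))"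
    by (rule runs_weaken)
      (use bnm in \<open>auto simp: \<sigma>_def swept_def drift_def fun_eq_iff prod_eq_iff\<close>)
  moreover have "runs (Act (set_act m 1)) (\<tau>(n := written x (\<tau> n))) 1
      (\<tau>(n := written x (\<tau> n), m := (mark_at (snd (\<tau> m)), snd (\<tau> m))))"
    using bnm blank by (intro runs_weaken[OF runs_set])
      (auto simp: stack_tape_def mark_at_def fun_eq_iff)
  ultimately have "runs (load b n m) \<tau> (length x * 3 + 1 + 1 + (length x * 3 + 5 + 1 + 1))
      (\<tau>(n := written x (\<tau> n), m := (mark_at (snd (\<tau> m)), snd (\<tau> m))))"
    unfolding load_def by (intro runs_Seq)
  then show ?thesis by (rule runs_weaken) auto
qed

text \<open>Tape \<open>m\<close> carries a marker at the cell where the word on tape \<open>b\<close> starts.\<close>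

definition fetch :: "nat \<Rightarrow> nat \<Rightarrow> nat \<Rightarrow> nat \<Rightarrow> com" where
  "fetch b n m u = Seq (rewind n {} (drift {b, m} (-1)))
     (Seq (seek m (drift {b, m} 1)) (copy b u {} (drift {b, m} 1)))"

lemma runs_fetch:
  assumes bnmu: "distinct [b, n, m, u]"
    and n: "counts N (fst (\<tau> n), snd (\<tau> n) - int N)"
    and m: "\<tau> m = (mark_at g, g + d)" "\<bar>d\<bar> \<le> int N"
    and y: "\<And>j. j \<le> length y \<Longrightarrow> fst (\<tau> b) (snd (\<tau> b) - d + int j) = word_tape y (int j)"
  shows "runs (fetch b n m u) \<tau> (N * 9 + length y * 3 + 9)
    (\<tau>(n := (fst (\<tau> n), snd (\<tau> n) - int N), b := (fst (\<tau> b), snd (\<tau> b) - d + int (length y)),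
       m := (mark_at g, g + int (length y)), u := written y (\<tau> u)))"
proof -
  define \<sigma> where "\<sigma> = swept {} ((drift {b, m} (-1))(n := -1)) N \<tau>"
  define N' where "N' = nat (int N - d)"
  have N': "int N' = int N - d" "N' \<le> 2 * N" using m(2) by (auto simp: N'_def)
  define \<rho> where "\<rho> = \<tau>(n := (fst (\<tau> n), snd (\<tau> n) - int N), b := (fst (\<tau> b), snd (\<tau> b) - d),
      m := (mark_at g, g))"
  have "runs (rewind n {} (drift {b, m} (-1))) \<tau> (N * 3 + 5) \<sigma>"
    unfolding \<sigma>_def using counts_eq_0_iff[OF n] by (intro runs_rewind) auto
  moreover have "runs (seek m (drift {b, m} 1)) \<sigma> (N' * 3 + 1) (swept {} (drift {b, m} 1) N' \<sigma>)"
    using bnmu m(1) N' by (intro runs_seek[where h = g]) (auto simp: \<sigma>_def swept_def drift_def)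
  then have "runs (seek m (drift {b, m} 1)) \<sigma> (N * 6 + 1) \<rho>"
    by (rule runs_weaken) (use bnmu m(1) N' in
      \<open>auto simp: \<sigma>_def \<rho>_def swept_def drift_def fun_eq_iff prod_eq_iff\<close>)
  moreover have "runs (copy b u {} (drift {b, m} 1)) \<rho> (length y * 3 + 1)
      ((swept {} (drift {b, m} 1) (length y) \<rho>)(u := written y (\<rho> u)))"
    using bnmu y by (intro runs_copy) (auto simp: \<rho>_def drift_def)
  ultimately have "runs (fetch b n m u) \<tau> (N * 3 + 5 + 1 + (N * 6 + 1 + 1 + (length y * 3 + 1)))
      ((swept {} (drift {b, m} 1) (length y) \<rho>)(u := written y (\<rho> u)))"
    unfolding fetch_def by (intro runs_Seq)
  then show ?thesis
    by (rule runs_weaken)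
      (use bnmu in \<open>auto simp: \<rho>_def swept_def drift_def fun_eq_iff prod_eq_iff\<close>)
qed

definition call_com :: "tm \<Rightarrow> nat \<Rightarrow> com" where
  "call_com M b = (let q = b + tm_tapes M; n = q + 1; m = q + 2; u = q + 3 in
     Seq (load b n m) (Seq (Loop (\<lambda>ss. ss q \<noteq> 1) (Act (sim_act M b)))
     (Seq (fetch b n m u) (Seq (erase n ({b..<q} \<union> {m}))
       (Seq (Act (set_act q 0)) (rewind u {} (\<lambda>_. 0)))))))"

lemma bounded_call_com:
  assumes "tm_wf M" "b + tm_tapes M + 6 + tm_states M + tm_symbols M \<le> B"
  shows "bounded_com B (call_com M b)"
proof -
  have "bounded_com B (Act (sim_act M b))" using assms by (intro bounded_sim_act) auto
  then show ?thesis
    unfolding call_com_def load_def fetch_def Let_def bounded_com.simps(3,5) using assms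
    by (intro conjI bounded_sweeps bounded_seek bounded_erase bounded_set) (auto simp: drift_def)
qed

locale halting_run =
  fixes M :: tm and b :: nat and x :: "bool list" and \<tau> :: tapes and t :: nat and y :: "bool list"
    and cfg :: tm_config
  assumes wf: "tm_wf M" and word_in: "stack_tape (\<tau> b) x"
    and blank: "\<And>i. b < i \<Longrightarrow> stack_tape (\<tau> i) []"
    and running: "\<And>k. k < t \<Longrightarrow> fst ((tm_step M ^^ k) (tm_init M x)) \<noteq> 1"
    and cfg: "cfg = (tm_step M ^^ t) (tm_init M x)" and halted: "fst cfg = 1"
    and word_out: "\<And>j. j \<le> length y \<Longrightarrow> fst (snd cfg ! 0) (int j) = word_tape y (int j)"
begin

definition "state = b + tm_tapes M"
definition "counter = state + 1"
definition "marker = state + 2"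
definition "result = state + 3"
definition "scratch = {b..<state} \<union> {marker}"
definition "N = length x + t"

lemma layout: "b < state" "state < counter" "counter < marker" "marker < result"
  using wf by (auto simp: state_def counter_def marker_def result_def tm_wf_def)

lemma not_scratch: "counter \<notin> scratch" "state \<notin> scratch" "result \<notin> scratch"
  using layout by (auto simp: scratch_def)

lemma tape_cases:
  assumes "b \<le> i"
  obtains "i \<in> scratch" | "i = state" | "i = counter" | "i = result" | "result < i"
  using assms unfolding scratch_def result_def marker_def counter_def Un_iff
    atLeastLessThan_iff singleton_iff
  by linarith

lemma confined_cfg: "i < tm_tapes M \<Longrightarrow> confined t (length x) (snd cfg ! i)"
  unfolding cfg by (rule tm_config_reachable(2)[OF wf])

lemma tapes_pos: "0 < tm_tapes M"
  using wf by (simp add: tm_wf_def)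

lemma t_pos: "0 < t"
  using halted by (auto simp: cfg tm_init_def intro: ccontr)

lemma length_output: "length y \<le> N"
proof (cases y)
  case (Cons a y')
  then have "fst (snd cfg ! 0) (int (length y')) \<noteq> 0"
    using word_out[of "length y'"] by (simp add: word_tape_eq_0_iff)
  then have "int (length y') < int (max (length x) t)"
    using confined_cfg[OF tapes_pos] unfolding confined_def by blast
  then show ?thesis using Cons by (auto simp: N_def)
qed simp

definition "loaded = \<tau>(counter := written x (\<tau> counter),
    marker := (mark_at (snd (\<tau> marker)), snd (\<tau> marker)))"
definition "final = simulated M b loaded cfg t"
definition "fetched = final(counter := (fst (final counter), snd (final counter) - int N),
  b := (fst (final b), snd (\<tau> b) + int (length y)),
  marker := (mark_at (snd (\<tau> marker)), snd (\<tau> marker) + int (length y)),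
    result := written y (\<tau> result))"

lemma runs_loaded: "runs (load b counter marker) \<tau> (length x * 6 + 9) loaded"
  unfolding loaded_def using layout by (intro runs_load) (auto simp: word_in blank)

lemma runs_final:
  "runs (Loop (\<lambda>ss. ss state \<noteq> 1) (Act (sim_act M b))) loaded (t * 3 + 1) final"
  unfolding state_def final_def
proof (rule runs_simulate[where M = M and x = x and t = t, folded cfg, OF wf])
  show "stack_tape (loaded b) x" using layout word_in by (simp add: loaded_def)
  show "stack_tape (loaded i) []" if "b < i" "i \<le> b + tm_tapes M" for i
    using that blank[of i] layout by (auto simp: loaded_def state_def)
qed (use running halted in \<open>auto simp: cfg\<close>)

lemma final_state: "final state = (mark_at (snd (\<tau> state)), snd (\<tau> state))"
  using layout
  by (auto simp: final_def simulated_def Let_def state_def[symmetric] halted loaded_def mark_at_def)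

lemma final_counter: "counts N (fst (final counter), snd (final counter) - int N)"
proof -
  have content: "fst (\<tau> counter) = (\<lambda>_. 0)"
    using blank[of counter] layout by (auto simp: stack_tape_def)
  have "final counter = (\<lambda>p. if snd (loaded counter) \<le> p \<and> p < snd (loaded counter) + int t then 1
      else fst (loaded counter) p, snd (loaded counter) + int t)"
    unfolding final_def simulated_def Let_def counter_def state_def by simp
  moreover have "loaded counter = written x (\<tau> counter)" using layout by (simp add: loaded_def)
  ultimately show ?thesis
    by (auto simp: counts_def written_def content word_tape_eq_0_iff N_def
      simp del: neq0_conv split: if_splits)
qed

lemma final_marker: "final marker = (mark_at (snd (\<tau> marker)), snd (\<tau> marker) + snd (snd cfg ! 0))"
  using layout
  by (simp add: final_def simulated_def Let_def state_def[symmetric] marker_def loaded_def)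

lemma final_simulated: "b \<le> i \<Longrightarrow> i < state \<Longrightarrow> final i = shift_tape (snd (\<tau> i)) (snd cfg ! (i - b))"
  using layout by (simp add: final_def simulated_def Let_def state_def[symmetric] loaded_def)

lemma final_other: "i < b \<or> result \<le> i \<Longrightarrow> final i = \<tau> i"
  using layout
  by (auto simp: final_def simulated_def Let_def state_def[symmetric] loaded_def result_def
    counter_def marker_def)

lemma runs_fetched: "runs (fetch b counter marker result) final (N * 9 + length y * 3 + 9) fetched"
proof -
  let ?d = "snd (snd cfg ! 0)"
  have first: "final b = shift_tape (snd (\<tau> b)) (snd cfg ! 0)"
    using final_simulated[of b] layout by simp
  have "runs (fetch b counter marker result) final (N * 9 + length y * 3 + 9)
    (final(counter := (fst (final counter), snd (final counter) - int N),
       b := (fst (final b), snd (final b) - ?d + int (length y)),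
       marker := (mark_at (snd (\<tau> marker)), snd (\<tau> marker) + int (length y)),
         result := written y (final result)))"
  proof (rule runs_fetch)
    show "\<bar>?d\<bar> \<le> int N" using confined_cfg[OF tapes_pos] by (simp add: confined_def N_def)
    show "fst (final b) (snd (final b) - ?d + int j) = word_tape y (int j)" if "j \<le> length y" for j
      using word_out[OF that] by (simp add: first shift_tape_def)
  qed (use layout final_counter final_marker in auto)
  then show ?thesis
    by (simp add: fetched_def final_other first shift_tape_def)
qed

lemma near_fetched:
  assumes "i \<in> scratch"
  shows "near N (fetched i)"
proof (cases "i = marker")
  case True
  then have "fetched i = (mark_at (snd (\<tau> marker)), snd (\<tau> marker) + int (length y))"
    using layout by (simp add: fetched_def)
  then show ?thesis
    unfolding near_def using t_pos length_output
    by (intro exI[of _ "snd (\<tau> marker)"]) (auto simp: mark_at_def N_def)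
next
  case False
  then have i: "b \<le> i" "i < state" "i - b < tm_tapes M"
    using assms by (auto simp: scratch_def state_def)
  note cfg = confined_cfg[OF i(3), unfolded confined_def]
  have content: "fst (fetched i) = (\<lambda>p. fst (snd cfg ! (i - b)) (p - snd (\<tau> i)))"
    using final_simulated[OF i(1,2)] i layout by (auto simp: fetched_def shift_tape_def)
  have "snd (fetched i) = (if i = b then snd (\<tau> b) + int (length y)
      else snd (snd cfg ! (i - b)) + snd (\<tau> i))"
    using final_simulated[OF i(1,2)] i layout by (auto simp: fetched_def shift_tape_def)
  then have "snd (\<tau> i) - int N \<le> snd (fetched i) \<and> snd (fetched i) \<le> snd (\<tau> i) + int N"
    using cfg length_output by (auto simp: N_def)
  moreover have "snd (\<tau> i) - int N \<le> p \<and> p < snd (\<tau> i) + int N" if "fst (fetched i) p \<noteq> 0" for p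
    using cfg that unfolding content by (auto simp: N_def dest: spec[of _ "p - snd (\<tau> i)"])
  ultimately show ?thesis unfolding near_def by blast
qed

lemma runs_return:
  obtains \<tau>' where "runs (Seq (erase counter scratch)
      (Seq (Act (set_act state 0)) (rewind result {} (\<lambda>_. 0))))
      fetched (N * 21 + length y * 3 + 33) \<tau>'"
    "\<And>i. i < b \<or> result < i \<Longrightarrow> \<tau>' i = \<tau> i"
    "\<And>i. i \<in> insert counter (insert state scratch) \<Longrightarrow> fst (\<tau>' i) = (\<lambda>_. 0)"
      "stack_tape (\<tau>' result) y"
proof -
  have counter: "counts N (fetched counter)" using final_counter layout by (simp add: fetched_def)
  obtain \<sigma> where erase: "runs (erase counter scratch) fetched (N * 21 + 25) \<sigma>"
    and erased: "\<And>i. i \<in> insert counter scratch \<Longrightarrow> fst (\<sigma> i) = (\<lambda>_. 0)"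
    and kept: "\<And>i. i \<notin> insert counter scratch \<Longrightarrow> \<sigma> i = fetched i"
    by (rule runs_erase[of N fetched counter scratch, OF counter not_scratch(1) near_fetched])
      (assumption | rule that)+
  define \<rho> where "\<rho> = \<sigma>(state := ((\<lambda>_. 0), snd (\<tau> state)))"
  define \<tau>' where "\<tau>' = \<rho>(result := (fst (\<rho> result), snd (\<tau> result)))"
  have state: "\<sigma> state = (mark_at (snd (\<tau> state)), snd (\<tau> state))"
    using kept[of state] not_scratch layout final_state by (simp add: fetched_def)
  have result: "\<rho> result = (\<lambda>p. word_tape y (p - snd (\<tau> result)), snd (\<tau> result) + int (length y))"
    using kept[of result] not_scratch layout blank[of result]
    by (auto simp: \<rho>_def fetched_def written_def stack_tape_def fun_eq_iff word_tape_eq_0_iff)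
  have "runs (Act (set_act state 0)) \<sigma> 1 \<rho>"
    by (rule runs_weaken[OF runs_set]) (auto simp: \<rho>_def state mark_at_def fun_eq_iff)
  moreover have "runs (rewind result {} (\<lambda>_. 0)) \<rho> (length y * 3 + 5)
      (swept {} ((\<lambda>_. 0)(result := -1)) (length y) \<rho>)"
    by (rule runs_rewind) (auto simp: result word_tape_eq_0_iff simp del: neq0_conv)
  then have "runs (rewind result {} (\<lambda>_. 0)) \<rho> (length y * 3 + 5) \<tau>'"
    by (rule runs_weaken) (auto simp: \<tau>'_def result swept_def fun_eq_iff prod_eq_iff)
  ultimately have "runs (Seq (erase counter scratch)
      (Seq (Act (set_act state 0)) (rewind result {} (\<lambda>_. 0))))
      fetched (N * 21 + 25 + 1 + (1 + 1 + (length y * 3 + 5))) \<tau>'"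
    by (intro runs_Seq[OF erase] runs_Seq)
  then have "runs (Seq (erase counter scratch)
      (Seq (Act (set_act state 0)) (rewind result {} (\<lambda>_. 0))))
      fetched (N * 21 + length y * 3 + 33) \<tau>'" by (rule runs_weaken) simp_all
  moreover have "\<tau>' i = \<tau> i" if "i < b \<or> result < i" for i
  proof -
    have "i \<notin> insert counter scratch" "i \<noteq> state" "i \<noteq> result" "i \<noteq> b" "i \<noteq> marker"
      using that layout by (auto simp: scratch_def)
    then show ?thesis using kept[of i] final_other[of i] that
      by (auto simp: \<tau>'_def \<rho>_def fetched_def)
  qed
  moreover have "fst (\<tau>' i) = (\<lambda>_. 0)" if "i \<in> insert counter (insert state scratch)" for i
    using that erased[of i] not_scratch layout by (auto simp: \<tau>'_def \<rho>_def)
  moreover have "stack_tape (\<tau>' result) y" by (simp add: \<tau>'_def result stack_tape_def)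
  ultimately show ?thesis by (rule that)
qed

lemma runs_call:
  obtains \<tau>' where "runs (call_com M b) \<tau> (50 * N + 60) \<tau>'" "\<And>i. i < b \<Longrightarrow> \<tau>' i = \<tau> i"
    "\<And>i. b \<le> i \<Longrightarrow> stack_tape (\<tau>' i) (if i = result then y else [])"
proof -
  obtain \<tau>' where return: "runs (Seq (erase counter scratch)
      (Seq (Act (set_act state 0)) (rewind result {} (\<lambda>_. 0))))
      fetched (N * 21 + length y * 3 + 33) \<tau>'"
    and others: "\<And>i. i < b \<or> result < i \<Longrightarrow> \<tau>' i = \<tau> i"
    and erased: "\<And>i. i \<in> insert counter (insert state scratch) \<Longrightarrow> fst (\<tau>' i) = (\<lambda>_. 0)"
    and result: "stack_tape (\<tau>' result) y"
    by (rule runs_return) (assumption | rule that)+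
  have "runs (call_com M b) \<tau> (length x * 6 + 9 + 1 +
      (t * 3 + 1 + 1 + (N * 9 + length y * 3 + 9 + 1 +
      (N * 21 + length y * 3 + 33)))) \<tau>'"
    unfolding call_com_def Let_def state_def[symmetric] counter_def[symmetric] marker_def[symmetric]
      result_def[symmetric] scratch_def[symmetric]
    by (intro runs_Seq[OF runs_loaded] runs_Seq[OF runs_final] runs_Seq[OF runs_fetched] return)
  then have "runs (call_com M b) \<tau> (50 * N + 60) \<tau>'"
    by (rule runs_weaken) (use length_output in \<open>auto simp: N_def\<close>)
  moreover have "stack_tape (\<tau>' i) (if i = result then y else [])" if i: "b \<le> i" for i
  proof -
    consider "i \<in> insert counter (insert state scratch)" | "i = result" | "result < i"
      using tape_cases[OF i] by blast
    then show ?thesis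
      using erased[of i] result others[of i] blank[of i] not_scratch layout
      by cases (auto simp: stack_tape_def)
  qed
  ultimately show ?thesis using that others by blast
qed

end

lemma tm_step_halted: "fst c = 1 \<Longrightarrow> (tm_step M ^^ n) c = c"
  by (induction n) (auto simp: tm_step_def case_prod_beta prod_eq_iff)

lemma runs_call_com:
  assumes wf: "tm_wf M" and x: "stack_tape (\<tau> b) x" and blank: "\<And>i. b < i \<Longrightarrow> stack_tape (\<tau> i) []"
    and out: "tm_outputs M x T y"
  obtains \<tau>' where "runs (call_com M b) \<tau> (50 * (length x + T) + 60) \<tau>'" "\<And>i. i < b \<Longrightarrow> \<tau>' i = \<tau> i"
    "\<And>i. b \<le> i \<Longrightarrow> stack_tape (\<tau>' i) (if i = b + tm_tapes M + 3 then y else [])"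
proof -
  define cfg where "cfg k = (tm_step M ^^ k) (tm_init M x)" for k
  define t where "t = (LEAST k. fst (cfg k) = 1)"
  have halted_T: "fst (cfg T) = 1" using out by (auto simp: tm_outputs_def cfg_def)
  then have halted: "fst (cfg t) = 1" and "t \<le> T"
    unfolding t_def by (auto intro: LeastI Least_le)
  have running: "fst (cfg k) \<noteq> 1" if "k < t" for k
    using that not_less_Least unfolding t_def by blast
  have "cfg T = (tm_step M ^^ (T - t)) (cfg t)"
    using \<open>t \<le> T\<close> funpow_add[of "T - t" t "tm_step M"] by (simp add: cfg_def)
  then have "cfg T = cfg t" using tm_step_halted[OF halted] by simp
  moreover have "hd (snd (cfg t)) = snd (cfg t) ! 0"
    using tm_config_reachable(1)[OF wf, of t x] wf
    by (intro hd_conv_nth) (auto simp: cfg_def tm_config_valid_def tm_wf_def)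
  ultimately have "fst (snd (cfg t) ! 0) (int j) = word_tape y (int j)" if "j \<le> length y" for j
    using out that by (auto simp: tm_outputs_def cfg_def case_prod_beta)
  then interpret halting_run M b x \<tau> t y "cfg t"
    using halted running by unfold_locales (auto simp: wf x blank cfg_def)
  obtain \<tau>' where "runs (call_com M b) \<tau> (50 * N + 60) \<tau>'" "\<And>i. i < b \<Longrightarrow> \<tau>' i = \<tau> i"
    "\<And>i. b \<le> i \<Longrightarrow> stack_tape (\<tau>' i) (if i = result then y else [])"
    by (rule runs_call) blast
  moreover have "50 * N + 60 \<le> 50 * (length x + T) + 60" using \<open>t \<le> T\<close> by (simp add: N_def)
  ultimately show ?thesis
    using that[of \<tau>'] runs_mono by (auto simp: result_def state_def)
qed

lemma poly_runs_call_com: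
  fixes p :: "nat poly"
  assumes wf: "tm_wf M" and out: "\<And>i. D i \<Longrightarrow> tm_outputs M (A i e) (poly p (length (A i e))) (y i)"
    and empty: "\<And>i. D i \<Longrightarrow> empty_from (e + 1) (A i)"
    and B: "\<And>i. D i \<Longrightarrow> B i = (A i)(e := [], e + tm_tapes M + 3 := y i)"
  shows "poly_runs D A (call_com M (e + 2)) B"
proof (rule poly_runsI)
  show "bounded_com (e + 2 + tm_tapes M + 6 + tm_states M + tm_symbols M) (call_com M (e + 2))"
    using bounded_call_com[OF wf] by simp
  show "poly_size D A (\<lambda>i. 50 * (length (A i e) + poly p (length (A i e))) + 60)"
    by (intro poly_size_intros)
  fix i assume i: "D i"
  show "store_runs (call_com M (e + 2)) (A i)
      (50 * (length (A i e) + poly p (length (A i e))) + 60) (B i)"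
    unfolding store_runs_def
  proof (intro allI impI)
    fix \<tau> assume \<tau>: "represents \<tau> (A i)"
    have tape: "stack_tape (\<tau> (e + 2)) (A i e)" using \<tau> unfolding represents_def by blast
    have blank: "stack_tape (\<tau> j) []" if "e + 2 < j" for j
    proof -
      have "j - 2 + 2 = j" "e + 1 \<le> j - 2" using that by auto
      then show ?thesis
        using \<tau>[unfolded represents_def, rule_format, of "j - 2"] empty[OF i]
        by (simp only: empty_from_def)
    qed
    obtain \<tau>' where run: "runs (call_com M (e + 2)) \<tau>
        (50 * (length (A i e) + poly p (length (A i e))) + 60) \<tau>'"
      and low: "\<And>j. j < e + 2 \<Longrightarrow> \<tau>' j = \<tau> j"
      and high: "\<And>j. e + 2 \<le> j \<Longrightarrow> stack_tape (\<tau>' j) (if j = e + 2 + tm_tapes M + 3 then y i else [])"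
      by (rule runs_call_com[of M \<tau> "e + 2", OF wf tape blank out[OF i]]) (assumption | rule that)+
    have "stack_tape (\<tau>' (r + 2)) (B i r)" for r
    proof (cases "r < e")
      case True
      then show ?thesis using low[of "r + 2"] \<tau> by (simp add: B[OF i] represents_def)
    next
      case False
      then show ?thesis using high[of "r + 2"] empty[OF i]
        by (auto simp: B[OF i] empty_from_def split: if_splits)
    qed
    then show "\<exists>\<tau>'. runs (call_com M (e + 2)) \<tau>
        (50 * (length (A i e) + poly p (length (A i e))) + 60) \<tau>' \<and>
        represents \<tau>' (B i) \<and> \<tau>' 0 = \<tau> 0 \<and> \<tau>' 1 = \<tau> 1"
      using run low by (intro exI[of _ \<tau>']) (simp add: represents_def)
  qed
qed

lemma computable_call:
  assumes f: "poly_time_on Dom f" and E: "computable d D E" and dom: "\<And>s. D s \<Longrightarrow> E s \<in> Dom"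
  shows "computable d D (\<lambda>s. f (E s))"
proof (rule computableI)
  fix e assume e: "d \<le> e"
  let ?D = "\<lambda>s. D s \<and> empty_from e s"
  obtain M and p :: "nat poly" where wf: "tm_wf M"
    and out: "\<And>x. x \<in> Dom \<Longrightarrow> tm_outputs M x (poly p (length x)) (f x)"
    using f unfolding poly_time_on_def by blast
  obtain c where c: "poly_runs ?D (\<lambda>s. s) c (\<lambda>s. s(e := E s))"
    by (rule computableE[OF E e])
  let ?u = "e + tm_tapes M + 3"
  have "poly_runs ?D (\<lambda>s. s(e := E s)) (call_com M (e + 2)) (\<lambda>s. s(?u := f (E s)))"
    using out dom by (intro poly_runs_call_com[OF wf]) (auto simp: empty_from_def fun_eq_iff)
  moreover have "poly_runs ?D (\<lambda>s. s(?u := f (E s))) (move ?u (e + 1))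
      (\<lambda>s. s(e + 1 := rev (f (E s))))"
    by (rule poly_runs_move) (auto simp: empty_from_def fun_eq_iff)
  moreover have "poly_runs ?D (\<lambda>s. s(e + 1 := rev (f (E s)))) (move (e + 1) e)
      (\<lambda>s. s(e := f (E s)))"
    by (rule poly_runs_move) (auto simp: empty_from_def fun_eq_iff)
  ultimately have "poly_runs ?D (\<lambda>s. s)
      (Seq c (Seq (call_com M (e + 2)) (Seq (move ?u (e + 1)) (move (e + 1) e))))
      (\<lambda>s. s(e := f (E s)))"
    by (intro poly_runs_Seq[OF c] poly_runs_Seq)
  then show "\<exists>c. poly_runs ?D (\<lambda>s. s) c (\<lambda>s. s(e := f (E s)))" by blast
qed (use computable_upd[OF E] in auto)


definition read_input :: com where
  "read_input = Seq (Act (set_act 1 1)) (Seq (copy 0 2 {0} (drift {0, 1} 1))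
     (Seq (seek 1 (drift {0, 1} (-1))) (rewind 2 {} (\<lambda>_. 0))))"

definition started :: "bool list \<Rightarrow> tapes" where
  "started x i = (if i = 1 then mark_at 0 else if i = 2 then word_tape x else (\<lambda>_. 0), 0)"

lemma runs_read_input: "runs read_input (input_tapes x) (length x * 9 + 11) (started x)"
proof -
  let ?\<tau> = "(input_tapes x)(1 := (mark_at 0, 0))"
  define \<sigma> where "\<sigma> = (swept {0} (drift {0, 1} 1) (length x) ?\<tau>)(2 := written x (?\<tau> 2))"
  define \<rho> where "\<rho> = swept {} (drift {0, 1} (-1)) (length x) \<sigma>"
  have word: "\<sigma> 2 = (word_tape x, int (length x))" "\<rho> 2 = (word_tape x, int (length x))"
    by (auto simp: \<rho>_def \<sigma>_def written_def input_tapes_def swept_def drift_def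
      fun_eq_iff word_tape_eq_0_iff)
  have "runs (Act (set_act 1 1)) (input_tapes x) 1 ?\<tau>"
    by (rule runs_weaken[OF runs_set]) (auto simp: input_tapes_def mark_at_def fun_eq_iff)
  moreover have "runs (copy 0 2 {0} (drift {0, 1} 1)) ?\<tau> (length x * 3 + 1) \<sigma>"
    unfolding \<sigma>_def by (rule runs_copy) (auto simp: input_tapes_def drift_def)
  moreover have "runs (seek 1 (drift {0, 1} (-1))) \<sigma> (length x * 3 + 1) \<rho>"
    unfolding \<rho>_def by (rule runs_seek[where h = 0]) (auto simp: \<sigma>_def swept_def drift_def)
  moreover have "runs (rewind 2 {} (\<lambda>_. 0)) \<rho> (length x * 3 + 5)
      (swept {} ((\<lambda>_. 0)(2 := -1)) (length x) \<rho>)"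
    by (rule runs_rewind) (auto simp: word word_tape_eq_0_iff simp del: neq0_conv)
  ultimately have "runs read_input (input_tapes x)
      (1 + 1 + (length x * 3 + 1 + 1 + (length x * 3 + 1 + 1 + (length x * 3 + 5))))
      (swept {} ((\<lambda>_. 0)(2 := -1)) (length x) \<rho>)"
    unfolding read_input_def by (intro runs_Seq)
  then show ?thesis
  proof (rule runs_weaken)
    show "swept {} ((\<lambda>_. 0)(2 := -1)) (length x) \<rho> = started x"
    proof
      fix i
      show "swept {} ((\<lambda>_. 0)(2 := -1)) (length x) \<rho> i = started x i"
        using word by (cases "i = 2")
          (auto simp: swept_def \<rho>_def \<sigma>_def drift_def started_def input_tapes_def
            fun_eq_iff word_tape_eq_0_iff)
    qed
  qed simp
qed

lemma represents_started: "represents (started x) ((\<lambda>_. [])(0 := x))"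
  unfolding represents_def by (simp add: started_def stack_tape_def numeral_2_eq_2)

lemma store_size_singleton: "store_size ((\<lambda>_. [])(0 := x)) N \<le> length x"
  by (simp add: store_size_def if_distrib[of length] cong: if_cong)

lemma poly_time_on_computable:
  assumes F: "computable 1 (\<lambda>s. s 0 \<in> Dom) (\<lambda>s. F (s 0))"
  shows "poly_time_on Dom F"
proof -
  obtain c where c: "poly_runs (\<lambda>s. s 0 \<in> Dom \<and> empty_from 1 s) (\<lambda>s. s) c (\<lambda>s. s(1 := F (s 0)))"
    by (rule computableE[OF F order_refl])
  let ?s = "\<lambda>x. (\<lambda>_. [])(0 := x) :: store" and ?s' = "\<lambda>x. (\<lambda>_. [])(0 := x, 1 := F x) :: store"
  have "poly_runs (\<lambda>x. x \<in> Dom) ?s c ?s'"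
    using c by (rule poly_runs_at) (auto simp: empty_from_def)
  then obtain B T where B: "bounded_com B c" and "poly_size (\<lambda>x. x \<in> Dom) ?s T"
    and run: "\<And>x. x \<in> Dom \<Longrightarrow> store_runs c (?s x) (T x) (?s' x)"
    by (rule poly_runsE) blast
  then obtain N and p :: "nat poly" where "\<And>x. x \<in> Dom \<Longrightarrow> T x \<le> poly p (store_size (?s x) N)"
    unfolding poly_size_def by blast
  then have T: "T x \<le> poly p (length x)" if "x \<in> Dom" for x
    using that poly_nat_mono[OF store_size_singleton] le_trans by blast
  define q where "q = [:14, 9:] + smult 4 p"
  show ?thesis
  proof (rule poly_time_on_com)
    show "bounded_com (B + 4) (Seq read_input (Seq c (copy 3 0 {} (drift {3} 1))))"
      unfolding read_input_def bounded_com.simps(3)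
      using bounded_com_mono[OF B]
      by (intro conjI bounded_sweeps bounded_seek bounded_set) (auto simp: drift_def)
    fix x assume x: "x \<in> Dom"
    obtain \<tau> where \<tau>: "runs c (started x) (T x) \<tau>" "represents \<tau> (?s' x)" "\<tau> 0 = started x 0"
      using run[OF x] represents_started unfolding store_runs_def by blast
    have tape: "fst (\<tau> 3) p = word_tape (F x) (p - snd (\<tau> 3))" for p
      using \<tau>(2)[unfolded represents_def, rule_format, of 1]
      by (simp add: stack_tape_def eval_nat_numeral)
    let ?\<tau>' = "(swept {} (drift {3} 1) (length (F x)) \<tau>)(0 := written (F x) (\<tau> 0))"
    have "runs (copy 3 0 {} (drift {3} 1)) \<tau> (length (F x) * 3 + 1) ?\<tau>'"
      by (rule runs_copy) (auto simp: tape drift_def)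
    then have "runs (Seq read_input (Seq c (copy 3 0 {} (drift {3} 1)))) (input_tapes x)
        (length x * 9 + 11 + 1 + (T x + 1 + (length (F x) * 3 + 1))) ?\<tau>'"
      by (intro runs_Seq[OF runs_read_input] runs_Seq[OF \<tau>(1)])
    moreover have "length (F x) \<le> T x" using store_runs_length[OF run[OF x], of 1] by simp
    ultimately have "runs (Seq read_input (Seq c (copy 3 0 {} (drift {3} 1)))) (input_tapes x)
        (poly q (length x)) ?\<tau>'"
      using T[OF x] by (elim runs_weaken) (auto simp: q_def)
    moreover have "fst (?\<tau>' 0) (int i) = word_tape (F x) (int i)" if "i \<le> length (F x)" for i
      using that by (auto simp: \<tau>(3) started_def written_def word_tape_eq_0_iff)
    ultimately show "\<exists>\<tau>. runs (Seq read_input (Seq c (copy 3 0 {} (drift {3} 1)))) (input_tapes x)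
        (poly q (length x)) \<tau> \<and>
        (\<forall>i\<le>length (F x). fst (\<tau> 0) (int i) = word_tape (F x) (int i))" by blast
  qed
qed

lemma poly_time_on_comp:
  assumes "poly_time_on D f" "poly_time_on D' g" "f ` D \<subseteq> D'"
  shows "poly_time_on D (\<lambda>x. g (f x))"
proof (rule poly_time_on_computable)
  have "computable 1 (\<lambda>s. s 0 \<in> D) (\<lambda>s. f (s 0))"
    by (rule computable_call[OF assms(1) computable_var]) auto
  then show "computable 1 (\<lambda>s. s 0 \<in> D) (\<lambda>s. g (f (s 0)))"
    using assms(3) by (intro computable_call[OF assms(2)]) auto
qed

section \<open>Scanning the encodings\<close>

lemma enc_bits_prefix: "enc_bits x @ s = enc_bits y @ t \<Longrightarrow> x = y \<and> s = t"
proof (induction x arbitrary: y)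
  case Nil
  then show ?case by (cases y) auto
next
  case (Cons b x)
  then show ?case by (cases y) auto
qed

lemma enc_nat_prefix: "enc_nat a @ s = enc_nat b @ t \<Longrightarrow> a = b \<and> s = t"
proof -
  assume "enc_nat a @ s = enc_nat b @ t"
  then have bits: "map (bit a) [0..<floorlog 2 a] = map (bit b) [0..<floorlog 2 b]" and "s = t"
    unfolding enc_nat_def using enc_bits_prefix by blast+
  have less: "n < 2 ^ floorlog 2 n" for n by (rule floorlog_leD) simp_all
  have "take_bit (floorlog 2 a) a = take_bit (floorlog 2 b) b"
    using bits by (metis horner_sum_bit_eq_take_bit)
  then show ?thesis using \<open>s = t\<close> by (simp add: take_bit_nat_eq_self less)
qed

lemma enc_list_simps [simp]:
  "enc_list f [] = [False]" "enc_list f (x # xs) = True # f x @ enc_list f xs"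
  by (auto simp: enc_list_def)

lemma enc_list_prefix:
  assumes "\<And>x y s t. x \<in> X \<Longrightarrow> y \<in> X \<Longrightarrow> f x @ s = f y @ t \<Longrightarrow> x = y \<and> s = t" "set xs \<subseteq> X" "set ys \<subseteq> X"
  shows "enc_list f xs @ s = enc_list f ys @ t \<Longrightarrow> xs = ys \<and> s = t"
  using assms(2,3)
proof (induction xs arbitrary: ys)
  case Nil
  then show ?case by (cases ys) auto
next
  case (Cons x xs)
  then obtain y ys' where ys: "ys = y # ys'" by (cases ys) auto
  then have "f x @ (enc_list f xs @ s) = f y @ (enc_list f ys' @ t)" using Cons.prems(1) by simp
  moreover have "x \<in> X" "y \<in> X" "set xs \<subseteq> X" "set ys' \<subseteq> X" using Cons.prems ys by auto
  ultimately have "x = y \<and> enc_list f xs @ s = enc_list f ys' @ t" by (intro assms(1))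
  moreover from this have "xs = ys' \<and> s = t"
    using \<open>set xs \<subseteq> X\<close> \<open>set ys' \<subseteq> X\<close> by (intro Cons.IH) auto
  ultimately show ?case using ys by simp
qed

lemma enc_nat_list_inj: "enc_list enc_nat xs = enc_list enc_nat ys \<Longrightarrow> xs = ys"
  using enc_list_prefix[of UNIV enc_nat xs ys "[]" "[]", OF enc_nat_prefix] by simp

lemma pack_inj: "pack xs = pack ys \<Longrightarrow> xs = ys"
proof (induction xs arbitrary: ys)
  case Nil
  then show ?case by (cases ys) (auto simp: enc_bits_def enc_list_def)
next
  case (Cons x xs)
  then show ?case
  proof (cases ys)
    case Nil
    with Cons show ?thesis by (auto simp: enc_bits_def enc_list_def)
  next
    case (Cons y ys')
    then show ?thesis using Cons.prems Cons.IH enc_bits_prefix[of x "pack xs" y "pack ys'"] by auto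
  qed
qed

definition quote :: "bool list \<Rightarrow> bool list" where
  "quote x = concat (map (\<lambda>b. [True, b]) x)"

lemma quote_simps [simp]: "quote [] = []" "quote (b # x) = True # b # quote x"
  "quote (x @ y) = quote x @ quote y"
  by (auto simp: quote_def)

lemma enc_bits_quote: "enc_bits x = quote x @ [False]"
  by (induction x) auto

definition automaton :: "nat list \<Rightarrow> nat list \<Rightarrow> (nat \<Rightarrow> bool \<Rightarrow> bool list) \<Rightarrow> nat \<Rightarrow> bool \<Rightarrow>
    nat \<times> bool list" where
  "automaton next1 next0 emit q b = ((if b then next1 else next0) ! q, emit q b)"

lemma automaton_bounded:
  assumes "\<forall>x\<in>set next1 \<union> set next0. x < n" "length next1 = n" "length next0 = n" "q < n"
  shows "fst (automaton next1 next0 emit q b) < n"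
  using assms by (auto simp: automaton_def)

lemma concat_map_enc_bits: "concat (map h (enc_bits x)) =
    concat (map h (butlast (enc_bits x))) @ h False"
  by (simp add: enc_bits_quote)

text \<open>State \<open>f\<close> reads the flags of an \<open>enc_bits\<close> code and state \<open>d\<close> the bits that they announce.\<close>

lemma automaton_enc_bits:
  assumes "next1 ! f = d" "next1 ! d = f" "next0 ! d = f" "next0 ! f = q"
  shows "transduce_state (automaton next1 next0 emit) f (enc_bits x) = q"
    and "(\<And>b. emit d b = h b) \<Longrightarrow> emit f True = h True \<Longrightarrow>
       transduce (automaton next1 next0 emit) f (enc_bits x) =
         concat (map h (butlast (enc_bits x))) @ emit f False"
proof -
  show "transduce_state (automaton next1 next0 emit) f (enc_bits x) = q"
    using assms by (induction x) (auto simp: automaton_def)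
  show "(\<And>b. emit d b = h b) \<Longrightarrow> emit f True = h True \<Longrightarrow>
       transduce (automaton next1 next0 emit) f (enc_bits x) =
         concat (map h (butlast (enc_bits x))) @ emit f False"
    using assms by (induction x) (auto simp: automaton_def enc_bits_quote butlast_append)
qed

lemma automaton_enc_nat:
  assumes "next1 ! f = d" "next1 ! d = f" "next0 ! d = f" "next0 ! f = q"
    and "\<And>b. emit d b = h b" "\<And>b. emit f b = h b"
  shows "transduce (automaton next1 next0 emit) f (enc_nat x @ y) =
    concat (map h (enc_nat x)) @ transduce (automaton next1 next0 emit) q y"
  using assms automaton_enc_bits[where emit = emit, OF assms(1-4)] unfolding enc_nat_def
  by (simp add: transduce_append concat_map_enc_bits)

text \<open>
  States 0-1 and 2-3 read the two sizes of a Unique Games instance, state 4 the flag that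
  announces a constraint, 5-6 and 7-8 its two vertices, 9 the flag of an entry of its permutation
  table, and 10-11 the entry. State 12 is final.
\<close>

definition ug_next1 :: "nat list" where "ug_next1 = [1, 0, 3, 2, 5, 6, 5, 8, 7, 10, 11, 10, 12]"
definition ug_next0 :: "nat list" where "ug_next0 = [2, 0, 4, 2, 12, 7, 5, 9, 7, 4, 9, 10, 12]"

definition scan_ug :: "(nat \<Rightarrow> bool \<Rightarrow> bool list) \<Rightarrow> nat \<Rightarrow> bool list \<Rightarrow> bool list" where
  "scan_ug emit = transduce (automaton ug_next1 ug_next0 emit)"

definition constraint_code :: "nat \<Rightarrow> nat \<times> nat \<times> (nat \<Rightarrow> nat) \<Rightarrow> bool list" where
  "constraint_code R = (\<lambda>(u, v, \<pi>). enc_nat u @ enc_nat v @ enc_list enc_nat (map \<pi> [0..<R]))"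

lemma enc_ug_eq: "enc_ug R U = enc_nat (ug_left U) @ enc_nat (ug_right U) @
    enc_list (constraint_code R) (ug_constraints U)"
  by (simp add: enc_ug_def constraint_code_def)

lemma scan_ug_enc_nat:
  assumes "(f, q) \<in> {(0, 2), (2, 4), (5, 7), (7, 9), (10, 9)}" "\<And>b. emit f b = h b"
    "\<And>b. emit (Suc f) b = h b"
  shows "scan_ug emit f (enc_nat x @ y) = concat (map h (enc_nat x)) @ scan_ug emit q y"
  unfolding scan_ug_def
  by (rule automaton_enc_nat[where d = "Suc f"])
    (use assms in \<open>auto simp: ug_next1_def ug_next0_def\<close>)

lemma scan_ug_flag:
  "scan_ug emit 4 (True # y) = emit 4 True @ scan_ug emit 5 y"
    "scan_ug emit 4 [False] = emit 4 False"
  "scan_ug emit 9 (True # y) = emit 9 True @ scan_ug emit 10 y"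
    "scan_ug emit 9 (False # y) = emit 9 False @ scan_ug emit 4 y"
  by (simp_all add: scan_ug_def automaton_def ug_next1_def ug_next0_def)

lemma scan_ug_permutation:
  assumes "\<And>b. emit 10 b = h b" "\<And>b. emit 11 b = h b" "emit 9 True = h True"
  shows "scan_ug emit 9 (enc_list enc_nat xs @ y) =
      concat (map h (butlast (enc_list enc_nat xs))) @ emit 9 False @ scan_ug emit 4 y"
proof (induction xs)
  case (Cons x xs)
  have "scan_ug emit 9 (enc_list enc_nat (x # xs) @ y) =
      h True @ concat (map h (enc_nat x)) @ scan_ug emit 9 (enc_list enc_nat xs @ y)"
    using assms by (simp add: scan_ug_flag scan_ug_enc_nat[of 10 9 emit h])
  then show ?case unfolding Cons by (simp add: butlast_append enc_list_def)
qed (simp add: scan_ug_flag)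

lemma scan_ug_constraint:
  assumes "\<And>b. emit 5 b = hu b" "\<And>b. emit 6 b = hu b" "\<And>b. emit 7 b = hv b" "\<And>b. emit 8 b = hv b"
    "\<And>b. emit 10 b = hp b" "\<And>b. emit 11 b = hp b" "emit 9 True = hp True"
  shows "scan_ug emit 5 (constraint_code R (u, v, \<pi>) @ y) =
      concat (map hu (enc_nat u)) @ concat (map hv (enc_nat v)) @
      concat (map hp (butlast (enc_list enc_nat (map \<pi> [0..<R])))) @
        emit 9 False @ scan_ug emit 4 y"
  using assms
  by (simp add: constraint_code_def scan_ug_enc_nat[of 5 7 emit hu] scan_ug_enc_nat[of 7 9 emit hv]
    scan_ug_permutation)

definition emit_items :: "nat \<Rightarrow> bool \<Rightarrow> bool list" where
  "emit_items q b = (if q < 5 \<or> q = 12 then []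
      else if q = 9 \<and> \<not> b then [True, False, False] else [True, b])"

definition emit_in :: "nat \<Rightarrow> nat \<Rightarrow> nat \<Rightarrow> bool \<Rightarrow> bool list" where
  "emit_in i j q b = (if i \<le> q \<and> q \<le> j then [b] else [])"

lemma butlast_enc_list: "enc_list f xs = butlast (enc_list f xs) @ [False]"
  by (simp add: enc_list_def)

lemma scan_ug_emit_items_constraint:
  "scan_ug emit_items 5 (constraint_code R c @ y) =
      enc_bits (constraint_code R c) @ scan_ug emit_items 4 y"
proof -
  obtain u v \<pi> where c: "c = (u, v, \<pi>)" by (cases c) auto
  have "quote (enc_list enc_nat (map \<pi> [0..<R])) =
      quote (butlast (enc_list enc_nat (map \<pi> [0..<R]))) @ [True, False]"
    using arg_cong[OF butlast_enc_list, of quote enc_nat "map \<pi> [0..<R]"] by simp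
  then show ?thesis
    unfolding c
    by (subst scan_ug_constraint[where hu = "\<lambda>b. [True, b]" and hv = "\<lambda>b. [True, b]"
      and hp = "\<lambda>b. [True, b]"])
      (auto simp: emit_items_def enc_bits_quote constraint_code_def quote_def[symmetric])
qed

lemma scan_ug_items: "scan_ug emit_items 0 (enc_ug R U) =
    pack (map (constraint_code R) (ug_constraints U))"
proof -
  have "scan_ug emit_items 4 (enc_list (constraint_code R) cs) =
      pack (map (constraint_code R) cs)" for cs
    by (induction cs) (simp_all add: scan_ug_flag scan_ug_emit_items_constraint
      emit_items_def[of 4])
  moreover have "scan_ug emit_items f (enc_nat x @ y) = scan_ug emit_items q y"
    if "(f, q) \<in> {(0, 2), (2, 4)}" for f q x y
    using that by (subst scan_ug_enc_nat[where h = "\<lambda>_. []" and q = q])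
      (auto simp: emit_items_def map_replicate_const)
  ultimately show ?thesis by (simp add: enc_ug_eq)
qed

lemma constraint_code_parts:
  "scan_ug (emit_in 5 6) 5 (constraint_code R (u, v, \<pi>)) = enc_nat u"
  "scan_ug (emit_in 7 8) 5 (constraint_code R (u, v, \<pi>)) = enc_nat v"
  "scan_ug (emit_in 9 11) 5 (constraint_code R (u, v, \<pi>)) = enc_list enc_nat (map \<pi> [0..<R])"
  using scan_ug_constraint[of "emit_in 5 6" "\<lambda>b. [b]" "\<lambda>_. []" "\<lambda>_. []" R u v \<pi> "[]"]
    scan_ug_constraint[of "emit_in 7 8" "\<lambda>_. []" "\<lambda>b. [b]" "\<lambda>_. []" R u v \<pi> "[]"]
    scan_ug_constraint[of "emit_in 9 11" "\<lambda>_. []" "\<lambda>_. []" "\<lambda>b. [b]" R u v \<pi> "[]"]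
    butlast_enc_list[of enc_nat "map \<pi> [0..<R]"]
  by (simp_all add: emit_in_def scan_ug_def map_replicate_const)

text \<open>States 1-2 and 3-4 read the two ends of an arc, state 0 the flag before it, and 5 is final.\<close>

definition arc_next1 :: "nat list" where "arc_next1 = [1, 2, 1, 4, 3, 5]"
definition arc_next0 :: "nat list" where "arc_next0 = [5, 3, 1, 0, 3, 5]"

definition scan_arcs :: "bool list \<Rightarrow> bool list" where
  "scan_arcs = transduce (automaton arc_next1 arc_next0 (\<lambda>q b.
     if q = 0 \<or> q = 5 then [] else if q = 3 \<and> \<not> b then [True, False, False] else [True, b])) 0"

lemma scan_arcs_enc_list: "scan_arcs (enc_list enc_arc es) = pack (map enc_arc es)"
proof (induction es)
  case Nil
  then show ?case by (simp add: scan_arcs_def automaton_def)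
next
  case (Cons e es)
  define emit where "emit q b = (if q = 0 \<or> q = 5 then []
      else if q = 3 \<and> \<not> b then [True, False, False] else [True, b])"
    for q :: nat and b
  let ?t = "transduce (automaton arc_next1 arc_next0 emit)"
  have scan: "scan_arcs = ?t 0" by (simp add: scan_arcs_def emit_def[abs_def])
  obtain u v where e: "e = (u, v)" by fastforce
  have "?t 0 (enc_list enc_arc (e # es)) = ?t 1 (enc_nat u @ enc_nat v @ enc_list enc_arc es)"
    by (simp add: e enc_arc_def automaton_def[of _ _ _ 0] emit_def[of 0]) (simp add: arc_next1_def)
  also have "\<dots> = quote (enc_nat u) @ ?t 3 (enc_nat v @ enc_list enc_arc es)"
    unfolding quote_def
    by (rule automaton_enc_nat[where d = 2]) (auto simp: arc_next1_def arc_next0_def emit_def)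
  also have "?t 3 (enc_nat v @ enc_list enc_arc es) =
      quote (enc_nat v) @ False # ?t 0 (enc_list enc_arc es)"
    using automaton_enc_bits(1)[of arc_next1 3 4 arc_next0 0 emit]
      automaton_enc_bits(2)[of arc_next1 3 4 arc_next0 0 emit "\<lambda>b. [True, b]"]
    unfolding enc_nat_def quote_def transduce_append concat_map_enc_bits
    by (simp add: arc_next1_def arc_next0_def emit_def)
  finally show ?case using Cons by (simp add: scan e enc_arc_def enc_bits_quote)
qed

section \<open>Vertex numbers and their codes\<close>

text \<open>
  With this numbering the binary code of a vertex is that of \<open>c\<close>, padded to \<open>q\<close> bits, followed by
  a unary code of \<open>j\<close>, and programs can write it without arithmetic.
\<close>

definition vertex_id :: "nat \<Rightarrow> nat \<Rightarrow> nat \<Rightarrow> nat" where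
  "vertex_id q j c = c + 2 ^ (q + j)"

definition unary :: "nat \<Rightarrow> bool list" where
  "unary j = concat (replicate j [True, False]) @ [True, True, False]"

definition index_bits :: "nat \<Rightarrow> nat \<Rightarrow> bool list" where
  "index_bits q c = quote (map (bit c) [0..<q])"

lemma enc_nat_vertex_id:
  assumes "c < 2 ^ q"
  shows "enc_nat (vertex_id q j c) = index_bits q c @ unary j"
proof -
  have "(2 :: nat) ^ q \<le> 2 ^ (q + j)" by simp
  then have "2 ^ (q + j) \<le> vertex_id q j c" "vertex_id q j c < 2 ^ Suc (q + j)"
    using assms by (simp_all add: vertex_id_def less_le_trans)
  then have size: "floorlog 2 (vertex_id q j c) = Suc (q + j)"
    by (intro antisym floorlog_leI floorlog_ge_SucI) simp_all
  have div: "vertex_id q j c div 2 ^ i = c div 2 ^ i + 2 ^ (q + j - i)" if "i \<le> q + j" for i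
  proof -
    have "vertex_id q j c = c + 2 ^ (q + j - i) * 2 ^ i"
      using that by (simp add: vertex_id_def flip: power_add)
    then show ?thesis by simp
  qed
  have "bit (vertex_id q j c) i \<longleftrightarrow> (if i < q then bit c i else i = q + j)" if "i \<le> q + j" for i
  proof (cases "i < q")
    case True
    then have "even ((2 :: nat) ^ (q + j - i))" by simp
    then show ?thesis using True div[OF that] by (simp add: bit_iff_odd)
  next
    case False
    then have "(2 :: nat) ^ q \<le> 2 ^ i" by simp
    then have "c < 2 ^ i" using assms less_le_trans by blast
    then have "c div 2 ^ i = 0" by simp
    then show ?thesis using False div[OF that] that by (auto simp: bit_iff_odd)
  qed
  then have "map (bit (vertex_id q j c)) [0..<Suc (q + j)] =
      map (bit c) [0..<q] @ replicate j False @ [True]"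
    by (intro nth_equalityI) (auto simp: nth_append less_Suc_eq simp del: upt_Suc)
  then have "enc_nat (vertex_id q j c) =
      enc_bits (map (bit c) [0..<q] @ replicate j False @ [True])"
    unfolding enc_nat_def size by simp
  moreover have "quote (replicate j False) = concat (replicate j [True, False])"
    by (induction j) auto
  ultimately show ?thesis by (simp add: enc_bits_quote index_bits_def unary_def)
qed

lemma vertex_id_less: "c < 2 ^ q \<Longrightarrow> j < j' \<Longrightarrow> vertex_id q j c < vertex_id q j' c'"
proof -
  assume a: "c < 2 ^ q" "j < j'"
  have "(2 :: nat) ^ q \<le> 2 ^ (q + j)" by simp
  then have "vertex_id q j c < 2 ^ Suc (q + j)" using a by (simp add: vertex_id_def less_le_trans)
  also have "\<dots> \<le> 2 ^ (q + j')" using a by (intro power_increasing) auto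
  finally show ?thesis by (simp add: vertex_id_def)
qed

lemma vertex_id_inject: "c < 2 ^ q \<Longrightarrow> c' < 2 ^ q \<Longrightarrow>
    vertex_id q j c = vertex_id q j' c' \<longleftrightarrow> j = j' \<and> c = c'"
  using vertex_id_less[of c q j j' c'] vertex_id_less[of c' q j' j c]
  by (cases j j' rule: linorder_cases) (auto simp: vertex_id_def)

lemma enc_nat_power: "enc_nat (2 ^ t) = unary t"
  using enc_nat_vertex_id[of 0 0 t] by (simp add: vertex_id_def index_bits_def)

lemma enc_rat_of_nat: "enc_rat (inv real_of_rat (real n)) = enc_nat n @ [True, True, False]"
proof -
  have "inj real_of_rat" by (rule injI) simp
  then have "inv real_of_rat (real n) = of_nat n" using inv_f_f[of real_of_rat "of_nat n"] by simp
  moreover have "quotient_of (of_nat n) = (int n, 1)"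
    using quotient_of_int[of "int n"] by (simp add: of_int_of_nat_eq)
  moreover have "enc_nat 1 = [True, True, False]" using enc_nat_power[of 0] by (simp add: unary_def)
  ultimately show ?thesis by (simp add: enc_rat_def)
qed

section \<open>The reduction as a program\<close>

lemma computable_concat:
  assumes "\<And>e s x. d \<le> e \<Longrightarrow> D (s(e := x)) = D s" "\<And>c. c \<in> set cs \<Longrightarrow> computable d D (E c)"
  shows "computable d D (\<lambda>s. concat (map (\<lambda>c. E c s) cs))"
  using assms(2)
proof (induction cs)
  case Nil
  then show ?case using computable_const[OF assms(1)] by simp
next
  case (Cons c cs)
  then show ?case using computable_append[of d D "E c" "\<lambda>s. concat (map (\<lambda>c. E c s) cs)"] by simp
qed

lemma computable_finite_case:
  assumes "\<And>e s x. d \<le> e \<Longrightarrow> D (s(e := x)) = D s" "computable d D K" "finite A"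
    "\<And>k. k \<in> A \<Longrightarrow> computable d D (E k)"
  shows "computable d D (\<lambda>s. if K s \<in> A then E (K s) s else [])"
  using assms(3,4)
proof (induction A rule: finite_induct)
  case empty
  then show ?case using computable_const[OF assms(1)] by simp
next
  case (insert k A)
  have "computable d D (\<lambda>s. if K s = k then E k s else if K s \<in> A then E (K s) s else [])"
    using insert by (intro computable_if_eq assms(2) computable_const[OF assms(1)]) auto
  moreover have "(\<lambda>s. if K s = k then E k s else if K s \<in> A then E (K s) s else []) =
      (\<lambda>s. if K s \<in> insert k A then E (K s) s else [])" by auto
  ultimately show ?case by simp
qed

lemma computable_automaton:
  assumes "computable d D E" "\<forall>x\<in>set next1 \<union> set next0. x < n" "length next1 = n"
    "length next0 = n" "q < n"
  shows "computable d D (\<lambda>s. transduce (automaton next1 next0 emit) q (E s))"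
  using assms(1) automaton_bounded[OF assms(2-4)] assms(5) by (rule computable_transduce)

lemma computable_scan_ug: "computable d D E \<Longrightarrow> q < 13 \<Longrightarrow> computable d D (\<lambda>s. scan_ug emit q (E s))"
  unfolding scan_ug_def
  by (rule computable_automaton[where n = 13]) (auto simp: ug_next1_def ug_next0_def)

lemma computable_scan_arcs: "computable d D E \<Longrightarrow> computable d D (\<lambda>s. scan_arcs (E s))"
  unfolding scan_arcs_def
  by (rule computable_automaton[where n = 6]) (auto simp: arc_next1_def arc_next0_def)

definition left_code :: "bool list \<Rightarrow> bool list" where "left_code = scan_ug (emit_in 5 6) 5"
definition right_code :: "bool list \<Rightarrow> bool list" where "right_code = scan_ug (emit_in 7 8) 5"
definition perm_code :: "bool list \<Rightarrow> bool list" where "perm_code = scan_ug (emit_in 9 11) 5"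

definition unary_code :: "bool list \<Rightarrow> bool list" where
  "unary_code i = transduce (\<lambda>_ _. (0, [True, False])) 0 i @ [True, True, False]"

lemma unary_code_replicate: "unary_code (replicate j True) = unary j"
proof -
  have "transduce (\<lambda>_ _. (0, [True, False])) 0 (replicate j True) =
      concat (replicate j [True, False])"
    by (induction j) auto
  then show ?thesis by (simp add: unary_code_def unary_def)
qed

definition key_code :: "bool list \<Rightarrow> bool list \<Rightarrow> bool list \<Rightarrow> bool list \<Rightarrow> bool list" where
  "key_code i y i' y' = (if i = i' then [True] else [False]) @
      (if left_code y = left_code y' then [True] else [False]) @
     (if right_code y = right_code y' then [True] else [False]) @ perm_code y"

text \<open>
  \<open>W\<close> gives the weight of an arc between the gadget vertices \<open>c\<close> and \<open>c'\<close> of two constraints. It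
  may depend on a key of the two constraints: whether they are the same, agree in \<open>u\<close> and agree in
  \<open>v\<close>, and the permutation of the first one. An infinite weight \<open>None\<close> is replaced by \<open>2 ^ (m +
  B)\<close>.
\<close>

locale reduction_table =
  fixes R M q B threshold :: nat and W :: "bool list \<Rightarrow> nat \<Rightarrow> nat \<Rightarrow> nat option"
    and ter_index :: "nat \<Rightarrow> nat"
    and H :: "nat pair_pre_digraph"
  assumes M_le: "M \<le> 2 ^ q" and ter_index_less: "s \<in> pverts H \<Longrightarrow> ter_index s < M"
    and inj_ter_index: "inj_on ter_index (pverts H)"
    and threshold_le: "threshold \<le> 2 ^ B"
begin

definition ug_codes :: "bool list set" where
  "ug_codes = {enc_ug R U | U. ug_instance R U}"

definition constraint_codes :: "bool list \<Rightarrow> bool list list" where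
  "constraint_codes X = (SOME ys. scan_ug emit_items 0 X = pack ys)"

lemma constraint_codes_enc_ug: "constraint_codes (enc_ug R U) =
    map (constraint_code R) (ug_constraints U)"
  unfolding constraint_codes_def scan_ug_items
  by (rule some_equality[where P = "\<lambda>ys. _ = pack ys"]) (auto dest: pack_inj)

lemma pack_constraint_codes: "X \<in> ug_codes \<Longrightarrow> scan_ug emit_items 0 X = pack (constraint_codes X)"
  by (auto simp: ug_codes_def constraint_codes_enc_ug scan_ug_items)

definition keys :: "bool list set" where
  "keys = (\<lambda>(a, b, c, \<pi>). a # b # c # enc_list enc_nat (map \<pi> [0..<R])) `
     (UNIV \<times> UNIV \<times> UNIV \<times> {\<pi>. \<pi> permutes {..<R}})"

lemma finite_keys: "finite keys"
  unfolding keys_def by (intro finite_imageI finite_cartesian_product finite_permutations) auto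

definition weight_code :: "bool list \<Rightarrow> bool list \<Rightarrow> nat \<Rightarrow> nat \<Rightarrow> bool list" where
  "weight_code X k c c' = (case W k c c' of
      None \<Rightarrow> concat (map (\<lambda>j. [True, False]) [0..<length (constraint_codes X)]) @ unary B
    | Some x \<Rightarrow> enc_nat x) @ [True, True, False]"

definition arc_code :: "bool list \<Rightarrow> bool list \<Rightarrow> nat \<Rightarrow> nat \<Rightarrow> bool list" where
  "arc_code i i' c c' = index_bits q c @ unary_code i @ index_bits q c' @ unary_code i'"

definition arc_entry :: "bool list \<Rightarrow> bool list \<Rightarrow> bool list \<Rightarrow> bool list \<Rightarrow> bool list \<Rightarrow> nat \<Rightarrow>
    nat \<Rightarrow> bool list" where
  "arc_entry X i y i' y' c c' = [True] @ arc_code i i' c c' @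
     (if key_code i y i' y' \<in> keys then weight_code X (key_code i y i' y') c c' else [])"

definition all_pairs :: "(bool list \<Rightarrow> bool list \<Rightarrow> bool list \<Rightarrow> bool list \<Rightarrow> bool list \<Rightarrow> nat \<Rightarrow> nat \<Rightarrow>
    bool list) \<Rightarrow> bool list \<Rightarrow> bool list" where
  "all_pairs f X = concat (map (\<lambda>j. concat (map (\<lambda>c. concat (map (\<lambda>j'. concat (map (\<lambda>c'.
     f X (replicate j True) (constraint_codes X ! j) (replicate j' True)
       (constraint_codes X ! j') c c')
       [0..<M])) [0..<length (constraint_codes X)])) [0..<M])) [0..<length (constraint_codes X)])"

definition reduce :: "bool list \<Rightarrow> bool list" where
  "reduce X =
     concat (map (\<lambda>j. concat (map (\<lambda>c. [True] @ index_bits q c @ unary_code (replicate j True))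
       [0..<M])) [0..<length (constraint_codes X)]) @
     [False] @ all_pairs arc_entry X @ [False] @
     enc_list enc_nat (map (\<lambda>s. vertex_id q 0 (ter_index s)) (sorted_list_of_set (pverts H)))"

definition valid_input :: "(nat \<Rightarrow> bool list) \<Rightarrow> bool" where
  "valid_input s \<longleftrightarrow> s 0 \<in> ug_codes"

lemma valid_input_upd [simp]: "0 < e \<Longrightarrow> valid_input (s(e := x)) = valid_input s"
  by (simp add: valid_input_def)

lemma computable_input: "1 \<le> d \<Longrightarrow> computable d valid_input (\<lambda>s. s 0)"
  by (intro computable_var) auto

lemma computable_constraint_codes: "1 \<le> d \<Longrightarrow>
    computable d valid_input (\<lambda>s. scan_ug emit_items 0 (s 0))"
  by (rule computable_scan_ug[OF computable_input]) auto

lemma computable_code_parts: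
  assumes "1 \<le> d" "y < d"
  shows "computable d valid_input (\<lambda>s. left_code (s y))"
    "computable d valid_input (\<lambda>s. right_code (s y))"
    "computable d valid_input (\<lambda>s. perm_code (s y))"
    "computable d valid_input (\<lambda>s. unary_code (s y))"
proof -
  have v: "computable d valid_input (\<lambda>s. s y)" using assms by (intro computable_var) auto
  show "computable d valid_input (\<lambda>s. left_code (s y))"
    "computable d valid_input (\<lambda>s. right_code (s y))"
    "computable d valid_input (\<lambda>s. perm_code (s y))"
    unfolding left_code_def right_code_def perm_code_def by (rule computable_scan_ug[OF v]; simp)+
  show "computable d valid_input (\<lambda>s. unary_code (s y))"
    unfolding unary_code_def using assms
    by (intro computable_append computable_transduce[where n = 1, OF v] computable_const) auto
qed

lemma computable_foreach_constraint:
  assumes "1 \<le> d" "\<And>a. d \<le> a \<Longrightarrow> computable (a + 2) valid_input (\<lambda>s. E s (s a) (s (a + 1)))"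
    "\<And>e s i x y. d \<le> e \<Longrightarrow> E (s(e := x)) i y = E s i y"
  shows "computable d valid_input
      (\<lambda>s. concat (map (\<lambda>j. E s (replicate j True) (constraint_codes (s 0) ! j))
        [0..<length (constraint_codes (s 0))]))"
  by (rule computable_foreach[OF computable_constraint_codes[OF assms(1)], where xs = "\<lambda>s.
      constraint_codes (s 0)" and E = E])
    (use assms in \<open>auto simp: valid_input_def pack_constraint_codes\<close>)

lemma computable_key_code:
  assumes "1 \<le> d" "i < d" "y < d" "i' < d" "y' < d"
  shows "computable d valid_input (\<lambda>s. key_code (s i) (s y) (s i') (s y'))"
  unfolding key_code_def using assms
  by (intro computable_append computable_if_eq computable_code_parts computable_const
    computable_var) auto

lemma computable_arc_code:
  assumes "1 \<le> d" "i < d" "i' < d"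
  shows "computable d valid_input (\<lambda>s. arc_code (s i) (s i') c c')"
  unfolding arc_code_def using assms
  by (intro computable_append computable_code_parts computable_const) auto

lemma computable_all_pairs:
  assumes f: "\<And>d i y i' y' c c'. 1 \<le> d \<Longrightarrow> i < d \<Longrightarrow> y < d \<Longrightarrow> i' < d \<Longrightarrow> y' < d \<Longrightarrow>
      computable d valid_input (\<lambda>s. f (s 0) (s i) (s y) (s i') (s y') c c')"
    and "1 \<le> d"
  shows "computable d valid_input (\<lambda>s. all_pairs f (s 0))"
proof -
  have inner: "computable d valid_input (\<lambda>s. concat (map (\<lambda>j'. concat (map (\<lambda>c'.
     f (s 0) (s i) (s y) (replicate j' True) (constraint_codes (s 0) ! j') c c') [0..<M]))
       [0..<length (constraint_codes (s 0))]))"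
    if "1 \<le> d" "i < d" "y < d" for d i y c
  proof (rule computable_foreach_constraint[where E = "\<lambda>s i' y'. concat
      (map (\<lambda>c'. f (s 0) (s i) (s y) i' y' c c') [0..<M])"])
    fix a assume "d \<le> a"
    then show "computable (a + 2) valid_input
        (\<lambda>s. concat (map (\<lambda>c'. f (s 0) (s i) (s y) (s a) (s (a + 1)) c c') [0..<M]))"
      using that by (intro computable_concat f) auto
  qed (use that in auto)
  show ?thesis
    unfolding all_pairs_def
  proof (rule computable_foreach_constraint[where E = "\<lambda>s i y. concat
      (map (\<lambda>c. concat (map (\<lambda>j'. concat (map (\<lambda>c'.
     f (s 0) i y (replicate j' True) (constraint_codes (s 0) ! j') c c') [0..<M]))
       [0..<length (constraint_codes (s 0))])) [0..<M])"])
    fix a assume "d \<le> a"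
    then show "computable (a + 2) valid_input
        (\<lambda>s. concat (map (\<lambda>c. concat (map (\<lambda>j'. concat (map (\<lambda>c'.
     f (s 0) (s a) (s (a + 1)) (replicate j' True) (constraint_codes (s 0) ! j') c c') [0..<M]))
       [0..<length (constraint_codes (s 0))])) [0..<M]))"
      using assms(2) by (intro computable_concat inner) auto
  qed (use assms(2) in auto)
qed

lemma computable_foreach_constraint_const:
  assumes "1 \<le> d"
  shows "computable d valid_input (\<lambda>s. concat (map (\<lambda>j. x) [0..<length (constraint_codes (s 0))]))"
  using assms by (intro computable_foreach_constraint[where E = "\<lambda>_ _ _. x"] computable_const) auto

lemma computable_weight_code:
  assumes "1 \<le> d"
  shows "computable d valid_input (\<lambda>s. weight_code (s 0) k c c')"
  unfolding weight_code_def using assms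
  by (cases "W k c c'") (auto intro!: computable_append computable_const
    computable_foreach_constraint_const)

lemma computable_reduce: "computable 1 valid_input (\<lambda>s. reduce (s 0))"
proof -
  have vertices: "computable 1 valid_input
      (\<lambda>s. concat
        (map (\<lambda>j. concat (map (\<lambda>c. [True] @ index_bits q c @ unary_code (replicate j True))
          [0..<M])) [0..<length (constraint_codes (s 0))]))"
  proof (rule computable_foreach_constraint[where E = "\<lambda>s i y. concat
      (map (\<lambda>c. [True] @ index_bits q c @ unary_code i) [0..<M])"])
    fix a :: nat assume "1 \<le> a"
    then show "computable (a + 2) valid_input
        (\<lambda>s. concat (map (\<lambda>c. [True] @ index_bits q c @ unary_code (s a)) [0..<M]))"
      by (intro computable_concat computable_append computable_code_parts computable_const) auto
  qed auto
  have arcs: "computable 1 valid_input (\<lambda>s. all_pairs arc_entry (s 0))"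
  proof (rule computable_all_pairs)
    fix d i y i' y' c c' :: nat assume d: "1 \<le> d" "i < d" "y < d" "i' < d" "y' < d"
    show "computable d valid_input (\<lambda>s. arc_entry (s 0) (s i) (s y) (s i') (s y') c c')"
      unfolding arc_entry_def using d finite_keys
      by (intro computable_append computable_const computable_arc_code
          computable_finite_case[where E = "\<lambda>k s. weight_code (s 0) k c c'"] computable_key_code
            computable_weight_code) auto
  qed simp
  show ?thesis unfolding reduce_def
    by (intro computable_append vertices arcs computable_const) auto
qed

end

definition arc_codes :: "bool list \<Rightarrow> bool list list" where
  "arc_codes Z = (SOME zs. scan_arcs Z = pack zs)"

lemma arc_codes_enc_list: "arc_codes (enc_list enc_arc es) = map enc_arc es"
  unfolding arc_codes_def scan_arcs_enc_list
  by (rule some_equality[where P = "\<lambda>zs. _ = pack zs"]) (auto dest: pack_inj)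

lemma enc_nat_eq_iff: "enc_nat a = enc_nat b \<longleftrightarrow> a = b"
  using enc_nat_prefix[of a "[]" b "[]"] by auto

lemma enc_arc_eq_iff: "enc_arc e = enc_arc e' \<longleftrightarrow> e = e'"
proof
  assume "enc_arc e = enc_arc e'"
  then have "enc_nat (fst e) @ enc_nat (snd e) = enc_nat (fst e') @ enc_nat (snd e')"
    by (simp add: enc_arc_def split: prod.splits)
  from enc_nat_prefix[OF this] show "e = e'" by (simp add: enc_nat_eq_iff prod_eq_iff)
qed simp

lemma concat_map_concat_map:
  "concat (map f (concat (map g xs))) = concat (map (\<lambda>x. concat (map f (g x))) xs)"
  by (induction xs) auto

lemma concat_map_product:
  "concat (map f (List.product xs ys)) = concat (map (\<lambda>x. concat (map (\<lambda>y. f (x, y)) ys)) xs)"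
  by (simp add: product_concat_map concat_map_concat_map comp_def)

lemma concat_replicate_eq: "concat (map (\<lambda>j. replicate (f j) b) xs) =
    replicate (sum_list (map f xs)) b"
  by (induction xs) (auto simp: replicate_add)

lemma concat_map_cong: "(\<And>x. x \<in> set xs \<Longrightarrow> f x = g x) \<Longrightarrow> concat (map f xs) = concat (map g xs)"
  by (metis map_cong)

lemma concat_if_eq_Nil: "concat (map (\<lambda>j. if P j then [True] else []) xs) = [] \<longleftrightarrow> (\<forall>j\<in>set xs. \<not> P j)"
  by (induction xs) auto

definition less_bit :: "bool list \<Rightarrow> nat \<Rightarrow> bool list" where
  "less_bit z n = (if concat (map (\<lambda>j. if replicate j True = z then [True] else []) [0..<n]) = []
      then [False] else [True])"

lemma less_bit_replicate: "less_bit (replicate t True) n = [t < n]"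
  by (auto simp: less_bit_def replicate_eq_replicate)

lemma computable_less_bit:
  assumes L: "computable d D L" and L_eq: "\<And>s. D s \<Longrightarrow> L s = replicate (n s) False"
    and n: "\<And>e s x. d \<le> e \<Longrightarrow> n (s(e := x)) = n s" and Z: "computable d D Z"
  shows "computable d D (\<lambda>s. less_bit (Z s) (n s))"
proof -
  have D: "D (s(e := x)) = D s" if "d \<le> e" for e s x using computable_upd(2)[OF Z that] .
  have const: "computable d D (\<lambda>s. x)" for x by (rule computable_const[OF D])
  have "computable d D (\<lambda>s. concat (map (\<lambda>j. if replicate j True = Z s then [True] else [])
      [0..<length (replicate (n s) ([] :: bool list))]))"
  proof (rule computable_foreach[OF L, where E = "\<lambda>s i y. if i = Z s then [True]
      else []" and xs = "\<lambda>s. replicate (n s) []"])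
    show "L s = pack (replicate (n s) [])" if "D s" for s
      using L_eq[OF that] concat_replicate_eq[of "\<lambda>_. 1" False "[0..<n s]"]
      by (simp add: pack_def enc_bits_def map_replicate_const[symmetric])
    show "computable (a + 2) D (\<lambda>s. if s a = Z s then [True] else [])" if "d \<le> a" for a
      using that D computable_weaken[OF Z, of "a + 2"]
      by (intro computable_if_eq computable_var computable_const) auto
    show "(if i = Z (s(e := x)) then [True] else []) = (if i = Z s then [True] else [])"
      if "d \<le> e" for e s i x
      using computable_upd(1)[OF Z that] by simp
  qed (simp add: n)
  then show ?thesis unfolding less_bit_def by (intro computable_if_eq const) simp
qed

context reduction_table begin

definition unary_weight :: "bool list \<Rightarrow> bool list \<Rightarrow> nat \<Rightarrow> nat \<Rightarrow> bool list" where
  "unary_weight X k c c' = (case W k c c' of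
      None \<Rightarrow> concat (map (\<lambda>j. replicate threshold True) [0..<length (constraint_codes X)])
    | Some x \<Rightarrow> replicate x True)"

definition member_flag :: "(bool list \<Rightarrow> bool list) \<Rightarrow> bool list \<Rightarrow> bool list \<Rightarrow> bool list" where
  "member_flag Y X z =
      concat (map (\<lambda>j. if arc_codes (Y X) ! j = z then [True] else [])
        [0..<length (arc_codes (Y X))])"

definition cost_entry :: "(bool list \<Rightarrow> bool list) \<Rightarrow> bool list \<Rightarrow> bool list \<Rightarrow> bool list \<Rightarrow> bool list \<Rightarrow>
    bool list \<Rightarrow> nat \<Rightarrow> nat \<Rightarrow> bool list" where
  "cost_entry Y X i y i' y' c c' = (if member_flag Y X (arc_code i i' c c') = [] then [] else
     if key_code i y i' y' \<in> keys then unary_weight X (key_code i y i' y') c c' else [])"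

definition decide_light :: "(bool list \<Rightarrow> bool list) \<Rightarrow> bool list \<Rightarrow> bool list" where
  "decide_light Y X = less_bit (all_pairs (cost_entry Y) X)
      (threshold * length (constraint_codes X))"

lemma member_flag_eq_Nil_iff: "Y X = enc_list enc_arc es \<Longrightarrow>
    member_flag Y X z = [] \<longleftrightarrow> z \<notin> enc_arc ` set es"
proof -
  assume Y: "Y X = enc_list enc_arc es"
  have "member_flag Y X z = [] \<longleftrightarrow> (\<forall>j<length (arc_codes (Y X)). arc_codes (Y X) ! j \<noteq> z)"
    unfolding member_flag_def concat_if_eq_Nil by auto
  also have "\<dots> \<longleftrightarrow> z \<notin> set (arc_codes (Y X))" by (auto simp: in_set_conv_nth)
  finally show ?thesis by (simp add: Y arc_codes_enc_list)
qed

lemma computable_member_flag: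
  assumes Y: "computable 1 valid_input (\<lambda>s. Y (s 0))"
    and enc: "\<And>X. X \<in> ug_codes \<Longrightarrow> \<exists>es. Y X = enc_list enc_arc es"
    and "1 \<le> d" and Z: "computable d valid_input Z"
  shows "computable d valid_input (\<lambda>s. member_flag Y (s 0) (Z s))"
  unfolding member_flag_def
proof (rule computable_foreach[where xs = "\<lambda>s. arc_codes (Y (s 0))"
  and E = "\<lambda>s i y. if y = Z s then [True] else []"])
  have "computable d valid_input (\<lambda>s. Y (s 0))" using computable_weaken[OF Y] assms(3) by simp
  then show "computable d valid_input (\<lambda>s. scan_arcs (Y (s 0)))"
    by (rule computable_scan_arcs)
  show "scan_arcs (Y (s 0)) = pack (arc_codes (Y (s 0)))" if "valid_input s" for s
    using that enc[of "s 0"] by (auto simp: valid_input_def arc_codes_enc_list scan_arcs_enc_list)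
  show "computable (a + 2) valid_input (\<lambda>s. if s (a + 1) = Z s then [True] else [])"
    if "d \<le> a" for a
    using that computable_weaken[OF Z, of "a + 2"]
    by (intro computable_if_eq computable_var computable_const) auto
  show "(if y = Z (s(e := x)) then [True] else []) = (if y = Z s then [True] else [])"
    if "d \<le> e" for e s x y
    using computable_upd(1)[OF Z that] by simp
qed (use assms(3) in auto)

lemma computable_unary_weight:
  assumes "1 \<le> d"
  shows "computable d valid_input (\<lambda>s. unary_weight (s 0) k c c')"
  unfolding unary_weight_def using assms
  by (cases "W k c c'") (auto intro!: computable_const computable_foreach_constraint_const)

lemma computable_decide_light:
  assumes Y: "computable 1 valid_input (\<lambda>s. Y (s 0))"
    and enc: "\<And>X. X \<in> ug_codes \<Longrightarrow> \<exists>es. Y X = enc_list enc_arc es"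
  shows "computable 1 valid_input (\<lambda>s. decide_light Y (s 0))"
  unfolding decide_light_def
proof (rule computable_less_bit)
  show "computable 1 valid_input
      (\<lambda>s. concat (map (\<lambda>j. replicate threshold False) [0..<length (constraint_codes (s 0))]))"
    by (rule computable_foreach_constraint_const) simp
  show "concat (map (\<lambda>j. replicate threshold False) [0..<length (constraint_codes (s 0))]) =
      replicate (threshold * length (constraint_codes (s 0))) False" for s
    by (simp add: concat_replicate_eq sum_list_triv mult.commute)
  show "computable 1 valid_input (\<lambda>s. all_pairs (cost_entry Y) (s 0))"
  proof (rule computable_all_pairs)
    fix d i y i' y' c c' :: nat assume d: "1 \<le> d" "i < d" "y < d" "i' < d" "y' < d"
    show "computable d valid_input (\<lambda>s. cost_entry Y (s 0) (s i) (s y) (s i') (s y') c c')"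
      unfolding cost_entry_def using d finite_keys
      by (intro computable_if_eq computable_member_flag[OF Y enc]
        computable_const computable_arc_code
          computable_finite_case[where E = "\<lambda>k s. unary_weight (s 0) k c c'"] computable_key_code
            computable_unary_weight) auto
  qed simp
qed auto

definition key :: "ug \<Rightarrow> nat \<Rightarrow> nat \<Rightarrow> bool list" where
  "key U j j' = (case (ug_constraints U ! j, ug_constraints U ! j') of ((u, v, \<pi>), (u', v', \<pi>')) \<Rightarrow>
     [j = j', u = u', v = v'] @ enc_list enc_nat (map \<pi> [0..<R]))"

lemma key_code_replicate: "key_code (replicate j True) (constraint_code R (ug_constraints U ! j))
    (replicate j' True) (constraint_code R (ug_constraints U ! j')) = key U j j'"
  by (cases "ug_constraints U ! j"; cases "ug_constraints U ! j'")
    (simp add: key_code_def key_def left_code_def right_code_def perm_code_def constraint_code_parts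
      enc_nat_eq_iff replicate_eq_replicate)

lemma key_in_keys:
  assumes "ug_instance R U" "j < length (ug_constraints U)"
  shows "key U j j' \<in> keys"
proof -
  obtain u v \<pi> where c: "ug_constraints U ! j = (u, v, \<pi>)" by (cases "ug_constraints U ! j") auto
  have "(u, v, \<pi>) \<in> set (ug_constraints U)" using nth_mem[OF assms(2)] c by simp
  then have \<pi>: "\<pi> permutes {..<R}" using assms(1) unfolding ug_instance_def by blast
  obtain u' v' \<pi>' where c': "ug_constraints U ! j' = (u', v', \<pi>')"
    by (cases "ug_constraints U ! j'") auto
  have "key U j j' = (\<lambda>(a, b, c, \<pi>). a # b # c # enc_list enc_nat (map \<pi> [0..<R]))
      (j = j', u = u', v = v', \<pi>)"
    by (simp add: key_def c c')
  moreover have "(j = j', u = u', v = v', \<pi>) \<in> UNIV \<times> UNIV \<times> UNIV \<times> {\<pi>. \<pi> permutes {..<R}}"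
    using \<pi> by simp
  ultimately show ?thesis unfolding keys_def by (rule image_eqI)
qed

definition arc_weight :: "ug \<Rightarrow> nat \<Rightarrow> nat \<Rightarrow> nat \<Rightarrow> nat \<Rightarrow> nat" where
  "arc_weight U j c j' c' =
      (case W (key U j j') c c' of None \<Rightarrow> 2 ^ (length (ug_constraints U) + B) | Some x \<Rightarrow> x)"

definition decode_id :: "nat \<Rightarrow> nat \<times> nat" where
  "decode_id = inv_into (UNIV \<times> {..<2 ^ q}) (\<lambda>(j, c). vertex_id q j c)"

lemma decode_vertex_id [simp]: "c < M \<Longrightarrow> decode_id (vertex_id q j c) = (j, c)"
proof -
  assume "c < M"
  moreover have "inj_on (\<lambda>(j, c). vertex_id q j c) (UNIV \<times> {..<2 ^ q})"
    by (auto simp: inj_on_def vertex_id_inject)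
  ultimately show ?thesis using inv_into_f_f[of "\<lambda>(j, c). vertex_id q j c"
    "UNIV \<times> {..<2 ^ q}" "(j, c)"] M_le
    by (simp add: decode_id_def)
qed

definition reduced_vertices :: "ug \<Rightarrow> nat set" where
  "reduced_vertices U = (\<lambda>(j, c). vertex_id q j c) ` ({..<length (ug_constraints U)} \<times> {..<M})"

definition reduced :: "ug \<Rightarrow> dmc" where
  "reduced U = \<lparr>
     supply_graph = \<lparr>pverts = reduced_vertices U, parcs = reduced_vertices U \<times> reduced_vertices U\<rparr>,
     weight = (\<lambda>(x, y). real (arc_weight U (fst (decode_id x)) (snd (decode_id x))
       (fst (decode_id y)) (snd (decode_id y)))),
     terminal = (\<lambda>s. vertex_id q 0 (ter_index s))\<rparr>"

lemma less_two_power: "c < M \<Longrightarrow> c < 2 ^ q" using M_le by simp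

lemma reduced_in_dmc_inputs:
  assumes "ug_instance R U"
  shows "reduced U \<in> dmc_inputs H"
proof -
  have "0 < length (ug_constraints U)" using assms by (auto simp: ug_instance_def)
  then have "vertex_id q 0 (ter_index s) \<in> reduced_vertices U" if "s \<in> pverts H" for s
    using ter_index_less[OF that]
    by (auto simp: reduced_vertices_def intro: image_eqI[of _ _ "(0, ter_index s)"])
  moreover have "inj_on (\<lambda>s. vertex_id q 0 (ter_index s)) (pverts H)"
    using inj_ter_index ter_index_less by (auto simp: inj_on_def vertex_id_inject less_two_power)
  moreover have "finite (reduced_vertices U)" by (simp add: reduced_vertices_def)
  ultimately show ?thesis
    by (auto simp: dmc_inputs_def dmc_instance_def reduced_def
      intro!: pair_fin_digraph.intro pair_wf_digraph.intro pair_fin_digraph_axioms.intro)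
qed

lemma sorted_list_of_reduced_vertices: "sorted_list_of_set (reduced_vertices U) =
    concat (map (\<lambda>j. map (vertex_id q j) [0..<M]) [0..<length (ug_constraints U)])"
proof -
  have sorted: "sorted_wrt (<) (concat (map (\<lambda>j. map (vertex_id q j) [0..<M]) [0..<m]))" for m
  proof (induction m)
    case (Suc m)
    have "sorted_wrt (<) (map (vertex_id q m) [0..<M])"
      by (simp add: sorted_wrt_map vertex_id_def)
    then show ?case
      using Suc by (auto simp: sorted_wrt_append intro!: vertex_id_less less_two_power)
  qed simp
  have "set (concat (map (\<lambda>j. map (vertex_id q j) [0..<M]) [0..<length (ug_constraints U)])) =
      reduced_vertices U"
    by (auto simp: reduced_vertices_def)
  then show ?thesis using sorted[of "length (ug_constraints U)"]
    by (metis sorted_list_of_set.idem_if_sorted_distinct strict_sorted_iff)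
qed

lemma arc_code_replicate: "c < M \<Longrightarrow> c' < M \<Longrightarrow>
    arc_code (replicate j True) (replicate j' True) c c' = enc_arc
  (vertex_id q j c, vertex_id q j' c')"
  by (simp add: arc_code_def unary_code_replicate enc_arc_def enc_nat_vertex_id less_two_power)

lemma weight_code_enc_ug: "weight_code (enc_ug R U) (key U j j') c c' =
    enc_nat (arc_weight U j c j' c') @ [True, True, False]"
  by (auto simp: weight_code_def arc_weight_def constraint_codes_enc_ug enc_nat_power unary_def
    map_replicate_const replicate_add split: option.splits)

lemma reduce_enc_ug:
  assumes U: "ug_instance R U"
  shows "reduce (enc_ug R U) = enc_dmc H (reduced U)"
proof -
  let ?m = "length (ug_constraints U)"
  let ?vs = "concat (map (\<lambda>j. map (vertex_id q j) [0..<M]) [0..<?m])"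
  have vs: "sorted_list_of_set (pverts (supply_graph (reduced U))) = ?vs"
    by (simp add: reduced_def sorted_list_of_reduced_vertices)
  have set_vs: "set ?vs = reduced_vertices U" by (auto simp: reduced_vertices_def)
  have complete: "filter (\<lambda>e. e \<in> parcs (supply_graph (reduced U))) (List.product ?vs ?vs) =
      List.product ?vs ?vs"
    unfolding filter_id_conv set_product set_vs by (simp add: reduced_def)
  have vertices: "enc_list enc_nat ?vs =
      concat (map (\<lambda>j. concat (map (\<lambda>c. [True] @ index_bits q c @ unary_code (replicate j True))
        [0..<M])) [0..<?m]) @ [False]"
    unfolding enc_list_def concat_map_concat_map map_map comp_def
    by (intro arg_cong2[of _ _ _ _ "(@)"] refl concat_map_cong)
      (simp add: enc_nat_vertex_id less_two_power unary_code_replicate)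
  have arcs: "enc_list (\<lambda>e. enc_arc e @ enc_rat (inv real_of_rat (weight (reduced U) e)))
      (List.product ?vs ?vs) =
      all_pairs arc_entry (enc_ug R U) @ [False]"
    unfolding enc_list_def concat_map_product concat_map_concat_map all_pairs_def
      constraint_codes_enc_ug
      length_map map_map comp_def
  proof (intro arg_cong2[of _ _ _ _ "(@)"] refl concat_map_cong)
    fix j c j' c' assume "j \<in> set [0..<?m]" "c \<in> set [0..<M]" "j' \<in> set [0..<?m]" "c' \<in> set [0..<M]"
    then have "j < ?m" "c < M" "j' < ?m" "c' < M" by auto
    then show "True # enc_arc (vertex_id q j c, vertex_id q j' c') @
        enc_rat (inv real_of_rat (weight (reduced U) (vertex_id q j c, vertex_id q j' c'))) =
      arc_entry (enc_ug R U) (replicate j True) (map (constraint_code R) (ug_constraints U) ! j)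
        (replicate j' True) (map (constraint_code R) (ug_constraints U) ! j') c c'"
      using key_in_keys[OF U, of j j']
      by (simp add: arc_entry_def key_code_replicate arc_code_replicate weight_code_enc_ug
        reduced_def enc_rat_of_nat)
  qed
  show ?thesis
    unfolding enc_dmc_def Let_def vs complete vertices arcs reduce_def constraint_codes_enc_ug
    by (simp add: reduced_def comp_def)
qed

lemma sum_reduced_vertices:
  fixes f :: "nat \<times> nat \<Rightarrow> 'b :: comm_monoid_add"
  shows "(\<Sum>e\<in>reduced_vertices U \<times> reduced_vertices U. f e) =
    (\<Sum>j<length (ug_constraints U). \<Sum>c<M. \<Sum>j'<length (ug_constraints U). \<Sum>c'<M. f
      (vertex_id q j c, vertex_id q j' c'))"
proof -
  have inj: "inj_on (\<lambda>(j, c). vertex_id q j c) ({..<length (ug_constraints U)} \<times> {..<M})"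
    by (auto simp: inj_on_def vertex_id_inject less_two_power)
  have vertices: "(\<Sum>x\<in>reduced_vertices U. g x) =
      (\<Sum>j<length (ug_constraints U). \<Sum>c<M. g (vertex_id q j c))" for g :: "nat \<Rightarrow> 'b"
    unfolding reduced_vertices_def sum.reindex[OF inj] sum.cartesian_product
    by (simp add: comp_def case_prod_unfold)
  have "sum f (reduced_vertices U \<times> reduced_vertices U) =
      (\<Sum>x\<in>reduced_vertices U. \<Sum>y\<in>reduced_vertices U. f (x, y))"
    by (simp add: sum.cartesian_product)
  then show ?thesis unfolding vertices .
qed

definition truncated_weight :: "ug \<Rightarrow> nat \<Rightarrow> nat \<Rightarrow> nat \<Rightarrow> nat \<Rightarrow> nat" where
  "truncated_weight U j c j' c' =
     (case W (key U j j') c c' of None \<Rightarrow> threshold * length (ug_constraints U) | Some x \<Rightarrow> x)"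

definition arc_sum :: "(nat \<Rightarrow> nat \<Rightarrow> nat \<Rightarrow> nat \<Rightarrow> nat) \<Rightarrow> (nat \<times> nat) set \<Rightarrow> nat" where
  "arc_sum f X =
      (\<Sum>(x, y)\<in>X. f (fst (decode_id x)) (snd (decode_id x)) (fst (decode_id y))
        (snd (decode_id y)))"

lemma arc_sum_eq:
  assumes "X \<subseteq> reduced_vertices U \<times> reduced_vertices U"
  shows "arc_sum f X = (\<Sum>j<length (ug_constraints U). \<Sum>c<M. \<Sum>j'<length (ug_constraints U). \<Sum>c'<M.
    if (vertex_id q j c, vertex_id q j' c') \<in> X then f j c j' c' else 0)"
proof -
  let ?f = "\<lambda>(x, y). f (fst (decode_id x)) (snd (decode_id x)) (fst (decode_id y))
      (snd (decode_id y))"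
  have "arc_sum f X = (\<Sum>e\<in>reduced_vertices U \<times> reduced_vertices U. if e \<in> X then ?f e else 0)"
    unfolding arc_sum_def using assms by (simp add: sum.If_cases Int_absorb1 reduced_vertices_def)
  then show ?thesis unfolding sum_reduced_vertices prod.case by (auto intro!: sum.cong)
qed

lemma all_pairs_cost_entry:
  assumes U: "ug_instance R U" and Y: "Y (enc_ug R U) = enc_list enc_arc es"
    and es: "set es \<subseteq> reduced_vertices U \<times> reduced_vertices U"
  shows "all_pairs (cost_entry Y) (enc_ug R U) =
      replicate (arc_sum (truncated_weight U) (set es)) True"
proof -
  let ?m = "length (ug_constraints U)" and ?w = "truncated_weight U"
  have "all_pairs (cost_entry Y) (enc_ug R U) =
      concat (map (\<lambda>j. concat (map (\<lambda>c. concat (map (\<lambda>j'. concat (map (\<lambda>c'.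
       replicate (if (vertex_id q j c, vertex_id q j' c') \<in> set es then ?w j c j' c' else 0) True)
       [0..<M])) [0..<?m])) [0..<M])) [0..<?m])"
    unfolding all_pairs_def constraint_codes_enc_ug length_map
  proof (intro concat_map_cong)
    fix j c j' c' assume "j \<in> set [0..<?m]" "c \<in> set [0..<M]" "j' \<in> set [0..<?m]" "c' \<in> set [0..<M]"
    then have "j < ?m" "c < M" "j' < ?m" "c' < M" by auto
    moreover have "enc_arc e \<in> enc_arc ` set es \<longleftrightarrow> e \<in> set es" for e
      by (auto simp: enc_arc_eq_iff image_iff)
    moreover have "unary_weight (enc_ug R U) (key U j j') c c' = replicate (?w j c j' c') True"
      by (auto simp: unary_weight_def truncated_weight_def
        constraint_codes_enc_ug concat_replicate_eq
          sum_list_triv mult.commute split: option.splits)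
    ultimately show "cost_entry Y (enc_ug R U) (replicate j True)
        (map (constraint_code R) (ug_constraints U) ! j)
        (replicate j' True) (map (constraint_code R) (ug_constraints U) ! j') c c' =
      replicate (if (vertex_id q j c, vertex_id q j' c') \<in> set es then ?w j c j' c' else 0) True"
      using key_in_keys[OF U, of j j']
      by (simp add: cost_entry_def key_code_replicate arc_code_replicate
        member_flag_eq_Nil_iff[of Y, OF Y])
  qed
  also have "\<dots> = replicate (arc_sum ?w (set es)) True"
    unfolding arc_sum_eq[OF es] concat_replicate_eq interv_sum_list_conv_sum_set_nat
      set_upt atLeast0LessThan ..
  finally show ?thesis .
qed

lemma arc_sum_truncated_weight_less_iff:
  assumes "finite X"
  shows "arc_sum (truncated_weight U) X < threshold * length (ug_constraints U) \<longleftrightarrow>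
    arc_sum (arc_weight U) X < threshold * length (ug_constraints U)"
proof -
  let ?m = "length (ug_constraints U)"
  define v where "v =
      (\<lambda>(x, y). truncated_weight U (fst (decode_id x)) (snd (decode_id x)) (fst (decode_id y))
        (snd (decode_id y)))"
  define w where "w =
      (\<lambda>(x, y). arc_weight U (fst (decode_id x)) (snd (decode_id x)) (fst (decode_id y))
        (snd (decode_id y)))"
  have "?m < 2 ^ ?m" by (rule less_exp)
  then have big: "threshold * ?m \<le> 2 ^ (?m + B)"
    using mult_mono[OF threshold_le, of ?m "2 ^ ?m"] by (simp add: power_add mult.commute)
  have "sum v X < threshold * ?m \<longleftrightarrow> sum w X < threshold * ?m"
  proof (cases "\<exists>e\<in>X. v e \<noteq> w e")
    case True
    then obtain e where e: "e \<in> X" "v e \<noteq> w e" by auto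
    then have "v e = threshold * ?m" "w e = 2 ^ (?m + B)"
      by (auto simp: v_def w_def truncated_weight_def arc_weight_def
        split: option.splits prod.splits)
    then have "threshold * ?m \<le> sum v X" "threshold * ?m \<le> sum w X"
      using member_le_sum[of e X v] member_le_sum[of e X w] e(1) assms big by auto
    then show ?thesis by simp
  qed (simp cong: sum.cong)
  then show ?thesis unfolding arc_sum_def v_def w_def .
qed

lemma decide_light_eq:
  assumes "ug_instance R U" "Y (enc_ug R U) = enc_list enc_arc es"
    "set es \<subseteq> reduced_vertices U \<times> reduced_vertices U"
  shows "decide_light Y (enc_ug R U) =
    [(\<Sum>e\<in>set es. weight (reduced U) e) < real (threshold * length (ug_constraints U))]"
proof -
  have "(\<Sum>e\<in>set es. weight (reduced U) e) = real (arc_sum (arc_weight U) (set es))"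
    by (simp add: arc_sum_def reduced_def case_prod_unfold)
  then show ?thesis
    unfolding decide_light_def all_pairs_cost_entry[of U Y es, OF assms] less_bit_replicate
    by (simp only: constraint_codes_enc_ug length_map arc_sum_truncated_weight_less_iff
      finite_set of_nat_less_iff)
qed

end

section \<open>Boolean functions of low influence\<close>

definition chi :: "'a set \<Rightarrow> 'a set \<Rightarrow> real" where
  "chi S z = (-1) ^ card (S \<inter> z)"

definition mean :: "'a set \<Rightarrow> ('a set \<Rightarrow> real) \<Rightarrow> real" where
  "mean X f = (\<Sum>z\<in>Pow X. f z) / 2 ^ card X"

definition fourier :: "'a set \<Rightarrow> ('a set \<Rightarrow> real) \<Rightarrow> 'a set \<Rightarrow> real" where
  "fourier X f S = mean X (\<lambda>z. f z * chi S z)"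

definition chi_sum :: "'a set \<Rightarrow> ('a set \<Rightarrow> real) \<Rightarrow> 'a set \<Rightarrow> real" where
  "chi_sum X c z = (\<Sum>S\<in>Pow X. c S * chi S z)"

lemma sum_Pow_insert:
  assumes "finite X" "x \<notin> X"
  shows "(\<Sum>z\<in>Pow (insert x X). f z) = (\<Sum>z\<in>Pow X. f z + f (insert x z))"
proof -
  have "inj_on (insert x) (Pow X)" using assms(2) by (auto simp: inj_on_def)
  moreover have "Pow X \<inter> insert x ` Pow X = {}" using assms(2) by auto
  ultimately show ?thesis
    using assms by (simp add: Pow_insert sum.union_disjoint sum.reindex sum.distrib)
qed

lemma mean_insert:
  assumes "finite X" "x \<notin> X"
  shows "mean (insert x X) f = mean X (\<lambda>z. (f z + f (insert x z)) / 2)"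
  using assms by (simp add: mean_def sum_Pow_insert sum_divide_distrib)

lemma mean_add: "mean X (\<lambda>z. f z + g z) = mean X f + mean X g"
  by (simp add: mean_def sum.distrib add_divide_distrib)

lemma mean_cmult: "mean X (\<lambda>z. c * f z) = c * mean X f"
  by (simp add: mean_def sum_distrib_left)

lemma mean_sum: "mean X (\<lambda>z. \<Sum>i\<in>I. f i z) = (\<Sum>i\<in>I. mean X (f i))"
  by (simp add: mean_def sum.swap[of _ I] sum_divide_distrib)

lemma mean_cong: "(\<And>z. z \<subseteq> X \<Longrightarrow> f z = g z) \<Longrightarrow> mean X f = mean X g"
  unfolding mean_def by (auto intro!: sum.cong)

lemma mean_nonneg: "(\<And>z. z \<subseteq> X \<Longrightarrow> 0 \<le> f z) \<Longrightarrow> 0 \<le> mean X f"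
  unfolding mean_def by (intro divide_nonneg_nonneg sum_nonneg) auto

lemma mean_const: "finite X \<Longrightarrow> mean X (\<lambda>z. c) = c"
  by (simp add: mean_def card_Pow)

lemma mean_Cauchy_Schwarz: "(mean X (\<lambda>z. f z * g z))\<^sup>2 \<le>
    mean X (\<lambda>z. (f z)\<^sup>2) * mean X (\<lambda>z. (g z)\<^sup>2)"
  unfolding mean_def power_divide times_divide_times_eq power2_eq_square[of "2 ^ card X", symmetric]
  by (intro divide_right_mono Cauchy_Schwarz_ineq_sum) simp

lemma chi_commute: "chi S z = chi z S"
  by (simp add: chi_def Int_commute)

lemma chi_insert_right:
  assumes "finite S" "x \<notin> z"
  shows "chi S (insert x z) = (if x \<in> S then - chi S z else chi S z)"
proof (cases "x \<in> S")
  case True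
  then have "S \<inter> insert x z = insert x (S \<inter> z)" by auto
  then show ?thesis using True assms by (simp add: chi_def)
qed (simp add: chi_def)

lemma chi_insert_left: "finite z \<Longrightarrow> x \<notin> S \<Longrightarrow>
    chi (insert x S) z = (if x \<in> z then - chi S z else chi S z)"
  using chi_insert_right[of z x S] by (simp add: chi_commute)

lemma mean_chi:
  assumes "finite X" "S \<subseteq> X" "T \<subseteq> X"
  shows "mean X (\<lambda>z. chi S z * chi T z) = (if S = T then 1 else 0)"
  using assms
proof (induction X arbitrary: S T rule: finite_induct)
  case empty
  then show ?case by (simp add: mean_def chi_def)
next
  case (insert x X)
  have finite_sets: "finite S" "finite T" using insert by (auto intro: finite_subset)
  have sub: "S - {x} \<subseteq> X" "T - {x} \<subseteq> X" using insert by auto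
  have remove: "chi A z = chi (A - {x}) z" if "z \<subseteq> X" for A z
  proof -
    have "A \<inter> z = (A - {x}) \<inter> z" using that insert(2) by auto
    then show ?thesis by (simp add: chi_def)
  qed
  have "mean (insert x X) (\<lambda>z. chi S z * chi T z) =
      mean X (\<lambda>z. (if x \<in> S \<longleftrightarrow> x \<in> T then 1 else 0) * (chi (S - {x}) z * chi (T - {x}) z))"
    unfolding mean_insert[OF insert(1,2)]
  proof (rule mean_cong)
    fix z assume z: "z \<subseteq> X"
    then have "x \<notin> z" using insert by auto
    then show "(chi S z * chi T z + chi S (insert x z) * chi T (insert x z)) / 2 =
       (if x \<in> S \<longleftrightarrow> x \<in> T then 1 else 0) * (chi (S - {x}) z * chi (T - {x}) z)"
      unfolding chi_insert_right[OF finite_sets(1) \<open>x \<notin> z\<close>]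
        chi_insert_right[OF finite_sets(2) \<open>x \<notin> z\<close>]
        remove[OF z, of S] remove[OF z, of T] by simp
  qed
  also have "\<dots> = (if (x \<in> S \<longleftrightarrow> x \<in> T) \<and> S - {x} = T - {x} then 1 else 0)"
    unfolding mean_cmult insert(3)[OF sub] by simp
  also have "((x \<in> S \<longleftrightarrow> x \<in> T) \<and> S - {x} = T - {x}) \<longleftrightarrow> S = T" by auto
  finally show ?case .
qed

lemma fourier_chi_sum:
  assumes "finite X" "S \<subseteq> X"
  shows "fourier X (chi_sum X c) S = c S"
proof -
  have "fourier X (chi_sum X c) S = mean X (\<lambda>z. \<Sum>T\<in>Pow X. c T * (chi T z * chi S z))"
    unfolding fourier_def chi_sum_def by (simp add: sum_distrib_left mult_ac)
  also have "\<dots> = (\<Sum>T\<in>Pow X. if T = S then c T else 0)"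
    unfolding mean_sum mean_cmult using assms by (intro sum.cong) (auto simp: mean_chi)
  finally show ?thesis using assms by simp
qed

lemma chi_sum_fourier:
  assumes "finite X" "z \<subseteq> X"
  shows "chi_sum X (fourier X f) z = f z"
proof -
  have "chi_sum X (fourier X f) z = (\<Sum>S\<in>Pow X. mean X (\<lambda>w. f w * (chi w S * chi z S)))"
    unfolding chi_sum_def fourier_def mult.commute[of "mean X _"] mean_cmult[symmetric]
    by (simp add: chi_commute mult_ac)
  also have "\<dots> = (\<Sum>w\<in>Pow X. f w * mean X (\<lambda>S. chi w S * chi z S))"
    unfolding mean_def sum_divide_distrib sum_distrib_left by (subst sum.swap) simp
  also have "\<dots> = (\<Sum>w\<in>Pow X. if w = z then f w else 0)"
    using assms by (intro sum.cong) (auto simp: mean_chi)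
  finally show ?thesis using assms by simp
qed

lemma parseval:
  assumes "finite X"
  shows "mean X (\<lambda>z. f z * g z) = (\<Sum>S\<in>Pow X. fourier X f S * fourier X g S)"
proof -
  have "mean X (\<lambda>z. f z * g z) = mean X (\<lambda>z. \<Sum>S\<in>Pow X. fourier X f S * (g z * chi S z))"
  proof (rule mean_cong)
    fix z assume "z \<subseteq> X"
    have "(\<Sum>S\<in>Pow X. fourier X f S * (g z * chi S z)) = chi_sum X (fourier X f) z * g z"
      unfolding chi_sum_def sum_distrib_right by (simp add: mult_ac)
    then show "f z * g z = (\<Sum>S\<in>Pow X. fourier X f S * (g z * chi S z))"
      using chi_sum_fourier[OF assms \<open>z \<subseteq> X\<close>] by simp
  qed
  then show ?thesis by (simp add: mean_sum mean_cmult fourier_def[of X g])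
qed

lemma chi_sum_insert:
  assumes "finite X" "x \<notin> X" "z \<subseteq> X"
  shows "chi_sum (insert x X) c z = chi_sum X c z + chi_sum X (\<lambda>S. c (insert x S)) z"
    "chi_sum (insert x X) c (insert x z) = chi_sum X c z - chi_sum X (\<lambda>S. c (insert x S)) z"
proof -
  have "x \<notin> z" "finite z" using assms by (auto intro: finite_subset)
  have chi: "chi (insert x S) z = chi S z" "chi S (insert x z) = chi S z"
    "chi (insert x S) (insert x z) = - chi S z"
    if "S \<in> Pow X" for S
  proof -
    have "finite S" "x \<notin> S" using that assms by (auto intro: finite_subset)
    then show "chi (insert x S) z = chi S z" "chi S (insert x z) = chi S z"
      "chi (insert x S) (insert x z) = - chi S z"
      using \<open>x \<notin> z\<close> \<open>finite z\<close> by (simp_all add: chi_insert_left chi_insert_right)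
  qed
  show "chi_sum (insert x X) c z = chi_sum X c z + chi_sum X (\<lambda>S. c (insert x S)) z"
    "chi_sum (insert x X) c (insert x z) = chi_sum X c z - chi_sum X (\<lambda>S. c (insert x S)) z"
    unfolding chi_sum_def sum_Pow_insert[OF assms(1,2)]
    by (simp_all add: chi sum.distrib sum_subtractf)
qed

text \<open>The two cube halves have values \<open>f + g\<close> and \<open>f - g\<close>, and \<open>g\<close> has smaller degree.\<close>

lemma fourth_moment_le:
  assumes f: "mean X (\<lambda>z. (f z) ^ 4) \<le> K * (mean X (\<lambda>z. (f z)\<^sup>2))\<^sup>2"
    and g: "9 * mean X (\<lambda>z. (g z) ^ 4) \<le> K * (mean X (\<lambda>z. (g z)\<^sup>2))\<^sup>2"
    and "0 \<le> K"
  shows "mean X (\<lambda>z. ((f z + g z) ^ 4 + (f z - g z) ^ 4) / 2) \<le>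
    K * (mean X (\<lambda>z. ((f z + g z)\<^sup>2 + (f z - g z)\<^sup>2) / 2))\<^sup>2"
proof -
  define a b where "a = mean X (\<lambda>z. (f z)\<^sup>2)" "b = mean X (\<lambda>z. (g z)\<^sup>2)"
  define e where "e = mean X (\<lambda>z. (f z)\<^sup>2 * (g z)\<^sup>2)"
  have "0 \<le> a" "0 \<le> b" unfolding a_b_def by (auto intro: mean_nonneg)
  have "(3 * e)\<^sup>2 \<le> mean X (\<lambda>z. (f z) ^ 4) * (9 * mean X (\<lambda>z. (g z) ^ 4))"
    using mean_Cauchy_Schwarz[of X "\<lambda>z. (f z)\<^sup>2" "\<lambda>z. (g z)\<^sup>2"]
    by (simp add: e_def power_mult_distrib flip: power_mult)
  also have "\<dots> \<le> (K * a\<^sup>2) * (K * b\<^sup>2)"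
    unfolding a_b_def using \<open>0 \<le> K\<close> by (intro mult_mono f g mult_nonneg_nonneg mean_nonneg) simp_all
  also have "\<dots> = (K * a * b)\<^sup>2" by (simp add: power2_eq_square mult_ac)
  finally have e: "3 * e \<le> K * a * b"
    by (rule power2_le_imp_le) (simp add: \<open>0 \<le> K\<close> \<open>0 \<le> a\<close> \<open>0 \<le> b\<close>)
  have "mean X (\<lambda>z. ((f z + g z) ^ 4 + (f z - g z) ^ 4) / 2) =
      mean X (\<lambda>z. (f z) ^ 4 + (6 * ((f z)\<^sup>2 * (g z)\<^sup>2) + (g z) ^ 4))"
    by (rule mean_cong) (simp add: power4_eq_xxxx power2_eq_square algebra_simps)
  also have "\<dots> \<le> K * a\<^sup>2 + 2 * (K * a * b) + K * b\<^sup>2"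
    using f g e mean_nonneg[of X "\<lambda>z. (g z) ^ 4"] by (simp add: mean_add mean_cmult e_def a_b_def)
  also have "\<dots> = K * (a + b)\<^sup>2" by (simp add: power2_eq_square algebra_simps)
  also have "a + b = mean X (\<lambda>z. ((f z + g z)\<^sup>2 + (f z - g z)\<^sup>2) / 2)"
    unfolding a_b_def mean_add[symmetric]
    by (rule mean_cong) (simp add: power2_eq_square algebra_simps)
  finally show ?thesis .
qed

lemma bonami:
  assumes "finite X" "\<And>S. S \<subseteq> X \<Longrightarrow> d < card S \<Longrightarrow> c S = 0"
  shows "mean X (\<lambda>z. (chi_sum X c z) ^ 4) \<le> 9 ^ d * (mean X (\<lambda>z. (chi_sum X c z)\<^sup>2))\<^sup>2"
  using assms
proof (induction X arbitrary: d c rule: finite_induct)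
  case empty
  have "(c {}) ^ 4 \<le> 9 ^ d * (c {}) ^ 4" using mult_right_mono[of 1 "9 ^ d" "(c {}) ^ 4"] by simp
  then show ?case by (simp add: mean_def chi_sum_def chi_def flip: power_mult)
next
  case (insert x X)
  define f where "f = chi_sum X c"
  define g where "g = chi_sum X (\<lambda>S. c (insert x S))"
  have card_insert: "card (insert x S) = Suc (card S)" if "S \<subseteq> X" for S
    using that insert(1,2) by (subst card_insert_disjoint) (auto intro: finite_subset)
  have "mean X (\<lambda>z. (f z) ^ 4) \<le> 9 ^ d * (mean X (\<lambda>z. (f z)\<^sup>2))\<^sup>2"
    unfolding f_def using insert.prems by (intro insert.IH) auto
  moreover have "9 * mean X (\<lambda>z. (g z) ^ 4) \<le> 9 ^ d * (mean X (\<lambda>z. (g z)\<^sup>2))\<^sup>2"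
  proof (cases d)
    case 0
    then have "c (insert x S) = 0" if "S \<subseteq> X" for S
      using insert.prems[of "insert x S"] that card_insert[OF that] by auto
    then have "g = (\<lambda>z. 0)" by (simp add: g_def chi_sum_def fun_eq_iff)
    then show ?thesis using insert(1) by (simp add: mean_const)
  next
    case (Suc d')
    have "mean X (\<lambda>z. (g z) ^ 4) \<le> 9 ^ d' * (mean X (\<lambda>z. (g z)\<^sup>2))\<^sup>2"
      unfolding g_def using Suc by (intro insert.IH insert.prems) (auto simp: card_insert)
    then show ?thesis by (simp add: Suc)
  qed
  moreover have "chi_sum (insert x X) c z = f z + g z"
    "chi_sum (insert x X) c (insert x z) = f z - g z"
    if "z \<subseteq> X" for z
    unfolding f_def g_def by (rule chi_sum_insert[OF insert(1,2) that])+
  ultimately show ?case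
    using fourth_moment_le[of X f "9 ^ d" g]
    by (simp add: mean_insert[OF insert(1,2)] cong: mean_cong)
qed

definition flip :: "'a \<Rightarrow> 'a set \<Rightarrow> 'a set" where
  "flip x z = (if x \<in> z then z - {x} else insert x z)"

definition influence :: "'a set \<Rightarrow> ('a set \<Rightarrow> bool) \<Rightarrow> 'a \<Rightarrow> real" where
  "influence X F x = mean X (\<lambda>z. of_bool (F z \<noteq> F (flip x z)))"

lemma influence_nonneg: "0 \<le> influence X F x"
  unfolding influence_def by (rule mean_nonneg) simp

lemma flip_flip [simp]: "flip x (flip x z) = z"
  by (auto simp: flip_def)

lemma bij_flip: "x \<in> X \<Longrightarrow> bij_betw (flip x) (Pow X) (Pow X)"
  by (rule bij_betwI[where g = "flip x"]) (auto simp: flip_def split: if_splits)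

lemma mean_reindex: "bij_betw h (Pow X) (Pow X) \<Longrightarrow> mean X (\<lambda>z. f (h z)) = mean X f"
  unfolding mean_def by (subst sum.reindex_bij_betw) auto

lemma chi_flip: "finite S \<Longrightarrow> chi S (flip x z) = (if x \<in> S then - chi S z else chi S z)"
proof -
  assume S: "finite S"
  show ?thesis
  proof (cases "x \<in> z")
    case True
    then have z: "z = insert x (flip x z)" "x \<notin> flip x z" by (auto simp: flip_def)
    have "chi S z = (if x \<in> S then - chi S (flip x z) else chi S (flip x z))"
      using chi_insert_right[OF S z(2)] z(1) by simp
    then show ?thesis by simp
  qed (use S in \<open>simp add: flip_def chi_insert_right\<close>)
qed

lemma fourier_derivative:
  assumes "finite X" "x \<in> X" "S \<subseteq> X"
  shows "fourier X (\<lambda>z. (f z - f (flip x z)) / 2) S = (if x \<in> S then fourier X f S else 0)"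
proof -
  have finite_S: "finite S" using assms(3,1) by (rule finite_subset)
  have "mean X (\<lambda>z. f (flip x z) * chi S z) = mean X (\<lambda>z. f z * chi S (flip x z))"
    using mean_reindex[OF bij_flip[OF assms(2)], of "\<lambda>z. f z * chi S (flip x z)"] by simp
  also have "\<dots> = (if x \<in> S then -1 else 1) * fourier X f S"
    unfolding fourier_def mean_cmult[symmetric]
    by (rule mean_cong) (simp add: chi_flip[OF finite_S])
  finally have flipped: "mean X (\<lambda>z. f (flip x z) * chi S z) =
      (if x \<in> S then -1 else 1) * fourier X f S" .
  have "fourier X (\<lambda>z. (f z - f (flip x z)) / 2) S =
      mean X (\<lambda>z. (1/2) * (f z * chi S z) + (-1/2) * (f (flip x z) * chi S z))"
    unfolding fourier_def by (rule mean_cong) (simp add: field_simps)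
  also have "\<dots> = (1/2) * fourier X f S + (-1/2) * ((if x \<in> S then -1 else 1) * fourier X f S)"
    unfolding mean_add mean_cmult flipped fourier_def ..
  finally show ?thesis by simp
qed

text \<open>
  For the low-degree part \<open>h\<close> of \<open>g\<close> the left side is \<open>mean X (g * h) = mean X (g * 1\<^sub>D * h)\<close>. Two
  applications of Cauchy-Schwarz and hypercontractivity gain the square root of the density of
  \<open>D\<close>.
\<close>

lemma level_inequality:
  assumes X: "finite X" and g: "\<And>z. z \<notin> D \<Longrightarrow> g z = 0"
  shows "(\<Sum>S | S \<subseteq> X \<and> card S \<le> d. (fourier X g S)\<^sup>2) \<le>
    mean X (\<lambda>z. (g z)\<^sup>2) * sqrt (mean X (\<lambda>z. of_bool (z \<in> D))) * 3 ^ d"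
proof -
  define h where "h = chi_sum X (\<lambda>S. if card S \<le> d then fourier X g S else 0)"
  define H where "H = (\<Sum>S | S \<subseteq> X \<and> card S \<le> d. (fourier X g S)\<^sup>2)"
  define E where "E = mean X (\<lambda>z. of_bool (z \<in> D) * (h z)\<^sup>2)"
  define p where "p = mean X (\<lambda>z. of_bool (z \<in> D))"
  define q where "q = mean X (\<lambda>z. (g z)\<^sup>2)"
  have pos: "0 \<le> p" "0 \<le> q" "0 \<le> E" "0 \<le> H"
    unfolding p_def q_def E_def H_def by (auto intro!: mean_nonneg sum_nonneg)
  have fourier_h: "fourier X h S = (if card S \<le> d then fourier X g S else 0)" if "S \<subseteq> X" for S
    unfolding h_def using X that by (rule fourier_chi_sum)
  have gh: "mean X (\<lambda>z. g z * h z) = H" and hh: "mean X (\<lambda>z. (h z)\<^sup>2) = H"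
    unfolding power2_eq_square[of "h _"] parseval[OF X] H_def using X
    by (intro sum.mono_neutral_cong_right; auto simp: fourier_h power2_eq_square)+
  have square: "(of_bool P :: real)\<^sup>2 = of_bool P" for P by (cases P) simp_all
  have "mean X (\<lambda>z. g z * (of_bool (z \<in> D) * h z)) = H"
    unfolding gh[symmetric] by (rule mean_cong) (use g in auto)
  then have "H\<^sup>2 \<le> q * E"
    using mean_Cauchy_Schwarz[of X g "\<lambda>z. of_bool (z \<in> D) * h z"]
    by (simp only: q_def E_def power_mult_distrib square)
  then have "(H\<^sup>2)\<^sup>2 \<le> q\<^sup>2 * E\<^sup>2" unfolding power_mult_distrib[symmetric] by (intro power_mono) auto
  also have "E\<^sup>2 \<le> p * mean X (\<lambda>z. (h z) ^ 4)"
    using mean_Cauchy_Schwarz[of X "\<lambda>z. of_bool (z \<in> D)" "\<lambda>z. (h z)\<^sup>2"]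
    by (simp add: p_def E_def square flip: power_mult)
  also have "mean X (\<lambda>z. (h z) ^ 4) \<le> 9 ^ d * H\<^sup>2"
    unfolding hh[symmetric] h_def using X by (intro bonami) auto
  finally have "(H\<^sup>2)\<^sup>2 \<le> q\<^sup>2 * (p * (9 ^ d * H\<^sup>2))" using pos by (simp add: mult_left_mono)
  then have cancellable: "H\<^sup>2 * H\<^sup>2 \<le> (q\<^sup>2 * p * 9 ^ d) * H\<^sup>2"
    by (simp add: power2_eq_square mult_ac)
  have "H\<^sup>2 \<le> q\<^sup>2 * p * 9 ^ d"
  proof (cases "H = 0")
    case False
    then have "0 < H\<^sup>2" by simp
    with cancellable show ?thesis by (rule mult_right_le_imp_le)
  qed (use pos in simp)
  also have "(9 :: real) ^ d = (3 ^ d)\<^sup>2" by (simp add: power2_eq_square flip: power_mult_distrib)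
  also have "q\<^sup>2 * p * (3 ^ d)\<^sup>2 = (q * sqrt p * 3 ^ d)\<^sup>2"
    using pos by (simp add: power_mult_distrib)
  finally have "H \<le> q * sqrt p * 3 ^ d" using pos by (intro power2_le_imp_le[of H]) auto
  then show ?thesis unfolding H_def q_def p_def .
qed

lemma
  fixes F :: "'a set \<Rightarrow> bool"
  assumes X: "finite X" "x \<in> X"
  defines "f \<equiv> \<lambda>z. of_bool (F z) :: real"
  shows sum_fourier_containing: "(\<Sum>S | S \<subseteq> X \<and> x \<in> S. (fourier X f S)\<^sup>2) = influence X F x / 4"
    and sum_fourier_low_containing: "(\<Sum>S | S \<subseteq> X \<and> x \<in> S \<and> card S \<le> d. (fourier X f S)\<^sup>2) \<le>
      influence X F x * sqrt (influence X F x) * 3 ^ d / 4"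
proof -
  define g where "g z = (f z - f (flip x z)) / 2" for z
  have fourier_g: "fourier X g S = (if x \<in> S then fourier X f S else 0)" if "S \<subseteq> X" for S
    unfolding g_def by (rule fourier_derivative[OF X that])
  have square: "(g z)\<^sup>2 = (1/4) * of_bool (F z \<noteq> F (flip x z))" for z
    by (auto simp: g_def f_def power2_eq_square)
  have mean_g: "mean X (\<lambda>z. (g z)\<^sup>2) = influence X F x / 4"
    unfolding square mean_cmult influence_def by simp
  have "(\<Sum>S | S \<subseteq> X \<and> x \<in> S. (fourier X f S)\<^sup>2) = (\<Sum>S\<in>Pow X. fourier X g S * fourier X g S)"
    using X(1) by (intro sum.mono_neutral_cong_left) (auto simp: fourier_g power2_eq_square)
  also have "\<dots> = influence X F x / 4"
    unfolding parseval[OF X(1), symmetric] mean_g[symmetric] by (simp add: power2_eq_square)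
  finally show "(\<Sum>S | S \<subseteq> X \<and> x \<in> S. (fourier X f S)\<^sup>2) = influence X F x / 4" .
  have "(\<Sum>S | S \<subseteq> X \<and> x \<in> S \<and> card S \<le> d. (fourier X f S)\<^sup>2) =
      (\<Sum>S | S \<subseteq> X \<and> card S \<le> d. (fourier X g S)\<^sup>2)"
    using X(1) by (intro sum.mono_neutral_cong_left) (auto simp: fourier_g)
  also have "\<dots> \<le> mean X (\<lambda>z. (g z)\<^sup>2) *
      sqrt (mean X (\<lambda>z. of_bool (z \<in> {z. F z \<noteq> F (flip x z)}))) * 3 ^ d"
    by (rule level_inequality[OF X(1)]) (simp add: g_def f_def)
  also have "\<dots> = influence X F x * sqrt (influence X F x) * 3 ^ d / 4"
    unfolding mean_g mem_Collect_eq influence_def[symmetric] by simp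
  finally show "(\<Sum>S | S \<subseteq> X \<and> x \<in> S \<and> card S \<le> d. (fourier X f S)\<^sup>2) \<le>
      influence X F x * sqrt (influence X F x) * 3 ^ d / 4" .
qed

lemma variance_eq_sum_fourier:
  fixes F :: "'a set \<Rightarrow> bool"
  assumes "finite X"
  defines "f \<equiv> \<lambda>z. of_bool (F z) :: real"
  shows "mean X f * (1 - mean X f) = (\<Sum>S\<in>Pow X - {{}}. (fourier X f S)\<^sup>2)"
proof -
  have "mean X f = mean X (\<lambda>z. f z * f z)" by (rule mean_cong) (simp add: f_def)
  also have "\<dots> = (\<Sum>S\<in>Pow X. (fourier X f S)\<^sup>2)" unfolding parseval[OF assms(1)] power2_eq_square ..
  also have "\<dots> = (fourier X f {})\<^sup>2 + (\<Sum>S\<in>Pow X - {{}}. (fourier X f S)\<^sup>2)"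
    using assms(1) by (subst sum.remove[of _ "{}"]) auto
  also have "fourier X f {} = mean X f" by (simp add: fourier_def chi_def)
  finally have "mean X f = (mean X f)\<^sup>2 + (\<Sum>S\<in>Pow X - {{}}. (fourier X f S)\<^sup>2)" .
  moreover have "mean X f * (1 - mean X f) = mean X f - (mean X f)\<^sup>2"
    by (simp add: power2_eq_square algebra_simps)
  ultimately show ?thesis by linarith
qed

text \<open>
  A set of size at most \<open>d\<close> is counted at least once, a larger one \<open>card S\<close> times with weight \<open>1 /
  d\<close>.
\<close>

lemma sum_nonempty_le_sum_containing:
  fixes w :: "'a set \<Rightarrow> real" and d :: nat
  assumes "finite X" "0 < d" and w: "\<And>S. 0 \<le> w S"
  shows "(\<Sum>S\<in>Pow X - {{}}. w S) \<le>
    (\<Sum>x\<in>X. (\<Sum>S | S \<subseteq> X \<and> x \<in> S \<and> card S \<le> d. w S) + (\<Sum>S | S \<subseteq> X \<and> x \<in> S. w S) / d)"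
proof -
  define v where "v S = (if card S \<le> d then w S else 0) + w S / d" for S
  have sum_v: "(\<Sum>S | S \<subseteq> X \<and> x \<in> S. v S) =
      (\<Sum>S | S \<subseteq> X \<and> x \<in> S \<and> card S \<le> d. w S) + (\<Sum>S | S \<subseteq> X \<and> x \<in> S. w S) / d" for x
  proof -
    have "(\<Sum>S | S \<subseteq> X \<and> x \<in> S. if card S \<le> d then w S else 0) =
        (\<Sum>S | S \<subseteq> X \<and> x \<in> S \<and> card S \<le> d. w S)"
      using assms(1) by (intro sum.mono_neutral_cong_right) auto
    then show ?thesis by (simp add: v_def sum.distrib sum_divide_distrib)
  qed
  have "w S \<le> (\<Sum>x\<in>S. v S)" if "S \<in> Pow X - {{}}" for S
  proof (cases "card S \<le> d")
    case True
    have "finite S" "S \<noteq> {}" using that assms(1) by (auto intro: finite_subset)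
    then have "1 \<le> card S" by (simp add: Suc_leI card_gt_0_iff)
    then have "1 * v S \<le> real (card S) * v S" using w by (intro mult_right_mono) (auto simp: v_def)
    moreover have "w S \<le> v S" using True w by (simp add: v_def)
    ultimately show ?thesis by simp
  next
    case False
    then have "w S * d \<le> w S * card S" using w by (intro mult_left_mono) auto
    then show ?thesis using False assms(2) by (simp add: v_def field_simps)
  qed
  then have "(\<Sum>S\<in>Pow X - {{}}. w S) \<le> (\<Sum>S\<in>Pow X - {{}}. \<Sum>x\<in>S. v S)" by (rule sum_mono)
  also have "\<dots> = (\<Sum>S\<in>Pow X. \<Sum>x\<in>S. v S)" using assms(1) by (intro sum.mono_neutral_left) auto
  also have "\<dots> = (\<Sum>S\<in>Pow X. \<Sum>x | x \<in> X \<and> x \<in> S. v S)" by (intro sum.cong) auto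
  also have "\<dots> = (\<Sum>x\<in>X. \<Sum>S | S \<in> Pow X \<and> x \<in> S. v S)"
    using assms(1) by (intro sum.swap_restrict) auto
  finally show ?thesis by (simp only: Pow_iff sum_v)
qed

lemma variance_le_influences:
  fixes F :: "'a set \<Rightarrow> bool"
  assumes X: "finite X" and "1 \<le> d" and \<tau>: "\<And>x. x \<in> X \<Longrightarrow> influence X F x \<le> \<tau>" "0 \<le> \<tau>"
    and C: "(\<Sum>x\<in>X. influence X F x) \<le> C" and \<mu>: "\<mu> = mean X (\<lambda>z. of_bool (F z))"
  shows "\<mu> * (1 - \<mu>) \<le> C * sqrt \<tau> * 3 ^ d / 4 + C / (4 * d)"
proof -
  define w where "w S = (fourier X (\<lambda>z. of_bool (F z)) S)\<^sup>2" for S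
  have containing: "(\<Sum>S | S \<subseteq> X \<and> x \<in> S \<and> card S \<le> d. w S) + (\<Sum>S | S \<subseteq> X \<and> x \<in> S. w S) / d \<le>
      influence X F x * (sqrt \<tau> * 3 ^ d / 4 + 1 / (4 * d))" if x: "x \<in> X" for x
  proof -
    have "(\<Sum>S | S \<subseteq> X \<and> x \<in> S \<and> card S \<le> d. w S) \<le> influence X F x *
        sqrt (influence X F x) * 3 ^ d / 4"
      unfolding w_def by (rule sum_fourier_low_containing[OF X x])
    also have "\<dots> \<le> influence X F x * sqrt \<tau> * 3 ^ d / 4"
      using \<tau>(1)[OF x] influence_nonneg[of X F x]
      by (intro divide_right_mono mult_right_mono mult_left_mono) auto
    finally have low: "(\<Sum>S | S \<subseteq> X \<and> x \<in> S \<and> card S \<le> d. w S) \<le>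
        influence X F x * sqrt \<tau> * 3 ^ d / 4" .
    have all: "(\<Sum>S | S \<subseteq> X \<and> x \<in> S. w S) = influence X F x / 4"
      unfolding w_def by (rule sum_fourier_containing[OF X x])
    show ?thesis unfolding all using low by (simp add: distrib_left mult.assoc)
  qed
  have "\<mu> * (1 - \<mu>) = (\<Sum>S\<in>Pow X - {{}}. w S)"
    unfolding \<mu> w_def by (rule variance_eq_sum_fourier[OF X])
  also have "\<dots> \<le> (\<Sum>x\<in>X. (\<Sum>S | S \<subseteq> X \<and> x \<in> S \<and> card S \<le> d. w S) + (\<Sum>S | S \<subseteq> X \<and> x \<in> S. w S) / d)"
    using X \<open>1 \<le> d\<close> by (intro sum_nonempty_le_sum_containing) (auto simp: w_def)
  also have "\<dots> \<le> (\<Sum>x\<in>X. influence X F x * (sqrt \<tau> * 3 ^ d / 4 + 1 / (4 * d)))"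
    by (rule sum_mono) (rule containing)
  also have "\<dots> \<le> C * (sqrt \<tau> * 3 ^ d / 4 + 1 / (4 * d))"
    unfolding sum_distrib_right[symmetric] using C \<tau>(2) by (intro mult_right_mono) auto
  finally show ?thesis by (simp add: algebra_simps)
qed

definition low_influence_dichotomy :: "'a set \<Rightarrow> real \<Rightarrow> real \<Rightarrow> real \<Rightarrow> bool" where
  "low_influence_dichotomy X \<tau> C \<delta> \<longleftrightarrow>
      (\<forall>F. (\<forall>x\<in>X. influence X F x \<le> \<tau>) \<longrightarrow> (\<Sum>x\<in>X. influence X F x) \<le> C \<longrightarrow>
     mean X (\<lambda>z. of_bool (F z)) \<le> \<delta> \<or> 1 - \<delta> \<le> mean X (\<lambda>z. of_bool (F z)))"

lemma ex_low_influence_dichotomy: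
  fixes C \<delta> :: real
  assumes "0 \<le> C" "0 < \<delta>" "\<delta> \<le> 1 / 2"
  obtains \<tau> where "0 < \<tau>"
    "\<And>X :: 'a set. finite X \<Longrightarrow> low_influence_dichotomy X \<tau> C \<delta>"
proof -
  obtain d :: nat where d: "C / \<delta> < d" using reals_Archimedean2 by blast
  then have "1 \<le> d" using assms by (cases d) (auto simp: divide_less_0_iff)
  define \<tau> where "\<tau> = (\<delta> / (2 * (C + 1) * 3 ^ d))\<^sup>2"
  have "0 < \<tau>" using assms by (simp add: \<tau>_def)
  have "C / (4 * d) \<le> \<delta> / 4" using d \<open>1 \<le> d\<close> assms by (simp add: field_simps)
  moreover have "C * sqrt \<tau> * 3 ^ d / 4 \<le> \<delta> / 8"
  proof -
    have "sqrt \<tau> * 3 ^ d = \<delta> / (2 * (C + 1))" using assms by (simp add: \<tau>_def)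
    then have "C * sqrt \<tau> * 3 ^ d / 4 = \<delta> / 8 * (C / (C + 1))" using assms by (simp add: mult.assoc)
    also have "\<dots> \<le> \<delta> / 8 * 1" using assms by (intro mult_left_mono) auto
    finally show ?thesis by simp
  qed
  moreover have "\<delta> * (1 / 2) \<le> \<delta> * (1 - \<delta>)" using assms by (intro mult_left_mono) auto
  ultimately have bound: "C * sqrt \<tau> * 3 ^ d / 4 + C / (4 * d) < \<delta> * (1 - \<delta>)"
    using assms(2) by linarith
  have "low_influence_dichotomy X \<tau> C \<delta>" if X: "finite X" for X :: "'a set"
    unfolding low_influence_dichotomy_def
  proof (intro allI impI, rule ccontr)
    fix F assume F: "\<forall>x\<in>X. influence X F x \<le> \<tau>" "(\<Sum>x\<in>X. influence X F x) \<le> C"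
    define \<mu> where "\<mu> = mean X (\<lambda>z. of_bool (F z))"
    assume "\<not> (mean X (\<lambda>z. of_bool (F z)) \<le> \<delta> \<or> 1 - \<delta> \<le> mean X (\<lambda>z. of_bool (F z)))"
    then have "0 < (\<mu> - \<delta>) * (1 - \<delta> - \<mu>)" by (auto simp: \<mu>_def)
    then have "\<delta> * (1 - \<delta>) < \<mu> * (1 - \<mu>)" by (simp add: algebra_simps)
    moreover have "\<mu> * (1 - \<mu>) \<le> C * sqrt \<tau> * 3 ^ d / 4 + C / (4 * d)"
      using F \<open>1 \<le> d\<close> \<open>0 < \<tau>\<close> by (intro variance_le_influences[OF X]) (auto simp: \<mu>_def)
    ultimately show False using bound by simp
  qed
  with \<open>0 < \<tau>\<close> show ?thesis by (rule that)
qed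

section \<open>The cube of labels\<close>

definition coords :: "nat \<Rightarrow> nat \<Rightarrow> (nat \<times> nat) set" where
  "coords R n = {..<R} \<times> {..<n}"

text \<open>
  A point of the cube is a subset of \<open>coords R n\<close>; its \<open>i\<close>-th block of \<open>n\<close> bits is a number below
  \<open>2 ^ n\<close>.
\<close>

definition block :: "nat \<Rightarrow> nat \<Rightarrow> (nat \<times> nat) set \<Rightarrow> nat" where
  "block n i z = horner_sum of_bool 2 (map (\<lambda>b. (i, b) \<in> z) [0..<n])"

definition shift :: "nat \<Rightarrow> nat \<Rightarrow> nat \<Rightarrow> (nat \<times> nat) set \<Rightarrow> (nat \<times> nat) set" where
  "shift R n k z = {(i, b). i < R \<and> b < n \<and> bit ((block n i z + k) mod 2 ^ n) b}"

definition permute :: "(nat \<Rightarrow> nat) \<Rightarrow> (nat \<times> nat) set \<Rightarrow> (nat \<times> nat) set" where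
  "permute \<pi> z = (\<lambda>(i, b). (\<pi> i, b)) ` z"

lemma finite_coords [simp]: "finite (coords R n)"
  by (simp add: coords_def)

lemma bit_block: "bit (block n i z) b \<longleftrightarrow> b < n \<and> (i, b) \<in> z"
  unfolding block_def by (auto simp: bit_horner_sum_bit_iff)

lemma block_less: "block n i z < 2 ^ n"
proof -
  have "take_bit n (block n i z) = block n i z"
    by (rule bit_eqI) (auto simp: bit_take_bit_iff bit_block)
  then show ?thesis by (simp add: take_bit_nat_eq_self_iff)
qed

lemma block_shift: "i < R \<Longrightarrow> block n i (shift R n k z) = (block n i z + k) mod 2 ^ n"
proof -
  assume "i < R"
  then have "block n i (shift R n k z) =
      horner_sum of_bool 2 (map (bit ((block n i z + k) mod 2 ^ n)) [0..<n])"
    unfolding block_def[of n i "shift R n k z"]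
    by (intro arg_cong[where f = "horner_sum of_bool 2"] map_cong) (auto simp: shift_def)
  then show ?thesis by (simp add: horner_sum_bit_eq_take_bit take_bit_eq_mod)
qed

lemma blocks_inject:
  assumes "z \<subseteq> coords R n" "z' \<subseteq> coords R n" "\<And>i. i < R \<Longrightarrow> block n i z = block n i z'"
  shows "z = z'"
proof -
  have "(i, b) \<in> z \<longleftrightarrow> (i, b) \<in> z'" if "i < R" "b < n" for i b
    using assms(3)[OF that(1)] bit_block[of n i z b] bit_block[of n i z' b] that by simp
  then show ?thesis using assms(1,2) by (auto simp: coords_def)
qed

lemma bij_betw_Pow_endo_inj:
  assumes "finite X" "inj_on h (Pow X)" "h ` Pow X \<subseteq> Pow X"
  shows "bij_betw h (Pow X) (Pow X)"
  using assms endo_inj_surj[of "Pow X" h] by (simp add: bij_betw_def)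

lemma bij_shift: "bij_betw (shift R n k) (Pow (coords R n)) (Pow (coords R n))"
proof (rule bij_betw_Pow_endo_inj)
  show "inj_on (shift R n k) (Pow (coords R n))"
  proof (rule inj_onI)
    fix z z' assume z: "z \<in> Pow (coords R n)" "z' \<in> Pow (coords R n)"
      "shift R n k z = shift R n k z'"
    show "z = z'"
    proof (rule blocks_inject)
      fix i assume "i < R"
      then have "(block n i z + k) mod 2 ^ n = (block n i z' + k) mod 2 ^ n"
        using z(3) block_shift by metis
      then have "block n i z mod 2 ^ n = block n i z' mod 2 ^ n"
        using cong_add_rcancel_nat[of "block n i z" k "block n i z'" "2 ^ n"]
        by (simp add: cong_def)
      then show "block n i z = block n i z'" using block_less by simp
    qed (use z in auto)
  qed
qed (auto simp: shift_def coords_def)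

lemma inj_permute_pair: "\<pi> permutes S \<Longrightarrow> inj (\<lambda>(i, b). (\<pi> i, b))"
  by (auto simp: inj_on_def dest: permutes_inj injD)

lemma mem_permute: "\<pi> permutes S \<Longrightarrow> (\<pi> i, b) \<in> permute \<pi> z \<longleftrightarrow> (i, b) \<in> z"
  unfolding permute_def using permutes_inj[of \<pi> S] by (auto dest: injD)

lemma permute_subset: "\<pi> permutes {..<R} \<Longrightarrow> z \<subseteq> coords R n \<Longrightarrow> permute \<pi> z \<subseteq> coords R n"
  using permutes_in_image[of \<pi> "{..<R}"] by (auto simp: permute_def coords_def)

lemma bij_permute: "\<pi> permutes {..<R} \<Longrightarrow> bij_betw (permute \<pi>) (Pow (coords R n)) (Pow (coords R n))"
  by (rule bij_betw_Pow_endo_inj)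
    (auto simp: permute_def inj_image_eq_iff[OF inj_permute_pair] intro!: inj_onI
      dest: permute_subset[unfolded permute_def])

lemma block_permute: "\<pi> permutes S \<Longrightarrow> block n (\<pi> i) (permute \<pi> z) = block n i z"
  by (simp add: block_def mem_permute)

lemma permute_flip: "\<pi> permutes S \<Longrightarrow> permute \<pi> (flip (i, b) z) = flip (\<pi> i, b) (permute \<pi> z)"
proof -
  assume \<pi>: "\<pi> permutes S"
  have "permute \<pi> (z - {(i, b)}) = permute \<pi> z - {(\<pi> i, b)}"
    unfolding permute_def image_set_diff[OF inj_permute_pair[OF \<pi>]] by simp
  then show ?thesis using mem_permute[OF \<pi>, of i b z]
    by (simp add: flip_def) (simp add: permute_def)
qed

lemma block_flip: "i \<noteq> j \<Longrightarrow> block n i (flip (j, b) z) = block n i z"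
  unfolding block_def by (intro arg_cong[where f = "horner_sum of_bool 2"] map_cong)
    (auto simp: flip_def)

definition cube_count :: "nat \<Rightarrow> nat \<Rightarrow> ((nat \<times> nat) set \<Rightarrow> bool) \<Rightarrow> nat" where
  "cube_count R n P = card {z \<in> Pow (coords R n). P z}"

definition cube_size :: "nat \<Rightarrow> nat \<Rightarrow> nat" where
  "cube_size R n = 2 ^ (R * n)"

lemma card_coords: "card (coords R n) = R * n"
  by (simp add: coords_def card_cartesian_product)

lemma of_nat_cube_count: "of_nat (cube_count R n P) = (\<Sum>z\<in>Pow (coords R n). of_bool (P z))"
proof -
  have "{z \<in> Pow (coords R n). P z} = Pow (coords R n) \<inter> {z. P z}" by auto
  then show ?thesis by (simp add: cube_count_def)
qed

lemmas cube_count_eq_sum = of_nat_cube_count[where 'a = nat, unfolded of_nat_id]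

lemma mean_eq_cube_count: "mean (coords R n) (\<lambda>z. of_bool (P z)) = cube_count R n P / cube_size R n"
  by (simp add: mean_def of_nat_cube_count cube_size_def card_coords)

lemma cube_count_reindex: "bij_betw h (Pow (coords R n)) (Pow (coords R n)) \<Longrightarrow>
    cube_count R n (\<lambda>z. P (h z)) = cube_count R n P"
  unfolding cube_count_eq_sum by (rule sum.reindex_bij_betw[of h _ _ "\<lambda>z. of_bool (P z)"])

lemma cube_count_mono: "(\<And>z. z \<subseteq> coords R n \<Longrightarrow> P z \<Longrightarrow> P' z) \<Longrightarrow> cube_count R n P \<le> cube_count R n P'"
  unfolding cube_count_def by (intro card_mono) auto

lemma cube_count_disj_le: "cube_count R n (\<lambda>z. P z \<or> P' z) \<le> cube_count R n P + cube_count R n P'"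
  unfolding cube_count_eq_sum sum.distrib[symmetric] by (rule sum_mono) auto

lemma cube_count_le: "cube_count R n P \<le> cube_size R n"
proof -
  have "cube_count R n P \<le> card (Pow (coords R n))"
    unfolding cube_count_def by (rule card_mono) auto
  then show ?thesis by (simp add: card_Pow cube_size_def card_coords)
qed

lemma bij_betw_add_mod: "bij_betw (\<lambda>k. (t + k) mod N) {..<N} {..<N :: nat}"
proof -
  have "inj_on (\<lambda>k. (t + k) mod N) {..<N}"
  proof (rule inj_onI)
    fix k k' assume k: "k \<in> {..<N}" "k' \<in> {..<N}" "(t + k) mod N = (t + k') mod N"
    then have "[t + k = t + k'] (mod N)" by (simp add: cong_def)
    then have "[k = k'] (mod N)" using cong_add_lcancel_nat by blast
    then show "k = k'" using k by (simp add: cong_def)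
  qed
  moreover have "(\<lambda>k. (t + k) mod N) ` {..<N} \<subseteq> {..<N}" by (auto intro: mod_less_divisor)
  ultimately show ?thesis using endo_inj_surj[of "{..<N}"] by (simp add: bij_betw_def)
qed

text \<open>
  Shifting all blocks by \<open>k\<close> and averaging over \<open>k\<close> shows that a block is uniformly distributed.
\<close>

lemma cube_count_block:
  assumes "i < R" "T \<subseteq> {..<2 ^ n}"
  shows "2 ^ n * cube_count R n (\<lambda>z. block n i z \<in> T) = cube_size R n * card T"
proof -
  have "2 ^ n * cube_count R n (\<lambda>z. block n i z \<in> T) =
      (\<Sum>k<2 ^ n. cube_count R n (\<lambda>z. block n i (shift R n k z) \<in> T))"
    using cube_count_reindex[OF bij_shift, of R n "\<lambda>z. block n i z \<in> T"] by simp
  also have "\<dots> = (\<Sum>z\<in>Pow (coords R n). \<Sum>k<2 ^ n. of_bool ((block n i z + k) mod 2 ^ n \<in> T))"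
    unfolding cube_count_eq_sum block_shift[OF assms(1)] by (rule sum.swap)
  also have "\<dots> = (\<Sum>z\<in>Pow (coords R n). \<Sum>k<2 ^ n. of_bool (k \<in> T))"
    by (intro sum.cong refl sum.reindex_bij_betw bij_betw_add_mod)
  also have "\<dots> = (\<Sum>z\<in>Pow (coords R n). card T)" using assms(2) by (simp add: inf.absorb2)
  also have "\<dots> = cube_size R n * card T" by (simp add: card_Pow card_coords cube_size_def)
  finally show ?thesis .
qed

lemma cube_size_pos: "0 < cube_size R n"
  by (simp add: cube_size_def)

lemma influence_eq_cube_count: "influence (coords R n) F x =
    cube_count R n (\<lambda>z. F z \<noteq> F (flip x z)) / cube_size R n"
  unfolding influence_def by (rule mean_eq_cube_count)

lemma influence_permute_le:
  assumes \<pi>: "\<pi> permutes {..<R}" and ib: "(i, b) \<in> coords R n"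
  shows "influence (coords R n) f (i, b) * cube_size R n \<le>
    influence (coords R n) g (\<pi> i, b) * cube_size R n +
      2 * cube_count R n (\<lambda>z. f z \<noteq> g (permute \<pi> z))"
proof -
  let ?differ = "\<lambda>z. f z \<noteq> g (permute \<pi> z)" and ?flip = "flip (i, b)"
  let ?flip_g = "\<lambda>z. g z \<noteq> g (flip (\<pi> i, b) z)"
  have "cube_count R n (\<lambda>z. f z \<noteq> f (?flip z)) \<le>
      cube_count R n (\<lambda>z. (?flip_g (permute \<pi> z) \<or> ?differ z) \<or> ?differ (?flip z))"
    by (rule cube_count_mono) (auto simp: permute_flip[OF \<pi>])
  also have "\<dots> \<le> cube_count R n (\<lambda>z. ?flip_g (permute \<pi> z)) + cube_count R n ?differ +
      cube_count R n (\<lambda>z. ?differ (?flip z))"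
    by (intro order.trans[OF cube_count_disj_le] add_right_mono cube_count_disj_le)
  also have "cube_count R n (\<lambda>z. ?differ (?flip z)) = cube_count R n ?differ"
    by (rule cube_count_reindex[OF bij_flip[OF ib], where P = ?differ])
  also have "cube_count R n (\<lambda>z. ?flip_g (permute \<pi> z)) = cube_count R n ?flip_g"
    by (rule cube_count_reindex[OF bij_permute[OF \<pi>], where P = ?flip_g])
  finally show ?thesis
    using cube_size_pos[of R n] by (simp add: influence_eq_cube_count)
qed

section \<open>The gadget\<close>

datatype gadget_vertex = Term nat | Node bool nat "(nat \<times> nat) set"

definition parallel_weight :: "'i set \<Rightarrow> ('i \<Rightarrow> gadget_vertex) \<Rightarrow> ('i \<Rightarrow> gadget_vertex) \<Rightarrow> ('i \<Rightarrow> nat) \<Rightarrow>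
    gadget_vertex \<Rightarrow> gadget_vertex \<Rightarrow> nat" where
  "parallel_weight J a b c p q = (\<Sum>i\<in>J. if p = a i \<and> q = b i then c i else 0)"

lemma sum_parallel_weight:
  assumes "finite G" "\<And>i. i \<in> J \<Longrightarrow> a i \<in> G \<and> b i \<in> G"
  shows "(\<Sum>p\<in>G. \<Sum>q\<in>G. if viol p q then parallel_weight J a b c p q else 0) =
      (\<Sum>i\<in>J. if viol (a i) (b i) then c i else 0)"
proof -
  have "(\<Sum>p\<in>G. \<Sum>q\<in>G. if viol p q then parallel_weight J a b c p q else 0) =
      (\<Sum>p\<in>G. \<Sum>q\<in>G. \<Sum>i\<in>J. if p = a i \<and> q = b i then (if viol (a i) (b i) then c i else 0) else 0)"
  proof (intro sum.cong refl)
    fix p q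
    show "(if viol p q then parallel_weight J a b c p q else 0) =
        (\<Sum>i\<in>J. if p = a i \<and> q = b i then (if viol (a i) (b i) then c i else 0) else 0)"
      by (cases "viol p q") (auto simp: parallel_weight_def intro!: sum.cong sum.neutral)
  qed
  also have "\<dots> =
      (\<Sum>i\<in>J. \<Sum>p\<in>G. \<Sum>q\<in>G. if p = a i \<and> q = b i then (if viol (a i) (b i) then c i else 0) else 0)"
    by (simp add: sum.swap[of _ J G])
  also have "\<dots> = (\<Sum>i\<in>J. if viol (a i) (b i) then c i else 0)"
  proof (intro sum.cong refl)
    fix i assume i: "i \<in> J"
    define k where "k = (if viol (a i) (b i) then c i else 0)"
    have "(\<Sum>p\<in>G. \<Sum>q\<in>G. if p = a i \<and> q = b i then k else 0) =
        (\<Sum>p\<in>G. if p = a i then (\<Sum>q\<in>G. if q = b i then k else 0) else 0)"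
      by (intro sum.cong) auto
    also have "\<dots> = k" using assms(1) assms(2)[OF i] by simp
    finally show "(\<Sum>p\<in>G. \<Sum>q\<in>G. if p = a i \<and> q = b i then (if viol (a i) (b i) then c i else 0)
        else 0) = (if viol (a i) (b i) then c i else 0)"
      by (simp only: k_def)
  qed
  finally show ?thesis .
qed

lemma sum_if_eq_cube_count: "(\<Sum>z\<in>Pow (coords R n). if P z then k else 0) = k * cube_count R n P"
  unfolding cube_count_eq_sum sum_distrib_left by (intro sum.cong) auto

text \<open>
  \<open>D a\<close> is the distance from source \<open>a\<close>, in units in which the LP separates at distance \<open>2 ^ n\<close>. A
  labelling \<open>S\<close> of the vertices by sets of sources stands for the cut of the arcs on which it
  decreases.
\<close>

locale gap_gadget =
  fixes HV :: "nat set" and F :: "(nat \<times> nat) set" and A V :: "nat set" and E :: "(nat \<times> nat) set"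
    and w l :: "nat \<times> nat \<Rightarrow> nat" and ter :: "nat \<Rightarrow> nat" and D :: "nat \<Rightarrow> nat \<Rightarrow> nat"
    and K :: real and n P Q :: nat
  assumes finite_HV: "finite HV" and finite_V: "finite V" and E_sub: "E \<subseteq> V \<times> V" and A_sub: "A \<subseteq> HV"
    and F_sub: "F \<subseteq> HV \<times> HV" and F_loopfree: "(s, s) \<notin> F" and ter_V: "ter ` HV \<subseteq> V"
    and D_source: "a \<in> HV \<Longrightarrow> D a (ter a) = 0"
    and D_arc: "(u, v) \<in> E \<Longrightarrow> D a v \<le> D a u + l (u, v)"
    and D_sink: "(a, b) \<in> F \<Longrightarrow> a \<in> A \<Longrightarrow> b \<notin> A \<Longrightarrow> 2 ^ n \<le> D a (ter b)"
    and cut_ge: "(\<And>a b. (a, b) \<in> F \<Longrightarrow> a \<in> A \<Longrightarrow> b \<notin> A \<Longrightarrow> a \<in> S (ter a) \<and> a \<notin> S (ter b)) \<Longrightarrow>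
       K \<le> (\<Sum>(u, v) | (u, v) \<in> E \<and> \<not> S u \<subseteq> S v. real (w (u, v)))"
    and K_pos: "0 < K" and P_pos: "0 < P"
begin

lemma finite_E: "finite E"
  using finite_subset[OF E_sub] finite_V by simp

lemma finite_A: "finite A"
  using A_sub finite_HV by (rule finite_subset)

definition gadget_vertices :: "nat \<Rightarrow> gadget_vertex set" where
  "gadget_vertices R = Term ` HV \<union> (\<lambda>(s, v, z). Node s v z) ` (UNIV \<times> V \<times> Pow (coords R n))"

lemma finite_gadget_vertices: "finite (gadget_vertices R)"
  using finite_HV finite_V by (simp add: gadget_vertices_def)

lemma Node_in_gadget_vertices: "v \<in> V \<Longrightarrow> z \<subseteq> coords R n \<Longrightarrow> Node s v z \<in> gadget_vertices R"
  unfolding gadget_vertices_def by (rule UnI2, rule image_eqI[of _ _ "(s, v, z)"]) auto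

text \<open>
  Shifted copies of the arcs of the gap instance, unit arcs along the edges of the cubes, and arcs
  of weight \<open>Q\<close> that link the cubes of the two endpoints of a constraint with permutation \<open>\<pi>\<close>.
\<close>

definition gadget_weight :: "nat \<Rightarrow> (nat \<Rightarrow> nat) \<Rightarrow> gadget_vertex \<Rightarrow> gadget_vertex \<Rightarrow> nat" where
  "gadget_weight R \<pi> p q =
     parallel_weight (E \<times> Pow (coords R n)) (\<lambda>(e, z). Node True (fst e) z)
       (\<lambda>(e, z). Node True (snd e) (shift R n (l e) z)) (\<lambda>(e, z). P * w e) p q +
     parallel_weight (UNIV \<times> V \<times> coords R n \<times> Pow (coords R n)) (\<lambda>(s, v, x, z). Node s v z)
       (\<lambda>(s, v, x, z). Node s v (flip x z)) (\<lambda>_. 1) p q +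
     parallel_weight (V \<times> Pow (coords R n)) (\<lambda>(v, z). Node True v z)
       (\<lambda>(v, z). Node False v (permute \<pi> z)) (\<lambda>_. Q) p q +
     parallel_weight (V \<times> Pow (coords R n)) (\<lambda>(v, z). Node False v (permute \<pi> z))
       (\<lambda>(v, z). Node True v z) (\<lambda>_. Q) p q"

definition gadget_cost :: "nat \<Rightarrow> (nat \<Rightarrow> nat) \<Rightarrow> (gadget_vertex \<Rightarrow> gadget_vertex \<Rightarrow> bool) \<Rightarrow> nat" where
  "gadget_cost R \<pi> viol =
      (\<Sum>p\<in>gadget_vertices R. \<Sum>q\<in>gadget_vertices R. if viol p q then gadget_weight R \<pi> p q else 0)"


definition shift_count :: "nat \<Rightarrow> (gadget_vertex \<Rightarrow> gadget_vertex \<Rightarrow> bool) \<Rightarrow> nat \<times> nat \<Rightarrow> nat" where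
  "shift_count R viol e =
      cube_count R n (\<lambda>z. viol (Node True (fst e) z) (Node True (snd e) (shift R n (l e) z)))"

definition edge_count :: "nat \<Rightarrow> (gadget_vertex \<Rightarrow> gadget_vertex \<Rightarrow> bool) \<Rightarrow> bool \<Rightarrow> nat \<Rightarrow>
    nat \<times> nat \<Rightarrow> nat" where
  "edge_count R viol s v x = cube_count R n (\<lambda>z. viol (Node s v z) (Node s v (flip x z)))"

definition link_count ::
  "nat \<Rightarrow> (nat \<Rightarrow> nat) \<Rightarrow> (gadget_vertex \<Rightarrow> gadget_vertex \<Rightarrow> bool) \<Rightarrow> nat \<Rightarrow> nat" where
  "link_count R \<pi> viol v = cube_count R n (\<lambda>z. viol (Node True v z) (Node False v (permute \<pi> z))) +
     cube_count R n (\<lambda>z. viol (Node False v (permute \<pi> z)) (Node True v z))"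

lemma gadget_cost_eq:
  assumes "\<pi> permutes {..<R}"
  shows "gadget_cost R \<pi> viol = (\<Sum>e\<in>E. P * w e * shift_count R viol e) +
     (\<Sum>s\<in>UNIV. \<Sum>v\<in>V. \<Sum>x\<in>coords R n. edge_count R viol s v x) + Q * (\<Sum>v\<in>V. link_count R \<pi> viol v)"
proof -
  have split: "(if c then x1 + x2 + x3 + x4 else 0) =
      (if c then x1 else 0) + (if c then x2 else 0) + (if c then x3 else 0) +
        (if c then x4 else (0 :: nat))" for c x1 x2 x3 x4
    by simp
  have shift: "shift R n k z \<subseteq> coords R n" for k z by (auto simp: shift_def coords_def)
  have flip: "flip x z \<subseteq> coords R n" if "x \<in> coords R n" "z \<subseteq> coords R n" for x z
    using that by (auto simp: flip_def)
  have ends: "a \<in> V" "b \<in> V" if "(a, b) \<in> E" for a b using that E_sub by auto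
  have permute: "permute \<pi> z \<subseteq> coords R n" if "z \<subseteq> coords R n" for z
    by (rule permute_subset[OF assms that])
  have arcs: "(\<Sum>e\<in>E. P * w e * shift_count R viol e) = (\<Sum>i\<in>E \<times> Pow (coords R n).
      if viol ((\<lambda>(e, z). Node True (fst e) z) i)
        ((\<lambda>(e, z). Node True (snd e) (shift R n (l e) z)) i)
      then (\<lambda>(e, z). P * w e) i else 0)"
    unfolding shift_count_def sum_if_eq_cube_count[symmetric] sum.cartesian_product
    by (intro sum.cong) auto
  have edges: "(\<Sum>s\<in>UNIV. \<Sum>v\<in>V. \<Sum>x\<in>coords R n. edge_count R viol s v x) =
      (\<Sum>i\<in>UNIV \<times> V \<times> coords R n \<times> Pow (coords R n).
        if viol ((\<lambda>(s, v, x, z). Node s v z) i) ((\<lambda>(s, v, x, z). Node s v (flip x z)) i)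
          then (\<lambda>_. 1) i else 0)"
    unfolding edge_count_def cube_count_eq_sum sum.cartesian_product by (intro sum.cong) auto
  have link: "Q * (\<Sum>v\<in>V. cube_count R n (\<lambda>z. viol (f v z) (g v z))) = (\<Sum>i\<in>V \<times> Pow (coords R n).
      if viol ((\<lambda>(v, z). f v z) i) ((\<lambda>(v, z). g v z) i) then (\<lambda>_. Q) i else 0)" for f g
    unfolding sum_distrib_left sum_if_eq_cube_count[symmetric] sum.cartesian_product
    by (intro sum.cong) auto
  show ?thesis
    unfolding gadget_cost_def gadget_weight_def split sum.distrib arcs edges link_count_def
      distrib_left link add.assoc[symmetric]
    by (intro arg_cong2[where f = "(+)"]; intro sum_parallel_weight finite_gadget_vertices)
       (auto intro!: Node_in_gadget_vertices dest: ends shift[THEN subsetD] flip[THEN subsetD]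
         permute[THEN subsetD])
qed

lemma gadget_cost_mono:
  assumes "\<And>p q. p \<in> gadget_vertices R \<Longrightarrow> q \<in> gadget_vertices R \<Longrightarrow> viol p q \<Longrightarrow>
      gadget_weight R \<pi> p q \<noteq> 0 \<Longrightarrow> viol' p q"
  shows "gadget_cost R \<pi> viol \<le> gadget_cost R \<pi> viol'"
  unfolding gadget_cost_def
proof (intro sum_mono)
  fix p q assume "p \<in> gadget_vertices R" "q \<in> gadget_vertices R"
  then show "(if viol p q then gadget_weight R \<pi> p q else 0) \<le>
      (if viol' p q then gadget_weight R \<pi> p q else 0)"
    using assms[of p q] by (cases "gadget_weight R \<pi> p q = 0") auto
qed

definition decreases :: "(gadget_vertex \<Rightarrow> nat set) \<Rightarrow> gadget_vertex \<Rightarrow> gadget_vertex \<Rightarrow> bool" where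
  "decreases S p q \<longleftrightarrow> \<not> S p \<subseteq> S q"

subsection \<open>Dictator cuts\<close>

definition dictator :: "nat \<Rightarrow> nat \<Rightarrow> gadget_vertex \<Rightarrow> nat set" where
  "dictator i i' p = (case p of
      Term s \<Rightarrow> if s \<in> A then {s} else {a \<in> A. (a, s) \<notin> F}
    | Node s v z \<Rightarrow> {a \<in> A. D a v \<le> block n (if s then i else i') z})"

lemma dictator_Node: "dictator i i' (Node s v z) = {a \<in> A. D a v \<le> block n (if s then i else i') z}"
  by (simp add: dictator_def)

lemma shift_count_dictator:
  assumes "e \<in> E" "i < R"
  shows "2 ^ n * shift_count R (decreases (dictator i i')) e \<le> cube_size R n * l e"
proof -
  define T where "T = {2 ^ n - l e..<2 ^ n}"
  have "shift_count R (decreases (dictator i i')) e \<le> cube_count R n (\<lambda>z. block n i z \<in> T)"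
    unfolding shift_count_def
  proof (rule cube_count_mono, rule ccontr)
    fix z assume cut: "decreases (dictator i i') (Node True (fst e) z)
        (Node True (snd e) (shift R n (l e) z))"
      and "block n i z \<notin> T"
    then have "block n i z + l e < 2 ^ n" using block_less[of n i z] by (auto simp: T_def)
    then have "block n i (shift R n (l e) z) = block n i z + l e"
      using block_shift[OF assms(2)] by simp
    moreover have "D a (snd e) \<le> block n i z + l e" if "D a (fst e) \<le> block n i z" for a
      using D_arc[of "fst e" "snd e" a] assms(1) that by simp
    ultimately show False using cut by (auto simp: decreases_def dictator_Node)
  qed
  then have "2 ^ n * shift_count R (decreases (dictator i i')) e \<le>
      2 ^ n * cube_count R n (\<lambda>z. block n i z \<in> T)" by simp
  also have "\<dots> = cube_size R n * card T" by (rule cube_count_block[OF assms(2)]) (auto simp: T_def)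
  also have "\<dots> \<le> cube_size R n * l e" by (auto simp: T_def)
  finally show ?thesis .
qed

lemma sum_edge_count_dictator:
  assumes "i < R" "i' < R"
  shows "(\<Sum>x\<in>coords R n. edge_count R (decreases (dictator i i')) s v x) \<le> n * cube_size R n"
proof -
  define j where "j = (if s then i else i')"
  have "j < R" using assms by (simp add: j_def)
  have "edge_count R (decreases (dictator i i')) s v x \<le>
      (if fst x = j then cube_size R n else 0)" for x
  proof (cases "fst x = j")
    case False
    then have "\<not> decreases (dictator i i') (Node s v z) (Node s v (flip x z))" for z
      using block_flip[of j "fst x" n "snd x" z]
      unfolding decreases_def dictator_Node j_def[symmetric] by auto
    then show ?thesis by (simp add: edge_count_def cube_count_def)
  qed (simp add: edge_count_def cube_count_le)
  then have "(\<Sum>x\<in>coords R n. edge_count R (decreases (dictator i i')) s v x) \<le>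
      (\<Sum>x\<in>coords R n. if fst x = j then cube_size R n else 0)"
    by (rule sum_mono)
  also have "\<dots> = (\<Sum>k<R. \<Sum>b<n. if k = j then cube_size R n else 0)"
    unfolding coords_def sum.cartesian_product by (intro sum.cong) auto
  also have "\<dots> = (\<Sum>k<R. if k = j then n * cube_size R n else 0)" by (intro sum.cong) auto
  also have "\<dots> = n * cube_size R n" using \<open>j < R\<close> by simp
  finally show ?thesis .
qed

lemma sum_link_count_dictator:
  assumes "\<pi> permutes {..<R}"
  shows "Q * (\<Sum>v\<in>V. link_count R \<pi> (decreases (dictator i i')) v) \<le>
    cube_size R n * (if i' = \<pi> i then 0 else 2 * Q * card V)"
proof (cases "i' = \<pi> i")
  case True
  then have "dictator i i' (Node True v z) = dictator i i' (Node False v (permute \<pi> z))" for v z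
    by (simp add: dictator_Node block_permute[OF assms])
  then show ?thesis by (simp add: link_count_def decreases_def cube_count_def)
next
  case False
  have "link_count R \<pi> (decreases (dictator i i')) v \<le> 2 * cube_size R n" for v
    unfolding link_count_def mult_2 by (intro add_mono cube_count_le)
  then have "(\<Sum>v\<in>V. link_count R \<pi> (decreases (dictator i i')) v) \<le> card V * (2 * cube_size R n)"
    using sum_bounded_above[of V "link_count R \<pi> (decreases (dictator i i'))"] by simp
  then have "Q * (\<Sum>v\<in>V. link_count R \<pi> (decreases (dictator i i')) v) \<le>
      Q * (card V * (2 * cube_size R n))"
    by (rule mult_le_mono2)
  then show ?thesis using False by (simp add: mult_ac)
qed

lemma gadget_cost_dictator:
  assumes \<pi>: "\<pi> permutes {..<R}" and i: "i < R" "i' < R"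
  shows "2 ^ n * gadget_cost R \<pi> (decreases (dictator i i')) \<le>
    cube_size R n * (P * (\<Sum>e\<in>E. w e * l e) + 2 ^ n * (2 * card V * n) +
      2 ^ n * (if i' = \<pi> i then 0 else 2 * Q * card V))"
proof -
  let ?viol = "decreases (dictator i i')" and ?Z = "cube_size R n"
  let ?edges = "\<Sum>s\<in>UNIV. \<Sum>v\<in>V. \<Sum>x\<in>coords R n. edge_count R ?viol s v x"
  have "2 ^ n * (\<Sum>e\<in>E. P * w e * shift_count R ?viol e) =
      (\<Sum>e\<in>E. P * w e * (2 ^ n * shift_count R ?viol e))"
    by (simp add: sum_distrib_left mult_ac)
  also have "\<dots> \<le> (\<Sum>e\<in>E. P * w e * (?Z * l e))"
    by (intro sum_mono mult_le_mono2 shift_count_dictator i(1))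
  also have "\<dots> = ?Z * (P * (\<Sum>e\<in>E. w e * l e))" by (simp add: sum_distrib_left mult_ac)
  finally have arcs: "2 ^ n * (\<Sum>e\<in>E. P * w e * shift_count R ?viol e) \<le>
      ?Z * (P * (\<Sum>e\<in>E. w e * l e))" .
  have "?edges \<le> (\<Sum>s\<in>(UNIV :: bool set). \<Sum>v\<in>V. n * ?Z)"
    by (intro sum_mono sum_edge_count_dictator i)
  also have "\<dots> = ?Z * (2 * card V * n)" by (simp add: UNIV_bool)
  finally have edges: "?edges \<le> ?Z * (2 * card V * n)" .
  have "2 ^ n * gadget_cost R \<pi> ?viol =
      2 ^ n * (\<Sum>e\<in>E. P * w e * shift_count R ?viol e) + 2 ^ n * ?edges +
      2 ^ n * (Q * (\<Sum>v\<in>V. link_count R \<pi> ?viol v))"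
    unfolding gadget_cost_eq[OF \<pi>] distrib_left ..
  also have "\<dots> \<le> ?Z * (P * (\<Sum>e\<in>E. w e * l e)) + 2 ^ n * (?Z * (2 * card V * n)) +
      2 ^ n * (?Z * (if i' = \<pi> i then 0 else 2 * Q * card V))"
    by (intro add_mono mult_le_mono2 arcs edges sum_link_count_dictator[OF \<pi>])
  also have "\<dots> = ?Z * (P * (\<Sum>e\<in>E. w e * l e) + 2 ^ n * (2 * card V * n) +
      2 ^ n * (if i' = \<pi> i then 0 else 2 * Q * card V))"
    by (simp only: distrib_left mult.left_commute[of "2 ^ n" ?Z])
  finally show ?thesis .
qed

subsection \<open>Influential labels of a cheap labelling\<close>

definition influential_labels :: "real \<Rightarrow> nat \<Rightarrow> (gadget_vertex \<Rightarrow> nat set) \<Rightarrow> bool \<Rightarrow> nat set" where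
  "influential_labels \<tau> R S s =
     {i. i < R \<and>
       (\<exists>b<n. \<exists>v\<in>V. \<exists>a\<in>A. \<tau> / 2 < influence (coords R n) (\<lambda>z. a \<in> S (Node s v z)) (i, b))}"

lemma card_influential_labels:
  assumes "0 < \<tau>" and C: "\<And>v a. v \<in> V \<Longrightarrow> a \<in> A \<Longrightarrow>
      (\<Sum>x\<in>coords R n. influence (coords R n) (\<lambda>z. a \<in> S (Node s v z)) x) \<le> C"
  shows "card (influential_labels \<tau> R S s) \<le> card V * card A * (2 * C / \<tau>)"
proof -
  define h where "h v a x = influence (coords R n) (\<lambda>z. a \<in> S (Node s v z)) x" for v a x
  define B where "B v a = {x \<in> coords R n. \<tau> / 2 < h v a x}" for v a
  have finite_B: "finite (B v a)" for v a by (simp add: B_def)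
  have card_B: "real (card (B v a)) \<le> 2 * C / \<tau>" if "v \<in> V" "a \<in> A" for v a
  proof -
    have "\<tau> / 2 * card (B v a) = (\<Sum>x\<in>B v a. \<tau> / 2)" by simp
    also have "\<dots> \<le> (\<Sum>x\<in>B v a. h v a x)" by (intro sum_mono) (auto simp: B_def)
    also have "\<dots> \<le> (\<Sum>x\<in>coords R n. h v a x)"
      by (intro sum_mono2) (auto simp: B_def h_def influence_nonneg)
    also have "\<dots> \<le> C" unfolding h_def by (rule C[OF that])
    finally show ?thesis using assms(1) by (simp add: field_simps)
  qed
  have "influential_labels \<tau> R S s \<subseteq> fst ` (\<Union>v\<in>V. \<Union>a\<in>A. B v a)"
  proof
    fix i assume "i \<in> influential_labels \<tau> R S s"
    then obtain b v a where "i < R" "b < n" "v \<in> V" "a \<in> A" "\<tau> / 2 < h v a (i, b)"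
      by (auto simp: influential_labels_def h_def)
    then show "i \<in> fst ` (\<Union>v\<in>V. \<Union>a\<in>A. B v a)"
      by (intro image_eqI[of _ _ "(i, b)"]) (auto simp: B_def coords_def)
  qed
  then have "card (influential_labels \<tau> R S s) \<le> card (\<Union>v\<in>V. \<Union>a\<in>A. B v a)"
    using finite_B finite_V finite_A by (intro surj_card_le) auto
  also have "\<dots> \<le> (\<Sum>v\<in>V. \<Sum>a\<in>A. card (B v a))"
    by (intro order.trans[OF card_UN_le[OF finite_V]] sum_mono card_UN_le finite_A)
  finally have "real (card (influential_labels \<tau> R S s)) \<le> (\<Sum>v\<in>V. \<Sum>a\<in>A. real (card (B v a)))"
    by (metis (mono_tags, lifting) of_nat_le_iff of_nat_sum sum.cong)
  also have "\<dots> \<le> (\<Sum>v\<in>V. \<Sum>a\<in>A. 2 * C / \<tau>)" by (intro sum_mono card_B)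
  finally show ?thesis by (simp add: mult_ac)
qed

lemma influence_le_edge_count:
  assumes "x \<in> coords R n"
  shows "influence (coords R n) (\<lambda>z. a \<in> S (Node s v z)) x * cube_size R n \<le>
      2 * edge_count R (decreases S) s v x"
proof -
  let ?cut = "\<lambda>z. decreases S (Node s v z) (Node s v (flip x z))"
  have "cube_count R n (\<lambda>z. (a \<in> S (Node s v z)) \<noteq> (a \<in> S (Node s v (flip x z)))) \<le>
      cube_count R n (\<lambda>z. ?cut z \<or> ?cut (flip x z))"
    by (intro cube_count_mono) (auto simp: decreases_def)
  also have "\<dots> \<le> cube_count R n ?cut + cube_count R n (\<lambda>z. ?cut (flip x z))"
    by (rule cube_count_disj_le)
  also have "cube_count R n (\<lambda>z. ?cut (flip x z)) = cube_count R n ?cut"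
    by (rule cube_count_reindex[OF bij_flip[OF assms], where P = ?cut])
  finally show ?thesis
    using cube_size_pos[of R n] by (simp add: influence_eq_cube_count edge_count_def)
qed

lemma shift_count_ge:
  assumes "1 - \<delta> \<le> mean (coords R n) (\<lambda>z. of_bool (a \<in> S (Node True (fst e) z)))"
    and "mean (coords R n) (\<lambda>z. of_bool (a \<in> S (Node True (snd e) z))) \<le> \<delta>"
  shows "(1 - 2 * \<delta>) * cube_size R n \<le> shift_count R (decreases S) e"
proof -
  let ?cut = "\<lambda>z. decreases S (Node True (fst e) z) (Node True (snd e) (shift R n (l e) z))"
  have "cube_count R n (\<lambda>z. a \<in> S (Node True (fst e) z)) \<le>
      cube_count R n (\<lambda>z. ?cut z \<or> a \<in> S (Node True (snd e) (shift R n (l e) z)))"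
    by (rule cube_count_mono) (auto simp: decreases_def)
  also have "\<dots> \<le> cube_count R n ?cut + cube_count R n
      (\<lambda>z. a \<in> S (Node True (snd e) (shift R n (l e) z)))"
    by (rule cube_count_disj_le)
  also have "cube_count R n (\<lambda>z. a \<in> S (Node True (snd e) (shift R n (l e) z))) =
      cube_count R n (\<lambda>z. a \<in> S (Node True (snd e) z))"
    by (rule cube_count_reindex[OF bij_shift])
  finally have "real (cube_count R n (\<lambda>z. a \<in> S (Node True (fst e) z))) \<le>
      shift_count R (decreases S) e + cube_count R n (\<lambda>z. a \<in> S (Node True (snd e) z))"
    unfolding shift_count_def by linarith
  moreover have "(1 - \<delta>) * cube_size R n \<le> cube_count R n (\<lambda>z. a \<in> S (Node True (fst e) z))"
    and "cube_count R n (\<lambda>z. a \<in> S (Node True (snd e) z)) \<le> \<delta> * cube_size R n"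
    using assms cube_size_pos[of R n] by (simp_all add: mean_eq_cube_count field_simps)
  ultimately show ?thesis by (simp add: algebra_simps)
qed

lemma cube_count_le_link_count:
  "cube_count R n (\<lambda>z. (a \<in> S (Node True v z)) \<noteq> (a \<in> S (Node False v (permute \<pi> z)))) \<le>
      link_count R \<pi> (decreases S) v"
proof -
  have "cube_count R n (\<lambda>z. (a \<in> S (Node True v z)) \<noteq> (a \<in> S (Node False v (permute \<pi> z)))) \<le>
      cube_count R n (\<lambda>z. decreases S (Node True v z) (Node False v (permute \<pi> z)) \<or>
        decreases S (Node False v (permute \<pi> z)) (Node True v z))"
    by (rule cube_count_mono) (auto simp: decreases_def)
  also have "\<dots> \<le> link_count R \<pi> (decreases S) v"
    unfolding link_count_def by (rule cube_count_disj_le)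
  finally show ?thesis .
qed

end

locale cheap_labelling = gap_gadget HV F A V E w l ter D K n P Q
  for HV F A V E w l ter D and K :: real and n P Q +
  fixes R :: nat and \<pi> :: "nat \<Rightarrow> nat" and S :: "gadget_vertex \<Rightarrow> nat set" and \<delta> \<tau> :: real
  assumes \<delta>: "0 < \<delta>" "\<delta> < 1 / 2" and \<tau>: "0 < \<tau>" "4 * P * K \<le> \<tau> * Q"
    and dichotomy: "low_influence_dichotomy (coords R n) \<tau> (2 * P * K) \<delta>"
    and \<pi>: "\<pi> permutes {..<R}"
    and S_source: "a \<in> A \<Longrightarrow> z \<subseteq> coords R n \<Longrightarrow> a \<in> S (Node True (ter a) z)"
    and S_sink: "(a, b) \<in> F \<Longrightarrow> a \<in> A \<Longrightarrow> b \<notin> A \<Longrightarrow> z \<subseteq> coords R n \<Longrightarrow> a \<notin> S (Node True (ter b) z)"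
    and cheap: "real (gadget_cost R \<pi> (decreases S)) < P * K * (1 - 2 * \<delta>) * cube_size R n"
begin

lemma
  shows shift_cost_less: "(\<Sum>e\<in>E. P * w e * real (shift_count R (decreases S) e)) <
      P * K * (1 - 2 * \<delta>) * cube_size R n"
    and edge_cost_less: "real (\<Sum>s\<in>UNIV. \<Sum>v\<in>V. \<Sum>x\<in>coords R n. edge_count R (decreases S) s v x) <
        P * K * cube_size R n"
    and link_cost_less: "Q * real (\<Sum>v\<in>V. link_count R \<pi> (decreases S) v) < P * K * cube_size R n"
proof -
  define arcs edges links where "arcs = (\<Sum>e\<in>E. P * w e * shift_count R (decreases S) e)"
    and "edges = (\<Sum>s\<in>UNIV. \<Sum>v\<in>V. \<Sum>x\<in>coords R n. edge_count R (decreases S) s v x)"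
    and "links = (\<Sum>v\<in>V. link_count R \<pi> (decreases S) v)"
  have total: "real arcs + real edges + Q * real links < P * K * (1 - 2 * \<delta>) * cube_size R n"
    using cheap unfolding gadget_cost_eq[OF \<pi>] arcs_def edges_def links_def by simp
  have "P * K * (1 - 2 * \<delta>) * cube_size R n \<le> P * K * cube_size R n"
    using mult_left_mono[of "1 - 2 * \<delta>" 1 "P * K"] K_pos \<delta> by (intro mult_right_mono) auto
  moreover have "0 \<le> Q * real links" by simp
  ultimately have "real arcs < P * K * (1 - 2 * \<delta>) * cube_size R n"
    "real edges < P * K * cube_size R n"
    "Q * real links < P * K * cube_size R n" using total by linarith+
  then show "(\<Sum>e\<in>E. P * w e * real (shift_count R (decreases S) e)) <
      P * K * (1 - 2 * \<delta>) * cube_size R n"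
    "real (\<Sum>s\<in>UNIV. \<Sum>v\<in>V. \<Sum>x\<in>coords R n. edge_count R (decreases S) s v x) < P * K * cube_size R n"
    "Q * real (\<Sum>v\<in>V. link_count R \<pi> (decreases S) v) < P * K * cube_size R n"
    unfolding arcs_def edges_def links_def by simp_all
qed

lemma sum_influence_le:
  assumes v: "v \<in> V"
  shows "(\<Sum>x\<in>coords R n. influence (coords R n) (\<lambda>z. a \<in> S (Node s v z)) x) \<le> 2 * P * K"
proof -
  have "(\<Sum>x\<in>coords R n. influence (coords R n) (\<lambda>z. a \<in> S (Node s v z)) x) * cube_size R n \<le>
      (\<Sum>x\<in>coords R n. real (2 * edge_count R (decreases S) s v x))"
    unfolding sum_distrib_right by (intro sum_mono) (use influence_le_edge_count in auto)
  also have "\<dots> = 2 * real (\<Sum>x\<in>coords R n. edge_count R (decreases S) s v x)"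
    by (simp add: sum_distrib_left)
  also have "(\<Sum>x\<in>coords R n. edge_count R (decreases S) s v x) \<le>
      (\<Sum>v\<in>V. \<Sum>x\<in>coords R n. edge_count R (decreases S) s v x)"
    using member_le_sum[OF v, of "\<lambda>v. \<Sum>x\<in>coords R n. edge_count R (decreases S) s v x"] finite_V
    by simp
  also have "\<dots> \<le> (\<Sum>s\<in>UNIV. \<Sum>v\<in>V. \<Sum>x\<in>coords R n. edge_count R (decreases S) s v x)"
    using member_le_sum[of s UNIV "\<lambda>s. \<Sum>v\<in>V. \<Sum>x\<in>coords R n. edge_count R (decreases S) s v x"]
    by simp
  also have "real \<dots> \<le> P * K * cube_size R n" using edge_cost_less by simp
  finally have "(\<Sum>x\<in>coords R n. influence (coords R n) (\<lambda>z. a \<in> S (Node s v z)) x) * cube_size R n \<le>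
      (2 * P * K) * cube_size R n" by simp
  then show ?thesis using cube_size_pos[of R n] by simp
qed

lemma card_influential_labels_le: "real (card (influential_labels \<tau> R S s)) \<le>
    card V * card A * (4 * P * K / \<tau>)"
  using card_influential_labels[OF \<tau>(1) sum_influence_le, of s] by simp

text \<open>
  Otherwise rounding the means gives a cut of the gap instance that violates almost all shifts of
  its arcs.
\<close>

lemma ex_influential_coordinate:
  "\<exists>v\<in>V. \<exists>a\<in>A. \<exists>x\<in>coords R n. \<tau> < influence (coords R n) (\<lambda>z. a \<in> S (Node True v z)) x"
proof (rule ccontr)
  assume none: "\<not> ?thesis"
  define \<mu> where "\<mu> v a = mean (coords R n) (\<lambda>z. of_bool (a \<in> S (Node True v z)))" for v a
  have near_constant: "\<mu> v a \<le> \<delta> \<or> 1 - \<delta> \<le> \<mu> v a" if "v \<in> V" "a \<in> A" for v a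
    using dichotomy sum_influence_le[OF that(1), of a True] none that
    unfolding low_influence_dichotomy_def \<mu>_def by (force simp: not_less)
  define T where "T v = {a \<in> A. 1 / 2 \<le> \<mu> v a}" for v
  have "K \<le> (\<Sum>(u, v) | (u, v) \<in> E \<and> \<not> T u \<subseteq> T v. real (w (u, v)))"
  proof (rule cut_ge)
    fix a b assume ab: "(a, b) \<in> F" "a \<in> A" "b \<notin> A"
    have "\<mu> (ter a) a = mean (coords R n) (\<lambda>_. 1)" unfolding \<mu>_def
      using S_source[OF ab(2)] by (intro mean_cong) auto
    moreover have "\<mu> (ter b) a = mean (coords R n) (\<lambda>_. 0)" unfolding \<mu>_def
      using S_sink[OF ab] by (intro mean_cong) auto
    ultimately show "a \<in> T (ter a) \<and> a \<notin> T (ter b)" using ab by (simp add: T_def mean_const)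
  qed
  also have "\<dots> = (\<Sum>e | e \<in> E \<and> \<not> T (fst e) \<subseteq> T (snd e). real (w e))" by (intro sum.cong) auto
  finally have K: "K \<le> (\<Sum>e | e \<in> E \<and> \<not> T (fst e) \<subseteq> T (snd e). real (w e))" .
  have copies: "(1 - 2 * \<delta>) * cube_size R n \<le> shift_count R (decreases S) e"
    if e: "e \<in> E" "\<not> T (fst e) \<subseteq> T (snd e)" for e
  proof -
    obtain a where "a \<in> T (fst e)" "a \<notin> T (snd e)" using e(2) by blast
    moreover have "fst e \<in> V" "snd e \<in> V" using e(1) E_sub by auto
    ultimately have "1 - \<delta> \<le> \<mu> (fst e) a" "\<mu> (snd e) a \<le> \<delta>"
      using near_constant[of "fst e" a] near_constant[of "snd e" a] \<delta> by (auto simp: T_def)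
    then show ?thesis unfolding \<mu>_def by (rule shift_count_ge)
  qed
  have "P * K * (1 - 2 * \<delta>) * cube_size R n \<le>
      P * (\<Sum>e | e \<in> E \<and> \<not> T (fst e) \<subseteq> T (snd e). real (w e)) * ((1 - 2 * \<delta>) * cube_size R n)"
    using K \<delta> unfolding mult.assoc by (intro mult_left_mono mult_right_mono) auto
  also have "\<dots> = (\<Sum>e | e \<in> E \<and> \<not> T (fst e) \<subseteq> T (snd e). P * w e * ((1 - 2 * \<delta>) * cube_size R n))"
    by (simp add: sum_distrib_left sum_distrib_right)
  also have "\<dots> \<le> (\<Sum>e | e \<in> E \<and> \<not> T (fst e) \<subseteq> T (snd e). P * w e *
      real (shift_count R (decreases S) e))"
    using copies by (intro sum_mono mult_left_mono) auto
  also have "\<dots> \<le> (\<Sum>e\<in>E. P * w e * real (shift_count R (decreases S) e))"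
    using finite_E by (intro sum_mono2) auto
  finally show False using shift_cost_less by linarith
qed

lemma link_count_less:
  assumes "v \<in> V"
  shows "4 * real (link_count R \<pi> (decreases S) v) < \<tau> * cube_size R n"
proof -
  have "Q * real (link_count R \<pi> (decreases S) v) \<le> Q * real (\<Sum>v\<in>V. link_count R \<pi> (decreases S) v)"
    using member_le_sum[OF assms, of "link_count R \<pi> (decreases S)"] finite_V
    by (intro mult_left_mono of_nat_mono) auto
  then have "4 * (Q * real (link_count R \<pi> (decreases S) v)) < (4 * P * K) * cube_size R n"
    using link_cost_less by simp
  also have "\<dots> \<le> \<tau> * Q * cube_size R n" using \<tau>(2) by (intro mult_right_mono) auto
  finally have "Q * (4 * real (link_count R \<pi> (decreases S) v)) < Q * (\<tau> * cube_size R n)"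
    by (simp add: mult_ac)
  then show ?thesis by (rule mult_left_less_imp_less) simp
qed

lemma ex_matching_labels: "\<exists>i\<in>influential_labels \<tau> R S True. \<pi> i \<in> influential_labels \<tau> R S False"
proof -
  obtain v a i b where v: "v \<in> V" "a \<in> A" and ib: "(i, b) \<in> coords R n"
    and large: "\<tau> < influence (coords R n) (\<lambda>z. a \<in> S (Node True v z)) (i, b)"
    using ex_influential_coordinate by auto
  have "\<tau> * cube_size R n < influence (coords R n) (\<lambda>z. a \<in> S (Node True v z))
      (i, b) * cube_size R n"
    using large cube_size_pos by (intro mult_strict_right_mono) auto
  also have "\<dots> \<le> influence (coords R n) (\<lambda>z. a \<in> S (Node False v z)) (\<pi> i, b) * cube_size R n +
      2 * real (link_count R \<pi> (decreases S) v)"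
    using influence_permute_le[OF \<pi> ib, of "\<lambda>z. a \<in> S (Node True v z)" "\<lambda>z. a \<in> S (Node False v z)"]
      cube_count_le_link_count[of R a S v \<pi>] by linarith
  finally have "\<tau> / 2 * cube_size R n <
      influence (coords R n) (\<lambda>z. a \<in> S (Node False v z)) (\<pi> i, b) * cube_size R n"
    using link_count_less[OF v(1)] by simp
  then have "\<tau> / 2 < influence (coords R n) (\<lambda>z. a \<in> S (Node False v z)) (\<pi> i, b)"
    by (rule mult_right_less_imp_less) simp
  moreover have "i < R" "b < n" using ib by (auto simp: coords_def)
  moreover from this have "\<pi> i < R" using permutes_in_image[OF \<pi>, of i] by simp
  moreover have "\<tau> / 2 < influence (coords R n) (\<lambda>z. a \<in> S (Node True v z)) (i, b)"
    using large \<tau>(1) by linarith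
  ultimately show ?thesis using v unfolding influential_labels_def by blast
qed

end

section \<open>Completeness and soundness of the reduction\<close>

context gap_gadget
begin

text \<open>
  The arcs of infinite weight. They attach the terminals to the cubes and identify the cubes of
  constraints that share an endpoint.
\<close>

definition forced :: "bool \<Rightarrow> bool \<Rightarrow> gadget_vertex \<Rightarrow> gadget_vertex \<Rightarrow> bool" where
  "forced su sv p q = (case p of
      Term s \<Rightarrow> (case q of Term t \<Rightarrow> s = t | Node _ v _ \<Rightarrow> s \<in> A \<and> v = ter s)
    | Node s v z \<Rightarrow> (case q of
        Term t \<Rightarrow> t \<notin> A \<and> v = ter t
      | Node _ _ _ \<Rightarrow> p = q \<and> (if s then su else sv)))"

lemma gadget_weight_Term [simp]: "gadget_weight R \<pi> (Term s) q = 0"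
  "gadget_weight R \<pi> p (Term s) = 0"
  by (auto simp: gadget_weight_def parallel_weight_def intro!: sum.neutral)

text \<open>
  Constraint \<open>j\<close> joins \<open>us j\<close> to \<open>vs j\<close> with the permutation \<open>ps j\<close> and has its own copy of the
  gadget.
\<close>

definition positions :: "nat \<Rightarrow> nat \<Rightarrow> (nat \<times> gadget_vertex) set" where
  "positions m R = {..<m} \<times> gadget_vertices R"

lemma finite_positions: "finite (positions m R)"
  by (simp add: positions_def finite_gadget_vertices)

definition forced_arc :: "(nat \<Rightarrow> nat) \<Rightarrow> (nat \<Rightarrow> nat) \<Rightarrow>
    nat \<times> gadget_vertex \<Rightarrow> nat \<times> gadget_vertex \<Rightarrow> bool" where
  "forced_arc us vs x y \<longleftrightarrow>
     forced (us (fst x) = us (fst y)) (vs (fst x) = vs (fst y)) (snd x) (snd y)"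

definition position_weight :: "nat \<Rightarrow> (nat \<Rightarrow> nat) \<Rightarrow> (nat \<Rightarrow> nat) \<Rightarrow> (nat \<Rightarrow> nat \<Rightarrow> nat) \<Rightarrow> nat \<Rightarrow>
    nat \<times> gadget_vertex \<Rightarrow> nat \<times> gadget_vertex \<Rightarrow> nat" where
  "position_weight R us vs ps big x y = (if forced_arc us vs x y then big
     else if fst x = fst y then gadget_weight R (ps (fst x)) (snd x) (snd y) else 0)"

definition unforced :: "(nat \<Rightarrow> nat) \<Rightarrow> (nat \<Rightarrow> nat) \<Rightarrow>
    ((nat \<times> gadget_vertex) \<times> (nat \<times> gadget_vertex)) set \<Rightarrow> bool" where
  "unforced us vs C \<longleftrightarrow> (\<forall>(x, y)\<in>C. \<not> forced_arc us vs x y)"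

definition separating ::
  "nat \<Rightarrow> nat \<Rightarrow> ((nat \<times> gadget_vertex) \<times> (nat \<times> gadget_vertex)) set \<Rightarrow> bool" where
  "separating m R C \<longleftrightarrow> C \<subseteq> positions m R \<times> positions m R \<and>
     (\<forall>(s, t)\<in>F. ((0, Term s), (0, Term t)) \<notin> (positions m R \<times> positions m R - C)\<^sup>*)"

definition copy_cost :: "nat \<Rightarrow> (nat \<Rightarrow> nat \<Rightarrow> nat) \<Rightarrow>
    ((nat \<times> gadget_vertex) \<times> (nat \<times> gadget_vertex)) set \<Rightarrow> nat \<Rightarrow> nat" where
  "copy_cost R ps C j = gadget_cost R (ps j) (\<lambda>p q. ((j, p), (j, q)) \<in> C)"

lemma sum_position_weight:
  assumes C: "C \<subseteq> positions m R \<times> positions m R" and u: "unforced us vs C"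
  shows "(\<Sum>(x, y)\<in>C. position_weight R us vs ps big x y) = (\<Sum>j<m. copy_cost R ps C j)"
proof -
  have finite_pairs: "finite (positions m R \<times> positions m R)" using finite_positions by simp
  have "(\<Sum>(x, y)\<in>C. position_weight R us vs ps big x y) =
      (\<Sum>(x, y)\<in>C. if fst x = fst y then gadget_weight R (ps (fst x)) (snd x) (snd y) else 0)"
    using u by (intro sum.cong) (auto simp: position_weight_def unforced_def)
  also have "\<dots> = (\<Sum>(x, y)\<in>positions m R \<times> positions m R.
      if (x, y) \<in> C \<and> fst x = fst y then gadget_weight R (ps (fst x)) (snd x) (snd y) else 0)"
    using C finite_pairs by (intro sum.mono_neutral_cong_left) (auto split: if_splits)
  also have "\<dots> = (\<Sum>j<m. \<Sum>p\<in>gadget_vertices R. \<Sum>j'<m. \<Sum>q\<in>gadget_vertices R.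
      if ((j, p), (j', q)) \<in> C \<and> j = j' then gadget_weight R (ps j) p q else 0)"
    unfolding positions_def by (simp add: sum.cartesian_product' cong: if_cong)
  also have "\<dots> = (\<Sum>j<m. \<Sum>p\<in>gadget_vertices R. \<Sum>q\<in>gadget_vertices R.
      if ((j, p), (j, q)) \<in> C then gadget_weight R (ps j) p q else 0)"
  proof (intro sum.cong refl)
    fix j p assume j: "j \<in> {..<m}"
    let ?row = "\<Sum>q\<in>gadget_vertices R. if ((j, p), (j, q)) \<in> C
        then gadget_weight R (ps j) p q else 0"
    have "(\<Sum>j'<m. \<Sum>q\<in>gadget_vertices R. if ((j, p), (j', q)) \<in> C \<and> j = j'
        then gadget_weight R (ps j) p q else 0) =
       (\<Sum>j'<m. if j' = j then ?row else 0)"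
      by (intro sum.cong) (auto intro!: sum.cong)
    also have "\<dots> = ?row" using j by simp
    finally show "(\<Sum>j'<m. \<Sum>q\<in>gadget_vertices R.
        if ((j, p), (j', q)) \<in> C \<and> j = j' then gadget_weight R (ps j) p q else 0) = ?row" .
  qed
  finally show ?thesis by (simp add: copy_cost_def gadget_cost_def)
qed

subsection \<open>Completeness\<close>

lemma dictator_forced_mono:
  assumes "forced su sv p q" "su \<Longrightarrow> i = j" "sv \<Longrightarrow> i' = j'"
  shows "dictator i i' p \<subseteq> dictator j j' q"
proof (cases p)
  case p: (Term s)
  show ?thesis
  proof (cases q)
    case (Node s' v z)
    then have "s \<in> A" "v = ter s" using assms(1) p by (auto simp: forced_def)
    then show ?thesis using Node p D_source[of s] A_sub by (auto simp: dictator_def)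
  qed (use assms(1) p in \<open>simp add: forced_def dictator_def\<close>)
next
  case p: (Node s v z)
  show ?thesis
  proof (cases q)
    case (Term t)
    then have t: "t \<notin> A" "v = ter t" using assms(1) p by (auto simp: forced_def)
    have "(a, t) \<notin> F" if "a \<in> A" "D a (ter t) \<le> block n i z" for a i
      using D_sink[of a t] that t block_less[of n i z] by auto
    then show ?thesis using p Term t by (auto simp: dictator_def)
  next
    case (Node s' v' z')
    then show ?thesis using assms p by (auto simp: forced_def dictator_def split: if_splits)
  qed
qed

definition dictator_cut ::
    "nat \<Rightarrow> nat \<Rightarrow> (nat \<Rightarrow> nat) \<Rightarrow> (nat \<Rightarrow> nat) \<Rightarrow> (nat \<Rightarrow> nat \<Rightarrow> nat) \<Rightarrow> (nat \<Rightarrow> nat) \<Rightarrow> (nat \<Rightarrow> nat) \<Rightarrow>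
     ((nat \<times> gadget_vertex) \<times> (nat \<times> gadget_vertex)) set" where
  "dictator_cut m R us vs ps f g = {(x, y). x \<in> positions m R \<and> y \<in> positions m R \<and>
      \<not> forced_arc us vs x y \<and>
     (fst x \<noteq> fst y \<or> gadget_weight R (ps (fst x)) (snd x) (snd y) = 0 \<or>
      decreases (dictator (f (us (fst x))) (g (vs (fst x)))) (snd x) (snd y))}"

lemma unforced_dictator_cut: "unforced us vs (dictator_cut m R us vs ps f g)"
  by (auto simp: unforced_def dictator_cut_def)

lemma separating_dictator_cut: "separating m R (dictator_cut m R us vs ps f g)"
proof -
  define S where "S x = dictator (f (us (fst x))) (g (vs (fst x))) (snd x)"
    for x :: "nat \<times> gadget_vertex"
  define U where "U = positions m R \<times> positions m R - dictator_cut m R us vs ps f g"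
  have forced_or_copy: "forced_arc us vs x y \<or> fst x = fst y \<and>
      gadget_weight R (ps (fst x)) (snd x) (snd y) \<noteq> 0 \<and> S x \<subseteq> S y"
    if "(x, y) \<in> U" for x y
    using that by (auto simp: U_def dictator_cut_def decreases_def S_def)
  have mono: "S x \<subseteq> S y" if "(x, y) \<in> U" for x y
  proof (cases "forced_arc us vs x y")
    case True
    then show ?thesis unfolding S_def forced_arc_def by (rule dictator_forced_mono) auto
  qed (use forced_or_copy[OF that] in auto)
  have sink: "snd y = Term s" if "(x, y) \<in> U" "snd x = Term s" "s \<notin> A" for x y s
    using forced_or_copy[OF that(1)] that by (cases "snd y") (auto simp: forced_arc_def forced_def)
  have "((0, Term s), (0, Term t)) \<notin> U\<^sup>*" if st: "(s, t) \<in> F" for s t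
  proof
    assume path: "((0, Term s), (0, Term t)) \<in> U\<^sup>*"
    have "s \<noteq> t" using st F_loopfree by auto
    show False
    proof (cases "s \<in> A")
      case True
      have "S x \<subseteq> S y" if "(x, y) \<in> U\<^sup>*" for x y
        using that by (induction rule: rtrancl_induct) (use mono in blast)+
      from this[OF path] show False
        using True \<open>s \<noteq> t\<close> st by (auto simp: S_def dictator_def split: if_splits)
    next
      case False
      have "snd y = Term s" if "(x, y) \<in> U\<^sup>*" "snd x = Term s" for x y
        using that by (induction rule: rtrancl_induct) (use sink False in blast)+
      from this[OF path] show False using \<open>s \<noteq> t\<close> by simp
    qed
  qed
  then show ?thesis unfolding separating_def U_def by (auto simp: dictator_cut_def)
qed

lemma copy_cost_dictator_cut:
  assumes "ps j permutes {..<R}" "f (us j) < R" "g (vs j) < R"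
  shows "2 ^ n * copy_cost R ps (dictator_cut m R us vs ps f g) j \<le>
    cube_size R n * (P * (\<Sum>e\<in>E. w e * l e) + 2 ^ n * (2 * card V * n) +
      of_bool (g (vs j) \<noteq> ps j (f (us j))) * (2 ^ n * (2 * Q * card V)))"
proof -
  have "copy_cost R ps (dictator_cut m R us vs ps f g) j \<le>
      gadget_cost R (ps j) (decreases (dictator (f (us j)) (g (vs j))))"
    unfolding copy_cost_def by (rule gadget_cost_mono) (auto simp: dictator_cut_def)
  then have "2 ^ n * copy_cost R ps (dictator_cut m R us vs ps f g) j \<le>
      2 ^ n * gadget_cost R (ps j) (decreases (dictator (f (us j)) (g (vs j))))"
        by (rule mult_le_mono2)
  also note gadget_cost_dictator[OF assms]
  also have "2 ^ n * (if g (vs j) = ps j (f (us j)) then 0 else 2 * Q * card V) =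
      of_bool (g (vs j) \<noteq> ps j (f (us j))) * (2 ^ n * (2 * Q * card V))" by simp
  finally show ?thesis .
qed

lemma completeness:
  assumes ps: "\<And>j. j < m \<Longrightarrow> ps j permutes {..<R}"
    and f: "\<And>j. j < m \<Longrightarrow> f (us j) < R" and g: "\<And>j. j < m \<Longrightarrow> g (vs j) < R"
    and unsat: "card {j. j < m \<and> g (vs j) \<noteq> ps j (f (us j))} \<le> N"
  obtains C where "separating m R C" "unforced us vs C"
    "2 ^ n * (\<Sum>(x, y)\<in>C. position_weight R us vs ps big x y) \<le>
       cube_size R n * (m * (P * (\<Sum>e\<in>E. w e * l e) + 2 ^ n * (2 * card V * n)) +
         N * (2 ^ n * (2 * Q * card V)))"
proof -
  let ?C = "dictator_cut m R us vs ps f g"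
  define X where "X = P * (\<Sum>e\<in>E. w e * l e) + 2 ^ n * (2 * card V * n)"
  define Y where "Y = 2 ^ n * (2 * Q * card V)"
  define bad where "bad j \<longleftrightarrow> g (vs j) \<noteq> ps j (f (us j))" for j
  have "{j. j < m \<and> bad j} = {..<m} \<inter> Collect bad" by auto
  then have "card ({..<m} \<inter> Collect bad) \<le> N" using unsat by (simp add: bad_def)
  then have count: "(\<Sum>j<m. of_bool (bad j) * Y) \<le> N * Y" by (simp flip: sum_distrib_right)
  have "2 ^ n * (\<Sum>(x, y)\<in>?C. position_weight R us vs ps big x y) =
      (\<Sum>j<m. 2 ^ n * copy_cost R ps ?C j)"
    unfolding sum_distrib_left[symmetric]
    by (subst sum_position_weight[OF _ unforced_dictator_cut]) (auto simp: dictator_cut_def)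
  also have "\<dots> \<le> (\<Sum>j<m. cube_size R n * (X + of_bool (bad j) * Y))"
    unfolding X_def Y_def bad_def by (intro sum_mono copy_cost_dictator_cut ps f g) auto
  also have "\<dots> = cube_size R n * (m * X + (\<Sum>j<m. of_bool (bad j) * Y))"
    by (simp add: sum_distrib_left[symmetric] sum.distrib)
  also have "\<dots> \<le> cube_size R n * (m * X + N * Y)" by (intro mult_le_mono2 add_left_mono count)
  finally show ?thesis
    using that[OF separating_dictator_cut unforced_dictator_cut] unfolding X_def Y_def by blast
qed

end

subsection \<open>Soundness\<close>

lemma ex_large_set_of_cover:
  assumes "finite I" "\<And>i. i \<in> I \<Longrightarrow> finite (B i)" "G \<subseteq> (\<Union>i\<in>I. B i)"
  shows "\<exists>i. card G \<le> card I * card (B i)"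
proof (rule ccontr)
  assume "\<not> ?thesis"
  then have less: "card I * card (B i) < card G" for i by (meson not_le)
  have "card G \<le> card (\<Union>i\<in>I. B i)" using assms by (intro card_mono) auto
  also have "\<dots> \<le> (\<Sum>i\<in>I. card (B i))" by (rule card_UN_le[OF assms(1)])
  finally have total: "card G \<le> (\<Sum>i\<in>I. card (B i))" .
  have "0 < card G" using less gr_zeroI by fastforce
  then have "I \<noteq> {}" using total by auto
  have "card I * card G \<le> (\<Sum>i\<in>I. card I * card (B i))"
    using total unfolding sum_distrib_left[symmetric] by (rule mult_le_mono2)
  also have "\<dots> < (\<Sum>i\<in>I. card G)" using less assms(1) \<open>I \<noteq> {}\<close> by (intro sum_strict_mono) auto
  finally show False by simp
qed

lemma obtain_labelling_of_label_sets:
  fixes LU LV :: "nat \<Rightarrow> nat set"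
  assumes "0 < R" and LU: "\<And>u. LU u \<subseteq> {..<R}" and LV: "\<And>v. LV v \<subseteq> {..<R}" and G: "finite G"
    and matching: "\<And>j. j \<in> G \<Longrightarrow> \<exists>i\<in>LU (us j). ps j i \<in> LV (vs j)"
    and small: "\<And>j. j \<in> G \<Longrightarrow> card (LU (us j)) \<le> \<Lambda>" "\<And>j. j \<in> G \<Longrightarrow> card (LV (vs j)) \<le> \<Lambda>"
  obtains f g where "\<And>u. f u < R" "\<And>v. g v < R"
    "card G \<le> \<Lambda> * \<Lambda> * card {j \<in> G. g (vs j) = ps j (f (us j))}"
proof -
  define pick where "pick L r = (if r < card L then sorted_list_of_set L ! r else 0)"
    for L :: "nat set" and r
  have pick_less: "pick L r < R" if "L \<subseteq> {..<R}" for L r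
    using nth_mem[of r "sorted_list_of_set L"] that \<open>0 < R\<close> finite_subset[OF that]
    by (auto simp: pick_def)
  have ex_pick: "\<exists>r<\<Lambda>. pick L r = i" if "i \<in> L" "L \<subseteq> {..<R}" "card L \<le> \<Lambda>" for L i
  proof -
    have "i \<in> set (sorted_list_of_set L)" using that finite_subset[OF that(2)] by simp
    then obtain r where "r < card L" "sorted_list_of_set L ! r = i" by (auto simp: in_set_conv_nth)
    then show ?thesis using that(3) by (intro exI[of _ r]) (auto simp: pick_def)
  qed
  define sat where "sat = (\<lambda>(r, r'). {j \<in> G. pick (LV (vs j)) r' = ps j (pick (LU (us j)) r)})"
  let ?I = "{..<\<Lambda>} \<times> {..<\<Lambda>}"
  have "G \<subseteq> (\<Union>i\<in>?I. sat i)"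
  proof
    fix j assume j: "j \<in> G"
    then obtain i where i: "i \<in> LU (us j)" "ps j i \<in> LV (vs j)" using matching by blast
    obtain r r' where "r < \<Lambda>" "pick (LU (us j)) r = i" "r' < \<Lambda>" "pick (LV (vs j)) r' = ps j i"
      using ex_pick[OF i(1) LU small(1)[OF j]] ex_pick[OF i(2) LV small(2)[OF j]] by blast
    then show "j \<in> (\<Union>i\<in>?I. sat i)" using j by (intro UN_I[of "(r, r')"]) (auto simp: sat_def)
  qed
  then have "\<exists>i. card G \<le> card ?I * card (sat i)"
    using G by (intro ex_large_set_of_cover) (auto simp: sat_def)
  then obtain r r' where "card G \<le> \<Lambda> * \<Lambda> * card (sat (r, r'))"
    by (auto simp: card_cartesian_product)
  then show ?thesis
    using that[of "\<lambda>u. pick (LU u) r" "\<lambda>v. pick (LV v) r'"] pick_less[OF LU] pick_less[OF LV]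
    by (simp add: sat_def)
qed


locale cheap_separation = gap_gadget HV F A V E w l ter D K n P Q
  for HV F A V E w l ter D and K :: real and n P Q +
  fixes m R :: nat and us vs :: "nat \<Rightarrow> nat" and ps :: "nat \<Rightarrow> nat \<Rightarrow> nat" and \<delta> \<tau> :: real
    and C :: "((nat \<times> gadget_vertex) \<times> (nat \<times> gadget_vertex)) set"
  assumes m: "0 < m" and ps: "\<And>j. j < m \<Longrightarrow> ps j permutes {..<R}"
    and \<delta>: "0 < \<delta>" "\<delta> < 1 / 2" and \<tau>: "0 < \<tau>" "4 * P * K \<le> \<tau> * Q"
    and dichotomy: "low_influence_dichotomy (coords R n) \<tau> (2 * P * K) \<delta>"
    and sep: "separating m R C" and unf: "unforced us vs C"
    and cheap: "real (\<Sum>j<m. copy_cost R ps C j) < P * K * (1 - 3 * \<delta>) * cube_size R n * m"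
begin

definition kept :: "((nat \<times> gadget_vertex) \<times> (nat \<times> gadget_vertex)) set" where
  "kept = positions m R \<times> positions m R - C"

definition reach :: "nat \<Rightarrow> gadget_vertex \<Rightarrow> nat set" where
  "reach j p = {a \<in> A. ((0, Term a), (j, p)) \<in> kept\<^sup>*}"

lemma forced_arc_kept: "forced_arc us vs x y \<Longrightarrow> x \<in> positions m R \<Longrightarrow>
    y \<in> positions m R \<Longrightarrow> (x, y) \<in> kept"
  using unf by (auto simp: kept_def unforced_def)

lemma reach_mono: "((j, p), (j', q)) \<in> kept \<Longrightarrow> reach j p \<subseteq> reach j' q"
  by (auto simp: reach_def intro: rtrancl_into_rtrancl)

lemma reach_outside:
  assumes "Node s v z \<notin> gadget_vertices R"
  shows "reach j (Node s v z) = {}"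
proof -
  have "y = (0, Term a) \<or> y \<in> positions m R" if "((0, Term a), y) \<in> kept\<^sup>*" for y a
    using that by (cases rule: rtrancl.cases) (auto simp: kept_def)
  then show ?thesis using assms by (fastforce simp: reach_def positions_def)
qed

lemma Term_position: "a \<in> HV \<Longrightarrow> j < m \<Longrightarrow> (j, Term a) \<in> positions m R"
  by (auto simp: positions_def gadget_vertices_def)

lemma Node_position: "a \<in> HV \<Longrightarrow> j < m \<Longrightarrow> z \<subseteq> coords R n \<Longrightarrow> (j, Node s (ter a) z) \<in> positions m R"
  using ter_V by (auto simp: positions_def intro!: Node_in_gadget_vertices)

lemma reach_source:
  assumes "a \<in> A" "z \<subseteq> coords R n" "j < m"
  shows "a \<in> reach j (Node s (ter a) z)"
proof -
  have "((0, Term a), (j, Node s (ter a) z)) \<in> kept"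
    using assms m A_sub by (intro forced_arc_kept Term_position Node_position)
      (auto simp: forced_arc_def forced_def)
  then show ?thesis using assms by (auto simp: reach_def)
qed

lemma reach_sink:
  assumes "(a, b) \<in> F" "a \<in> A" "b \<notin> A" "z \<subseteq> coords R n" "j < m"
  shows "a \<notin> reach j (Node s (ter b) z)"
proof
  assume "a \<in> reach j (Node s (ter b) z)"
  then have "((0, Term a), (j, Node s (ter b) z)) \<in> kept\<^sup>*" by (simp add: reach_def)
  moreover have "((j, Node s (ter b) z), (0, Term b)) \<in> kept"
    using assms m F_sub by (intro forced_arc_kept Term_position Node_position)
      (auto simp: forced_arc_def forced_def)
  ultimately have "((0, Term a), (0, Term b)) \<in> kept\<^sup>*" by (rule rtrancl_into_rtrancl)
  then show False using sep assms(1) by (auto simp: separating_def kept_def)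
qed

lemma reach_eq:
  assumes "j < m" "j' < m" "if s then us j = us j' else vs j = vs j'"
  shows "reach j (Node s v z) = reach j' (Node s v z)"
proof (cases "Node s v z \<in> gadget_vertices R")
  case True
  then have "((j, Node s v z), (j', Node s v z)) \<in> kept"
    "((j', Node s v z), (j, Node s v z)) \<in> kept"
    using assms
    by (auto intro!: forced_arc_kept simp: positions_def forced_arc_def forced_def split: if_splits)
  then show ?thesis using reach_mono by (meson subset_antisym)
qed (simp add: reach_outside)

definition labels :: "nat \<Rightarrow> bool \<Rightarrow> nat set" where
  "labels j s = influential_labels \<tau> R (reach j) s"

lemma labels_eq: "j < m \<Longrightarrow> j' < m \<Longrightarrow> if s then us j = us j' else vs j = vs j' \<Longrightarrow>
    labels j s = labels j' s"
  unfolding labels_def influential_labels_def using reach_eq[of j j' s] by simp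

definition good :: "nat set" where
  "good = {j. j < m \<and> copy_cost R ps C j < P * K * (1 - 2 * \<delta>) * cube_size R n}"

lemma card_good: "\<delta> * m < card good"
proof -
  define B where "B = P * K * cube_size R n"
  have "0 < B" unfolding B_def using K_pos P_pos cube_size_pos[of R n] by simp
  have "card ({..<m} - good) = m - card good" by (subst card_Diff_subset) (auto simp: good_def)
  moreover have "card good \<le> card {..<m}" by (rule card_mono) (auto simp: good_def)
  ultimately have "B * ((1 - 2 * \<delta>) * (real m - card good)) = (\<Sum>j\<in>{..<m} - good. B * (1 - 2 * \<delta>))"
    by (simp add: of_nat_diff mult_ac)
  also have "\<dots> \<le> (\<Sum>j\<in>{..<m} - good. real (copy_cost R ps C j))"
    by (intro sum_mono) (auto simp: good_def B_def mult_ac not_less)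
  also have "\<dots> \<le> (\<Sum>j<m. real (copy_cost R ps C j))" by (intro sum_mono2) auto
  also have "\<dots> < B * ((1 - 3 * \<delta>) * m)" using cheap by (simp add: B_def mult_ac)
  finally have "(1 - 2 * \<delta>) * (real m - card good) < (1 - 3 * \<delta>) * m"
    using \<open>0 < B\<close> mult_less_cancel_left_pos by blast
  then have "\<delta> * m < (1 - 2 * \<delta>) * card good" by (simp add: algebra_simps)
  also have "\<dots> \<le> 1 * real (card good)" using \<delta> by (intro mult_right_mono) auto
  finally show ?thesis by simp
qed

lemma cheap_labelling_reach:
  assumes "j \<in> good"
  shows "cheap_labelling HV F A V E w l ter D K n P Q R (ps j) (reach j) \<delta> \<tau>"
proof
  have j: "j < m" using assms by (simp add: good_def)
  show "ps j permutes {..<R}" by (rule ps[OF j])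
  show "a \<in> reach j (Node True (ter a) z)" if "a \<in> A" "z \<subseteq> coords R n" for a z
    using that j by (rule reach_source)
  show "a \<notin> reach j (Node True (ter b) z)" if "(a, b) \<in> F" "a \<in> A" "b \<notin> A"
    "z \<subseteq> coords R n" for a b z
    using that j by (rule reach_sink)
  have "gadget_cost R (ps j) (decreases (reach j)) \<le> copy_cost R ps C j"
    unfolding copy_cost_def
  proof (rule gadget_cost_mono)
    fix p q assume "p \<in> gadget_vertices R" "q \<in> gadget_vertices R" "decreases (reach j) p q"
    then show "((j, p), (j, q)) \<in> C" using reach_mono[of j p j q] j
      by (auto simp: decreases_def kept_def positions_def)
  qed
  then show "real (gadget_cost R (ps j) (decreases (reach j))) <
      P * K * (1 - 2 * \<delta>) * cube_size R n"
    using assms by (simp add: good_def)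
qed (fact \<delta> \<tau> dichotomy)+

lemma soundness:
  assumes R: "0 < R" and \<Lambda>: "real (card V * card A) * (4 * P * K / \<tau>) \<le> \<Lambda>"
  obtains f g where "\<And>u. f u < R" "\<And>v. g v < R"
    "\<delta> * m \<le> real \<Lambda> * real \<Lambda> * real (card {j. j < m \<and> g (vs j) = ps j (f (us j))})"
proof -
  define LU where "LU u = labels (SOME j. j < m \<and> us j = u) True" for u
  define LV where "LV v = labels (SOME j. j < m \<and> vs j = v) False" for v
  have LU: "LU (us j) = labels j True" if "j < m" for j
    unfolding LU_def using someI[of "\<lambda>j'. j' < m \<and> us j' = us j" j] that by (intro labels_eq) auto
  have LV: "LV (vs j) = labels j False" if "j < m" for j
    unfolding LV_def using someI[of "\<lambda>j'. j' < m \<and> vs j' = vs j" j] that by (intro labels_eq) auto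
  have matching: "\<exists>i\<in>LU (us j). ps j i \<in> LV (vs j)" and small: "card (labels j s) \<le> \<Lambda>"
    if j: "j \<in> good" for j s
  proof -
    interpret cheap_labelling HV F A V E w l ter D K n P Q R "ps j" "reach j" \<delta> \<tau>
      by (rule cheap_labelling_reach[OF j])
    show "\<exists>i\<in>LU (us j). ps j i \<in> LV (vs j)"
      using ex_matching_labels j LU LV by (simp add: labels_def good_def)
    show "card (labels j s) \<le> \<Lambda>" using card_influential_labels_le[of s] \<Lambda> by (simp add: labels_def)
  qed
  obtain f g where f: "\<And>u. f u < R" and g: "\<And>v. g v < R"
    and sat: "card good \<le> \<Lambda> * \<Lambda> * card {j \<in> good. g (vs j) = ps j (f (us j))}"
  proof (rule obtain_labelling_of_label_sets[OF R, of LU LV good us ps vs \<Lambda>])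
    show "LU u \<subseteq> {..<R}" "LV v \<subseteq> {..<R}" for u v
      by (auto simp: LU_def LV_def labels_def influential_labels_def)
    show "card (LU (us j)) \<le> \<Lambda>" "card (LV (vs j)) \<le> \<Lambda>" if "j \<in> good" for j
      using small[OF that] that LU LV by (simp_all add: good_def)
  qed (use matching in \<open>auto simp: good_def\<close>)
  have "card {j \<in> good. g (vs j) = ps j (f (us j))} \<le> card {j. j < m \<and> g (vs j) = ps j (f (us j))}"
    by (intro card_mono) (auto simp: good_def)
  then have "card good \<le> \<Lambda> * \<Lambda> * card {j. j < m \<and> g (vs j) = ps j (f (us j))}"
    by (intro order.trans[OF sat] mult_le_mono2)
  then have "real (card good) \<le> real (\<Lambda> * \<Lambda> * card {j. j < m \<and> g (vs j) = ps j (f (us j))})"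
    by (rule of_nat_mono)
  then show ?thesis using card_good f g by (intro that[of f g]) simp_all
qed

end

section \<open>Gap instances\<close>

lemma ex_apath_iff_rtrancl:
  assumes "pair_wf_digraph G" "u \<in> pverts G"
  shows "(\<exists>p. pre_digraph.apath (with_proj G) u p v) \<longleftrightarrow> (u, v) \<in> (parcs G)\<^sup>*"
proof -
  interpret pair_wf_digraph G by fact
  have "(u, v) \<in> rtrancl_on (pverts G) (parcs G) \<longleftrightarrow> (u, v) \<in> (parcs G)\<^sup>*"
  proof
    assume uv: "(u, v) \<in> (parcs G)\<^sup>*"
    then have "v \<in> pverts G" using assms(2) by (induction) (auto dest: in_arcsD2)
    with uv show "(u, v) \<in> rtrancl_on (pverts G) (parcs G)"
      using assms(2)
      by (intro rtrancl_consistent_rtrancl_on) (auto dest: in_arcsD1 in_arcsD2)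
  qed (rule rtrancl_on_rtranclI)
  then show ?thesis using reachable_apath[of u v] unfolding reachable_def by simp
qed

definition separates :: "dmc \<Rightarrow> (nat \<times> nat) set \<Rightarrow> (nat \<times> nat) set \<Rightarrow> bool" where
  "separates I F C \<longleftrightarrow> C \<subseteq> parcs (supply_graph I) \<and>
     (\<forall>(s, t) \<in> F. (terminal I s, terminal I t) \<notin> (parcs (supply_graph I) - C)\<^sup>*)"

lemma multicut_iff_separates:
  assumes "pair_digraph H" "dmc_instance H I"
  shows "multicut H I C \<longleftrightarrow> separates I (parcs H) C"
proof -
  interpret H: pair_digraph H by fact
  interpret G: pair_fin_digraph "supply_graph I" using assms(2) by (simp add: dmc_instance_def)
  have "(\<exists>p. pre_digraph.apath (with_proj ((supply_graph I)\<lparr>parcs := parcs (supply_graph I) - C\<rparr>))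
      (terminal I s) p (terminal I t))
      \<longleftrightarrow> (terminal I s, terminal I t) \<in> (parcs (supply_graph I) - C)\<^sup>*" if "(s, t) \<in> parcs H" for s t
  proof -
    have "terminal I s \<in> pverts (supply_graph I)"
      using H.in_arcsD1[OF that] assms(2) by (auto simp: dmc_instance_def)
    moreover have "pair_wf_digraph ((supply_graph I)\<lparr>parcs := parcs (supply_graph I) - C\<rparr>)"
      by unfold_locales (auto dest: G.in_arcsD1 G.in_arcsD2)
    ultimately show ?thesis
      using ex_apath_iff_rtrancl[of "(supply_graph I)\<lparr>parcs := parcs (supply_graph I) - C\<rparr>"
        "terminal I s" "terminal I t"]
      by simp
  qed
  then show ?thesis unfolding multicut_def separates_def by blast
qed

lemma separates_all:
  assumes "pair_digraph H" "dmc_instance H I" "F \<subseteq> parcs H"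
  shows "separates I F (parcs (supply_graph I))"
proof -
  interpret H: pair_digraph H by fact
  have "terminal I s \<noteq> terminal I t" if "(s, t) \<in> F" for s t
  proof
    assume "terminal I s = terminal I t"
    moreover have st: "(s, t) \<in> parcs H" using that assms(3) by auto
    ultimately have "s = t"
      using H.in_arcsD1[OF st] H.in_arcsD2[OF st] assms(2)
      by (auto simp: dmc_instance_def dest: inj_onD)
    then show False using H.pair_no_loops[OF st] by simp
  qed
  then show ?thesis by (auto simp: separates_def)
qed

lemma multicut_opt_le:
  assumes "dmc_instance H I" "multicut H I C"
  shows "multicut_opt H I \<le> (\<Sum>e\<in>C. weight I e)"
proof -
  have "bdd_below ((\<lambda>C. \<Sum>e\<in>C. weight I e) ` {C. multicut H I C})"
    using assms(1)
    by (intro bdd_belowI[of _ 0]) (force simp: multicut_def dmc_instance_def intro!: sum_nonneg)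
  then show ?thesis unfolding multicut_opt_def using assms(2) by (intro cINF_lower) auto
qed

lemma le_multicut_opt:
  assumes "pair_digraph H" "dmc_instance H I" "\<And>C. multicut H I C \<Longrightarrow> b \<le> (\<Sum>e\<in>C. weight I e)"
  shows "b \<le> multicut_opt H I"
proof -
  have "multicut H I (parcs (supply_graph I))"
    using multicut_iff_separates[OF assms(1,2)] separates_all[OF assms(1,2)] by blast
  then show ?thesis unfolding multicut_opt_def using assms(3) by (intro cINF_greatest) auto
qed

lemma multicut_opt_nonneg:
  assumes "pair_digraph H" "dmc_instance H I"
  shows "0 \<le> multicut_opt H I"
  by (rule le_multicut_opt[OF assms])
    (use assms(2) in \<open>force simp: multicut_def dmc_instance_def intro!: sum_nonneg\<close>)

lemma unit_lengths_feasible: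
  assumes H: "pair_digraph H" and I: "dmc_instance H I"
  shows "distance_lp_feasible H I (\<lambda>_. 1)"
  unfolding distance_lp_feasible_def
proof (intro conjI ballI, simp, clarify)
  fix s t p
  assume st: "(s, t) \<in> parcs H"
    and p: "pre_digraph.apath (with_proj (supply_graph I)) (terminal I s) p (terminal I t)"
  interpret G: pair_fin_digraph "supply_graph I" using I by (simp add: dmc_instance_def)
  have "separates I (parcs H) (parcs (supply_graph I))" using separates_all[OF H I] by blast
  then have "terminal I s \<noteq> terminal I t" using st by (auto simp: separates_def)
  then have "p \<noteq> []" using p by (auto simp: G.apath_Nil_iff)
  then show "1 \<le> (\<Sum>e\<leftarrow>p. 1 :: real)" by (cases p) (auto simp: sum_list_triv)
qed

lemma separates_UN:
  assumes "\<And>j. j \<in> J \<Longrightarrow> separates I (F j) (C j)"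
  shows "separates I (\<Union>j\<in>J. F j) (\<Union>j\<in>J. C j)"
proof -
  have "(terminal I s, terminal I t) \<notin> (parcs (supply_graph I) - (\<Union>j\<in>J. C j))\<^sup>*"
    if "j \<in> J" "(s, t) \<in> F j" for j s t
  proof -
    have "(parcs (supply_graph I) - (\<Union>j\<in>J. C j))\<^sup>* \<subseteq> (parcs (supply_graph I) - C j)\<^sup>*"
      using that(1) by (intro rtrancl_mono) auto
    then show ?thesis using assms[OF that(1)] that(2) by (auto simp: separates_def)
  qed
  moreover have "(\<Union>j\<in>J. C j) \<subseteq> parcs (supply_graph I)" using assms by (auto simp: separates_def)
  ultimately show ?thesis unfolding separates_def by blast
qed

lemma sum_UN_le:
  fixes f :: "'a \<Rightarrow> real"
  assumes "finite J" "\<And>j. j \<in> J \<Longrightarrow> finite (C j)" "\<And>j e. j \<in> J \<Longrightarrow> e \<in> C j \<Longrightarrow> 0 \<le> f e"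
  shows "sum f (\<Union>j\<in>J. C j) \<le> (\<Sum>j\<in>J. sum f (C j))"
  using assms
proof (induction J rule: finite_induct)
  case (insert j J)
  have finite: "finite (C j)" "finite (\<Union>j\<in>J. C j)" using insert by auto
  have "0 \<le> sum f (C j \<inter> (\<Union>j\<in>J. C j))" using insert.prems(2) by (intro sum_nonneg) auto
  then have "sum f (C j \<union> (\<Union>j\<in>J. C j)) \<le> sum f (C j) + sum f (\<Union>j\<in>J. C j)"
    using sum.union_inter[OF finite, of f] by simp
  also have "sum f (\<Union>j\<in>J. C j) \<le> (\<Sum>j\<in>J. sum f (C j))" by (rule insert.IH) (use insert.prems in auto)
  finally show ?case using insert.hyps by simp
qed simp

definition lp_value :: "dmc \<Rightarrow> (nat \<times> nat \<Rightarrow> real) \<Rightarrow> real" where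
  "lp_value I x = (\<Sum>e\<in>parcs (supply_graph I). weight I e * x e)"

definition gap_witness :: "nat pair_pre_digraph \<Rightarrow> real \<Rightarrow> (nat \<times> nat) set \<Rightarrow> dmc \<Rightarrow>
    (nat \<times> nat \<Rightarrow> real) \<Rightarrow> bool" where
  "gap_witness H \<rho> F I x \<longleftrightarrow> dmc_instance H I \<and> distance_lp_feasible H I x \<and>
     (\<forall>C. separates I F C \<longrightarrow> \<rho> * lp_value I x < (\<Sum>e\<in>C. weight I e))"

lemma gap_witness_all_demands:
  assumes H: "pair_digraph H" and r: "0 < r" "ereal r < flow_cut_gap H"
  obtains I x where "gap_witness H r (parcs H) I x"
proof -
  obtain I where I: "dmc_instance H I" "distance_lp_opt H I > 0"
    "r < multicut_opt H I / distance_lp_opt H I"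
    using r(2) unfolding flow_cut_gap_def less_SUP_iff by auto
  have "distance_lp_opt H I < multicut_opt H I / r" using I(2,3) r(1) by (simp add: field_simps)
  then have "Inf (lp_value I ` {x. distance_lp_feasible H I x}) < multicut_opt H I / r"
    by (simp add: distance_lp_opt_def lp_value_def)
  then obtain x where x: "distance_lp_feasible H I x" "lp_value I x < multicut_opt H I / r"
    using cInf_lessD[of "lp_value I ` {x. distance_lp_feasible H I x}"]
      unit_lengths_feasible[OF H I(1)] by blast
  have "r * lp_value I x < (\<Sum>e\<in>C. weight I e)" if "separates I (parcs H) C" for C
  proof -
    have "r * lp_value I x < multicut_opt H I" using x(2) r(1) by (simp add: field_simps)
    also have "\<dots> \<le> (\<Sum>e\<in>C. weight I e)"
      using that multicut_iff_separates[OF H I(1)] by (intro multicut_opt_le I(1)) simp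
    finally show ?thesis .
  qed
  then have "gap_witness H r (parcs H) I x" using I(1) x(1) by (simp add: gap_witness_def)
  then show ?thesis by (rule that)
qed

text \<open>If every piece had a cheap cut, the union of these cuts would be too cheap for all demands.\<close>

lemma gap_witness_piece:
  fixes \<rho> :: real and F :: "'j \<Rightarrow> (nat \<times> nat) set"
  assumes H: "pair_digraph H" and J: "finite J" "J \<noteq> {}" and F: "(\<Union>j\<in>J. F j) = parcs H"
    and \<rho>: "0 < \<rho>" "ereal (real (card J) * \<rho>) < flow_cut_gap H"
  obtains I x j where "j \<in> J" "gap_witness H \<rho> (F j) I x"
proof -
  have "0 < real (card J) * \<rho>" using J \<rho>(1) by (simp add: card_gt_0_iff)
  then obtain I x where W: "gap_witness H (real (card J) * \<rho>) (parcs H) I x"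
    using gap_witness_all_demands[OF H _ \<rho>(2)] by blast
  then have I: "dmc_instance H I" by (simp add: gap_witness_def)
  interpret G: pair_fin_digraph "supply_graph I" using I by (simp add: dmc_instance_def)
  have "\<exists>j\<in>J. \<forall>C. separates I (F j) C \<longrightarrow> \<rho> * lp_value I x < (\<Sum>e\<in>C. weight I e)"
  proof (rule ccontr)
    assume "\<not> ?thesis"
    then obtain C where C: "\<And>j. j \<in> J \<Longrightarrow> separates I (F j) (C j)"
      "\<And>j. j \<in> J \<Longrightarrow> (\<Sum>e\<in>C j. weight I e) \<le> \<rho> * lp_value I x"
      by (metis not_le)
    have sub: "C j \<subseteq> parcs (supply_graph I)" if "j \<in> J" for j
      using C(1)[OF that] by (simp add: separates_def)
    have "real (card J) * \<rho> * lp_value I x < sum (weight I) (\<Union>j\<in>J. C j)"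
      using W separates_UN[of J I F C, OF C(1)] by (simp add: gap_witness_def F)
    also have "\<dots> \<le> (\<Sum>j\<in>J. sum (weight I) (C j))"
      using I sub finite_subset[OF sub G.pair_finite_arcs]
      by (intro sum_UN_le J(1)) (auto simp: dmc_instance_def)
    also have "\<dots> \<le> (\<Sum>j\<in>J. \<rho> * lp_value I x)" using C(2) by (rule sum_mono)
    finally show False by simp
  qed
  then show ?thesis using that W by (auto simp: gap_witness_def)
qed

subsection \<open>Integral distances and weights\<close>

lemma obtain_integer_scaling:
  fixes w x :: "'e \<Rightarrow> real" and \<rho> c :: real
  assumes "finite E" and w: "\<And>e. e \<in> E \<Longrightarrow> 0 \<le> w e" and x: "\<And>e. e \<in> E \<Longrightarrow> 0 \<le> x e"
    and \<rho>: "0 < \<rho>" and gap: "\<rho> * (\<Sum>e\<in>E. w e * x e) < c"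
  obtains n :: nat and w' l :: "'e \<Rightarrow> nat" where "\<And>e. e \<in> E \<Longrightarrow> 2 ^ n * w e \<le> w' e"
    "\<And>e. e \<in> E \<Longrightarrow> 2 ^ n * x e \<le> l e"
    "\<rho> * (\<Sum>e\<in>E. real (w' e * l e)) < 2 ^ n * (2 ^ n * c)"
proof -
  define lp where "lp = (\<Sum>e\<in>E. w e * x e)"
  define r where "r = (\<Sum>e\<in>E. w e) + (\<Sum>e\<in>E. x e) + card E"
  obtain n :: nat where n: "\<rho> * r / (c - \<rho> * lp) < 2 ^ n" using real_arch_pow[of 2] by auto
  define N :: real where "N = 2 ^ n"
  have N: "1 \<le> N" by (simp add: N_def)
  define w' where "w' e = nat \<lceil>N * w e\<rceil>" for e
  define l where "l e = nat \<lceil>N * x e\<rceil>" for e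
  have w': "N * w e \<le> w' e" "w' e \<le> N * w e + 1" and l: "N * x e \<le> l e"
    "l e \<le> N * x e + 1" if "e \<in> E" for e
    using w[OF that] x[OF that] N
    by (simp_all add: w'_def l_def le_of_int_ceiling of_int_ceiling_le_add_one)
  have "real (w' e * l e) \<le> (N * w e + 1) * (N * x e + 1)" if "e \<in> E" for e
    unfolding of_nat_mult using w'[OF that] l[OF that] w[OF that] N by (intro mult_mono) auto
  then have "(\<Sum>e\<in>E. real (w' e * l e)) \<le> (\<Sum>e\<in>E. (N * w e + 1) * (N * x e + 1))" by (rule sum_mono)
  also have "\<dots> = N * N * lp + N * (\<Sum>e\<in>E. w e) + N * (\<Sum>e\<in>E. x e) + card E"
    by (simp add: lp_def sum_distrib_left algebra_simps sum.distrib)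
  also have "\<dots> \<le> N * N * lp + N * r"
    using mult_right_mono[OF N, of "real (card E)"] by (simp add: r_def algebra_simps)
  finally have "\<rho> * (\<Sum>e\<in>E. real (w' e * l e)) \<le> \<rho> * (N * N * lp + N * r)"
    using \<rho> by (intro mult_left_mono) auto
  also have "\<dots> = N * (N * (\<rho> * lp) + \<rho> * r)" by (simp add: algebra_simps)
  also have "\<dots> < N * (N * c)"
  proof -
    have "\<rho> * r < N * (c - \<rho> * lp)" using n gap by (simp add: N_def lp_def field_simps)
    then have "N * (\<rho> * lp) + \<rho> * r < N * c" by (simp add: algebra_simps)
    then show ?thesis using N by (intro mult_strict_left_mono) auto
  qed
  finally show ?thesis using w'(1) l(1) unfolding N_def by (intro that[of n w' l]) auto
qed

lemma obtain_min_cut_value: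
  assumes H: "pair_digraph H" and F: "F \<subseteq> parcs H" and W: "gap_witness H \<rho> F I x"
  obtains c where "\<rho> * lp_value I x < c" "\<And>C. separates I F C \<Longrightarrow> c \<le> (\<Sum>e\<in>C. weight I e)"
proof -
  have I: "dmc_instance H I" using W by (simp add: gap_witness_def)
  interpret G: pair_fin_digraph "supply_graph I" using I by (simp add: dmc_instance_def)
  define costs where "costs = (\<lambda>C. \<Sum>e\<in>C. weight I e) ` {C. separates I F C}"
  have "finite {C. separates I F C}"
    by (rule finite_subset[of _ "Pow (parcs (supply_graph I))"]) (auto simp: separates_def)
  then have finite_costs: "finite costs" unfolding costs_def by simp
  moreover have "costs \<noteq> {}" using separates_all[OF H I F] by (auto simp: costs_def)
  ultimately have "Min costs \<in> costs" by (rule Min_in)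
  then have "\<rho> * lp_value I x < Min costs" using W by (auto simp: costs_def gap_witness_def)
  moreover have "Min costs \<le> (\<Sum>e\<in>C. weight I e)" if "separates I F C" for C
    using finite_costs that by (intro Min_le) (auto simp: costs_def)
  ultimately show ?thesis by (rule that)
qed

definition capped_distance :: "dmc \<Rightarrow> nat \<Rightarrow> (nat \<times> nat \<Rightarrow> nat) \<Rightarrow> nat \<Rightarrow> nat \<Rightarrow> nat" where
  "capped_distance I N l a v =
     (LEAST d. d \<in> insert N {\<Sum>e\<leftarrow>p. l e | p. pre_digraph.awalk (with_proj (supply_graph I))
       (terminal I a) p v})"

lemma capped_distance_cases:
  obtains "capped_distance I N l a v = N"
  | p where "pre_digraph.awalk (with_proj (supply_graph I)) (terminal I a) p v"
    "capped_distance I N l a v = (\<Sum>e\<leftarrow>p. l e)"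
proof -
  let ?lengths = "insert N {\<Sum>e\<leftarrow>p. l e | p. pre_digraph.awalk (with_proj (supply_graph I))
      (terminal I a) p v}"
  have "capped_distance I N l a v \<in> ?lengths"
    unfolding capped_distance_def by (rule LeastI[of _ N]) simp
  then show ?thesis using that by auto
qed

lemma
  shows capped_distance_le_cap: "capped_distance I N l a v \<le> N"
    and capped_distance_le: "pre_digraph.awalk (with_proj (supply_graph I)) (terminal I a) p v \<Longrightarrow>
      capped_distance I N l a v \<le> (\<Sum>e\<leftarrow>p. l e)"
  unfolding capped_distance_def by (auto intro: Least_le)

lemma capped_distance_source:
  assumes "dmc_instance H I" "a \<in> pverts H"
  shows "capped_distance I N l a (terminal I a) = 0"
proof -
  interpret G: pair_fin_digraph "supply_graph I" using assms(1) by (simp add: dmc_instance_def)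
  have "terminal I a \<in> pverts (supply_graph I)" using assms by (auto simp: dmc_instance_def)
  then have "G.awalk (terminal I a) [] (terminal I a)" by (simp add: G.awalk_Nil_iff)
  from capped_distance_le[OF this] show ?thesis by simp
qed

lemma capped_distance_arc:
  assumes I: "dmc_instance H I" and uv: "(u, v) \<in> parcs (supply_graph I)"
  shows "capped_distance I N l a v \<le> capped_distance I N l a u + l (u, v)"
proof (cases rule: capped_distance_cases[of I N l a u])
  case 1
  then show ?thesis using capped_distance_le_cap[of I N l a v] by simp
next
  case (2 p)
  interpret G: pair_fin_digraph "supply_graph I" using I by (simp add: dmc_instance_def)
  have "G.awalk u [(u, v)] v" using uv G.in_arcsD1 G.in_arcsD2 by (auto simp: G.awalk_def)
  then have "G.awalk (terminal I a) (p @ [(u, v)]) v"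
    using 2(1) by (auto simp: G.awalk_append_iff G.awlast_if_cas G.awalk_def)
  from capped_distance_le[OF this] show ?thesis using 2(2) by simp
qed

lemma sum_set_le_sum_list: "(\<Sum>e\<in>set p. l e) \<le> (\<Sum>e\<leftarrow>p. l e)" for l :: "'a \<Rightarrow> nat"
proof (induction p)
  case (Cons e p)
  then show ?case by (cases "e \<in> set p") (auto simp: insert_absorb)
qed simp

lemma le_capped_distance_sink:
  assumes I: "dmc_instance H I" and x: "distance_lp_feasible H I x" and ab: "(a, b) \<in> parcs H"
    and l: "\<And>e. e \<in> parcs (supply_graph I) \<Longrightarrow> real N * x e \<le> l e"
  shows "N \<le> capped_distance I N l a (terminal I b)"
proof (cases rule: capped_distance_cases[of I N l a "terminal I b"])
  case (2 p)
  interpret G: pair_fin_digraph "supply_graph I" using I by (simp add: dmc_instance_def)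
  define q where "q = G.awalk_to_apath p"
  have q: "G.apath (terminal I a) q (terminal I b)" "set q \<subseteq> set p"
    unfolding q_def using 2(1) by (auto intro: G.apath_awalk_to_apath dest: G.awalk_to_apath_subset)
  have "distinct q" using q(1) G.distinct_verts_imp_distinct by (auto simp: G.apath_def)
  have p: "set p \<subseteq> parcs (supply_graph I)" using 2(1) by (auto simp: G.awalk_def)
  have "1 \<le> (\<Sum>e\<leftarrow>q. x e)" using x ab q(1) unfolding distance_lp_feasible_def by blast
  then have "real N * 1 \<le> real N * (\<Sum>e\<leftarrow>q. x e)" by (rule mult_left_mono) simp
  also have "\<dots> = (\<Sum>e\<in>set q. real N * x e)"
    using \<open>distinct q\<close> by (simp add: sum_list_distinct_conv_sum_set sum_distrib_left)
  also have "\<dots> \<le> (\<Sum>e\<in>set q. real (l e))" using l q(2) p by (intro sum_mono) auto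
  also have "\<dots> = real (\<Sum>e\<in>set q. l e)" by simp
  finally have "N \<le> (\<Sum>e\<in>set q. l e)" by (simp only: of_nat_le_iff mult_1_right)
  also have "\<dots> \<le> (\<Sum>e\<in>set p. l e)" using q(2) by (intro sum_mono2) auto
  also have "\<dots> \<le> (\<Sum>e\<leftarrow>p. l e)" by (rule sum_set_le_sum_list)
  finally show ?thesis using 2(2) by simp
qed simp

lemma separates_decreasing_arcs:
  assumes "\<And>a b. (a, b) \<in> F \<Longrightarrow> a \<in> S (terminal I a) \<and> a \<notin> S (terminal I b)"
  shows "separates I F {(u, v) \<in> parcs (supply_graph I). \<not> S u \<subseteq> S v}"
proof -
  let ?C = "{(u, v) \<in> parcs (supply_graph I). \<not> S u \<subseteq> S v}"
  have "S u \<subseteq> S v" if "(u, v) \<in> (parcs (supply_graph I) - ?C)\<^sup>*" for u v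
    using that by (induction rule: rtrancl_induct) auto
  then show ?thesis unfolding separates_def using assms by fastforce
qed

text \<open>
  Weights and lengths are scaled to integers, \<open>D a\<close> is the distance from terminal \<open>a\<close>, and cuts
  become labellings of the vertices by sets of sources.
\<close>

locale integral_gap =
  fixes H :: "nat pair_pre_digraph" and I :: dmc and F :: "(nat \<times> nat) set" and \<rho> :: real
    and n :: nat and w l :: "nat \<times> nat \<Rightarrow> nat" and D :: "nat \<Rightarrow> nat \<Rightarrow> nat" and K :: real
  assumes H: "pair_digraph H" and I: "dmc_instance H I" and F: "F \<subseteq> parcs H" and \<rho>: "0 < \<rho>"
    and D_source: "a \<in> pverts H \<Longrightarrow> D a (terminal I a) = 0"
    and D_arc: "(u, v) \<in> parcs (supply_graph I) \<Longrightarrow> D a v \<le> D a u + l (u, v)"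
    and D_sink: "(a, b) \<in> F \<Longrightarrow> 2 ^ n \<le> D a (terminal I b)"
    and cut_ge: "(\<And>a b. (a, b) \<in> F \<Longrightarrow> a \<in> S (terminal I a) \<and> a \<notin> S (terminal I b)) \<Longrightarrow>
       K \<le> (\<Sum>(u, v) | (u, v) \<in> parcs (supply_graph I) \<and> \<not> S u \<subseteq> S v. real (w (u, v)))"
    and lp_less: "\<rho> * (\<Sum>e\<in>parcs (supply_graph I). real (w e * l e)) < 2 ^ n * K"
begin

lemma K_pos: "0 < K"
proof -
  have "0 \<le> \<rho> * (\<Sum>e\<in>parcs (supply_graph I). real (w e * l e))"
    using \<rho> by (intro mult_nonneg_nonneg sum_nonneg) auto
  then have "0 < 2 ^ n * K" using lp_less by linarith
  then show ?thesis by (simp add: zero_less_mult_iff)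
qed

end

lemma ex_integral_gap:
  assumes H: "pair_digraph H" and F: "F \<subseteq> parcs H" and \<rho>: "0 < \<rho>" and W: "gap_witness H \<rho> F I x"
  shows "\<exists>n w l D K. integral_gap H I F \<rho> n w l D K"
proof -
  let ?E = "parcs (supply_graph I)"
  have I: "dmc_instance H I" and x: "distance_lp_feasible H I x"
    using W by (simp_all add: gap_witness_def)
  interpret G: pair_fin_digraph "supply_graph I" using I by (simp add: dmc_instance_def)
  obtain c where c: "\<rho> * lp_value I x < c" "\<And>C. separates I F C \<Longrightarrow> c \<le> (\<Sum>e\<in>C. weight I e)"
    using obtain_min_cut_value[OF H F W] by blast
  obtain n w l where w: "\<And>e. e \<in> ?E \<Longrightarrow> 2 ^ n * weight I e \<le> real (w e)"
    and l: "\<And>e. e \<in> ?E \<Longrightarrow> 2 ^ n * x e \<le> real (l e)"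
    and lp: "\<rho> * (\<Sum>e\<in>?E. real (w e * l e)) < 2 ^ n * (2 ^ n * c)"
    by (rule obtain_integer_scaling[OF G.pair_finite_arcs _ _ \<rho> c(1)[unfolded lp_value_def]])
      (use I x in \<open>auto simp: dmc_instance_def distance_lp_feasible_def\<close>)
  have "integral_gap H I F \<rho> n w l (capped_distance I (2 ^ n) l) (2 ^ n * c)"
  proof (rule integral_gap.intro)
    show "capped_distance I (2 ^ n) l a (terminal I a) = 0" if "a \<in> pverts H" for a
      using I that by (rule capped_distance_source)
    show "capped_distance I (2 ^ n) l a v \<le> capped_distance I (2 ^ n) l a u + l (u, v)"
      if "(u, v) \<in> ?E" for a u v
      using I that by (rule capped_distance_arc)
    show "2 ^ n \<le> capped_distance I (2 ^ n) l a (terminal I b)" if "(a, b) \<in> F" for a b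
      using l that F by (intro le_capped_distance_sink[OF I x]) auto
    fix S :: "nat \<Rightarrow> nat set"
    assume S: "\<And>a b. (a, b) \<in> F \<Longrightarrow> a \<in> S (terminal I a) \<and> a \<notin> S (terminal I b)"
    let ?C = "{(u, v) \<in> ?E. \<not> S u \<subseteq> S v}"
    have "2 ^ n * c \<le> 2 ^ n * (\<Sum>e\<in>?C. weight I e)"
      using c(2)[OF separates_decreasing_arcs[of F S I, OF S]] by simp
    also have "\<dots> \<le> (\<Sum>e\<in>?C. real (w e))"
      unfolding sum_distrib_left using w by (intro sum_mono) auto
    also have "\<dots> = (\<Sum>(u, v) | (u, v) \<in> ?E \<and> \<not> S u \<subseteq> S v. real (w (u, v)))" by (intro sum.cong) auto
    finally show "2 ^ n * c \<le> (\<Sum>(u, v) | (u, v) \<in> ?E \<and> \<not> S u \<subseteq> S v. real (w (u, v)))" .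
  qed (fact H I F \<rho> lp)+
  then show ?thesis by blast
qed

subsection \<open>Bounds on the flow-cut gap\<close>

lemma feasible_arc_ge_1:
  assumes "pair_digraph H" "dmc_instance H I" "distance_lp_feasible H I x" "(s, t) \<in> parcs H"
    and st: "(terminal I s, terminal I t) \<in> parcs (supply_graph I)"
  shows "1 \<le> x (terminal I s, terminal I t)"
proof -
  interpret G: pair_fin_digraph "supply_graph I" using assms(2) by (simp add: dmc_instance_def)
  have "terminal I s \<noteq> terminal I t"
    using separates_all[OF assms(1,2), of "{(s, t)}"] assms(4) by (auto simp: separates_def)
  then have "G.apath (terminal I s) [(terminal I s, terminal I t)] (terminal I t)"
    using st G.in_arcsD1[OF st] G.in_arcsD2[OF st] by (auto simp: G.apath_def G.awalk_def)
  then have "1 \<le> (\<Sum>e\<leftarrow>[(terminal I s, terminal I t)]. x e)"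
    using assms(3,4) unfolding distance_lp_feasible_def by blast
  then show ?thesis by simp
qed

lemma flow_cut_gap_pos:
  assumes H: "pair_digraph H" and demand: "parcs H \<noteq> {}"
  shows "0 < flow_cut_gap H"
proof -
  interpret pair_digraph H by fact
  define I where "I = \<lparr>supply_graph = H, weight = \<lambda>_. 1, terminal = id\<rparr>"
  have I: "dmc_instance H I"
    unfolding dmc_instance_def I_def using pair_fin_digraph_axioms by simp
  have "real (card (parcs H)) \<le> multicut_opt H I"
  proof (rule le_multicut_opt[OF H I])
    fix C assume "multicut H I C"
    then have "separates I (parcs H) C" using multicut_iff_separates[OF H I] by simp
    then have "C = parcs H" by (fastforce simp: separates_def I_def)
    then show "real (card (parcs H)) \<le> (\<Sum>e\<in>C. weight I e)" by (simp add: I_def)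
  qed
  moreover have "real (card (parcs H)) \<le> distance_lp_opt H I"
    unfolding distance_lp_opt_def
  proof (rule cINF_greatest)
    show "{x. distance_lp_feasible H I x} \<noteq> {}" using unit_lengths_feasible[OF H I] by blast
    fix x assume "x \<in> {x. distance_lp_feasible H I x}"
    then have "1 \<le> x e" if "e \<in> parcs H" for e
      using feasible_arc_ge_1[OF H I, of x "fst e" "snd e"] that by (simp add: I_def)
    then have "(\<Sum>e\<in>parcs H. 1) \<le> (\<Sum>e\<in>parcs H. x e)" by (intro sum_mono) auto
    then show "real (card (parcs H)) \<le> (\<Sum>e\<in>parcs (supply_graph I). weight I e * x e)"
      by (simp add: I_def)
  qed
  moreover have "0 < card (parcs H)" using demand pair_finite_arcs by (simp add: card_gt_0_iff)
  ultimately have pos: "0 < distance_lp_opt H I" "0 < multicut_opt H I" by linarith+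
  then have "ereal (multicut_opt H I / distance_lp_opt H I) \<le> flow_cut_gap H"
    unfolding flow_cut_gap_def using I by (intro SUP_upper) auto
  moreover have "0 < ereal (multicut_opt H I / distance_lp_opt H I)" using pos by simp
  ultimately show ?thesis by (rule less_le_trans[rotated])
qed

text \<open>Cutting at a uniformly random distance below \<open>2 ^ n\<close> from the source costs the LP value.\<close>

lemma (in integral_gap) single_demand_le_lp:
  assumes ab: "F = {(a, b)}"
  shows "2 ^ n * K \<le> (\<Sum>e\<in>parcs (supply_graph I). real (w e * l e))"
proof -
  let ?E = "parcs (supply_graph I)"
  interpret H: pair_digraph H by (rule H)
  interpret G: pair_fin_digraph "supply_graph I" using I by (simp add: dmc_instance_def)
  define cut where "cut \<theta> e \<longleftrightarrow> D a (fst e) \<le> \<theta> \<and> \<theta> < D a (snd e)" for \<theta> and e :: "nat \<times> nat"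
  have threshold: "K \<le> (\<Sum>e\<in>?E. of_bool (cut \<theta> e) * real (w e))" if "\<theta> < 2 ^ n" for \<theta>
  proof -
    define S where "S v = {c. c = a \<and> D a v \<le> \<theta>}" for v
    have "a \<in> S (terminal I a)" "a \<notin> S (terminal I b)"
      using D_source[of a] D_sink[of a b] H.in_arcsD1[of a b] F ab that by (auto simp: S_def)
    then have "K \<le> (\<Sum>(u, v) | (u, v) \<in> ?E \<and> \<not> S u \<subseteq> S v. real (w (u, v)))"
      using ab by (intro cut_ge) auto
    also have "\<dots> = (\<Sum>e\<in>?E. of_bool (cut \<theta> e) * real (w e))"
      using G.pair_finite_arcs by (intro sum.mono_neutral_cong_left) (auto simp: S_def cut_def)
    finally show ?thesis .
  qed
  have "2 ^ n * K = (\<Sum>\<theta><(2 ^ n :: nat). K)" by simp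
  also have "\<dots> \<le> (\<Sum>\<theta><(2 ^ n :: nat). \<Sum>e\<in>?E. of_bool (cut \<theta> e) * real (w e))"
    by (intro sum_mono threshold) auto
  also have "\<dots> = (\<Sum>e\<in>?E. (\<Sum>\<theta><(2 ^ n :: nat). of_bool (cut \<theta> e)) * real (w e))"
    unfolding sum_distrib_right by (rule sum.swap)
  also have "\<dots> \<le> (\<Sum>e\<in>?E. real (l e) * real (w e))"
  proof (intro sum_mono mult_right_mono)
    fix e assume e: "e \<in> ?E"
    have "(\<Sum>\<theta><(2 ^ n :: nat). of_bool (cut \<theta> e)) = real (card ({..<2 ^ n :: nat} \<inter> {\<theta>. cut \<theta> e}))"
      by simp
    also have "card ({..<2 ^ n} \<inter> {\<theta>. cut \<theta> e}) \<le> card {D a (fst e)..<D a (snd e)}"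
      by (rule card_mono) (auto simp: cut_def)
    also have "\<dots> \<le> l e" using D_arc[of "fst e" "snd e" a] e by simp
    finally show "(\<Sum>\<theta><(2 ^ n :: nat). of_bool (cut \<theta> e)) \<le> real (l e)" by simp
  qed simp
  finally show ?thesis by (simp add: mult.commute)
qed

lemma flow_cut_gap_le_card_demands:
  assumes H: "pair_digraph H" and demand: "parcs H \<noteq> {}"
  shows "flow_cut_gap H \<le> ereal (real (card (parcs H)))"
proof (rule ccontr)
  assume "\<not> ?thesis"
  then have gap: "ereal (real (card (parcs H)) * 1) < flow_cut_gap H" by simp
  interpret pair_digraph H by fact
  have "(\<Union>e\<in>parcs H. {e}) = parcs H" by simp
  then obtain I x e where e: "e \<in> parcs H" and W: "gap_witness H 1 {e} I x"
    by (rule gap_witness_piece[OF H pair_finite_arcs demand _ zero_less_one gap]) blast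
  obtain a b where ab: "e = (a, b)" by fastforce
  have "{(a, b)} \<subseteq> parcs H" using e ab by simp
  from ex_integral_gap[OF H this zero_less_one W[unfolded ab]]
  obtain n w l D K where "integral_gap H I {(a, b)} 1 n w l D K" by blast
  then interpret integral_gap H I "{(a, b)}" 1 n w l D K .
  show False using single_demand_le_lp[OF refl] lp_less by simp
qed

lemma obtain_flow_cut_gap_real:
  assumes "pair_digraph H" "parcs H \<noteq> {}"
  obtains \<gamma> where "flow_cut_gap H = ereal \<gamma>" "0 < \<gamma>"
  using flow_cut_gap_pos[OF assms] flow_cut_gap_le_card_demands[OF assms]
  by (cases "flow_cut_gap H") auto

subsection \<open>Gap gadgets\<close>

lemma card_le_2_power_ceiling_log:
  assumes "2 \<le> k"
  shows "k \<le> 2 ^ nat \<lceil>log 2 (real k)\<rceil>" "0 < nat \<lceil>log 2 (real k)\<rceil>"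
proof -
  have "1 \<le> log 2 (real k)" using assms by (simp add: one_le_log_cancel_iff)
  then have ceiling: "1 \<le> \<lceil>log 2 (real k)\<rceil>" by linarith
  then show "0 < nat \<lceil>log 2 (real k)\<rceil>" by simp
  have "log 2 (real k) \<le> real (nat \<lceil>log 2 (real k)\<rceil>)" using ceiling by (simp add: le_of_int_ceiling)
  then have "real k \<le> 2 powr real (nat \<lceil>log 2 (real k)\<rceil>)"
    using assms by (subst (asm) log_le_iff) auto
  then show "k \<le> 2 ^ nat \<lceil>log 2 (real k)\<rceil>" by (simp add: powr_realpow flip: of_nat_le_iff)
qed

lemma (in pair_digraph) two_le_card_verts:
  assumes "parcs G \<noteq> {}"
  shows "2 \<le> card (pverts G)"
proof -
  obtain s t where st: "(s, t) \<in> parcs G" using assms by auto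
  then have "s \<noteq> t" "s \<in> pverts G" "t \<in> pverts G"
    using pair_no_loops[OF st] in_arcsD1[OF st] in_arcsD2[OF st] by auto
  then show ?thesis using card_mono[OF pair_finite_verts, of "{s, t}"] by simp
qed

lemma (in pair_digraph) obtain_bipartite_cover:
  assumes "card (pverts G) \<le> 2 ^ L"
  obtains A where "\<And>i. A i \<subseteq> pverts G"
    "(\<Union>i\<in>{..<L} \<times> (UNIV :: bool set). {(s, t) \<in> parcs G. s \<in> A i \<and> t \<notin> A i}) = parcs G"
proof -
  obtain num where num: "bij_betw num (pverts G) {0..<card (pverts G)}"
    using ex_bij_betw_finite_nat[OF pair_finite_verts] by blast
  define A where "A jb = {s \<in> pverts G. bit (num s) (fst jb) = snd jb}" for jb :: "nat \<times> bool"
  have "\<exists>j<L. s \<in> A (j, bit (num s) j) \<and> t \<notin> A (j, bit (num s) j)" if st: "(s, t) \<in> parcs G" for s t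
  proof -
    have V: "s \<in> pverts G" "t \<in> pverts G" "s \<noteq> t"
      using pair_no_loops[OF st] in_arcsD1[OF st] in_arcsD2[OF st] by auto
    then have "num s \<noteq> num t" using num by (auto simp: bij_betw_def dest: inj_onD)
    moreover have "num s < 2 ^ L" "num t < 2 ^ L"
      using bij_betw_apply[OF num V(1)] bij_betw_apply[OF num V(2)] assms by auto
    ultimately obtain j where "j < L" "bit (num s) j \<noteq> bit (num t) j"
      by (metis bit_eqI bit_take_bit_iff take_bit_nat_eq_self)
    then show ?thesis using V by (auto simp: A_def)
  qed
  then have "(\<Union>i\<in>{..<L} \<times> (UNIV :: bool set). {(s, t) \<in> parcs G. s \<in> A i \<and> t \<notin> A i}) = parcs G"
    by fastforce
  then show ?thesis by (intro that[of A]) (auto simp: A_def)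
qed

lemma gap_gadget_of_integral_gap:
  assumes "integral_gap H I {(s, t) \<in> parcs H. s \<in> A \<and> t \<notin> A} \<rho> n w l D K"
    and A: "A \<subseteq> pverts H" and P: "0 < P"
  shows "gap_gadget (pverts H) (parcs H) A (pverts (supply_graph I)) (parcs (supply_graph I)) w l
      (terminal I) D K n P"
proof -
  interpret integral_gap H I "{(s, t) \<in> parcs H. s \<in> A \<and> t \<notin> A}" \<rho> n w l D K by fact
  interpret H: pair_digraph H by (rule H)
  interpret G: pair_fin_digraph "supply_graph I" using I by (simp add: dmc_instance_def)
  show ?thesis
  proof
    show "finite (pverts H)" by (rule H.pair_finite_verts)
    show "finite (pverts (supply_graph I))" by (rule G.pair_finite_verts)
    show "parcs (supply_graph I) \<subseteq> pverts (supply_graph I) \<times> pverts (supply_graph I)"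
      using G.in_arcsD1 G.in_arcsD2 by auto
    show "parcs H \<subseteq> pverts H \<times> pverts H" using H.in_arcsD1 H.in_arcsD2 by auto
    show "(s, s) \<notin> parcs H" for s using H.pair_no_loops[of "(s, s)"] by auto
    show "terminal I ` pverts H \<subseteq> pverts (supply_graph I)" using I by (simp add: dmc_instance_def)
    show "K \<le> (\<Sum>(u, v) | (u, v) \<in> parcs (supply_graph I) \<and> \<not> S u \<subseteq> S v. real (w (u, v)))"
      if "\<And>a b. (a, b) \<in> parcs H \<Longrightarrow> a \<in> A \<Longrightarrow> b \<notin> A \<Longrightarrow> a \<in> S (terminal I a) \<and>
          a \<notin> S (terminal I b)" for S
      using that by (intro cut_ge) auto
  qed (use D_source D_arc D_sink K_pos A P in auto)
qed

lemma obtain_gap_gadget: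
  fixes \<rho> :: real
  assumes H: "pair_digraph H" and demand: "parcs H \<noteq> {}" and \<rho>: "0 < \<rho>"
    and gap: "ereal (2 * real_of_int \<lceil>log 2 (card (pverts H))\<rceil> * \<rho>) < flow_cut_gap H"
  obtains A V E w l ter D K n where
    "\<And>P. 0 < P \<Longrightarrow> gap_gadget (pverts H) (parcs H) A V E w l ter D K n P"
    "\<rho> * (\<Sum>e\<in>E. real (w e * l e)) < 2 ^ n * K"
proof -
  interpret pair_digraph H by fact
  define L where "L = nat \<lceil>log 2 (card (pverts H))\<rceil>"
  note L = card_le_2_power_ceiling_log[OF two_le_card_verts[OF demand], folded L_def]
  obtain A where A: "\<And>i. A i \<subseteq> pverts H"
    and cover: "(\<Union>i\<in>{..<L} \<times> (UNIV :: bool set). {(s, t) \<in> parcs H. s \<in> A i \<and> t \<notin> A i}) = parcs H"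
    using obtain_bipartite_cover[OF L(1)] by blast
  have "ereal (real (card ({..<L} \<times> (UNIV :: bool set))) * \<rho>) < flow_cut_gap H"
    using gap L(2) by (simp add: L_def card_cartesian_product mult_ac)
  then obtain I x i where W: "gap_witness H \<rho> {(s, t) \<in> parcs H. s \<in> A i \<and> t \<notin> A i} I x"
    using gap_witness_piece[OF H _ _ cover \<rho>] L(2) by fastforce
  have "{(s, t) \<in> parcs H. s \<in> A i \<and> t \<notin> A i} \<subseteq> parcs H" by auto
  from ex_integral_gap[OF H this \<rho> W]
  obtain n w l D K where gap: "integral_gap H I {(s, t) \<in> parcs H. s \<in> A i \<and> t \<notin> A i} \<rho> n w l D K"
    by blast
  show ?thesis
    by (rule that[OF gap_gadget_of_integral_gap[OF gap A] integral_gap.lp_less[OF gap]])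
qed

section \<open>Hardness of approximation\<close>

lemma class_P_subset_NP: "class_P \<subseteq> class_NP"
proof
  fix L assume "L \<in> class_P"
  then have L: "poly_time_on UNIV (\<lambda>x. [x \<in> L])" by (simp add: class_P_def)
  define unquote where "unquote = transduce (automaton [1, 0, 2] [2, 0, 2] (emit_in 1 1)) 0"
  have unquote: "unquote (enc_bits x) = x" for x
    unfolding unquote_def by (induction x) (auto simp: enc_bits_def automaton_def emit_in_def)
  have "computable 1 (\<lambda>s. s 0 \<in> UNIV) (\<lambda>s. unquote (s 0))"
    unfolding unquote_def by (rule computable_automaton[where n = 3]) (auto intro!: computable_var)
  then have "computable 1 (\<lambda>s. s 0 \<in> UNIV) (\<lambda>s. [unquote (s 0) \<in> L])"
    by (rule computable_call[OF L]) simp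
  then have "poly_time_on UNIV (\<lambda>y. [y \<in> {y. unquote y \<in> L}])"
    using poly_time_on_computable[of UNIV "\<lambda>y. [unquote y \<in> L]"] by simp
  then have "{y. unquote y \<in> L} \<in> class_P" by (simp add: class_P_def)
  then show "L \<in> class_NP"
    unfolding class_NP_def using unquote
    by (intro CollectI bexI[of _ "{y. unquote y \<in> L}"] exI[of _ 0]) auto
qed

lemma rtrancl_image_iff:
  assumes inj: "inj_on f A" and r: "r \<subseteq> A \<times> A" and xy: "x \<in> A" "y \<in> A"
  shows "(f x, f y) \<in> (map_prod f f ` r)\<^sup>* \<longleftrightarrow> (x, y) \<in> r\<^sup>*"
proof
  assume "(f x, f y) \<in> (map_prod f f ` r)\<^sup>*"
  then have "\<exists>z\<in>A. f y = f z \<and> (x, z) \<in> r\<^sup>*"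
  proof (induction "f y" arbitrary: y rule: rtrancl_induct)
    case base
    then show ?case using xy by (intro bexI[of _ x]) auto
  next
    case (step b)
    then obtain a c where ac: "(a, c) \<in> r" "b = f a" "f y = f c" by auto
    then obtain z where "z \<in> A" "b = f z" "(x, z) \<in> r\<^sup>*" using step(3)[of a] by auto
    moreover have "a \<in> A" "c \<in> A" using ac r by auto
    ultimately show ?case using ac inj by (metis inj_onD rtrancl.rtrancl_into_rtrancl)
  qed
  then show "(x, y) \<in> r\<^sup>*" using inj xy by (metis inj_onD)
next
  assume "(x, y) \<in> r\<^sup>*"
  then show "(f x, f y) \<in> (map_prod f f ` r)\<^sup>*"
    by induction (auto intro: rtrancl_into_rtrancl)
qed

lemma ug_satisfied_eq:
  "ug_satisfied U f g = real (card {j. j < length (ug_constraints U) \<and>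
      g (fst (snd (ug_constraints U ! j))) =
        snd (snd (ug_constraints U ! j)) (f (fst (ug_constraints U ! j)))})
    / real (length (ug_constraints U))"
  unfolding ug_satisfied_def length_filter_conv_card by (simp add: case_prod_unfold)

lemma finite_ug_values:
  "finite {ug_satisfied U f g | f g. f \<in> {..<ug_left U} \<rightarrow>\<^sub>E {..<R} \<and>
      g \<in> {..<ug_right U} \<rightarrow>\<^sub>E {..<R}}"
proof -
  have "{ug_satisfied U f g | f g. f \<in> {..<ug_left U} \<rightarrow>\<^sub>E {..<R} \<and> g \<in> {..<ug_right U} \<rightarrow>\<^sub>E {..<R}} =
     (\<lambda>(f, g). ug_satisfied U f g) ` (({..<ug_left U} \<rightarrow>\<^sub>E {..<R}) \<times> ({..<ug_right U} \<rightarrow>\<^sub>E {..<R}))"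
       by auto
  then show ?thesis by (simp add: finite_PiE)
qed

lemma ug_value_attained:
  assumes "1 \<le> R"
  obtains f g where "f \<in> {..<ug_left U} \<rightarrow>\<^sub>E {..<R}" "g \<in> {..<ug_right U} \<rightarrow>\<^sub>E {..<R}"
    "ug_value R U = ug_satisfied U f g"
proof -
  let ?S = "{ug_satisfied U f g | f g. f \<in> {..<ug_left U} \<rightarrow>\<^sub>E {..<R} \<and>
      g \<in> {..<ug_right U} \<rightarrow>\<^sub>E {..<R}}"
  have "restrict (\<lambda>_. 0) {..<ug_left U} \<in> {..<ug_left U} \<rightarrow>\<^sub>E {..<R}"
    "restrict (\<lambda>_. 0) {..<ug_right U} \<in> {..<ug_right U} \<rightarrow>\<^sub>E {..<R}"
    using assms by (auto simp: PiE_def)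
  then have "?S \<noteq> {}" by blast
  then have "Max ?S \<in> ?S" by (rule Max_in[OF finite_ug_values])
  then show ?thesis using that unfolding ug_value_def by blast
qed

lemma ug_satisfied_le_value:
  assumes U: "ug_instance R U" and f: "\<And>u. f u < R" and g: "\<And>v. g v < R"
  shows "ug_satisfied U f g \<le> ug_value R U"
proof -
  let ?f = "restrict f {..<ug_left U}" and ?g = "restrict g {..<ug_right U}"
  have "ug_satisfied U f g = ug_satisfied U ?f ?g"
    unfolding ug_satisfied_def using U
    by (intro arg_cong2[of _ _ _ _ "(/)"] arg_cong[of _ _ real] arg_cong[of _ _ length] filter_cong)
      (auto simp: ug_instance_def)
  also have "\<dots> \<le> ug_value R U"
    unfolding ug_value_def
    by (rule Max_ge[OF finite_ug_values], rule CollectI, rule exI[of _ ?f],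
      rule exI[of _ ?g]) (use f g in auto)
  finally show ?thesis .
qed

locale gadget_reduction = gap_gadget "pverts H" "parcs H" A V E w l ter D K n P Q
  for H :: "nat pair_pre_digraph" and A V E w l ter D K n P Q +
  fixes R M q B threshold :: nat and num :: "gadget_vertex \<Rightarrow> nat"
  assumes H: "pair_digraph H" and num: "bij_betw num (gadget_vertices R) {..<M}"
    and size_le: "M \<le> 2 ^ q" and threshold_bound: "threshold \<le> 2 ^ B"
begin

definition vertex_of :: "nat \<Rightarrow> gadget_vertex" where
  "vertex_of = inv_into (gadget_vertices R) num"

definition table :: "bool list \<Rightarrow> nat \<Rightarrow> nat \<Rightarrow> nat option" where
  "table k c c' = (if forced (k ! 1) (k ! 2) (vertex_of c) (vertex_of c') then None
     else Some (if k ! 0 then gadget_weight R (THE \<pi>. \<pi> permutes {..<R} \<and>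
       enc_list enc_nat (map \<pi> [0..<R]) = drop 3 k) (vertex_of c) (vertex_of c') else 0))"

lemma Term_in_gadget_vertices: "s \<in> pverts H \<Longrightarrow> Term s \<in> gadget_vertices R"
  by (simp add: gadget_vertices_def)

sublocale reduction_table R M q B threshold table "\<lambda>s. num (Term s)" H
proof
  show "num (Term s) < M" if "s \<in> pverts H" for s
    using bij_betw_apply[OF num Term_in_gadget_vertices[OF that]] by simp
  show "inj_on (\<lambda>s. num (Term s)) (pverts H)"
    using num Term_in_gadget_vertices by (auto simp: inj_on_def bij_betw_def)
qed (auto simp: size_le threshold_bound)

abbreviation "us U j \<equiv> fst (ug_constraints U ! j)"
abbreviation "vs U j \<equiv> fst (snd (ug_constraints U ! j))"
abbreviation "ps U j \<equiv> snd (snd (ug_constraints U ! j))"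

lemma permutes_constraint: "ug_instance R U \<Longrightarrow> j < length (ug_constraints U) \<Longrightarrow>
    ps U j permutes {..<R}"
  using nth_mem[of j "ug_constraints U"] unfolding ug_instance_def by fastforce

lemma num_inverse: "p \<in> gadget_vertices R \<Longrightarrow> num p < M"
  "p \<in> gadget_vertices R \<Longrightarrow> vertex_of (num p) = p"
  using num by (auto simp: bij_betw_def vertex_of_def)

lemma arc_weight_eq:
  assumes U: "ug_instance R U" and j: "j < length (ug_constraints U)" and p: "p \<in> gadget_vertices R"
    "p' \<in> gadget_vertices R"
  shows "arc_weight U j (num p) j' (num p') =
      position_weight R (us U) (vs U) (ps U) (2 ^ (length (ug_constraints U) + B)) (j, p) (j', p')"
proof -
  obtain u v \<pi> where c: "ug_constraints U ! j = (u, v, \<pi>)" by (cases "ug_constraints U ! j") auto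
  obtain u' v' \<pi>' where c': "ug_constraints U ! j' = (u', v', \<pi>')"
    by (cases "ug_constraints U ! j'") auto
  have k: "key U j j' = [j = j', u = u', v = v'] @ enc_list enc_nat (map \<pi> [0..<R])"
    by (simp add: key_def c c')
  have \<pi>: "\<pi> permutes {..<R}" using permutes_constraint[OF U j] by (simp add: c)
  have "(THE \<sigma>. \<sigma> permutes {..<R} \<and> enc_list enc_nat (map \<sigma> [0..<R]) =
      enc_list enc_nat (map \<pi> [0..<R])) = \<pi>"
  proof (rule the_equality)
    fix \<sigma> assume \<sigma>: "\<sigma> permutes {..<R} \<and> enc_list enc_nat (map \<sigma> [0..<R]) =
        enc_list enc_nat (map \<pi> [0..<R])"
    then have "map \<sigma> [0..<R] = map \<pi> [0..<R]" using enc_nat_list_inj by blast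
    then have "\<sigma> i = \<pi> i" if "i < R" for i using that by simp
    moreover have "\<sigma> i = i \<and> \<pi> i = i" if "\<not> i < R" for i using \<sigma> \<pi> that by (simp add: permutes_def)
    ultimately show "\<sigma> = \<pi>" by (metis ext)
  qed (use \<pi> in simp)
  moreover have "\<pi>' = \<pi>" if "j = j'" using that c c' by simp
  ultimately show ?thesis
    unfolding arc_weight_def table_def k
    by (simp add: num_inverse p position_weight_def forced_arc_def c c')
qed

definition place :: "nat \<times> gadget_vertex \<Rightarrow> nat" where
  "place x = vertex_id q (fst x) (num (snd x))"

lemma bij_place: "bij_betw place (positions (length (ug_constraints U)) R) (reduced_vertices U)"
proof -
  have "inj_on num (gadget_vertices R)" "num ` gadget_vertices R = {..<M}"
    using num by (auto simp: bij_betw_def)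
  then have "bij_betw (map_prod id num) (positions (length (ug_constraints U)) R)
      ({..<length (ug_constraints U)} \<times> {..<M})"
    unfolding positions_def bij_betw_def by (auto intro!: map_prod_inj_on map_prod_surj_on)
  moreover have "bij_betw (\<lambda>(j, c). vertex_id q j c) ({..<length (ug_constraints U)} \<times> {..<M})
      (reduced_vertices U)"
    unfolding bij_betw_def reduced_vertices_def
    by (auto simp: inj_on_def vertex_id_inject less_two_power)
  ultimately have "bij_betw ((\<lambda>(j, c). vertex_id q j c) \<circ> map_prod id num)
      (positions (length (ug_constraints U)) R) (reduced_vertices U)"
    by (rule bij_betw_trans)
  moreover have "(\<lambda>(j, c). vertex_id q j c) \<circ> map_prod id num = place" by (auto simp: place_def)
  ultimately show ?thesis by simp
qed

lemma multicut_place_iff: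
  assumes U: "ug_instance R U" and C: "C \<subseteq> positions m R \<times> positions m R"
    and m: "m = length (ug_constraints U)"
  shows "multicut H (reduced U) (map_prod place place ` C) \<longleftrightarrow> separating m R C"
proof -
  let ?X = "positions m R" and ?f = "map_prod place place"
  interpret H: pair_digraph H by (rule H)
  have inj: "inj_on place ?X" and im: "place ` ?X = reduced_vertices U"
    using bij_place[of U] m by (auto simp: bij_betw_def)
  have inj2: "inj_on ?f (?X \<times> ?X)" using inj by (rule map_prod_inj_on) (rule inj)
  have arcs: "parcs (supply_graph (reduced U)) = ?f ` (?X \<times> ?X)"
    using map_prod_surj_on[OF im im] by (simp add: reduced_def)
  have diff: "?f ` (?X \<times> ?X) - ?f ` C = ?f ` (?X \<times> ?X - C)"
    using inj_on_image_set_diff[OF inj2, of "?X \<times> ?X" C] C by auto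
  have m0: "0 < m" using U m by (simp add: ug_instance_def)
  have "(terminal (reduced U) s, terminal (reduced U) t) \<in> (?f ` (?X \<times> ?X - C))\<^sup>* \<longleftrightarrow>
      ((0, Term s), (0, Term t)) \<in> (?X \<times> ?X - C)\<^sup>*"
    if "(s, t) \<in> parcs H" for s t
  proof -
    have "(0, Term s) \<in> ?X" "(0, Term t) \<in> ?X"
      using H.in_arcsD1[OF that] H.in_arcsD2[OF that] Term_in_gadget_vertices m0
      by (auto simp: positions_def)
    from rtrancl_image_iff[OF inj _ this, of "?X \<times> ?X - C"]
    show ?thesis by (simp add: reduced_def place_def)
  qed
  moreover have "?f ` C \<subseteq> ?f ` (?X \<times> ?X)" using C by auto
  moreover have "dmc_instance H (reduced U)"
    using reduced_in_dmc_inputs[OF U] by (simp add: dmc_inputs_def)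
  ultimately show ?thesis
    unfolding multicut_iff_separates[OF H \<open>dmc_instance H (reduced U)\<close>] separates_def separating_def
      arcs diff using C by auto
qed

lemma weight_place:
  assumes U: "ug_instance R U" and C: "C \<subseteq> positions m R \<times> positions m R"
    and m: "m = length (ug_constraints U)"
  shows "(\<Sum>e\<in>map_prod place place ` C. weight (reduced U) e) =
      real (\<Sum>(x, y)\<in>C. position_weight R (us U) (vs U) (ps U) (2 ^ (m + B)) x y)"
proof -
  have inj: "inj_on place (positions m R)" using bij_place[of U] m by (auto simp: bij_betw_def)
  have "inj_on (map_prod place place) C"
    by (rule inj_on_subset[OF map_prod_inj_on[OF inj inj] C])
  moreover have "weight (reduced U) (map_prod place place xy) =
      real (case xy of (x, y) \<Rightarrow> position_weight R (us U) (vs U) (ps U) (2 ^ (m + B)) x y)"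
    if "xy \<in> C" for xy
  proof -
    obtain j p j' p' where xy: "xy = ((j, p), (j', p'))" by (metis surj_pair)
    have "j < m" "p \<in> gadget_vertices R" "p' \<in> gadget_vertices R"
      using that C xy by (auto simp: positions_def)
    then show ?thesis using arc_weight_eq[OF U, of j p p' j'] m
      by (simp add: xy reduced_def place_def num_inverse)
  qed
  ultimately show ?thesis by (simp add: sum.reindex)
qed

lemma reduced_dmc_instance: "ug_instance R U \<Longrightarrow> dmc_instance H (reduced U)"
  using reduced_in_dmc_inputs by (simp add: dmc_inputs_def)

lemma card_unsatisfied_le:
  assumes "0 < m" "m = length (ug_constraints U)" "1 - \<epsilon> \<le> ug_satisfied U f g"
  shows "real (card {j. j < m \<and> g (vs U j) \<noteq> ps U j (f (us U j))}) \<le> \<epsilon> * m"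
proof -
  define bad where "bad = {j. j < m \<and> g (vs U j) \<noteq> ps U j (f (us U j))}"
  define good where "good = {j. j < m \<and> g (vs U j) = ps U j (f (us U j))}"
  have "card bad + card good = card (bad \<union> good)"
    by (rule card_Un_disjoint[symmetric]) (auto simp: bad_def good_def)
  also have "bad \<union> good = {..<m}" by (auto simp: bad_def good_def)
  finally have "real (card bad) + real (card good) = m" by (metis card_lessThan of_nat_add)
  moreover have "(1 - \<epsilon>) * m \<le> card good"
    using assms unfolding ug_satisfied_eq good_def by (simp add: field_simps)
  ultimately show ?thesis by (simp add: bad_def algebra_simps)
qed

lemma multicut_opt_le_of_value:
  assumes U: "ug_instance R U" and val: "1 - \<epsilon> \<le> ug_value R U"
    and m: "m = length (ug_constraints U)"
  shows "2 ^ n * multicut_opt H (reduced U) \<le>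
      real (cube_size R n) * (real m * (real P * (\<Sum>e\<in>E. real (w e * l e)) +
    2 ^ n * (2 * real (card V) * real n)) + \<epsilon> * m * (2 ^ n * (2 * real Q * real (card V))))"
proof -
  have R: "1 \<le> R" and m0: "0 < m" using U m by (auto simp: ug_instance_def)
  obtain f g where f: "f \<in> {..<ug_left U} \<rightarrow>\<^sub>E {..<R}" and g: "g \<in> {..<ug_right U} \<rightarrow>\<^sub>E {..<R}"
    and fg: "ug_value R U = ug_satisfied U f g"
    by (rule ug_value_attained[OF R])
  define N where "N = card {j. j < m \<and> g (vs U j) \<noteq> ps U j (f (us U j))}"
  have N: "real N \<le> \<epsilon> * m" unfolding N_def using val m0 m fg by (intro card_unsatisfied_le) auto
  have ends: "us U j < ug_left U \<and> vs U j < ug_right U" if "j < m" for j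
    using nth_mem[of j "ug_constraints U"] U that m unfolding ug_instance_def by fastforce
  obtain C where C: "separating m R C" "unforced (us U) (vs U) C"
    "2 ^ n * (\<Sum>(x, y)\<in>C. position_weight R (us U) (vs U) (ps U) (2 ^ (m + B)) x y) \<le>
       cube_size R n * (m * (P * (\<Sum>e\<in>E. w e * l e) + 2 ^ n * (2 * card V * n)) +
         N * (2 ^ n * (2 * Q * card V)))"
  proof (rule completeness[of m "ps U" R f "us U" g "vs U" N "2 ^ (m + B)"])
    show "f (us U j) < R" "g (vs U j) < R" if "j < m" for j using ends[OF that] f g by auto
    show "ps U j permutes {..<R}" if "j < m" for j using permutes_constraint[OF U] that m by simp
  qed (auto simp: N_def intro: that)
  have sub: "C \<subseteq> positions m R \<times> positions m R" using C(1) by (simp add: separating_def)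
  have "multicut_opt H (reduced U) \<le> (\<Sum>e\<in>map_prod place place ` C. weight (reduced U) e)"
    using multicut_place_iff[OF U sub m] C(1)
    by (intro multicut_opt_le reduced_dmc_instance[OF U]) auto
  also have "\<dots> = real (\<Sum>(x, y)\<in>C. position_weight R (us U) (vs U) (ps U) (2 ^ (m + B)) x y)"
    by (rule weight_place[OF U sub m])
  finally have "2 ^ n * multicut_opt H (reduced U) \<le>
      real (2 ^ n * (\<Sum>(x, y)\<in>C. position_weight R (us U) (vs U) (ps U) (2 ^ (m + B)) x y))" by simp
  also have "\<dots> \<le>
      real (cube_size R n *
        (m * (P * (\<Sum>e\<in>E. w e * l e) + 2 ^ n * (2 * card V * n)) + N * (2 ^ n * (2 * Q * card V))))"
    using C(3) of_nat_le_iff by blast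
  also have "\<dots> = real (cube_size R n) *
      (real m * (real P * (\<Sum>e\<in>E. real (w e * l e)) + 2 ^ n * (2 * real (card V) * real n)) +
      real N * (2 ^ n * (2 * real Q * real (card V))))"
    by simp
  also have "\<dots> \<le> real (cube_size R n) *
      (real m * (real P * (\<Sum>e\<in>E. real (w e * l e)) + 2 ^ n * (2 * real (card V) * real n)) +
      \<epsilon> * m * (2 ^ n * (2 * real Q * real (card V))))"
    using N by (intro mult_left_mono add_left_mono mult_right_mono) auto
  finally show ?thesis .
qed

lemma multicut_opt_less_threshold:
  assumes U: "ug_instance R U" and val: "1 - \<epsilon> \<le> ug_value R U"
    and \<epsilon>: "\<epsilon> * (2 * real Q * real (card V)) \<le> 1"
    and \<rho>: "0 < \<rho>" and T: "threshold = cube_size R n * T"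
    and less: "\<rho> * (real P * (\<Sum>e\<in>E. real (w e * l e)) +
        2 ^ n * (2 * real (card V) * real n + 1)) < 2 ^ n * real T"
  shows "\<rho> * multicut_opt H (reduced U) < real (threshold * length (ug_constraints U))"
proof -
  define m where "m = length (ug_constraints U)"
  define S where "S = (\<Sum>e\<in>E. real (w e * l e))"
  have "0 < m" using U by (simp add: m_def ug_instance_def)
  then have Zm: "0 < real (cube_size R n) * m" using cube_size_pos[of R n] by simp
  have "2 ^ n * multicut_opt H (reduced U) \<le>
      real (cube_size R n) * (real m * (real P * S + 2 ^ n * (2 * real (card V) * real n)) +
      \<epsilon> * m * (2 ^ n * (2 * real Q * real (card V))))"
    unfolding S_def by (rule multicut_opt_le_of_value[OF U val m_def])
  also have "\<dots> = real (cube_size R n) * m *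
      (real P * S + 2 ^ n * (2 * real (card V) * real n + \<epsilon> * (2 * real Q * real (card V))))"
    by (simp add: algebra_simps)
  also have "\<dots> \<le> real (cube_size R n) * m * (real P * S + 2 ^ n * (2 * real (card V) * real n + 1))"
    using \<epsilon> by (intro mult_left_mono add_left_mono) auto
  finally have "\<rho> * (2 ^ n * multicut_opt H (reduced U)) \<le>
      \<rho> * (real (cube_size R n) * m * (real P * S + 2 ^ n * (2 * real (card V) * real n + 1)))"
    using \<rho> by (intro mult_left_mono) auto
  also have "\<dots> = real (cube_size R n) * m *
      (\<rho> * (real P * S + 2 ^ n * (2 * real (card V) * real n + 1)))" by simp
  also have "\<dots> < real (cube_size R n) * m * (2 ^ n * T)"
    using less Zm unfolding S_def by (intro mult_strict_left_mono) auto
  finally have "2 ^ n * (\<rho> * multicut_opt H (reduced U)) < 2 ^ n * real (threshold * m)"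
    by (simp add: T mult_ac)
  then show ?thesis unfolding m_def by (rule mult_left_less_imp_less) simp
qed

lemma obtain_light_separation:
  assumes U: "ug_instance R U" and m: "m = length (ug_constraints U)"
    and X: "multicut H (reduced U) X"
    and light: "(\<Sum>e\<in>X. weight (reduced U) e) < real (threshold * m)"
  obtains C where "separating m R C" "unforced (us U) (vs U) C"
    "(\<Sum>j<m. copy_cost R (ps U) C j) < threshold * m"
proof -
  define C where "C = {(x, y). x \<in> positions m R \<and> y \<in> positions m R \<and> (place x, place y) \<in> X}"
  have sub: "C \<subseteq> positions m R \<times> positions m R" by (auto simp: C_def)
  have image: "place ` positions m R = reduced_vertices U"
    using bij_place[of U] m by (auto simp: bij_betw_def)
  have "X \<subseteq> reduced_vertices U \<times> reduced_vertices U"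
    using X by (auto simp: multicut_def reduced_def)
  then have XC: "X = map_prod place place ` C"
    unfolding image[symmetric] by (force simp: C_def image_iff)
  have sep: "separating m R C" using X multicut_place_iff[OF U sub m] XC by simp
  let ?weight = "\<lambda>(x, y). position_weight R (us U) (vs U) (ps U) (2 ^ (m + B)) x y"
  have "real (sum ?weight C) < real (threshold * m)"
    using light weight_place[OF U sub m] unfolding XC by simp
  then have less: "sum ?weight C < threshold * m" by (simp only: of_nat_less_iff)
  have "finite C" using sub finite_positions by (metis finite_SigmaI finite_subset)
  have "?weight e < 2 ^ (m + B)" if "e \<in> C" for e
  proof -
    have "?weight e \<le> sum ?weight C" by (rule member_le_sum[OF that _ \<open>finite C\<close>]) simp
    also have "\<dots> < threshold * m" by (rule less)
    also have "\<dots> \<le> 2 ^ B * 2 ^ m" using threshold_bound less_exp[of m] by (intro mult_le_mono) auto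
    finally show ?thesis by (simp add: power_add mult.commute)
  qed
  then have unf: "unforced (us U) (vs U) C" unfolding unforced_def position_weight_def by fastforce
  show ?thesis using less by (intro that[OF sep unf]) (simp add: sum_position_weight[OF sub unf])
qed

lemma light_multicut_imp_value:
  fixes \<delta> \<tau> :: real
  assumes U: "ug_instance R U" and m: "m = length (ug_constraints U)"
    and \<delta>: "0 < \<delta>" "\<delta> < 1 / 2" and \<tau>: "0 < \<tau>" "4 * P * K \<le> \<tau> * Q"
    and dichotomy: "low_influence_dichotomy (coords R n) \<tau> (2 * P * K) \<delta>"
    and \<Lambda>: "real (card V * card A) * (4 * P * K / \<tau>) \<le> \<Lambda>"
    and threshold: "real threshold \<le> P * K * (1 - 3 * \<delta>) * cube_size R n"
    and X: "multicut H (reduced U) X" "(\<Sum>e\<in>X. weight (reduced U) e) < real (threshold * m)"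
  shows "\<delta> \<le> real \<Lambda> * real \<Lambda> * ug_value R U"
proof -
  have R: "0 < R" and m0: "0 < m" using U m by (auto simp: ug_instance_def)
  obtain C where C: "separating m R C" "unforced (us U) (vs U) C"
    "(\<Sum>j<m. copy_cost R (ps U) C j) < threshold * m"
    by (rule obtain_light_separation[OF U m X])
  interpret cheap_separation "pverts H" "parcs H" A V E w l ter D K n P Q m R "us U" "vs U" "ps U" \<delta> \<tau> C
  proof unfold_locales
    show "ps U j permutes {..<R}" if "j < m" for j using permutes_constraint[OF U] that m by simp
    have "real (\<Sum>j<m. copy_cost R (ps U) C j) < real (threshold * m)"
      using C(3) by (simp only: of_nat_less_iff)
    also have "\<dots> \<le> P * K * (1 - 3 * \<delta>) * cube_size R n * m"
      using mult_right_mono[OF threshold, of "real m"] by simp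
    finally show "real (\<Sum>j<m. copy_cost R (ps U) C j) < P * K * (1 - 3 * \<delta>) * cube_size R n * m" .
  qed (fact m0 \<delta> \<tau> dichotomy C)+
  obtain f g where f: "\<And>u. f u < R" and g: "\<And>v. g v < R"
    and satisfied: "\<delta> * m \<le> real \<Lambda> * real \<Lambda> *
        real (card {j. j < m \<and> g (vs U j) = ps U j (f (us U j))})"
    by (rule soundness[OF R \<Lambda>]) (rule that)
  have "\<delta> \<le> real \<Lambda> * real \<Lambda> * ug_satisfied U f g"
    using satisfied m0 unfolding ug_satisfied_eq assms(2)[symmetric] by (simp add: field_simps)
  also have "\<dots> \<le> real \<Lambda> * real \<Lambda> * ug_value R U"
    by (rule mult_left_mono[OF ug_satisfied_le_value[OF U f g]]) simp
  finally show ?thesis .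
qed

lemma decide_light_approximation:
  assumes approx: "dmc_approximation H (ereal \<alpha>) Alg" and U: "ug_instance R U"
  obtains X where "multicut H (reduced U) X"
    "(\<Sum>e\<in>X. weight (reduced U) e) \<le> \<alpha> * multicut_opt H (reduced U)"
    "decide_light (\<lambda>x. Alg (reduce x)) (enc_ug R U) =
        [(\<Sum>e\<in>X. weight (reduced U) e) < real (threshold * length (ug_constraints U))]"
proof -
  obtain es where es: "Alg (reduce (enc_ug R U)) = enc_list enc_arc es"
    "multicut H (reduced U) (set es)"
    "(\<Sum>e\<in>set es. weight (reduced U) e) \<le> \<alpha> * multicut_opt H (reduced U)"
    using approx reduced_in_dmc_inputs[OF U] reduce_enc_ug[OF U] unfolding dmc_approximation_def
    by auto
  have "set es \<subseteq> reduced_vertices U \<times> reduced_vertices U"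
    using es(2) by (auto simp: multicut_def reduced_def)
  from decide_light_eq[of U "\<lambda>x. Alg (reduce x)" es, OF U es(1) this] show ?thesis
    by (rule that[OF es(2,3)])
qed

lemma poly_time_on_decide_light:
  assumes poly: "poly_time_on (enc_dmc H ` dmc_inputs H) Alg"
    and approx: "dmc_approximation H (ereal \<alpha>) Alg"
  shows "poly_time_on ug_codes (decide_light (\<lambda>x. Alg (reduce x)))"
proof -
  have input: "reduce x \<in> enc_dmc H ` dmc_inputs H" if "x \<in> ug_codes" for x
    using that reduced_in_dmc_inputs reduce_enc_ug by (auto simp: ug_codes_def)
  then have "computable 1 valid_input (\<lambda>s. Alg (reduce (s 0)))"
    by (intro computable_call[OF poly computable_reduce]) (simp add: valid_input_def)
  moreover have "\<exists>es. Alg (reduce x) = enc_list enc_arc es" if "x \<in> ug_codes" for x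
    using approx input[OF that] unfolding dmc_approximation_def by fastforce
  ultimately have "computable 1 valid_input (\<lambda>s. decide_light (\<lambda>x. Alg (reduce x)) (s 0))"
    by (rule computable_decide_light)
  then show ?thesis unfolding valid_input_def by (rule poly_time_on_computable)
qed

lemma class_NP_subset_P_of_approximation:
  assumes poly: "poly_time_on (enc_dmc H ` dmc_inputs H) Alg"
    and approx: "dmc_approximation H (ereal \<alpha>) Alg"
    and hard: "NP_hard_promise {enc_ug R U | U. ug_instance R U \<and> ug_value R U \<ge> 1 - \<epsilon>}
       {enc_ug R U | U. ug_instance R U \<and> ug_value R U \<le> \<delta>}"
    and yes: "\<And>U. ug_instance R U \<Longrightarrow> 1 - \<epsilon> \<le> ug_value R U \<Longrightarrow>
       \<alpha> * multicut_opt H (reduced U) < real (threshold * length (ug_constraints U))"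
    and no: "\<And>U X. ug_instance R U \<Longrightarrow> ug_value R U \<le> \<delta> \<Longrightarrow> multicut H (reduced U) X \<Longrightarrow>
       real (threshold * length (ug_constraints U)) \<le> (\<Sum>e\<in>X. weight (reduced U) e)"
  shows "class_NP \<subseteq> class_P"
proof
  fix L assume "L \<in> class_NP"
  then obtain f where f: "poly_time_on UNIV f"
    and f_yes: "\<And>x. x \<in> L \<Longrightarrow> \<exists>U. f x = enc_ug R U \<and> ug_instance R U \<and> 1 - \<epsilon> \<le> ug_value R U"
    and f_no: "\<And>x. x \<notin> L \<Longrightarrow> \<exists>U. f x = enc_ug R U \<and> ug_instance R U \<and> ug_value R U \<le> \<delta>"
    using hard unfolding NP_hard_promise_def by fastforce
  let ?decide = "decide_light (\<lambda>x. Alg (reduce x))"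
  have "f x \<in> ug_codes" for x using f_yes[of x] f_no[of x]
    by (cases "x \<in> L") (auto simp: ug_codes_def)
  then have "poly_time_on UNIV (\<lambda>x. ?decide (f x))"
    by (intro poly_time_on_comp[OF f poly_time_on_decide_light[OF poly approx]]) auto
  moreover have "?decide (f x) = [x \<in> L]" for x
  proof (cases "x \<in> L")
    case True
    then obtain U where U: "f x = enc_ug R U" "ug_instance R U" "1 - \<epsilon> \<le> ug_value R U"
      using f_yes by blast
    obtain X where "(\<Sum>e\<in>X. weight (reduced U) e) \<le> \<alpha> * multicut_opt H (reduced U)"
      "?decide (enc_ug R U) = [(\<Sum>e\<in>X. weight (reduced U) e) <
          real (threshold * length (ug_constraints U))]"
      by (rule decide_light_approximation[OF approx U(2)])
    then show ?thesis using yes[OF U(2,3)] True U(1) by simp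
  next
    case False
    then obtain U where U: "f x = enc_ug R U" "ug_instance R U"
      "ug_value R U \<le> \<delta>" using f_no by blast
    obtain X where X: "multicut H (reduced U) X"
      "?decide (enc_ug R U) = [(\<Sum>e\<in>X. weight (reduced U) e) <
          real (threshold * length (ug_constraints U))]"
      by (rule decide_light_approximation[OF approx U(2)])
    then show ?thesis using no[OF U(2,3) X(1)] False U(1) by simp
  qed
  ultimately show "L \<in> class_P" by (simp add: class_P_def)
qed

lemma class_NP_subset_P_of_parameters:
  fixes \<delta> \<tau> :: real
  assumes poly: "poly_time_on (enc_dmc H ` dmc_inputs H) Alg"
    and approx: "dmc_approximation H (ereal \<alpha>) Alg"
    and hard: "NP_hard_promise {enc_ug R U | U. ug_instance R U \<and> ug_value R U \<ge> 1 - \<epsilon>'}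
       {enc_ug R U | U. ug_instance R U \<and> ug_value R U \<le> \<delta>'}"
    and \<rho>: "0 < \<rho>" "\<alpha> \<le> \<rho>" and \<epsilon>': "\<epsilon>' * (2 * real Q * real (card V)) \<le> 1"
    and threshold: "threshold = cube_size R n * T"
    and less: "\<rho> * (real P * (\<Sum>e\<in>E. real (w e * l e)) +
        2 ^ n * (2 * real (card V) * real n + 1)) < 2 ^ n * real T"
    and T: "real T \<le> real P * K * (1 - 3 * \<delta>)"
    and \<delta>: "0 < \<delta>" "\<delta> < 1 / 2" and \<tau>: "0 < \<tau>" "4 * P * K \<le> \<tau> * Q"
    and dichotomy: "low_influence_dichotomy (coords R n) \<tau> (2 * P * K) \<delta>"
    and \<Lambda>: "real (card V * card A) * (4 * P * K / \<tau>) \<le> \<Lambda>" and \<delta>': "\<delta>' * (real \<Lambda> * real \<Lambda>) < \<delta>"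
  shows "class_NP \<subseteq> class_P"
proof (rule class_NP_subset_P_of_approximation[OF poly approx hard])
  fix U assume U: "ug_instance R U" "1 - \<epsilon>' \<le> ug_value R U"
  have "\<alpha> * multicut_opt H (reduced U) \<le> \<rho> * multicut_opt H (reduced U)"
    using \<rho>(2) multicut_opt_nonneg[OF H reduced_dmc_instance[OF U(1)]] by (rule mult_right_mono)
  also have "\<dots> < real (threshold * length (ug_constraints U))"
    by (rule multicut_opt_less_threshold[OF U \<epsilon>' \<rho>(1) threshold less])
  finally show "\<alpha> * multicut_opt H (reduced U) < real (threshold * length (ug_constraints U))" .
next
  fix U X assume U: "ug_instance R U" "ug_value R U \<le> \<delta>'" and X: "multicut H (reduced U) X"
  have "real threshold \<le> P * K * (1 - 3 * \<delta>) * cube_size R n"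
    using mult_left_mono[OF T, of "real (cube_size R n)"] by (simp add: threshold mult_ac)
  note light = light_multicut_imp_value[OF U(1) refl \<delta> \<tau> dichotomy \<Lambda> this X]
  have "real \<Lambda> * real \<Lambda> * ug_value R U \<le> real \<Lambda> * real \<Lambda> * \<delta>'"
    using U(2) by (intro mult_left_mono) auto
  then show "real (threshold * length (ug_constraints U)) \<le> (\<Sum>e\<in>X. weight (reduced U) e)"
    using light \<delta>' by (force simp: mult.commute not_less[symmetric])
qed

end

text \<open>
  With large multiplicity \<open>P\<close> of the gap instance, the cost of the cube edges and the rounding of
  the threshold do not matter.
\<close>

lemma obtain_multiplicity:
  fixes \<rho> K S N c :: real
  assumes "0 < \<rho>" "0 < K" "0 \<le> S" "0 < N" "0 \<le> c" and gap: "\<rho> * S < N * K"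
  obtains \<delta> and P T :: nat where "0 < \<delta>" "\<delta> < 1 / 2" "0 < P"
    "\<rho> * (real P * S + N * (c + 1)) < N * T"
    "real T \<le> real P * K * (1 - 3 * \<delta>)"
proof -
  define G where "G = K - \<rho> * S / N"
  have G: "0 < G" using gap \<open>0 < N\<close> by (simp add: G_def field_simps)
  define \<delta> where "\<delta> = min (1 / 4) (G / (6 * K))"
  have \<delta>: "0 < \<delta>" "\<delta> < 1 / 2" using G \<open>0 < K\<close> by (auto simp: \<delta>_def)
  have "6 * K * \<delta> \<le> G" using \<open>0 < K\<close> mult_left_mono[of \<delta> "G / (6 * K)" "6 * K"] by (simp add: \<delta>_def)
  moreover have "\<rho> * S / N = K - G" "K * (1 - 3 * \<delta>) = K - 6 * K * \<delta> / 2"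
    by (simp_all add: G_def algebra_simps)
  ultimately have KG: "\<rho> * S / N + G / 2 \<le> K * (1 - 3 * \<delta>)" by linarith
  define c' where "c' = \<rho> * (c + 1)"
  have "0 < c'" using \<open>0 < \<rho>\<close> \<open>0 \<le> c\<close> by (simp add: c'_def)
  obtain P :: nat where P: "(c' + 2) / (G / 2) < real P" using reals_Archimedean2 by blast
  moreover have "0 < (c' + 2) / (G / 2)" using G \<open>0 < c'\<close> by simp
  ultimately have "0 < P" by (cases P) auto
  have "c' + 2 \<le> real P * (G / 2)" using P G by (simp add: field_simps)
  then have large: "real P * (\<rho> * S / N) + c' + 2 \<le> real P * K * (1 - 3 * \<delta>)"
    using mult_left_mono[OF KG, of "real P"] by (simp add: algebra_simps)
  define T where "T = nat \<lfloor>real P * K * (1 - 3 * \<delta>)\<rfloor>"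
  have "0 \<le> real P * (\<rho> * S / N)" using assms by simp
  then have T: "real P * (\<rho> * S / N) + c' < T" "real T \<le> real P * K * (1 - 3 * \<delta>)"
    using large \<open>0 < c'\<close> by (auto simp: T_def) linarith+
  have "\<rho> * (real P * S + N * (c + 1)) = N * (real P * (\<rho> * S / N) + c')"
    using \<open>0 < N\<close> by (simp add: c'_def algebra_simps)
  also have "\<dots> < N * T" using T(1) \<open>0 < N\<close> by (rule mult_strict_left_mono)
  finally show ?thesis by (rule that[OF \<delta> \<open>0 < P\<close> _ T(2)])
qed

lemma obtain_below:
  fixes a y :: real
  assumes "0 \<le> a" "0 < y"
  obtains z where "0 < z" "z * a < y"
  using assms that[of "y / (a + 1)"] by (simp add: pos_divide_less_eq algebra_simps)

text \<open>
  \<open>Q\<close> is chosen so large that linked cubes of a cheap labelling have almost the same influences.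
\<close>

lemma class_NP_subset_P_of_gap_gadget:
  assumes ugc: "unique_games_conjecture" and H: "pair_digraph H"
    and poly: "poly_time_on (enc_dmc H ` dmc_inputs H) Alg"
    and approx: "dmc_approximation H (ereal \<alpha>) Alg"
    and \<rho>: "0 < \<rho>" "\<alpha> \<le> \<rho>"
    and gadget: "\<And>P. 0 < P \<Longrightarrow> gap_gadget (pverts H) (parcs H) A V E w l ter D K n P"
    and gap: "\<rho> * (\<Sum>e\<in>E. real (w e * l e)) < 2 ^ n * K"
  shows "class_NP \<subseteq> class_P"
proof -
  have "0 < K" using gadget[of 1] by (simp add: gap_gadget_def)
  then obtain \<delta> P T where \<delta>: "0 < \<delta>" "\<delta> < 1 / 2" and P: "0 < P"
    and T: "\<rho> * (real P * (\<Sum>e\<in>E. real (w e * l e)) + 2 ^ n * (2 * real (card V) * real n + 1)) <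
        2 ^ n * T"
      "real T \<le> real P * K * (1 - 3 * \<delta>)"
    by (rule obtain_multiplicity[OF \<rho>(1) _ _ _ _ gap, of "2 * real (card V) * real n"])
      (auto simp: sum_nonneg)
  obtain \<tau> where \<tau>: "0 < \<tau>"
    and dichotomy: "\<And>X :: (nat \<times> nat) set. finite X \<Longrightarrow> low_influence_dichotomy X \<tau> (2 * P * K) \<delta>"
    by (rule ex_low_influence_dichotomy[of "2 * P * K" \<delta>]) (use \<open>0 < K\<close> \<delta> in auto)
  obtain Q :: nat where "4 * P * K / \<tau> < Q" using reals_Archimedean2 by blast
  then have Q: "4 * P * K \<le> \<tau> * Q" using \<tau> by (simp add: field_simps)
  obtain \<Lambda> :: nat where \<Lambda>: "real (card V * card A) * (4 * P * K / \<tau>) \<le> \<Lambda>"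
    using real_arch_simple by blast
  obtain \<epsilon>' where \<epsilon>': "0 < \<epsilon>'" "\<epsilon>' * (2 * real Q * real (card V)) < 1"
    by (rule obtain_below[of "2 * real Q * real (card V)" 1]) auto
  obtain \<delta>' where \<delta>': "0 < \<delta>'" "\<delta>' * (real \<Lambda> * real \<Lambda>) < \<delta>"
    by (rule obtain_below[of "real \<Lambda> * real \<Lambda>" \<delta>]) (use \<delta> in auto)
  obtain R where hard: "NP_hard_promise {enc_ug R U | U. ug_instance R U \<and> ug_value R U \<ge> 1 - \<epsilon>'}
      {enc_ug R U | U. ug_instance R U \<and> ug_value R U \<le> \<delta>'}"
    using ugc \<epsilon>'(1) \<delta>'(1) unfolding unique_games_conjecture_def by blast
  interpret gap_gadget "pverts H" "parcs H" A V E w l ter D K n P Q by (rule gadget[OF P])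
  define M where "M = card (gadget_vertices R)"
  obtain num where num: "bij_betw num (gadget_vertices R) {..<M}"
    using ex_bij_betw_finite_nat[OF finite_gadget_vertices] by (auto simp: M_def atLeast0LessThan)
  interpret H: pair_digraph H by (rule H)
  interpret gadget_reduction H A V E w l ter D K n P Q R M M
    "cube_size R n * T" "cube_size R n * T" num
    by unfold_locales (auto simp: H num less_imp_le[OF less_exp])
  show ?thesis
    by (rule class_NP_subset_P_of_parameters[OF poly approx hard \<rho>
      less_imp_le[OF \<epsilon>'(2)] refl T \<delta> \<tau> Q
      dichotomy[OF finite_coords] \<Lambda> \<delta>'(2)])
qed

theorem theorem3:
  fixes H :: "nat pair_pre_digraph" and k :: nat and \<epsilon> :: real
  assumes ugc: "unique_games_conjecture"
    and P_NP: "class_P \<noteq> class_NP"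
    and H: "pair_digraph H" "card (pverts H) = k"
    and demand: "parcs H \<noteq> {}"
    and eps: "\<epsilon> > 0"
  shows "\<not> poly_time_dmc_approximable H
            (flow_cut_gap H / ereal (2 * real_of_int \<lceil>log 2 (real k)\<rceil>) - ereal \<epsilon>)"
proof
  define L where "L = real_of_int \<lceil>log 2 (real k)\<rceil>"
  have L: "0 < L"
    using card_le_2_power_ceiling_log(2)[OF pair_digraph.two_le_card_verts[OF H(1) demand]] H(2)
    by (simp add: L_def)
  obtain \<gamma> where \<gamma>: "flow_cut_gap H = ereal \<gamma>" "0 < \<gamma>"
    by (rule obtain_flow_cut_gap_real[OF H(1) demand])
  define \<alpha> where "\<alpha> = \<gamma> / (2 * L) - \<epsilon>"
  define \<rho> where "\<rho> = max \<alpha> (\<gamma> / (4 * L))"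
  assume "poly_time_dmc_approximable H
      (flow_cut_gap H / ereal (2 * real_of_int \<lceil>log 2 (real k)\<rceil>) - ereal \<epsilon>)"
  then obtain Alg where poly: "poly_time_on (enc_dmc H ` dmc_inputs H) Alg"
    and approx: "dmc_approximation H (ereal \<alpha>) Alg"
    using L by (auto simp: poly_time_dmc_approximable_def \<gamma> \<alpha>_def L_def[symmetric])
  have \<rho>: "0 < \<rho>" "\<alpha> \<le> \<rho>" using L \<gamma>(2) by (auto simp: \<rho>_def less_max_iff_disj)
  have "\<rho> < \<gamma> / (2 * L)" using L \<gamma>(2) eps by (auto simp: \<rho>_def \<alpha>_def field_simps)
  then have "ereal (2 * real_of_int \<lceil>log 2 (card (pverts H))\<rceil> * \<rho>) < flow_cut_gap H"
    unfolding H(2) \<gamma>(1) L_def[symmetric] using L by (simp add: field_simps)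
  then obtain A V E w l ter D K n where gadget: "\<And>P. 0 < P \<Longrightarrow>
      gap_gadget (pverts H) (parcs H) A V E w l ter D K n P"
    and gap: "\<rho> * (\<Sum>e\<in>E. real (w e * l e)) < 2 ^ n * K"
    by (rule obtain_gap_gadget[OF H(1) demand \<rho>(1)]) (rule that, assumption+)
  have "class_NP \<subseteq> class_P"
    by (rule class_NP_subset_P_of_gap_gadget[OF ugc H(1) poly approx \<rho> gadget gap])
  then show False using P_NP class_P_subset_NP by blast
qed

end
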